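(* Let $X=\mathbf{R}/\mathbf{Z}$. (a) The group $\mathrm{PC}_{\mathbf{Aff}}(X)$ of piecewise affine self-transformations of $X$ has no infinite subgroup with Property FW (and hence no infinite subgroup with Kazhdan's Property T). (b) The group $\mathrm{PC}_{\mathbf{Proj}}(X)$ of piecewise projective self-transformations of $X$ has no infinite subgroup with Kazhdan's Property T.
   Context: All groups are considered as discrete groups. Piecewise groups: consider homeomorphisms $f:X\smallsetminus F\to X\smallsetminus F'$ with $F,F'\subset X=\mathbf{R}/\mathbf{Z}$ finite. Such an $f$ is affine (resp. projective) if, in the local coordinates on $\mathbf{R}/\mathbf{Z}$ given by local inverses of the projection $\mathbf{R}\to\mathbf{R}/\mathbf{Z}$, it is locally of the form $x\mapsto ax+b$ with $a\neq 0$ (resp. $x\mapsto (ax+b)/(cx+d)$ with $ad-bc\neq 0$). The group $\mathrm{PC}_{\mathbf{Aff}}(X)$ (resp. $\mathrm{PC}_{\mathbf{Proj}}(X)$) is the set of such affine (resp. projective) $f$, for all finite $F,F'$, where two of them are identified if they coincide on some cofinite subset; the group law is induced by composition. Discontinuities and orientation-reversing pieces are allowed. Property FW: given a group $G$ acting on a set $Y$, a subset $M\subset Y$ is commensurated if the symmetric difference $M\bigtriangleup gM$ is finite for every $g\in G$; it is transfixed if there is a $G$-invariant subset $M_0\subset Y$ with $M\bigtriangleup M_0$ finite. The group $G$ has Property FW if for every $G$-set $Y$, every commensurated subset of $Y$ is transfixed. *)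

theory Defs
  imports
    "HOL-Analysis.Analysis"
    "HOL-Algebra.Group_Action"
    "HOL-Algebra.Module"
begin

section \<open>The circle \<open>\<real>/\<int>\<close>\<close>

quotient_type circle = real / "\<lambda>x y. x - y \<in> \<int>"
  morphisms rep_circle to_circle
proof (rule equivpI)
  show "reflp (\<lambda>x y :: real. x - y \<in> \<int>)"
    by (simp add: reflp_def)
  show "symp (\<lambda>x y :: real. x - y \<in> \<int>)"
  proof (rule sympI)
    fix x y :: real
    assume "x - y \<in> \<int>"
    then have "- (x - y) \<in> \<int>"
      by (rule Ints_minus)
    then show "y - x \<in> \<int>"
      by simp
  qed
  show "transp (\<lambda>x y :: real. x - y \<in> \<int>)"
  proof (rule transpI)
    fix x y z :: real
    assume "x - y \<in> \<int>" "y - z \<in> \<int>"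
    then have "(x - y) + (y - z) \<in> \<int>"
      by (rule Ints_add)
    then show "x - z \<in> \<int>"
      by simp
  qed
qed

lemma to_circle_eq_iff: "to_circle x = to_circle y \<longleftrightarrow> x - y \<in> \<int>"
  by (fact circle.abs_eq_iff)

lemma to_circle_cases: obtains t where "x = to_circle t"
  by (induction x) auto

text \<open>\<^const>\<open>to_circle\<close> is the projection \<open>\<real> \<rightarrow> \<real>/\<int>\<close>; the topology is the quotient topology.\<close>

instantiation circle :: topological_space
begin

definition open_circle :: "circle set \<Rightarrow> bool" where
  "open_circle U \<longleftrightarrow> open (to_circle -` U)"

instance
  by standard (auto simp: open_circle_def vimage_Union)

end


section \<open>Piecewise affine and piecewise projective self-transformations\<close>

text \<open>
  Let \<open>x = to_circle t\<close>. Near \<open>x\<close> and near \<open>f x\<close>, the coordinates are local inverses of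
  \<^const>\<open>to_circle\<close>; so \<open>f\<close> reads \<open>s \<mapsto> \<phi> s\<close> in these coordinates iff
  \<open>f (to_circle s) = to_circle (\<phi> s)\<close> for \<open>s\<close> near \<open>t\<close>, up to adding an integer to \<open>\<phi>\<close>,
  which preserves the two forms of \<open>\<phi>\<close> below.
\<close>

definition locally_affine_at :: "(circle \<Rightarrow> circle) \<Rightarrow> real \<Rightarrow> bool" where
  "locally_affine_at f t \<longleftrightarrow>
     (\<exists>a b. a \<noteq> 0 \<and> (\<forall>\<^sub>F s in nhds t. f (to_circle s) = to_circle (a * s + b)))"

definition locally_projective_at :: "(circle \<Rightarrow> circle) \<Rightarrow> real \<Rightarrow> bool" where
  "locally_projective_at f t \<longleftrightarrow>
     (\<exists>a b c d. a * d - b * c \<noteq> 0 \<and>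
        (\<forall>\<^sub>F s in nhds t. c * s + d \<noteq> 0 \<and> f (to_circle s) = to_circle ((a * s + b) / (c * s + d))))"

text \<open>
  A homeomorphism \<open>X - F \<rightarrow> X - F'\<close> is represented by a total function on \<open>X\<close> whose values on
  the finite set \<open>F\<close> are arbitrary. These values are irrelevant, since functions are going to be
  identified when they agree on a cofinite set.
\<close>

definition piecewise :: "((circle \<Rightarrow> circle) \<Rightarrow> real \<Rightarrow> bool) \<Rightarrow> (circle \<Rightarrow> circle) set" where
  "piecewise P =
     {f. \<exists>F F' g. finite F \<and> finite F' \<and> homeomorphism (- F) (- F') f g \<and>
           (\<forall>t. to_circle t \<notin> F \<longrightarrow> P f t)}"

definition cofinite_eq ::
  "((circle \<Rightarrow> circle) \<Rightarrow> real \<Rightarrow> bool) \<Rightarrow> ((circle \<Rightarrow> circle) \<times> (circle \<Rightarrow> circle)) set" where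
  "cofinite_eq P =
     {(f, g). f \<in> piecewise P \<and> g \<in> piecewise P \<and> finite {x. f x \<noteq> g x}}"

definition PC :: "((circle \<Rightarrow> circle) \<Rightarrow> real \<Rightarrow> bool) \<Rightarrow> (circle \<Rightarrow> circle) set monoid" where
  "PC P =
     \<lparr>carrier = piecewise P // cofinite_eq P,
      mult = (\<lambda>A B. \<Union>f\<in>A. \<Union>g\<in>B. cofinite_eq P `` {f \<circ> g}),
      one = cofinite_eq P `` {id}\<rparr>"

definition PC_Aff :: "(circle \<Rightarrow> circle) set monoid" where
  "PC_Aff = PC locally_affine_at"

definition PC_Proj :: "(circle \<Rightarrow> circle) set monoid" where
  "PC_Proj = PC locally_projective_at"


lemma closed_vimage_to_circle:
  assumes "finite F" shows "closed (to_circle -` F)"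
proof -
  have "closed (to_circle -` {x})" for x
  proof (induction x)
    case (1 r)
    have "to_circle -` {to_circle r} = (+) r ` \<int>"
    proof (intro equalityI subsetI)
      fix y assume "y \<in> to_circle -` {to_circle r}"
      then have "y - r \<in> \<int>" by (simp add: to_circle_eq_iff)
      then show "y \<in> (+) r ` \<int>" by (intro image_eqI[of _ _ "y - r"]) auto
    qed (auto simp: to_circle_eq_iff)
    then show ?case by (simp add: closed_translation)
  qed
  then have "closed (\<Union>x\<in>F. to_circle -` {x})"
    using assms by (intro closed_UN) auto
  then show ?thesis by (simp add: vimage_eq_UN[symmetric])
qed

lemma eventually_not_in_vimage:
  assumes "finite F" "to_circle t \<notin> F"
  shows "\<forall>\<^sub>F s in nhds t. to_circle s \<notin> F"
  using closed_vimage_to_circle[OF assms(1)] assms(2)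
  by (auto simp: eventually_nhds closed_def intro!: exI[of _ "- (to_circle -` F)"])

locale local_property =
  fixes P :: "(circle \<Rightarrow> circle) \<Rightarrow> real \<Rightarrow> bool"
  assumes P_id: "P id t"
    and P_comp: "\<lbrakk>P g t; to_circle u = g (to_circle t); P f u\<rbrakk> \<Longrightarrow> P (f \<circ> g) t"
    and P_inv: "\<lbrakk>P f t; to_circle u = f (to_circle t);
                 \<forall>\<^sub>F s in nhds t. g (f (to_circle s)) = to_circle s\<rbrakk> \<Longrightarrow> P g u"
begin

lemma piecewise_id: "id \<in> piecewise P"
  unfolding piecewise_def
  by (auto intro!: exI[of _ "{}"] exI[of _ id] P_id simp: homeomorphism_def)

lemma piecewise_comp:
  assumes "f \<in> piecewise P" "g \<in> piecewise P"
  shows "f \<circ> g \<in> piecewise P"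
proof -
  obtain F1 F1' f' where f: "finite F1" "finite F1'" "homeomorphism (- F1) (- F1') f f'"
      "\<And>t. to_circle t \<notin> F1 \<Longrightarrow> P f t"
    using assms(1) unfolding piecewise_def by blast
  obtain F2 F2' g' where g: "finite F2" "finite F2'" "homeomorphism (- F2) (- F2') g g'"
      "\<And>t. to_circle t \<notin> F2 \<Longrightarrow> P g t"
    using assms(2) unfolding piecewise_def by blast
  define K where "K = F2 \<union> g' ` (F1 - F2')"
  define K' where "K' = F1' \<union> f ` (F2' - F1)"
  have K: "x \<in> - K \<longleftrightarrow> x \<notin> F2 \<and> g x \<notin> F1" for x
  proof -
    have "x \<in> g' ` (F1 - F2') \<longleftrightarrow> g x \<in> F1" if "x \<notin> F2"
    proof
      assume "x \<in> g' ` (F1 - F2')"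
      then obtain y where "y \<in> F1" "y \<notin> F2'" "x = g' y" by blast
      then show "g x \<in> F1" using homeomorphism_apply2[OF g(3), of y] by simp
    next
      assume "g x \<in> F1"
      moreover have "g' (g x) = x" using homeomorphism_apply1[OF g(3), of x] that by simp
      moreover have "g x \<notin> F2'" using homeomorphism_image1[OF g(3)] that by blast
      ultimately show "x \<in> g' ` (F1 - F2')" by (intro image_eqI[of _ _ "g x"]) auto
    qed
    then show ?thesis by (auto simp: K_def)
  qed
  have gK: "g ` (- K) = - F1 \<inter> - F2'"
  proof (intro equalityI subsetI)
    fix y assume "y \<in> - F1 \<inter> - F2'"
    then have "g (g' y) = y" "g' y \<in> - F2"
      using g(3) unfolding homeomorphism_def by auto
    then show "y \<in> g ` (- K)"
      using K \<open>y \<in> - F1 \<inter> - F2'\<close> by (intro image_eqI[of _ _ "g' y"]) auto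
  next
    fix y assume "y \<in> g ` (- K)"
    then show "y \<in> - F1 \<inter> - F2'"
      using g(3) K unfolding homeomorphism_def by blast
  qed
  have fK: "f ` (- F1 \<inter> - F2') = - K'"
  proof (intro equalityI subsetI)
    fix y assume y: "y \<in> f ` (- F1 \<inter> - F2')"
    then obtain x where x: "x \<notin> F1" "x \<notin> F2'" "y = f x" by auto
    have "y \<notin> F1'" using f(3) x unfolding homeomorphism_def by blast
    moreover have "y \<notin> f ` (F2' - F1)"
      using f(3) x unfolding homeomorphism_def by (metis Compl_iff DiffE imageE)
    ultimately show "y \<in> - K'" by (simp add: K'_def)
  next
    fix y assume y: "y \<in> - K'"
    then have "f (f' y) = y" "f' y \<notin> F1"
      using f(3) unfolding homeomorphism_def K'_def by auto
    moreover have "f' y \<notin> F2'"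
      using y calculation unfolding K'_def by (metis ComplD DiffI UnI2 imageI)
    ultimately show "y \<in> f ` (- F1 \<inter> - F2')"
      by (intro image_eqI[of _ _ "f' y"]) auto
  qed
  have "homeomorphism (- K) (- F1 \<inter> - F2') g g'"
    using gK by (intro homeomorphism_of_subsets[OF g(3)]) (auto simp: K_def)
  moreover have "homeomorphism (- F1 \<inter> - F2') (- K') f f'"
    using fK by (intro homeomorphism_of_subsets[OF f(3)]) auto
  ultimately have "homeomorphism (- K) (- K') (f \<circ> g) (g' \<circ> f')"
    by (rule homeomorphism_compose)
  moreover have "finite K" "finite K'" using f g by (auto simp: K_def K'_def)
  moreover have "P (f \<circ> g) t" if "to_circle t \<notin> K" for t
  proof -
    obtain u where u: "g (to_circle t) = to_circle u" by (rule to_circle_cases)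
    then show ?thesis using that K f(4)[of u] g(4)[of t] P_comp by auto
  qed
  ultimately show ?thesis unfolding piecewise_def by blast
qed

lemma piecewise_inv:
  assumes "f \<in> piecewise P"
  obtains g where "g \<in> piecewise P" "finite {x. g (f x) \<noteq> x}"
proof -
  obtain F F' g where f: "finite F" "finite F'" "homeomorphism (- F) (- F') f g"
      "\<And>t. to_circle t \<notin> F \<Longrightarrow> P f t"
    using assms unfolding piecewise_def by blast
  have "P g u" if u: "to_circle u \<notin> F'" for u
  proof -
    obtain t where t: "g (to_circle u) = to_circle t" by (rule to_circle_cases)
    have tF: "to_circle t \<notin> F" and ft: "f (to_circle t) = to_circle u"
      using f(3) u unfolding homeomorphism_def t[symmetric] by auto
    have "\<forall>\<^sub>F s in nhds t. g (f (to_circle s)) = to_circle s"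
      using eventually_not_in_vimage[OF f(1) tF] by eventually_elim
        (use f(3) in \<open>auto simp: homeomorphism_def\<close>)
    then show ?thesis using P_inv[OF f(4)[OF tF]] ft by simp
  qed
  moreover have "homeomorphism (- F') (- F) g f"
    using f(3) by (simp add: homeomorphism_symD)
  ultimately have "g \<in> piecewise P"
    unfolding piecewise_def using f(1,2) by blast
  moreover have "finite {x. g (f x) \<noteq> x}"
    using f(1) by (rule finite_subset[rotated]) (use f(3) in \<open>auto simp: homeomorphism_def\<close>)
  ultimately show ?thesis by (rule that)
qed

lemma equiv_cofinite_eq: "equiv (piecewise P) (cofinite_eq P)"
proof (intro equivI)
  show "sym (cofinite_eq P)" by (auto simp: sym_def cofinite_eq_def eq_commute)
  show "trans (cofinite_eq P)"
  proof (rule transI)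
    fix f g h assume "(f, g) \<in> cofinite_eq P" "(g, h) \<in> cofinite_eq P"
    moreover have "{x. f x \<noteq> h x} \<subseteq> {x. f x \<noteq> g x} \<union> {x. g x \<noteq> h x}" by auto
    ultimately show "(f, h) \<in> cofinite_eq P"
      by (auto simp: cofinite_eq_def elim: finite_subset)
  qed
qed (auto simp: refl_on_def cofinite_eq_def)

lemma congruent2_comp:
  "congruent2 (cofinite_eq P) (cofinite_eq P) (\<lambda>f g. cofinite_eq P `` {f \<circ> g})"
proof (rule congruent2I')
  fix f f' g g' assume fg: "(f, f') \<in> cofinite_eq P" "(g, g') \<in> cofinite_eq P"
  then have pc: "f \<in> piecewise P" "f' \<in> piecewise P" "g \<in> piecewise P" "g' \<in> piecewise P"
    and fin: "finite {x. f x \<noteq> f' x}" "finite {x. g x \<noteq> g' x}"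
    by (auto simp: cofinite_eq_def)
  obtain F F' h where g: "finite F" "homeomorphism (- F) (- F') g h"
    using pc(3) unfolding piecewise_def by blast
  have "{x. (f \<circ> g) x \<noteq> (f' \<circ> g') x} \<subseteq> F \<union> {x. g x \<noteq> g' x} \<union> h ` {x. f x \<noteq> f' x}"
  proof
    fix x assume x: "x \<in> {x. (f \<circ> g) x \<noteq> (f' \<circ> g') x}"
    show "x \<in> F \<union> {x. g x \<noteq> g' x} \<union> h ` {x. f x \<noteq> f' x}"
    proof (cases "x \<in> F \<or> g x \<noteq> g' x")
      case False
      then have "h (g x) = x" using homeomorphism_apply1[OF g(2), of x] by simp
      moreover have "f (g x) \<noteq> f' (g x)" using x False by simp
      ultimately show ?thesis by (intro UnI2 image_eqI[of _ _ "g x"]) auto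
    qed auto
  qed
  then have "finite {x. (f \<circ> g) x \<noteq> (f' \<circ> g') x}"
    by (rule finite_subset) (use fin g in auto)
  then have "(f \<circ> g, f' \<circ> g') \<in> cofinite_eq P"
    using pc by (auto simp: cofinite_eq_def intro!: piecewise_comp simp del: comp_apply)
  then show "cofinite_eq P `` {f \<circ> g} = cofinite_eq P `` {f' \<circ> g'}"
    by (rule equiv_class_eq[OF equiv_cofinite_eq])
qed

lemma PC_mult:
  assumes "f \<in> piecewise P" "g \<in> piecewise P"
  shows "cofinite_eq P `` {f} \<otimes>\<^bsub>PC P\<^esub> cofinite_eq P `` {g} = cofinite_eq P `` {f \<circ> g}"
  unfolding PC_def
  by (simp add: UN_equiv_class2[OF equiv_cofinite_eq equiv_cofinite_eq congruent2_comp assms])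

lemma PC_carrierE:
  assumes "A \<in> carrier (PC P)"
  obtains f where "f \<in> piecewise P" "A = cofinite_eq P `` {f}"
  using assms by (auto simp: PC_def elim: quotientE)

lemma PC_carrierI: "f \<in> piecewise P \<Longrightarrow> cofinite_eq P `` {f} \<in> carrier (PC P)"
  by (simp add: PC_def quotientI)

lemma PC_one: "\<one>\<^bsub>PC P\<^esub> = cofinite_eq P `` {id}"
  by (simp add: PC_def)

lemma group_PC: "group (PC P)"
proof (rule groupI)
  fix A B assume "A \<in> carrier (PC P)" "B \<in> carrier (PC P)"
  then show "A \<otimes>\<^bsub>PC P\<^esub> B \<in> carrier (PC P)"
    by (auto elim!: PC_carrierE simp: PC_mult intro!: PC_carrierI piecewise_comp)
next
  show "\<one>\<^bsub>PC P\<^esub> \<in> carrier (PC P)"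
    by (simp add: PC_one PC_carrierI piecewise_id)
next
  fix A B C assume "A \<in> carrier (PC P)" "B \<in> carrier (PC P)" "C \<in> carrier (PC P)"
  then show "A \<otimes>\<^bsub>PC P\<^esub> B \<otimes>\<^bsub>PC P\<^esub> C = A \<otimes>\<^bsub>PC P\<^esub> (B \<otimes>\<^bsub>PC P\<^esub> C)"
    by (auto elim!: PC_carrierE simp: PC_mult piecewise_comp comp_assoc)
next
  fix A assume "A \<in> carrier (PC P)"
  then show "\<one>\<^bsub>PC P\<^esub> \<otimes>\<^bsub>PC P\<^esub> A = A"
    by (auto elim!: PC_carrierE simp: PC_mult PC_one piecewise_id)
next
  fix A assume "A \<in> carrier (PC P)"
  then obtain f where f: "f \<in> piecewise P" "A = cofinite_eq P `` {f}"
    by (rule PC_carrierE)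
  obtain g where g: "g \<in> piecewise P" "finite {x. g (f x) \<noteq> x}"
    using piecewise_inv[OF f(1)] .
  have "(g \<circ> f, id) \<in> cofinite_eq P"
    using f g by (simp add: cofinite_eq_def piecewise_comp piecewise_id)
  then have "cofinite_eq P `` {g} \<otimes>\<^bsub>PC P\<^esub> A = \<one>\<^bsub>PC P\<^esub>"
    using f g by (simp add: PC_mult PC_one equiv_class_eq[OF equiv_cofinite_eq])
  then show "\<exists>B\<in>carrier (PC P). B \<otimes>\<^bsub>PC P\<^esub> A = \<one>\<^bsub>PC P\<^esub>"
    using g(1) PC_carrierI by blast
qed

end

interpretation affine: local_property locally_affine_at
proof
  fix t show "locally_affine_at id t"
    unfolding locally_affine_at_def by (intro exI[of _ 1] exI[of _ 0]) auto
next
  fix f g t u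
  assume "locally_affine_at g t" "to_circle u = g (to_circle t)" "locally_affine_at f u"
  then obtain a b a' b' where a: "a \<noteq> 0" "\<forall>\<^sub>F s in nhds t. g (to_circle s) = to_circle (a * s + b)"
    and a': "a' \<noteq> 0" "\<forall>\<^sub>F s in nhds u. f (to_circle s) = to_circle (a' * s + b')"
    unfolding locally_affine_at_def by blast
  have "to_circle u = to_circle (a * t + b)"
    using eventually_nhds_x_imp_x[OF a(2)] \<open>to_circle u = g (to_circle t)\<close> by simp
  define n where "n = u - (a * t + b)"
  have nZ: "n \<in> \<int>" using \<open>to_circle u = to_circle (a * t + b)\<close> by (simp add: to_circle_eq_iff n_def)
  have "((\<lambda>s. a * s + b + n) \<longlongrightarrow> a * t + b + n) (nhds t)"
    by (intro tendsto_intros filterlim_ident)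
  then have "\<forall>\<^sub>F s in nhds t. f (to_circle (a * s + b + n)) = to_circle (a' * (a * s + b + n) + b')"
    using a'(2) by (auto simp: n_def filterlim_iff)
  with a(2) have "\<forall>\<^sub>F s in nhds t. (f \<circ> g) (to_circle s) = to_circle (a' * a * s + (a' * (b + n) + b'))"
  proof eventually_elim
    case (elim s)
    have "to_circle (a * s + b + n) = to_circle (a * s + b)"
      using nZ by (simp add: to_circle_eq_iff)
    with elim show ?case by (simp add: algebra_simps)
  qed
  then show "locally_affine_at (f \<circ> g) t"
    unfolding locally_affine_at_def using a(1) a'(1)
    by (intro exI[of _ "a' * a"] exI[of _ "a' * (b + n) + b'"]) auto
next
  fix f g t u
  assume "locally_affine_at f t" and u: "to_circle u = f (to_circle t)"
    and g: "\<forall>\<^sub>F s in nhds t. g (f (to_circle s)) = to_circle s"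
  then obtain a b where a: "a \<noteq> 0" "\<forall>\<^sub>F s in nhds t. f (to_circle s) = to_circle (a * s + b)"
    unfolding locally_affine_at_def by blast
  have "to_circle u = to_circle (a * t + b)"
    using eventually_nhds_x_imp_x[OF a(2)] u by simp
  define n where "n = u - (a * t + b)"
  have nZ: "n \<in> \<int>" using \<open>to_circle u = to_circle (a * t + b)\<close> by (simp add: to_circle_eq_iff n_def)
  have t: "(u - b - n) / a = t" using a(1) by (simp add: n_def field_simps)
  have "((\<lambda>y. (y - b - n) / a) \<longlongrightarrow> (u - b - n) / a) (nhds u)"
    using a(1) by (intro tendsto_intros filterlim_ident) auto
  moreover have "\<forall>\<^sub>F s in nhds t. g (to_circle (a * s + b)) = to_circle s"
    using g a(2) by eventually_elim simp
  ultimately have "\<forall>\<^sub>F y in nhds u. g (to_circle (a * ((y - b - n) / a) + b)) = to_circle ((y - b - n) / a)"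
    unfolding t filterlim_iff by blast
  then have "\<forall>\<^sub>F y in nhds u. g (to_circle y) = to_circle (1 / a * y + - (b + n) / a)"
  proof eventually_elim
    case (elim y)
    have "to_circle (a * ((y - b - n) / a) + b) = to_circle y"
      using nZ a(1) by (simp add: to_circle_eq_iff)
    moreover have "(y - b - n) / a = 1 / a * y + - (b + n) / a"
      using a(1) by (simp add: field_simps)
    ultimately show ?case using elim by simp
  qed
  then show "locally_affine_at g u"
    unfolding locally_affine_at_def using a(1)
    by (intro exI[of _ "1 / a"] exI[of _ "- (b + n) / a"]) auto
qed

interpretation projective: local_property locally_projective_at
proof
  fix t show "locally_projective_at id t"
    unfolding locally_projective_at_def
    by (intro exI[of _ 1] exI[of _ 0] exI[of _ 0] exI[of _ 1]) auto
next
  fix f g t u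
  assume "locally_projective_at g t" and u: "to_circle u = g (to_circle t)"
    and "locally_projective_at f u"
  then obtain a b c d a' b' c' d' where a: "a * d - b * c \<noteq> 0"
      "\<forall>\<^sub>F s in nhds t. c * s + d \<noteq> 0 \<and> g (to_circle s) = to_circle ((a * s + b) / (c * s + d))"
    and a': "a' * d' - b' * c' \<noteq> 0"
      "\<forall>\<^sub>F s in nhds u. c' * s + d' \<noteq> 0 \<and> f (to_circle s) = to_circle ((a' * s + b') / (c' * s + d'))"
    unfolding locally_projective_at_def by blast
  have t: "c * t + d \<noteq> 0" "to_circle u = to_circle ((a * t + b) / (c * t + d))"
    using eventually_nhds_x_imp_x[OF a(2)] u by auto
  define n where "n = u - (a * t + b) / (c * t + d)"
  have nZ: "n \<in> \<int>" using t by (simp add: to_circle_eq_iff n_def)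
  define A B where "A = a + n * c" and "B = b + n * d"
  have AB: "(A * s + B) / (c * s + d) = (a * s + b) / (c * s + d) + n" if "c * s + d \<noteq> 0" for s
    using that by (simp add: A_def B_def field_simps)
  have "((\<lambda>s. (A * s + B) / (c * s + d)) \<longlongrightarrow> (A * t + B) / (c * t + d)) (nhds t)"
    using t by (intro tendsto_intros filterlim_ident)
  moreover have "(A * t + B) / (c * t + d) = u"
    using AB[OF t(1)] by (simp add: n_def)
  ultimately have "\<forall>\<^sub>F s in nhds t. c' * ((A * s + B) / (c * s + d)) + d' \<noteq> 0 \<and>
      f (to_circle ((A * s + B) / (c * s + d))) =
      to_circle ((a' * ((A * s + B) / (c * s + d)) + b') / (c' * ((A * s + B) / (c * s + d)) + d'))"
    using a'(2) unfolding filterlim_iff by blast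
  with a(2) have "\<forall>\<^sub>F s in nhds t. (c' * A + d' * c) * s + (c' * B + d' * d) \<noteq> 0 \<and>
    (f \<circ> g) (to_circle s) =
      to_circle (((a' * A + b' * c) * s + (a' * B + b' * d)) / ((c' * A + d' * c) * s + (c' * B + d' * d)))"
  proof eventually_elim
    case (elim s)
    define D where "D = c * s + d"
    define N where "N = A * s + B"
    have D: "D \<noteq> 0" using elim D_def by simp
    have "to_circle (N / D) = to_circle ((a * s + b) / D)"
      using AB[of s] nZ D by (simp add: to_circle_eq_iff D_def N_def)
    moreover have "(a' * (N / D) + b') / (c' * (N / D) + d') = (a' * N + b' * D) / (c' * N + d' * D)"
    proof -
      have "a' * (N / D) + b' = (a' * N + b' * D) / D" "c' * (N / D) + d' = (c' * N + d' * D) / D"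
        using D by (simp_all add: field_simps)
      then show ?thesis using D by simp
    qed
    moreover have "c' * N + d' * D \<noteq> 0"
    proof
      assume "c' * N + d' * D = 0"
      then have "(c' * N + d' * D) / D = 0" by simp
      then have "c' * (N / D) + d' = 0" using D by (simp add: add_divide_distrib)
      with elim show False by (simp add: D_def N_def)
    qed
    moreover have "c' * N + d' * D = (c' * A + d' * c) * s + (c' * B + d' * d)"
      "a' * N + b' * D = (a' * A + b' * c) * s + (a' * B + b' * d)"
      by (simp_all add: N_def D_def algebra_simps)
    ultimately show ?case using elim by (simp add: D_def[symmetric] N_def[symmetric])
  qed
  moreover have "(a' * A + b' * c) * (c' * B + d' * d) - (a' * B + b' * d) * (c' * A + d' * c) \<noteq> 0"
  proof -
    have "(a' * A + b' * c) * (c' * B + d' * d) - (a' * B + b' * d) * (c' * A + d' * c)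
        = (a' * d' - b' * c') * (a * d - b * c)"
      by (simp add: A_def B_def algebra_simps)
    then show ?thesis using a(1) a'(1) by simp
  qed
  ultimately show "locally_projective_at (f \<circ> g) t"
    unfolding locally_projective_at_def by blast
next
  fix f g t u
  assume "locally_projective_at f t" and u: "to_circle u = f (to_circle t)"
    and g: "\<forall>\<^sub>F s in nhds t. g (f (to_circle s)) = to_circle s"
  then obtain a b c d where a: "a * d - b * c \<noteq> 0"
      "\<forall>\<^sub>F s in nhds t. c * s + d \<noteq> 0 \<and> f (to_circle s) = to_circle ((a * s + b) / (c * s + d))"
    unfolding locally_projective_at_def by blast
  have t: "c * t + d \<noteq> 0" "to_circle u = to_circle ((a * t + b) / (c * t + d))"
    using eventually_nhds_x_imp_x[OF a(2)] u by auto
  define n where "n = u - (a * t + b) / (c * t + d)"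
  have nZ: "n \<in> \<int>" using t by (simp add: to_circle_eq_iff n_def)
  define A B where "A = a + n * c" and "B = b + n * d"
  have det: "A * d - B * c = a * d - b * c" by (simp add: A_def B_def algebra_simps)
  have AB: "(A * s + B) / (c * s + d) = (a * s + b) / (c * s + d) + n" if "c * s + d \<noteq> 0" for s
    using that by (simp add: A_def B_def field_simps)
  have uAB: "u = (A * t + B) / (c * t + d)"
    using AB[OF t(1)] by (simp add: n_def)
  have den: "- c * u + A = (a * d - b * c) / (c * t + d)"
    using t(1) det by (simp add: uAB field_simps)
  have den0: "- c * u + A \<noteq> 0" using den a(1) t(1) by simp
  have uD: "u * (c * t + d) = A * t + B" using t(1) by (simp add: uAB)
  have "(d * u - B) * (c * t + d) = d * (u * (c * t + d)) - B * (c * t + d)"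
    by (simp add: algebra_simps)
  also have "\<dots> = t * (A * d - B * c)"
    unfolding uD by (simp add: algebra_simps)
  finally have "(d * u - B) * (c * t + d) = t * (a * d - b * c)"
    unfolding det .
  then have tu: "(d * u + - B) / (- c * u + A) = t"
    unfolding den using t(1) a(1) by (simp add: field_simps)
  have lim: "((\<lambda>y. (d * y + - B) / (- c * y + A)) \<longlongrightarrow> (d * u + - B) / (- c * u + A)) (nhds u)"
    using den0 by (intro tendsto_intros filterlim_ident)
  have "\<forall>\<^sub>F s in nhds t. c * s + d \<noteq> 0 \<and> g (to_circle ((A * s + B) / (c * s + d))) = to_circle s"
    using g a(2)
  proof eventually_elim
    case (elim s)
    then have "to_circle ((A * s + B) / (c * s + d)) = to_circle ((a * s + b) / (c * s + d))"
      using AB[of s] nZ by (simp add: to_circle_eq_iff)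
    with elim show ?case by simp
  qed
  with lim have "\<forall>\<^sub>F y in nhds u. c * ((d * y + - B) / (- c * y + A)) + d \<noteq> 0 \<and>
      g (to_circle ((A * ((d * y + - B) / (- c * y + A)) + B) / (c * ((d * y + - B) / (- c * y + A)) + d)))
      = to_circle ((d * y + - B) / (- c * y + A))"
    unfolding tu filterlim_iff by blast
  moreover have "\<forall>\<^sub>F y in nhds u. - c * y + A \<noteq> 0"
  proof -
    have "((\<lambda>y. - c * y + A) \<longlongrightarrow> - c * u + A) (nhds u)" by (intro tendsto_intros filterlim_ident)
    then show ?thesis using den0 by (rule tendsto_imp_eventually_ne)
  qed
  ultimately have "\<forall>\<^sub>F y in nhds u. - c * y + A \<noteq> 0 \<and>
      g (to_circle y) = to_circle ((d * y + - B) / (- c * y + A))"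
  proof eventually_elim
    case (elim y)
    define E where "E = - c * y + A"
    have E: "E \<noteq> 0" using elim by (simp add: E_def)
    have "A * (d * y + - B) + B * E = (a * d - b * c) * y"
      "c * (d * y + - B) + d * E = a * d - b * c"
      unfolding det[symmetric] by (simp_all add: E_def algebra_simps)
    moreover have "A * ((d * y + - B) / E) + B = (A * (d * y + - B) + B * E) / E"
      "c * ((d * y + - B) / E) + d = (c * (d * y + - B) + d * E) / E"
      using E by (simp_all add: field_simps)
    ultimately have "(A * ((d * y + - B) / E) + B) / (c * ((d * y + - B) / E) + d) = y"
      using E a(1) by simp
    with elim show ?case by (simp add: E_def)
  qed
  moreover have "d * A - - B * - c \<noteq> 0" using det a(1) by (simp add: algebra_simps)
  ultimately show "locally_projective_at g u"
    unfolding locally_projective_at_def by blast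
qed

lemma group_PC_Aff: "group PC_Aff"
  unfolding PC_Aff_def by (rule affine.group_PC)

lemma group_PC_Proj: "group PC_Proj"
  unfolding PC_Proj_def by (rule projective.group_PC)


section \<open>Property FW\<close>

definition commensurated :: "('a, 'c) monoid_scheme \<Rightarrow> ('a \<Rightarrow> 'y \<Rightarrow> 'y) \<Rightarrow> 'y set \<Rightarrow> bool" where
  "commensurated G \<phi> M \<longleftrightarrow> (\<forall>g\<in>carrier G. finite (sym_diff M (\<phi> g ` M)))"

definition transfixed ::
  "('a, 'c) monoid_scheme \<Rightarrow> 'y set \<Rightarrow> ('a \<Rightarrow> 'y \<Rightarrow> 'y) \<Rightarrow> 'y set \<Rightarrow> bool" where
  "transfixed G Y \<phi> M \<longleftrightarrow>
     (\<exists>M0\<subseteq>Y. (\<forall>g\<in>carrier G. \<phi> g ` M0 = M0) \<and> finite (sym_diff M M0))"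

text \<open>
  HOL cannot quantify over types inside a formula, so \<open>Y\<close> ranges over the subsets of one type.
  That type is large enough: \<open>property_FW_universal\<close> below gives the property for
  \<open>G\<close>-sets of every type.
\<close>

definition property_FW :: "('a, 'c) monoid_scheme \<Rightarrow> bool" where
  "property_FW G \<longleftrightarrow>
     (\<forall>(Y :: ('a \<times> 'a \<times> nat) set) \<phi> M.
        group_action G Y \<phi> \<longrightarrow> M \<subseteq> Y \<longrightarrow> commensurated G \<phi> M \<longrightarrow> transfixed G Y \<phi> M)"

lemma group_action_transport:
  fixes G :: "('a, 'b) monoid_scheme"
  assumes act: "group_action G Y \<phi>" and W: "W \<subseteq> Y"
    and inv: "\<And>g. g \<in> carrier G \<Longrightarrow> \<phi> g ` W \<subseteq> W" and j: "inj_on j W"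
  shows "group_action G (j ` W) (\<lambda>g. \<lambda>x\<in>j ` W. j (\<phi> g (inv_into W j x)))"
proof -
  interpret group_action G Y \<phi> by (rule act)
  interpret G: group G using group_hom by (simp add: group_hom_def)
  define \<psi> where "\<psi> g = (\<lambda>x\<in>j ` W. j (\<phi> g (inv_into W j x)))" for g
  have \<psi>: "\<psi> g (j y) = j (\<phi> g y)" if "y \<in> W" for g y
    using that j by (simp add: \<psi>_def)
  have mem: "\<phi> g y \<in> W" if "g \<in> carrier G" "y \<in> W" for g y
    using inv that by blast
  have inverse: "\<phi> (inv\<^bsub>G\<^esub> g) (\<phi> g y) = y" if "g \<in> carrier G" "y \<in> W" for g y
    using orbit_sym_aux[OF that(1) _ refl] that W by auto
  have Bij: "\<psi> g \<in> Bij (j ` W)" if g: "g \<in> carrier G" for g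
  proof -
    have g': "inv\<^bsub>G\<^esub> g \<in> carrier G" using g by simp
    have "bij_betw (\<psi> g) (j ` W) (j ` W)"
      using inverse[OF g] inverse[OF g'] mem[OF g] mem[OF g'] g
      by (intro bij_betw_byWitness[where f' = "\<psi> (inv\<^bsub>G\<^esub> g)"]) (auto simp: \<psi>)
    then show ?thesis by (simp add: Bij_def \<psi>_def)
  qed
  have "\<psi> (g \<otimes>\<^bsub>G\<^esub> h) = \<psi> g \<otimes>\<^bsub>BijGroup (j ` W)\<^esub> \<psi> h" if gh: "g \<in> carrier G" "h \<in> carrier G" for g h
  proof
    fix x
    show "\<psi> (g \<otimes>\<^bsub>G\<^esub> h) x = (\<psi> g \<otimes>\<^bsub>BijGroup (j ` W)\<^esub> \<psi> h) x"
    proof (cases "x \<in> j ` W")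
      case True
      then obtain y where y: "y \<in> W" "x = j y" by blast
      then have "\<phi> (g \<otimes>\<^bsub>G\<^esub> h) y = \<phi> g (\<phi> h y)"
        using composition_rule gh W by blast
      then show ?thesis
        using Bij gh y mem by (simp add: BijGroup_def compose_def \<psi>)
    next
      case False
      then show ?thesis
        using Bij gh by (simp add: BijGroup_def compose_def \<psi>_def)
    qed
  qed
  then have "\<psi> \<in> hom G (BijGroup (j ` W))"
    using Bij by (auto simp: hom_def BijGroup_def)
  then have "group_action G (j ` W) \<psi>"
    by (simp add: group_action_def group_hom_def group_hom_axioms_def group_BijGroup G.group_axioms)
  then show ?thesis by (simp add: \<psi>_def[abs_def])
qed

theorem property_FW_universal:
  fixes G :: "('a, 'b) monoid_scheme" and Y :: "'y set"
  assumes FW: "property_FW G" and act: "group_action G Y \<phi>"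
    and M: "M \<subseteq> Y" "commensurated G \<phi> M"
  shows "transfixed G Y \<phi> M"
proof -
  interpret group_action G Y \<phi> by (rule act)
  interpret G: group G using group_hom by (simp add: group_hom_def)
  define S where "S g = sym_diff M (\<phi> g ` M)" for g
  define Z where "Z = {\<phi> h y |h g y. h \<in> carrier G \<and> g \<in> carrier G \<and> y \<in> S g}"
  have fin: "finite (S g)" if "g \<in> carrier G" for g
    using M(2) that by (simp add: commensurated_def S_def)
  have SY: "S g \<subseteq> Y" if "g \<in> carrier G" for g
    using M(1) surj_prop[OF that] by (auto simp: S_def)
  have ZY: "Z \<subseteq> Y"
    unfolding Z_def using SY element_image by blast
  have inv: "\<phi> k ` Z \<subseteq> Z" if k: "k \<in> carrier G" for k
  proof
    fix z assume "z \<in> \<phi> k ` Z"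
    then obtain h g y where *: "h \<in> carrier G" "g \<in> carrier G" "y \<in> S g" "z = \<phi> k (\<phi> h y)"
      by (auto simp: Z_def)
    then have "y \<in> Y" using SY by blast
    then have "z = \<phi> (k \<otimes>\<^bsub>G\<^esub> h) y" using * k by (simp add: composition_rule)
    moreover have "k \<otimes>\<^bsub>G\<^esub> h \<in> carrier G" using * k by simp
    ultimately show "z \<in> Z" unfolding Z_def mem_Collect_eq using *(2,3) by (intro exI conjI)
  qed
  have invZ: "\<phi> (inv\<^bsub>G\<^esub> g) z \<in> Z" if "g \<in> carrier G" "z \<in> Z" for g z
    using inv[of "inv\<^bsub>G\<^esub> g"] that by blast
  have cancel1: "\<phi> (inv\<^bsub>G\<^esub> g) (\<phi> g m) = m" if "g \<in> carrier G" "m \<in> Y" for g m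
    by (rule orbit_sym_aux[OF that refl])
  have cancel2: "\<phi> g (\<phi> (inv\<^bsub>G\<^esub> g) m) = m" if "g \<in> carrier G" "m \<in> Y" for g m
    using cancel1[of "inv\<^bsub>G\<^esub> g" m] that by simp
  have SZ: "S g \<subseteq> Z" if "g \<in> carrier G" for g
  proof
    fix y assume y: "y \<in> S g"
    then have "y \<in> Y" using SY[OF that] by blast
    then have "y = \<phi> \<one>\<^bsub>G\<^esub> y" by (metis id_eq_one restrict_apply')
    then show "y \<in> Z" unfolding Z_def mem_Collect_eq
      using y that G.one_closed by (intro exI conjI)
  qed
  define enc where "enc g = (SOME e :: 'y \<Rightarrow> nat. inj_on e (S g))" for g
  have enc: "inj_on (enc g) (S g)" if "g \<in> carrier G" for g
  proof -
    have "\<exists>e :: 'y \<Rightarrow> nat. inj_on e (S g)"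
      using finite_imp_inj_to_nat_seg[OF fin[OF that]] by blast
    then show ?thesis unfolding enc_def by (rule someI_ex)
  qed
  have "\<forall>z\<in>Z. \<exists>h g y. h \<in> carrier G \<and> g \<in> carrier G \<and> y \<in> S g \<and> z = \<phi> h y"
    unfolding Z_def by blast
  then obtain H K y where HKy: "\<And>z. z \<in> Z \<Longrightarrow>
      H z \<in> carrier G \<and> K z \<in> carrier G \<and> y z \<in> S (K z) \<and> z = \<phi> (H z) (y z)"
    by metis
  define j where "j z = (H z, K z, enc (K z) (y z))" for z
  have j: "inj_on j Z"
  proof (rule inj_onI)
    fix z z' assume zz: "z \<in> Z" "z' \<in> Z" "j z = j z'"
    then have e: "H z = H z'" "K z = K z'" "enc (K z) (y z) = enc (K z) (y z')" by (auto simp: j_def)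
    moreover have "y z \<in> S (K z)" "y z' \<in> S (K z)" "K z \<in> carrier G"
      using HKy[OF zz(1)] HKy[OF zz(2)] e by auto
    ultimately have "y z = y z'" using enc by (meson inj_onD)
    then show "z = z'" using HKy[OF zz(1)] HKy[OF zz(2)] e by metis
  qed
  let ?\<psi> = "\<lambda>g. \<lambda>x\<in>j ` Z. j (\<phi> g (inv_into Z j x))"
  have act': "group_action G (j ` Z) ?\<psi>"
    by (rule group_action_transport[OF act ZY inv j])
  have img: "?\<psi> g ` (j ` A) = j ` (\<phi> g ` A)" if "A \<subseteq> Z" for g A
    using that j unfolding image_image by (intro image_cong) (auto simp: subset_iff)
  have "commensurated G ?\<psi> (j ` (M \<inter> Z))"
    unfolding commensurated_def
  proof
    fix g assume g: "g \<in> carrier G"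
    have sub: "M \<inter> Z \<subseteq> Z" by simp
    have "sym_diff (j ` (M \<inter> Z)) (?\<psi> g ` (j ` (M \<inter> Z))) \<subseteq> j ` S g"
    proof -
      have "\<phi> g ` M \<inter> Z \<subseteq> \<phi> g ` (M \<inter> Z)"
      proof
        fix x assume x: "x \<in> \<phi> g ` M \<inter> Z"
        then obtain m where m: "m \<in> M" "x = \<phi> g m" by blast
        then have "m = \<phi> (inv\<^bsub>G\<^esub> g) x" using cancel1[OF g, of m] M(1) by auto
        then have "m \<in> Z" using invZ[OF g, of x] x by simp
        then show "x \<in> \<phi> g ` (M \<inter> Z)" using m by blast
      qed
      moreover have "\<phi> g ` (M \<inter> Z) \<subseteq> Z" using inv[OF g] by blast
      ultimately show ?thesis unfolding img[OF sub] S_def by blast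
    qed
    then show "finite (sym_diff (j ` (M \<inter> Z)) (?\<psi> g ` (j ` (M \<inter> Z))))"
      by (rule finite_subset) (use fin[OF g] in simp)
  qed
  moreover have "j ` (M \<inter> Z) \<subseteq> j ` Z" by blast
  ultimately have "transfixed G (j ` Z) ?\<psi> (j ` (M \<inter> Z))"
    using FW act' unfolding property_FW_def by blast
  then obtain N0 where N0: "N0 \<subseteq> j ` Z" "\<And>g. g \<in> carrier G \<Longrightarrow> ?\<psi> g ` N0 = N0"
      "finite (sym_diff (j ` (M \<inter> Z)) N0)"
    unfolding transfixed_def by blast
  obtain M1 where M1: "M1 \<subseteq> Z" "N0 = j ` M1"
    using N0(1) by (meson subset_imageE)
  have M1inv: "\<phi> g ` M1 = M1" if g: "g \<in> carrier G" for g
  proof -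
    have "j ` (\<phi> g ` M1) = j ` M1" using N0(2)[OF g] M1 img by metis
    moreover have "\<phi> g ` M1 \<subseteq> Z" using inv[OF g] M1 by blast
    ultimately show ?thesis using j M1(1) by (metis inj_on_image_eq_iff)
  qed
  have out: "\<phi> g ` (M - Z) \<subseteq> M - Z" if g: "g \<in> carrier G" for g
  proof
    fix x assume "x \<in> \<phi> g ` (M - Z)"
    then obtain m where m: "m \<in> M" "m \<notin> Z" "x = \<phi> g m" by blast
    have xZ: "x \<notin> Z"
    proof
      assume "x \<in> Z"
      then have "\<phi> (inv\<^bsub>G\<^esub> g) x \<in> Z" by (rule invZ[OF g])
      moreover have "\<phi> (inv\<^bsub>G\<^esub> g) x = m" using cancel1[OF g, of m] M(1) m by auto
      ultimately show False using m by simp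
    qed
    moreover have "x \<in> M" using SZ[OF g] m xZ unfolding S_def by blast
    ultimately show "x \<in> M - Z" by simp
  qed
  have outeq: "\<phi> g ` (M - Z) = M - Z" if g: "g \<in> carrier G" for g
  proof (intro equalityI out[OF g] subsetI)
    fix x assume x: "x \<in> M - Z"
    then have "\<phi> (inv\<^bsub>G\<^esub> g) x \<in> M - Z" using out[OF G.inv_closed[OF g]] by blast
    moreover have "\<phi> g (\<phi> (inv\<^bsub>G\<^esub> g) x) = x" using cancel2[OF g, of x] x M(1) by blast
    ultimately show "x \<in> \<phi> g ` (M - Z)" by (metis imageI)
  qed
  have "sym_diff M (M1 \<union> (M - Z)) = sym_diff (M \<inter> Z) M1"
    using M1(1) by blast
  moreover have "finite (sym_diff (M \<inter> Z) M1)"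
  proof -
    have "j ` sym_diff A M1 = sym_diff (j ` A) (j ` M1)" if "A \<subseteq> Z" for A
      using that inj_on_image_set_diff[OF j, of A M1] inj_on_image_set_diff[OF j, of M1 A] M1(1)
      by (auto simp: image_Un)
    then have "j ` sym_diff (M \<inter> Z) M1 \<subseteq> sym_diff (j ` (M \<inter> Z)) N0"
      using M1(2) by (metis inf_le2 order_refl)
    then have "finite (j ` sym_diff (M \<inter> Z) M1)" using N0(3) finite_subset by blast
    moreover have "inj_on j (sym_diff (M \<inter> Z) M1)"
      using j by (rule inj_on_subset) (use M1 in blast)
    ultimately show ?thesis by (rule finite_imageD)
  qed
  ultimately show ?thesis
    unfolding transfixed_def using M1 M1inv outeq M(1) ZY
    by (intro exI[of _ "M1 \<union> (M - Z)"]) (auto simp: image_Un)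
qed


section \<open>Kazhdan's Property T for discrete groups\<close>

definition complex_ring :: "complex ring" where
  "complex_ring = \<lparr>carrier = UNIV, mult = (*), one = 1, zero = 0, add = (+)\<rparr>"

record 'v inner_module = "(complex, 'v) module" +
  inprod :: "'v \<Rightarrow> 'v \<Rightarrow> complex"

definition hnorm :: "('v, 'c) inner_module_scheme \<Rightarrow> 'v \<Rightarrow> real" where
  "hnorm V x = sqrt (Re (inprod V x x))"

locale hilbert_space = module complex_ring V for V :: "('v, 'c) inner_module_scheme" (structure) +
  assumes inprod_add_left:
      "\<lbrakk>x \<in> carrier V; y \<in> carrier V; z \<in> carrier V\<rbrakk> \<Longrightarrow>
         inprod V (x \<oplus> y) z = inprod V x z + inprod V y z"
    and inprod_smult_left:
      "\<lbrakk>x \<in> carrier V; y \<in> carrier V\<rbrakk> \<Longrightarrow> inprod V (c \<odot> x) y = c * inprod V x y"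
    and inprod_commute:
      "\<lbrakk>x \<in> carrier V; y \<in> carrier V\<rbrakk> \<Longrightarrow> inprod V y x = cnj (inprod V x y)"
    and inprod_pos:
      "\<lbrakk>x \<in> carrier V; x \<noteq> \<zero>\<rbrakk> \<Longrightarrow> 0 < Re (inprod V x x)"
    and complete:
      "\<lbrakk>range X \<subseteq> carrier V;
        \<And>e. 0 < e \<Longrightarrow> \<exists>N. \<forall>m\<ge>N. \<forall>n\<ge>N. hnorm V (X m \<ominus> X n) < e\<rbrakk> \<Longrightarrow>
       \<exists>L\<in>carrier V. (\<lambda>n :: nat. hnorm V (X n \<ominus> L)) \<longlonglongrightarrow> 0"

text \<open>A \<^locale>\<open>group_action\<close> acts by bijections, so the operators \<open>\<pi> g\<close> are unitary.\<close>

locale unitary_rep =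
  hilbert_space V + group_action G "carrier V" \<pi>
  for G :: "('a, 'b) monoid_scheme" and V :: "('v, 'c) inner_module_scheme" and \<pi> +
  assumes rep_add:
      "\<lbrakk>g \<in> carrier G; x \<in> carrier V; y \<in> carrier V\<rbrakk> \<Longrightarrow> \<pi> g (x \<oplus>\<^bsub>V\<^esub> y) = \<pi> g x \<oplus>\<^bsub>V\<^esub> \<pi> g y"
    and rep_smult:
      "\<lbrakk>g \<in> carrier G; x \<in> carrier V\<rbrakk> \<Longrightarrow> \<pi> g (c \<odot>\<^bsub>V\<^esub> x) = c \<odot>\<^bsub>V\<^esub> \<pi> g x"
    and rep_inprod:
      "\<lbrakk>g \<in> carrier G; x \<in> carrier V; y \<in> carrier V\<rbrakk> \<Longrightarrow> inprod V (\<pi> g x) (\<pi> g y) = inprod V x y"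

definition has_almost_invariant_vector ::
  "('v, 'c) inner_module_scheme \<Rightarrow> ('a \<Rightarrow> 'v \<Rightarrow> 'v) \<Rightarrow> 'a set \<Rightarrow> real \<Rightarrow> bool" where
  "has_almost_invariant_vector V \<pi> S \<epsilon> \<longleftrightarrow>
     (\<exists>x\<in>carrier V - {\<zero>\<^bsub>V\<^esub>}. \<forall>s\<in>S. hnorm V (\<pi> s x \<ominus>\<^bsub>V\<^esub> x) < \<epsilon> * hnorm V x)"

definition has_invariant_vector ::
  "('a, 'b) monoid_scheme \<Rightarrow> ('v, 'c) inner_module_scheme \<Rightarrow> ('a \<Rightarrow> 'v \<Rightarrow> 'v) \<Rightarrow> bool" where
  "has_invariant_vector G V \<pi> \<longleftrightarrow> (\<exists>x\<in>carrier V - {\<zero>\<^bsub>V\<^esub>}. \<forall>g\<in>carrier G. \<pi> g x = x)"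


text \<open>
  As for Property FW, the Hilbert spaces range over the structures whose carrier is a subset of
  one type, which is large enough by \<open>kazhdan_pair_universal\<close> below: a nonzero
  \<open>(S, \<epsilon>)\<close>-invariant vector of a unitary representation on a Hilbert space of any type yields
  a nonzero invariant vector.
\<close>

definition kazhdan_pair :: "('a, 'b) monoid_scheme \<Rightarrow> 'a set \<Rightarrow> real \<Rightarrow> bool" where
  "kazhdan_pair G S \<epsilon> \<longleftrightarrow>
     (\<forall>(V :: ('a \<times> nat \<Rightarrow> complex) inner_module) \<pi>.
        unitary_rep G V \<pi> \<longrightarrow> has_almost_invariant_vector V \<pi> S \<epsilon> \<longrightarrow>
        has_invariant_vector G V \<pi>)"

text \<open>The compact subsets of a discrete group are the finite ones.\<close>

definition property_T :: "('a, 'b) monoid_scheme \<Rightarrow> bool" where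
  "property_T G \<longleftrightarrow> (\<exists>S \<epsilon>. S \<subseteq> carrier G \<and> finite S \<and> 0 < \<epsilon> \<and> kazhdan_pair G S \<epsilon>)"

context hilbert_space
begin

lemma inprod_add_right:
  assumes "x \<in> carrier V" "y \<in> carrier V" "z \<in> carrier V"
  shows "inprod V x (y \<oplus> z) = inprod V x y + inprod V x z"
proof -
  have "inprod V x (y \<oplus> z) = cnj (inprod V (y \<oplus> z) x)"
    using assms by (intro inprod_commute) auto
  also have "\<dots> = cnj (inprod V y x) + cnj (inprod V z x)"
    using assms by (simp add: inprod_add_left)
  also have "\<dots> = inprod V x y + inprod V x z"
    using inprod_commute[of y x] inprod_commute[of z x] assms by simp
  finally show ?thesis .
qed

lemma scalar_carrier [simp]: "c \<in> carrier complex_ring"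
  by (simp add: complex_ring_def)

lemma inprod_smult_right:
  assumes "x \<in> carrier V" "y \<in> carrier V"
  shows "inprod V x (c \<odot> y) = cnj c * inprod V x y"
proof -
  have "inprod V x (c \<odot> y) = cnj (inprod V (c \<odot> y) x)"
    using assms by (intro inprod_commute) auto
  also have "\<dots> = cnj c * inprod V x y"
    using assms inprod_commute[of y x] by (simp add: inprod_smult_left)
  finally show ?thesis .
qed

lemma smult_0: "x \<in> carrier V \<Longrightarrow> 0 \<odot> x = \<zero>"
  using smult_l_null[of x] by (simp add: complex_ring_def)

lemma smult_1: "x \<in> carrier V \<Longrightarrow> 1 \<odot> x = x"
  using smult_one[of x] by (simp add: complex_ring_def)

lemma smult_add: "x \<in> carrier V \<Longrightarrow> (a + b) \<odot> x = a \<odot> x \<oplus> b \<odot> x"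
  using smult_l_distr[of a b x] by (simp add: complex_ring_def)

lemma smult_smult: "x \<in> carrier V \<Longrightarrow> (a * b) \<odot> x = a \<odot> (b \<odot> x)"
  using smult_assoc1[of a b x] by (simp add: complex_ring_def)

lemma smult_uminus_1:
  assumes x: "x \<in> carrier V" shows "(-1) \<odot> x = \<ominus> x"
proof -
  have "(-1) \<odot> x \<oplus> x = (-1 + 1) \<odot> x"
    using x smult_add[of x "-1" 1] by (simp add: smult_1)
  also have "\<dots> = \<zero>" using x by (simp add: smult_0)
  finally have "(-1) \<odot> x \<oplus> x = \<zero>" .
  then have "\<ominus> x = (-1) \<odot> x" using x by (intro M.minus_equality) auto
  then show ?thesis by simp
qed

lemma inprod_zero_left: "x \<in> carrier V \<Longrightarrow> inprod V \<zero> x = 0"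
  using inprod_smult_left[of x x 0] by (simp add: smult_0)

lemma Re_inprod_nonneg: "x \<in> carrier V \<Longrightarrow> 0 \<le> Re (inprod V x x)"
  using inprod_pos[of x] inprod_zero_left[of x] by (cases "x = \<zero>") auto

lemma hnorm_nonneg: "x \<in> carrier V \<Longrightarrow> 0 \<le> hnorm V x"
  by (simp add: hnorm_def Re_inprod_nonneg)

lemma hnorm_zero: "hnorm V \<zero> = 0"
  by (simp add: hnorm_def inprod_zero_left)

lemma hnorm_eq_0: "x \<in> carrier V \<Longrightarrow> hnorm V x = 0 \<longleftrightarrow> x = \<zero>"
  using inprod_pos[of x] by (cases "x = \<zero>") (auto simp: hnorm_def inprod_zero_left)

lemma hnorm_sq: "x \<in> carrier V \<Longrightarrow> (hnorm V x)\<^sup>2 = Re (inprod V x x)"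
  by (simp add: hnorm_def Re_inprod_nonneg)

lemma inprod_self_real:
  assumes "x \<in> carrier V" shows "inprod V x x = of_real ((hnorm V x)\<^sup>2)"
  using inprod_commute[OF assms assms] by (simp add: hnorm_sq[OF assms] complex_eq_iff)

lemma hnorm_smult:
  assumes "x \<in> carrier V" shows "hnorm V (c \<odot> x) = cmod c * hnorm V x"
proof -
  have "inprod V (c \<odot> x) (c \<odot> x) = (c * cnj c) * inprod V x x"
    using assms by (simp add: inprod_smult_left inprod_smult_right)
  also have "\<dots> = of_real ((cmod c * hnorm V x)\<^sup>2)"
    by (simp add: complex_norm_square[symmetric] inprod_self_real[OF assms] power_mult_distrib)
  finally show ?thesis
    unfolding hnorm_def[of V "c \<odot> x"] by (simp add: hnorm_nonneg[OF assms] del: of_real_power)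
qed

lemma Re_inprod_le:
  assumes x: "x \<in> carrier V" and y: "y \<in> carrier V"
  shows "Re (inprod V x y) \<le> hnorm V x * hnorm V y"
proof (cases "y = \<zero>")
  case True
  then show ?thesis
    using inprod_commute[OF y x] by (simp add: inprod_zero_left x hnorm_zero)
next
  case False
  define X Y r where "X = hnorm V x" and "Y = hnorm V y" and "r = Re (inprod V x y)"
  have Y: "0 < Y" using False hnorm_nonneg[OF y] hnorm_eq_0[OF y] by (simp add: Y_def)
  have X: "0 \<le> X" using hnorm_nonneg[OF x] by (simp add: X_def)
  define t where "t = - r / Y\<^sup>2"
  have rx: "Re (inprod V y x) = r" using inprod_commute[OF x y] by (simp add: r_def)
  define z where "z = complex_of_real t \<odot> y"
  have z: "z \<in> carrier V" using y by (simp add: z_def)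
  have "Re (inprod V x z) = t * r" "Re (inprod V z x) = t * r" "Re (inprod V z z) = t * (t * Y\<^sup>2)"
    using x y rx unfolding z_def
    by (simp_all add: inprod_smult_left inprod_smult_right r_def Y_def hnorm_sq)
  moreover have "0 \<le> Re (inprod V (x \<oplus> z) (x \<oplus> z))"
    using x z by (intro Re_inprod_nonneg) auto
  moreover have "inprod V (x \<oplus> z) (x \<oplus> z)
      = inprod V x x + inprod V x z + (inprod V z x + inprod V z z)"
    using x z by (simp add: inprod_add_left inprod_add_right)
  moreover have "Re (inprod V x x) = X\<^sup>2" using x by (simp add: X_def hnorm_sq)
  ultimately have "0 \<le> X\<^sup>2 + 2 * (t * r) + t * (t * Y\<^sup>2)"
    by (simp only: plus_complex.sel)
  also have "\<dots> = X\<^sup>2 - r\<^sup>2 / Y\<^sup>2"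
    using Y by (simp add: t_def power2_eq_square field_simps)
  finally have "r\<^sup>2 \<le> (X * Y)\<^sup>2"
    using Y by (simp add: pos_divide_le_eq power_mult_distrib)
  moreover have "0 \<le> X * Y" using X Y by simp
  ultimately have "r \<le> X * Y" by (rule power2_le_imp_le)
  then show ?thesis by (simp add: X_def Y_def r_def)
qed

lemma hnorm_triangle:
  assumes x: "x \<in> carrier V" and y: "y \<in> carrier V"
  shows "hnorm V (x \<oplus> y) \<le> hnorm V x + hnorm V y"
proof (rule power2_le_imp_le)
  have "Re (inprod V y x) = Re (inprod V x y)" using inprod_commute[OF x y] by simp
  then have "(hnorm V (x \<oplus> y))\<^sup>2 = (hnorm V x)\<^sup>2 + 2 * Re (inprod V x y) + (hnorm V y)\<^sup>2"
    using x y by (simp add: hnorm_sq inprod_add_left inprod_add_right)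
  also have "\<dots> \<le> (hnorm V x)\<^sup>2 + 2 * (hnorm V x * hnorm V y) + (hnorm V y)\<^sup>2"
    using Re_inprod_le[OF x y] by simp
  finally show "(hnorm V (x \<oplus> y))\<^sup>2 \<le> (hnorm V x + hnorm V y)\<^sup>2"
    by (simp add: power2_sum algebra_simps)
  show "0 \<le> hnorm V x + hnorm V y" using x y by (simp add: hnorm_nonneg)
qed

lemma hnorm_uminus: "x \<in> carrier V \<Longrightarrow> hnorm V (\<ominus> x) = hnorm V x"
  using hnorm_smult[of x "-1"] by (simp add: smult_uminus_1)

lemma hnorm_minus_commute:
  assumes "x \<in> carrier V" "y \<in> carrier V" shows "hnorm V (x \<ominus> y) = hnorm V (y \<ominus> x)"
proof -
  have "\<ominus> (x \<ominus> y) = y \<ominus> x"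
    using assms by (simp add: M.minus_eq M.minus_add M.minus_minus M.a_comm)
  then show ?thesis using assms hnorm_uminus[of "x \<ominus> y"] by simp
qed

lemma hnorm_minus_triangle:
  assumes "x \<in> carrier V" "y \<in> carrier V" "z \<in> carrier V"
  shows "hnorm V (x \<ominus> z) \<le> hnorm V (x \<ominus> y) + hnorm V (y \<ominus> z)"
proof -
  have "(x \<ominus> y) \<oplus> (y \<ominus> z) = x \<oplus> ((\<ominus> y \<oplus> y) \<oplus> \<ominus> z)"
    using assms by (simp add: M.minus_eq M.a_assoc)
  also have "\<dots> = x \<ominus> z" using assms by (simp add: M.l_neg M.minus_eq)
  finally show ?thesis
    using hnorm_triangle[of "x \<ominus> y" "y \<ominus> z"] assms by simp
qed

lemma minus_zero_iff:
  assumes "x \<in> carrier V" "y \<in> carrier V" shows "x \<ominus> y = \<zero> \<longleftrightarrow> x = y"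
  using assms by (metis M.minus_eq M.r_neg M.minus_equality M.a_inv_closed M.minus_minus)

lemma add_minus_add:
  assumes "x \<in> carrier V" "y \<in> carrier V" "x' \<in> carrier V" "y' \<in> carrier V"
  shows "(x \<oplus> y) \<ominus> (x' \<oplus> y') = (x \<ominus> x') \<oplus> (y \<ominus> y')"
  using assms by (simp add: M.minus_eq M.minus_add M.a_ac)

lemma smult_minus:
  assumes "x \<in> carrier V" "y \<in> carrier V"
  shows "c \<odot> x \<ominus> c \<odot> y = c \<odot> (x \<ominus> y)"
  using assms by (simp add: M.minus_eq smult_r_distr smult_r_minus)

end

text \<open>Transport of a closed subspace of a Hilbert space along an injection.\<close>

definition transport_module ::
  "('v, 'c) inner_module_scheme \<Rightarrow> 'v set \<Rightarrow> ('v \<Rightarrow> 'w) \<Rightarrow> 'w inner_module" where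
  "transport_module V W j =
     \<lparr>carrier = j ` W, mult = undefined, one = undefined, zero = j \<zero>\<^bsub>V\<^esub>,
      add = (\<lambda>x y. j (inv_into W j x \<oplus>\<^bsub>V\<^esub> inv_into W j y)),
      smult = (\<lambda>c x. j (c \<odot>\<^bsub>V\<^esub> inv_into W j x)),
      inprod = (\<lambda>x y. inprod V (inv_into W j x) (inv_into W j y))\<rparr>"

locale closed_subspace = hilbert_space V for V :: "('v, 'c) inner_module_scheme" (structure) +
  fixes W :: "'v set"
  assumes sub: "W \<subseteq> carrier V"
    and zero_mem: "\<zero> \<in> W"
    and add_mem: "\<lbrakk>x \<in> W; y \<in> W\<rbrakk> \<Longrightarrow> x \<oplus> y \<in> W"
    and smult_mem: "x \<in> W \<Longrightarrow> c \<odot> x \<in> W"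
    and closed: "\<lbrakk>x \<in> carrier V; \<And>e. 0 < e \<Longrightarrow> \<exists>y\<in>W. hnorm V (x \<ominus> y) < e\<rbrakk> \<Longrightarrow> x \<in> W"
begin

lemma subD: "x \<in> W \<Longrightarrow> x \<in> carrier V"
  using sub by blast

lemma uminus_mem: "x \<in> W \<Longrightarrow> \<ominus> x \<in> W"
  using smult_mem[of x "-1"] subD[of x] by (simp add: smult_uminus_1)

context
  fixes j :: "'v \<Rightarrow> 'w" and U :: "'w inner_module"
  assumes j: "inj_on j W"
  defines "U \<equiv> transport_module V W j"
begin

lemma transport_simps:
  "carrier U = j ` W" "\<zero>\<^bsub>U\<^esub> = j \<zero>"
  "\<lbrakk>x \<in> W; y \<in> W\<rbrakk> \<Longrightarrow> j x \<oplus>\<^bsub>U\<^esub> j y = j (x \<oplus> y)"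
  "x \<in> W \<Longrightarrow> c \<odot>\<^bsub>U\<^esub> j x = j (c \<odot> x)"
  "\<lbrakk>x \<in> W; y \<in> W\<rbrakk> \<Longrightarrow> inprod U (j x) (j y) = inprod V x y"
  "x \<in> W \<Longrightarrow> hnorm U (j x) = hnorm V x"
  using j by (simp_all add: U_def transport_module_def hnorm_def)

lemma abelian_group_transport: "abelian_group U"
proof (rule abelian_groupI)
  fix x assume "x \<in> carrier U"
  then obtain w where w: "w \<in> W" "x = j w" by (auto simp: transport_simps)
  then have "j (\<ominus> w) \<oplus>\<^bsub>U\<^esub> x = \<zero>\<^bsub>U\<^esub>"
    using subD[OF w(1)] by (simp add: transport_simps uminus_mem M.l_neg)
  then show "\<exists>y\<in>carrier U. y \<oplus>\<^bsub>U\<^esub> x = \<zero>\<^bsub>U\<^esub>"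
    using w uminus_mem by (auto simp: transport_simps)
qed (auto simp: transport_simps zero_mem add_mem subD M.a_ac)

lemma transport_minus:
  assumes "x \<in> W" "y \<in> W" shows "j x \<ominus>\<^bsub>U\<^esub> j y = j (x \<ominus> y)"
proof -
  interpret U: abelian_group U by (rule abelian_group_transport)
  have "\<ominus>\<^bsub>U\<^esub> j y = j (\<ominus> y)"
    using assms subD by (intro U.minus_equality) (auto simp: transport_simps uminus_mem M.l_neg)
  then show ?thesis
    using assms by (simp add: a_minus_def transport_simps uminus_mem)
qed

lemma hilbert_space_transport: "hilbert_space U"
proof -
  have "module complex_ring U"
    by (rule moduleI[OF R.cring_axioms abelian_group_transport])
      (auto simp: transport_simps smult_mem add_mem subD smult_l_distr smult_r_distr smult_assoc1
        intro!: arg_cong[of _ _ j] smult_one)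
  moreover have "hilbert_space_axioms U"
  proof
    fix X :: "nat \<Rightarrow> 'w"
    assume X: "range X \<subseteq> carrier U"
      and cauchy: "\<And>e. 0 < e \<Longrightarrow> \<exists>N. \<forall>m\<ge>N. \<forall>n\<ge>N. hnorm U (X m \<ominus>\<^bsub>U\<^esub> X n) < e"
    have "\<forall>n. \<exists>w. w \<in> W \<and> X n = j w" using X by (auto simp: transport_simps)
    then obtain Y where Y: "\<And>n. Y n \<in> W" "\<And>n. X n = j (Y n)" by metis
    have mem: "x \<ominus> y \<in> W" if "x \<in> W" "y \<in> W" for x y
      using that by (simp add: M.minus_eq add_mem uminus_mem)
    have diff: "hnorm U (j x \<ominus>\<^bsub>U\<^esub> j y) = hnorm V (x \<ominus> y)" if "x \<in> W" "y \<in> W" for x y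
      using that by (simp add: transport_minus transport_simps mem)
    have "\<exists>L\<in>carrier V. (\<lambda>n. hnorm V (Y n \<ominus> L)) \<longlonglongrightarrow> 0"
    proof (rule complete)
      show "range Y \<subseteq> carrier V" using Y subD by blast
      show "\<exists>N. \<forall>m\<ge>N. \<forall>n\<ge>N. hnorm V (Y m \<ominus> Y n) < e" if "0 < e" for e
        using cauchy[OF that] by (simp add: Y diff)
    qed
    then obtain L where L: "L \<in> carrier V" "(\<lambda>n. hnorm V (Y n \<ominus> L)) \<longlonglongrightarrow> 0" by blast
    have "L \<in> W"
    proof (rule closed[OF L(1)])
      fix e :: real assume "0 < e"
      with L(2) have "\<forall>\<^sub>F n in sequentially. hnorm V (Y n \<ominus> L) < e"
        by (rule order_tendstoD)
      then obtain n where "hnorm V (Y n \<ominus> L) < e"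
        by (auto simp: eventually_sequentially)
      then show "\<exists>y\<in>W. hnorm V (L \<ominus> y) < e"
        using Y(1)[of n] subD[of "Y n"] L(1) hnorm_minus_commute[of L "Y n"] by (intro bexI[of _ "Y n"]) auto
    qed
    with L(2) Y show "\<exists>L\<in>carrier U. (\<lambda>n. hnorm U (X n \<ominus>\<^bsub>U\<^esub> L)) \<longlonglongrightarrow> 0"
      by (intro bexI[of _ "j L"]) (auto simp: diff transport_simps)
  next
    fix x assume "x \<in> carrier U" "x \<noteq> \<zero>\<^bsub>U\<^esub>"
    then obtain w where w: "w \<in> W" "x = j w" "w \<noteq> \<zero>" by (auto simp: transport_simps)
    then show "0 < Re (inprod U x x)"
      using inprod_pos[of w] subD[of w] by (simp add: transport_simps)
  next
    fix x y assume "x \<in> carrier U" "y \<in> carrier U"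
    then obtain v w where "v \<in> W" "x = j v" "w \<in> W" "y = j w" by (auto simp: transport_simps)
    then show "inprod U y x = cnj (inprod U x y)"
      using inprod_commute[of v w] subD by (simp add: transport_simps)
  qed (auto simp: transport_simps add_mem smult_mem subD inprod_add_left inprod_smult_left)
  ultimately show ?thesis by (simp add: hilbert_space_def)
qed

end

end

text \<open>An injection into the type used in \<^const>\<open>kazhdan_pair\<close>.\<close>

definition encode_lists :: "(nat \<Rightarrow> (complex \<times> 'a) list) \<Rightarrow> 'a \<times> nat \<Rightarrow> complex" where
  "encode_lists s = (\<lambda>(a, k).
     let n = fst (prod_decode (k div 2)); i = snd (prod_decode (k div 2))
     in if i < length (s n) \<and> snd (s n ! i) = a then (if even k then fst (s n ! i) else 1) else 0)"

lemma inj_encode_lists: "inj encode_lists"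
proof (rule injI)
  fix s s' :: "nat \<Rightarrow> (complex \<times> 'a) list"
  assume eq: "encode_lists s = encode_lists s'"
  have odd: "encode_lists s (a, 2 * prod_encode (n, i) + 1) =
      (if i < length (s n) \<and> snd (s n ! i) = a then 1 else 0)" for s :: "nat \<Rightarrow> (complex \<times> 'a) list" and a n i
    by (simp add: encode_lists_def Let_def)
  have ev: "encode_lists s (a, 2 * prod_encode (n, i)) =
      (if i < length (s n) \<and> snd (s n ! i) = a then fst (s n ! i) else 0)" for s :: "nat \<Rightarrow> (complex \<times> 'a) list" and a n i
    by (simp add: encode_lists_def Let_def)
  have iff: "i < length (s n) \<and> snd (s n ! i) = a \<longleftrightarrow> i < length (s' n) \<and> snd (s' n ! i) = a" for n i a
    using odd[of s a n i] odd[of s' a n i] eq by (metis zero_neq_one)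
  show "s = s'"
  proof
    fix n
    have lt: "i < length (s n) \<longleftrightarrow> i < length (s' n)" for i using iff by blast
    then have len: "length (s n) = length (s' n)" by (metis linorder_neqE_nat less_irrefl)
    show "s n = s' n"
    proof (rule nth_equalityI[OF len])
      fix i assume i: "i < length (s n)"
      then have "snd (s n ! i) = snd (s' n ! i)" using iff by blast
      moreover have "fst (s n ! i) = fst (s' n ! i)"
        using ev[of s "snd (s n ! i)" n i] ev[of s' "snd (s n ! i)" n i] i lt eq calculation by simp
      ultimately show "s n ! i = s' n ! i" by (simp add: prod_eq_iff)
    qed
  qed
qed

context unitary_rep
begin

lemma group_G: "group G"
  using group_hom by (simp add: group_hom_def)

lemma rep_closed: "\<lbrakk>g \<in> carrier G; x \<in> carrier V\<rbrakk> \<Longrightarrow> \<pi> g x \<in> carrier V"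
  by (rule element_image[OF _ _ refl])

lemma rep_zero: "g \<in> carrier G \<Longrightarrow> \<pi> g \<zero>\<^bsub>V\<^esub> = \<zero>\<^bsub>V\<^esub>"
  using rep_smult[of g "\<zero>\<^bsub>V\<^esub>" 0] by (simp add: smult_0 rep_closed)

lemma rep_minus:
  assumes "g \<in> carrier G" "x \<in> carrier V" "y \<in> carrier V"
  shows "\<pi> g (x \<ominus>\<^bsub>V\<^esub> y) = \<pi> g x \<ominus>\<^bsub>V\<^esub> \<pi> g y"
  using assms rep_smult[of g y "-1"]
  by (simp add: M.minus_eq rep_add smult_uminus_1 rep_closed)

lemma rep_hnorm: "\<lbrakk>g \<in> carrier G; x \<in> carrier V\<rbrakk> \<Longrightarrow> hnorm V (\<pi> g x) = hnorm V x"
  by (simp add: hnorm_def rep_inprod)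

lemma unitary_rep_transport:
  assumes W: "closed_subspace V W" and inv: "\<And>g. g \<in> carrier G \<Longrightarrow> \<pi> g ` W \<subseteq> W"
    and j: "inj_on j W"
  shows "unitary_rep G (transport_module V W j) (\<lambda>g. \<lambda>x\<in>j ` W. j (\<pi> g (inv_into W j x)))"
proof -
  interpret W: closed_subspace V W by (rule W)
  note simps = W.transport_simps[OF j]
  have mem: "\<pi> g x \<in> W" if "g \<in> carrier G" "x \<in> W" for g x
    using inv that by blast
  have act: "group_action G (carrier (transport_module V W j))
      (\<lambda>g. \<lambda>x\<in>j ` W. j (\<pi> g (inv_into W j x)))"
    unfolding simps by (rule group_action_transport[OF group_action_axioms W.sub inv j])
  let ?\<rho> = "\<lambda>g. \<lambda>x\<in>j ` W. j (\<pi> g (inv_into W j x))"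
  have \<rho>: "?\<rho> g (j x) = j (\<pi> g x)" if "x \<in> W" for g x
    using that j by simp
  show ?thesis
  proof (intro unitary_rep.intro W.hilbert_space_transport[OF j] act unitary_rep_axioms.intro)
  qed (auto simp: simps \<rho> W.add_mem W.smult_mem W.subD mem rep_add rep_smult rep_inprod
        simp del: restrict_apply)
qed

fun comb :: "'v \<Rightarrow> (complex \<times> 'a) list \<Rightarrow> 'v" where
  "comb x [] = \<zero>\<^bsub>V\<^esub>"
| "comb x ((c, g) # l) = c \<odot>\<^bsub>V\<^esub> \<pi> g x \<oplus>\<^bsub>V\<^esub> comb x l"

definition cyclic_lists :: "(complex \<times> 'a) list set" where
  "cyclic_lists = {l. snd ` set l \<subseteq> carrier G}"

definition cyclic_subspace :: "'v \<Rightarrow> 'v set" where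
  "cyclic_subspace x =
     {y \<in> carrier V. \<forall>e>0. \<exists>l\<in>cyclic_lists. hnorm V (y \<ominus>\<^bsub>V\<^esub> comb x l) < e}"

context
  fixes x0 assumes x0: "x0 \<in> carrier V"
begin

lemma comb_closed: "l \<in> cyclic_lists \<Longrightarrow> comb x0 l \<in> carrier V"
  by (induction l) (auto simp: cyclic_lists_def rep_closed x0)

lemma comb_append:
  "\<lbrakk>l \<in> cyclic_lists; l' \<in> cyclic_lists\<rbrakk> \<Longrightarrow> comb x0 (l @ l') = comb x0 l \<oplus>\<^bsub>V\<^esub> comb x0 l'"
proof (induction l)
  case Nil then show ?case by (simp add: comb_closed)
next
  case (Cons p l)
  moreover from Cons have "l \<in> cyclic_lists" "snd p \<in> carrier G" by (auto simp: cyclic_lists_def)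
  ultimately show ?case
    by (cases p) (simp add: comb_closed rep_closed x0 M.a_assoc)
qed

lemma comb_smult:
  "l \<in> cyclic_lists \<Longrightarrow> comb x0 (map (\<lambda>(a, g). (c * a, g)) l) = c \<odot>\<^bsub>V\<^esub> comb x0 l"
proof (induction l)
  case Nil
  show ?case using smult_r_null[of c] by simp
next
  case (Cons p l)
  moreover from Cons have "l \<in> cyclic_lists" "snd p \<in> carrier G" by (auto simp: cyclic_lists_def)
  ultimately show ?case
    by (cases p) (simp add: comb_closed rep_closed x0 smult_r_distr smult_smult)
qed

lemma comb_rep:
  assumes "g \<in> carrier G"
  shows "l \<in> cyclic_lists \<Longrightarrow> comb x0 (map (\<lambda>(a, h). (a, g \<otimes>\<^bsub>G\<^esub> h)) l) = \<pi> g (comb x0 l)"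
proof (induction l)
  case Nil
  show ?case using assms by (simp add: rep_zero)
next
  case (Cons p l)
  moreover from Cons have "l \<in> cyclic_lists" "snd p \<in> carrier G" by (auto simp: cyclic_lists_def)
  ultimately show ?case
    using assms by (cases p) (simp add: comb_closed rep_closed x0 rep_add rep_smult composition_rule)
qed

lemma cyclic_lists_maps:
  assumes "l \<in> cyclic_lists"
  shows "map (\<lambda>(a, g). (c * a, g)) l \<in> cyclic_lists"
    and "g \<in> carrier G \<Longrightarrow> map (\<lambda>(a, h). (a, g \<otimes>\<^bsub>G\<^esub> h)) l \<in> cyclic_lists"
proof -
  interpret G: group G by (rule group_G)
  show "map (\<lambda>(a, g). (c * a, g)) l \<in> cyclic_lists"
    and "g \<in> carrier G \<Longrightarrow> map (\<lambda>(a, h). (a, g \<otimes>\<^bsub>G\<^esub> h)) l \<in> cyclic_lists"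
    using assms by (fastforce simp: cyclic_lists_def)+
qed

lemma cyclicE:
  assumes "y \<in> cyclic_subspace x0" "0 < e"
  obtains l where "l \<in> cyclic_lists" "hnorm V (y \<ominus>\<^bsub>V\<^esub> comb x0 l) < e"
  using assms by (auto simp: cyclic_subspace_def)

lemma comb_mem:
  assumes "l \<in> cyclic_lists" shows "comb x0 l \<in> cyclic_subspace x0"
  using assms comb_closed minus_zero_iff[of "comb x0 l" "comb x0 l"]
  by (auto simp: cyclic_subspace_def hnorm_zero intro!: bexI[of _ l])

lemma x0_mem: "x0 \<in> cyclic_subspace x0"
proof -
  interpret G: group G by (rule group_G)
  have "\<pi> \<one>\<^bsub>G\<^esub> x0 = x0" using id_eq_one x0 by (metis restrict_apply')
  then have "comb x0 [(1, \<one>\<^bsub>G\<^esub>)] = x0" using x0 by (simp add: smult_1)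
  moreover have "[(1, \<one>\<^bsub>G\<^esub>)] \<in> cyclic_lists" by (simp add: cyclic_lists_def)
  ultimately show ?thesis using comb_mem by metis
qed

lemma closed_subspace_cyclic: "closed_subspace V (cyclic_subspace x0)"
proof (intro closed_subspace.intro closed_subspace_axioms.intro hilbert_space_axioms)
  show "cyclic_subspace x0 \<subseteq> carrier V" by (auto simp: cyclic_subspace_def)
  show "\<zero>\<^bsub>V\<^esub> \<in> cyclic_subspace x0"
    using comb_mem[of "[]"] by (simp add: cyclic_lists_def)
next
  fix x y assume xy: "x \<in> cyclic_subspace x0" "y \<in> cyclic_subspace x0"
  then have V: "x \<in> carrier V" "y \<in> carrier V" by (auto simp: cyclic_subspace_def)
  have "\<exists>l\<in>cyclic_lists. hnorm V ((x \<oplus>\<^bsub>V\<^esub> y) \<ominus>\<^bsub>V\<^esub> comb x0 l) < e" if "0 < e" for e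
  proof -
    have e2: "0 < e / 2" using that by simp
    obtain l where l: "l \<in> cyclic_lists" "hnorm V (x \<ominus>\<^bsub>V\<^esub> comb x0 l) < e / 2"
      using xy(1) e2 by (rule cyclicE)
    obtain l' where l': "l' \<in> cyclic_lists" "hnorm V (y \<ominus>\<^bsub>V\<^esub> comb x0 l') < e / 2"
      using xy(2) e2 by (rule cyclicE)
    have "hnorm V ((x \<oplus>\<^bsub>V\<^esub> y) \<ominus>\<^bsub>V\<^esub> comb x0 (l @ l')) \<le>
        hnorm V (x \<ominus>\<^bsub>V\<^esub> comb x0 l) + hnorm V (y \<ominus>\<^bsub>V\<^esub> comb x0 l')"
      using V l l' by (simp add: comb_append comb_closed add_minus_add hnorm_triangle)
    then have "hnorm V ((x \<oplus>\<^bsub>V\<^esub> y) \<ominus>\<^bsub>V\<^esub> comb x0 (l @ l')) < e" using l l' by simp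
    moreover have "l @ l' \<in> cyclic_lists" using l l' by (auto simp: cyclic_lists_def)
    ultimately show ?thesis by blast
  qed
  then show "x \<oplus>\<^bsub>V\<^esub> y \<in> cyclic_subspace x0" using V by (simp add: cyclic_subspace_def)
next
  fix x c assume x: "x \<in> cyclic_subspace x0"
  then have V: "x \<in> carrier V" by (auto simp: cyclic_subspace_def)
  have "\<exists>l\<in>cyclic_lists. hnorm V (c \<odot>\<^bsub>V\<^esub> x \<ominus>\<^bsub>V\<^esub> comb x0 l) < e" if "0 < e" for e
  proof -
    have "0 < e / (cmod c + 1)" using that by (simp add: add_nonneg_pos)
    then obtain l where l: "l \<in> cyclic_lists" "hnorm V (x \<ominus>\<^bsub>V\<^esub> comb x0 l) < e / (cmod c + 1)"
      using x by (metis cyclicE)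
    have pos: "0 < cmod c + 1" by (simp add: add_nonneg_pos)
    have nn: "0 \<le> hnorm V (x \<ominus>\<^bsub>V\<^esub> comb x0 l)" using V l comb_closed by (simp add: hnorm_nonneg)
    have "hnorm V (c \<odot>\<^bsub>V\<^esub> x \<ominus>\<^bsub>V\<^esub> comb x0 (map (\<lambda>(a, g). (c * a, g)) l))
        = cmod c * hnorm V (x \<ominus>\<^bsub>V\<^esub> comb x0 l)"
      using V l comb_closed by (simp add: comb_smult smult_minus hnorm_smult)
    also have "\<dots> \<le> (cmod c + 1) * hnorm V (x \<ominus>\<^bsub>V\<^esub> comb x0 l)"
      using nn by (intro mult_right_mono) auto
    also have "\<dots> < e" using l(2) pos by (simp add: pos_less_divide_eq mult.commute)
    finally show ?thesis using cyclic_lists_maps(1)[OF l(1)] by blast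
  qed
  then show "c \<odot>\<^bsub>V\<^esub> x \<in> cyclic_subspace x0" using V by (simp add: cyclic_subspace_def)
next
  fix x assume V: "x \<in> carrier V"
    and lim: "\<And>e. 0 < e \<Longrightarrow> \<exists>y\<in>cyclic_subspace x0. hnorm V (x \<ominus>\<^bsub>V\<^esub> y) < e"
  have "\<exists>l\<in>cyclic_lists. hnorm V (x \<ominus>\<^bsub>V\<^esub> comb x0 l) < e" if "0 < e" for e
  proof -
    have e2: "0 < e / 2" using that by simp
    obtain y where y: "y \<in> cyclic_subspace x0" "hnorm V (x \<ominus>\<^bsub>V\<^esub> y) < e / 2"
      using lim[OF e2] by blast
    obtain l where l: "l \<in> cyclic_lists" "hnorm V (y \<ominus>\<^bsub>V\<^esub> comb x0 l) < e / 2"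
      using y(1) e2 by (rule cyclicE)
    have "y \<in> carrier V" using y(1) by (simp add: cyclic_subspace_def)
    then have "hnorm V (x \<ominus>\<^bsub>V\<^esub> comb x0 l) < e"
      using hnorm_minus_triangle[OF V, of y "comb x0 l"] y(2) l comb_closed by force
    then show ?thesis using l(1) by blast
  qed
  then show "x \<in> cyclic_subspace x0" using V by (simp add: cyclic_subspace_def)
qed

lemma rep_cyclic:
  assumes g: "g \<in> carrier G" shows "\<pi> g ` cyclic_subspace x0 \<subseteq> cyclic_subspace x0"
proof
  fix y assume "y \<in> \<pi> g ` cyclic_subspace x0"
  then obtain x where x: "x \<in> cyclic_subspace x0" "y = \<pi> g x" by blast
  then have V: "x \<in> carrier V" by (simp add: cyclic_subspace_def)
  have "\<exists>l\<in>cyclic_lists. hnorm V (y \<ominus>\<^bsub>V\<^esub> comb x0 l) < e" if "0 < e" for e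
  proof -
    obtain l where l: "l \<in> cyclic_lists" "hnorm V (x \<ominus>\<^bsub>V\<^esub> comb x0 l) < e"
      using x(1) \<open>0 < e\<close> by (rule cyclicE)
    have "hnorm V (y \<ominus>\<^bsub>V\<^esub> comb x0 (map (\<lambda>(a, h). (a, g \<otimes>\<^bsub>G\<^esub> h)) l)) = hnorm V (\<pi> g (x \<ominus>\<^bsub>V\<^esub> comb x0 l))"
      using g V l comb_closed x by (simp add: comb_rep rep_minus)
    also have "\<dots> < e" using g V l comb_closed by (simp add: rep_hnorm)
    finally show ?thesis using cyclic_lists_maps(2)[OF l(1) g] by blast
  qed
  then show "y \<in> cyclic_subspace x0"
    using V g x rep_closed by (simp add: cyclic_subspace_def)
qed

lemma cyclic_embedding: "\<exists>j :: 'v \<Rightarrow> 'a \<times> nat \<Rightarrow> complex. inj_on j (cyclic_subspace x0)"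
proof -
  have "\<forall>y n. \<exists>l. y \<in> cyclic_subspace x0 \<longrightarrow>
      l \<in> cyclic_lists \<and> hnorm V (y \<ominus>\<^bsub>V\<^esub> comb x0 l) < 1 / real (Suc n)"
    by (metis cyclicE zero_less_divide_1_iff of_nat_0_less_iff zero_less_Suc)
  then obtain s where s: "\<And>y n. y \<in> cyclic_subspace x0 \<Longrightarrow>
      s y n \<in> cyclic_lists \<and> hnorm V (y \<ominus>\<^bsub>V\<^esub> comb x0 (s y n)) < 1 / real (Suc n)"
    by metis
  have "inj_on (\<lambda>y. encode_lists (s y)) (cyclic_subspace x0)"
  proof (rule inj_onI)
    fix y z assume y: "y \<in> cyclic_subspace x0" and z: "z \<in> cyclic_subspace x0"
      and "encode_lists (s y) = encode_lists (s z)"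
    then have eq: "s y = s z" using inj_encode_lists by (meson injD)
    have V: "y \<in> carrier V" "z \<in> carrier V" using y z by (auto simp: cyclic_subspace_def)
    have "hnorm V (y \<ominus>\<^bsub>V\<^esub> z) \<le> 0"
    proof (rule field_le_epsilon)
      fix e :: real assume "0 < e"
      then obtain n where n: "1 / real (Suc n) < e / 2"
        using reals_Archimedean[of "e / 2"] by (auto simp: inverse_eq_divide)
      let ?c = "comb x0 (s y n)"
      have c: "?c \<in> carrier V" using s[OF y, of n] comb_closed by blast
      have "hnorm V (y \<ominus>\<^bsub>V\<^esub> z) \<le> hnorm V (y \<ominus>\<^bsub>V\<^esub> ?c) + hnorm V (?c \<ominus>\<^bsub>V\<^esub> z)"
        using V c by (intro hnorm_minus_triangle)
      also have "hnorm V (?c \<ominus>\<^bsub>V\<^esub> z) = hnorm V (z \<ominus>\<^bsub>V\<^esub> ?c)"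
        using V c by (intro hnorm_minus_commute)
      finally show "hnorm V (y \<ominus>\<^bsub>V\<^esub> z) \<le> 0 + e"
        using s[OF y, of n] s[OF z, of n] n unfolding eq by linarith
    qed
    moreover have "0 \<le> hnorm V (y \<ominus>\<^bsub>V\<^esub> z)" using V by (simp add: hnorm_nonneg)
    ultimately have "y \<ominus>\<^bsub>V\<^esub> z = \<zero>\<^bsub>V\<^esub>" using V hnorm_eq_0[of "y \<ominus>\<^bsub>V\<^esub> z"] by simp
    then show "y = z" using V minus_zero_iff by blast
  qed
  then show ?thesis by blast
qed

end

theorem kazhdan_pair_universal:
  assumes pair: "kazhdan_pair G S \<epsilon>" and S: "S \<subseteq> carrier G"
    and almost: "has_almost_invariant_vector V \<pi> S \<epsilon>"
  shows "has_invariant_vector G V \<pi>"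
proof -
  obtain x0 where x0: "x0 \<in> carrier V" "x0 \<noteq> \<zero>\<^bsub>V\<^esub>"
      and al: "\<And>s. s \<in> S \<Longrightarrow> hnorm V (\<pi> s x0 \<ominus>\<^bsub>V\<^esub> x0) < \<epsilon> * hnorm V x0"
    using almost by (auto simp: has_almost_invariant_vector_def)
  define W where "W = cyclic_subspace x0"
  obtain j :: "'v \<Rightarrow> 'a \<times> nat \<Rightarrow> complex" where j: "inj_on j W"
    using cyclic_embedding[OF x0(1)] W_def by blast
  have W: "closed_subspace V W" unfolding W_def by (rule closed_subspace_cyclic[OF x0(1)])
  interpret W: closed_subspace V W by (rule W)
  have inv: "\<pi> g ` W \<subseteq> W" if "g \<in> carrier G" for g
    unfolding W_def by (rule rep_cyclic[OF x0(1) that])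
  have x0W: "x0 \<in> W" unfolding W_def by (rule x0_mem[OF x0(1)])
  define U where "U = transport_module V W j"
  define \<rho> where "\<rho> = (\<lambda>g. \<lambda>x\<in>j ` W. j (\<pi> g (inv_into W j x)))"
  have rep: "unitary_rep G U \<rho>"
    unfolding U_def \<rho>_def by (rule unitary_rep_transport[OF W inv j])
  note simps = W.transport_simps[OF j, folded U_def]
  have \<rho>: "\<rho> g (j x) = j (\<pi> g x)" if "x \<in> W" for g x
    using that j by (simp add: \<rho>_def)
  have mem: "\<pi> g x \<in> W" if "g \<in> carrier G" "x \<in> W" for g x
    using inv that by blast
  have nz: "j x = \<zero>\<^bsub>U\<^esub> \<longleftrightarrow> x = \<zero>\<^bsub>V\<^esub>" if "x \<in> W" for x
    using that j W.zero_mem by (auto simp: simps inj_on_eq_iff)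
  have "hnorm U (\<rho> s (j x0) \<ominus>\<^bsub>U\<^esub> j x0) < \<epsilon> * hnorm U (j x0)" if s: "s \<in> S" for s
  proof -
    have sG: "s \<in> carrier G" using S s by blast
    have m: "\<pi> s x0 \<ominus>\<^bsub>V\<^esub> x0 \<in> W"
      using mem[OF sG x0W] x0W by (simp add: M.minus_eq W.add_mem W.uminus_mem)
    have "\<rho> s (j x0) \<ominus>\<^bsub>U\<^esub> j x0 = j (\<pi> s x0 \<ominus>\<^bsub>V\<^esub> x0)"
      using W.transport_minus[OF j mem[OF sG x0W] x0W] x0W by (simp add: \<rho> U_def)
    then show ?thesis using al[OF s] simps(6)[OF m] simps(6)[OF x0W] by simp
  qed
  then have "has_almost_invariant_vector U \<rho> S \<epsilon>"
    unfolding has_almost_invariant_vector_def using x0 x0W nz[OF x0W]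
    by (intro bexI[of _ "j x0"]) (auto simp: simps)
  then have "has_invariant_vector G U \<rho>"
    using pair rep unfolding kazhdan_pair_def by blast
  then obtain x where x: "x \<in> W" "x \<noteq> \<zero>\<^bsub>V\<^esub>" "\<And>g. g \<in> carrier G \<Longrightarrow> \<rho> g (j x) = j x"
    unfolding has_invariant_vector_def using nz by (auto simp: simps)
  have "\<pi> g x = x" if g: "g \<in> carrier G" for g
    using x(3)[OF g] \<rho>[OF x(1)] mem[OF g x(1)] x(1) j by (metis inj_onD)
  then show ?thesis
    unfolding has_invariant_vector_def using x W.subD by blast
qed

end

end

theory Submission
  imports Defs
begin

text \<open>
  Let \<open>G\<close> be a group of piecewise projective maps with Property FW. It acts on the directed points of
  the circle (points with a side), and its germs there are homographies. Adjacent directed points are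
  glued by the identity; this gluing is commensurated by \<open>G\<close>, hence it agrees up to finitely many
  points with an invariant gluing. After regluing, the circle becomes a finite union of cycles and
  exceptional points, with a projective structure preserved by \<open>G\<close>.

  If \<open>G\<close> is infinite, the orbits on some cycle \<open>C\<close> are infinite. A section over \<open>C\<close> of the adjoint bundle
  that \<open>G\<close> preserves up to scalars is then impossible: it is a vector field without zeros, in
  whose flow parameter a subgroup of finite index acts on \<open>C\<close> by translations, and Property FW makes
  these of bounded finite order. If the
  holonomy of \<open>C\<close> is not scalar, its traceless part gives such a section. If it is scalar, then \<open>G\<close>
  acts on all sections through a homomorphism to \<open>PGL\<^sub>2(\<real>)\<close>. In the affine case the translations form
  an invariant line. Under Property T the action on the hyperbolic plane has a bounded orbit, hence a
  fixed point, because the logarithm of the Lorentzian product of two points is of conditionally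
  negative type; a fixed point is again an invariant section.
\<close>

text \<open>A piecewise map has no canonical value at a singular point, but both one-sided germs
  exist there, because injectivity excludes poles; hence \<open>G\<close> acts on directed points
  rather than on the circle. An element disturbs the gluing of the two sides of a point only where
  it is singular or touches the base point, that is at finitely many points, and this is the
  finiteness on which Property FW operates. Its other use is arithmetic: homomorphisms to \<real>
  vanish and homomorphisms to \<real>/\<int> have finite order, so the multipliers of germs and of
  sections become trivial on subgroups of finite index.

  The traceless matrices that commute with a non-scalar holonomy form a line, and the group has to
  preserve it. With scalar holonomy nothing singles out a line, and this is where (a) and (b) part:
  one uses the point at infinity, the other a fixed point in the hyperbolic plane. Property T is
  used only through \<open>bounded_lengths\<close>, a statement about kernels on the group: it
  passes to subgroups of finite index by finite products of kernels, and it gives both Property FW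
  and the bounded orbit.\<close>

lemma group_actionI:
  fixes G :: "('a, 'b) monoid_scheme"
  assumes "group G"
    and closed: "\<And>g x. g \<in> carrier G \<Longrightarrow> x \<in> Y \<Longrightarrow> \<phi> g x \<in> Y"
    and one: "\<And>x. x \<in> Y \<Longrightarrow> \<phi> \<one>\<^bsub>G\<^esub> x = x"
    and mult: "\<And>g h x. \<lbrakk>g \<in> carrier G; h \<in> carrier G; x \<in> Y\<rbrakk> \<Longrightarrow> \<phi> (g \<otimes>\<^bsub>G\<^esub> h) x = \<phi> g (\<phi> h x)"
  shows "group_action G Y (\<lambda>g. \<lambda>x\<in>Y. \<phi> g x)"
proof -
  interpret group G by fact
  have Bij: "(\<lambda>x\<in>Y. \<phi> g x) \<in> Bij Y" if g: "g \<in> carrier G" for g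
  proof -
    have "bij_betw (\<phi> g) Y Y"
      using g closed one mult[of "inv\<^bsub>G\<^esub> g" g] mult[of g "inv\<^bsub>G\<^esub> g"]
      by (intro bij_betw_byWitness[where f' = "\<phi> (inv\<^bsub>G\<^esub> g)"]) auto
    then show ?thesis by (simp add: Bij_def bij_betw_restrict_eq)
  qed
  have "(\<lambda>g. \<lambda>x\<in>Y. \<phi> g x) \<in> hom G (BijGroup Y)"
    using Bij closed by (auto simp: hom_def BijGroup_def compose_def mult intro!: restrict_ext)
  then show ?thesis
    by (simp add: group_action_def group_hom_def group_hom_axioms_def group_BijGroup is_group)
qed

text \<open>The working form of Property FW: the action is given by its laws on \<open>Y\<close>,
  which may have any type, and invariance of the new set is stated as closure under the group. The
  restriction to \<open>Y\<close> inside the proof is due to \<open>Bij\<close>, which contains only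
  extensional functions.\<close>

lemma FW_transfix:
  fixes G :: "('a, 'b) monoid_scheme" and Y :: "'y set"
  assumes "property_FW G" "group G"
    and closed: "\<And>g x. g \<in> carrier G \<Longrightarrow> x \<in> Y \<Longrightarrow> \<phi> g x \<in> Y"
    and "\<And>x. x \<in> Y \<Longrightarrow> \<phi> \<one>\<^bsub>G\<^esub> x = x"
    and "\<And>g h x. \<lbrakk>g \<in> carrier G; h \<in> carrier G; x \<in> Y\<rbrakk> \<Longrightarrow> \<phi> (g \<otimes>\<^bsub>G\<^esub> h) x = \<phi> g (\<phi> h x)"
    and M: "M \<subseteq> Y" "\<And>g. g \<in> carrier G \<Longrightarrow> finite (sym_diff M (\<phi> g ` M))"
  shows "\<exists>M0. M0 \<subseteq> Y \<and> (\<forall>g\<in>carrier G. \<forall>x\<in>M0. \<phi> g x \<in> M0) \<and> finite (sym_diff M M0)"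
proof -
  have im: "(\<lambda>x\<in>Y. \<phi> g x) ` N = \<phi> g ` N" if "N \<subseteq> Y" for N g
    using that by (intro image_cong) auto
  have "commensurated G (\<lambda>g. \<lambda>x\<in>Y. \<phi> g x) M"
    unfolding commensurated_def im[OF M(1)] using M(2) by blast
  then have "transfixed G Y (\<lambda>g. \<lambda>x\<in>Y. \<phi> g x) M"
    using assms by (intro property_FW_universal[OF _ group_actionI]) auto
  then obtain M0 where M0: "M0 \<subseteq> Y" "\<And>g. g \<in> carrier G \<Longrightarrow> \<phi> g ` M0 = M0" "finite (sym_diff M M0)"
    unfolding transfixed_def using im by metis
  have "\<forall>g\<in>carrier G. \<forall>x\<in>M0. \<phi> g x \<in> M0"
    using M0(2) by (metis image_eqI)
  then show ?thesis using M0(1,3) by (intro exI[of _ M0] conjI)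
qed

section \<open>Subgroups of finite index\<close>

definition fin_index :: "('a, 'b) monoid_scheme \<Rightarrow> 'a set \<Rightarrow> bool" where
  "fin_index G H \<longleftrightarrow> subgroup H G \<and>
     (\<exists>R. finite R \<and> R \<subseteq> carrier G \<and> (\<forall>g\<in>carrier G. \<exists>r\<in>R. inv\<^bsub>G\<^esub> r \<otimes>\<^bsub>G\<^esub> g \<in> H))"

context group
begin

lemma fin_index_subgroup: "fin_index G H \<Longrightarrow> subgroup H G"
  by (simp add: fin_index_def)

lemma fin_index_group: "fin_index G H \<Longrightarrow> group (G\<lparr>carrier := H\<rparr>)"
  by (simp add: fin_index_subgroup subgroup_imp_group)

lemma inv_mult_eq: "\<lbrakk>x \<in> carrier G; y \<in> carrier G\<rbrakk> \<Longrightarrow> x \<otimes> (inv x \<otimes> y) = y"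
  by (simp add: m_assoc[symmetric])

text \<open>A label with finitely many values bounds the number of cosets as soon as equal labels
  mean equal left cosets. The labels in use are orbit points, intervals, values of characters and
  pairs of coset representatives.\<close>

lemma fin_index_label:
  assumes H: "subgroup H G" and "finite (c ` carrier G)"
    and c: "\<And>g g'. \<lbrakk>g \<in> carrier G; g' \<in> carrier G; c g = c g'\<rbrakk> \<Longrightarrow> inv g \<otimes> g' \<in> H"
  shows "fin_index G H"
proof -
  define R where "R = inv_into (carrier G) c ` c ` carrier G"
  have "R \<subseteq> carrier G" by (auto simp: R_def inv_into_into)
  moreover have "\<exists>r\<in>R. inv r \<otimes> g \<in> H" if "g \<in> carrier G" for g
    using that by (intro bexI[of _ "inv_into (carrier G) c (c g)"] c) (auto simp: R_def f_inv_into_f inv_into_into)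
  moreover have "finite R" using assms(2) by (simp add: R_def)
  ultimately show ?thesis using H unfolding fin_index_def by blast
qed

text \<open>One representative is chosen per left coset, so \<open>\<rho>\<close> is invariant under
  right multiplication by \<open>H\<close>. The normalisation \<open>\<rho> h = \<one>\<close> makes
  an induced action restrict to the original one on the coset of the unit.\<close>

lemma fin_index_rep:
  assumes "fin_index G H"
  obtains \<rho> where "finite (\<rho> ` carrier G)" "\<And>g. g \<in> carrier G \<Longrightarrow> \<rho> g \<in> carrier G"
    "\<And>g. g \<in> carrier G \<Longrightarrow> inv (\<rho> g) \<otimes> g \<in> H"
    "\<And>g h. \<lbrakk>g \<in> carrier G; h \<in> H\<rbrakk> \<Longrightarrow> \<rho> (g \<otimes> h) = \<rho> g"
    "\<And>h. h \<in> H \<Longrightarrow> \<rho> h = \<one>"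
proof -
  interpret H: subgroup H G using assms by (rule fin_index_subgroup)
  obtain R where R: "finite R" "R \<subseteq> carrier G" "\<And>g. g \<in> carrier G \<Longrightarrow> \<exists>r\<in>R. inv r \<otimes> g \<in> H"
    using assms(1) by (auto simp: fin_index_def)
  define \<rho> where "\<rho> g = (if g \<in> H then \<one> else SOME r. r \<in> R \<and> inv r \<otimes> g \<in> H)" for g
  have some: "\<rho> g \<in> R \<and> inv (\<rho> g) \<otimes> g \<in> H" if "g \<in> carrier G" "g \<notin> H" for g
    using someI_ex[of "\<lambda>r. r \<in> R \<and> inv r \<otimes> g \<in> H"] R(3)[OF that(1)] that by (auto simp: \<rho>_def)
  have mem: "x \<otimes> h \<in> H \<longleftrightarrow> x \<in> H" if "x \<in> carrier G" "h \<in> H" for x h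
  proof
    assume "x \<otimes> h \<in> H"
    then have "x \<otimes> h \<otimes> inv h \<in> H" using that by blast
    then show "x \<in> H" using that by (simp add: m_assoc)
  qed (use that in blast)
  show thesis
  proof (rule that)
    have "\<rho> ` carrier G \<subseteq> insert \<one> R" using some by (auto simp: \<rho>_def)
    then show "finite (\<rho> ` carrier G)" using R finite_subset by blast
    show "\<rho> g \<in> carrier G" if "g \<in> carrier G" for g
      using some[OF that] R that by (cases "g \<in> H") (auto simp: \<rho>_def)
    show "inv (\<rho> g) \<otimes> g \<in> H" if "g \<in> carrier G" for g
      using some[OF that] that by (cases "g \<in> H") (auto simp: \<rho>_def)
    show "\<rho> h = \<one>" if "h \<in> H" for h using that by (simp add: \<rho>_def)
    show "\<rho> (g \<otimes> h) = \<rho> g" if "g \<in> carrier G" "h \<in> H" for g h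
    proof -
      have "inv r \<otimes> (g \<otimes> h) \<in> H \<longleftrightarrow> inv r \<otimes> g \<in> H" if "r \<in> R" for r
        using mem[of "inv r \<otimes> g" h] that \<open>g \<in> carrier G\<close> \<open>h \<in> H\<close> R by (auto simp: m_assoc subset_iff)
      then have "(\<lambda>r. r \<in> R \<and> inv r \<otimes> (g \<otimes> h) \<in> H) = (\<lambda>r. r \<in> R \<and> inv r \<otimes> g \<in> H)" by blast
      then show ?thesis using mem[OF that] by (simp add: \<rho>_def)
    qed
  qed
qed

lemma fin_index_trans:
  assumes H: "fin_index G H" and K: "fin_index (G\<lparr>carrier := H\<rparr>) K"
  shows "fin_index G K"
proof -
  interpret H: subgroup H G using H by (rule fin_index_subgroup)
  interpret HG: group "G\<lparr>carrier := H\<rparr>" using H by (rule fin_index_group)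
  interpret K: subgroup K "G\<lparr>carrier := H\<rparr>" using K by (rule HG.fin_index_subgroup)
  obtain \<rho> where \<rho>: "finite (\<rho> ` carrier G)" "\<And>g. g \<in> carrier G \<Longrightarrow> \<rho> g \<in> carrier G"
    "\<And>g. g \<in> carrier G \<Longrightarrow> inv (\<rho> g) \<otimes> g \<in> H"
    "\<And>g h. \<lbrakk>g \<in> carrier G; h \<in> H\<rbrakk> \<Longrightarrow> \<rho> (g \<otimes> h) = \<rho> g" "\<And>h. h \<in> H \<Longrightarrow> \<rho> h = \<one>"
    by (rule fin_index_rep[OF H]) blast
  let ?H = "G\<lparr>carrier := H\<rparr>"
  obtain \<kappa> where \<kappa>0: "finite (\<kappa> ` carrier ?H)" "\<And>g. g \<in> carrier ?H \<Longrightarrow> \<kappa> g \<in> carrier ?H"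
    "\<And>g. g \<in> carrier ?H \<Longrightarrow> inv\<^bsub>?H\<^esub> (\<kappa> g) \<otimes>\<^bsub>?H\<^esub> g \<in> K"
    "\<And>g h. \<lbrakk>g \<in> carrier ?H; h \<in> K\<rbrakk> \<Longrightarrow> \<kappa> (g \<otimes>\<^bsub>?H\<^esub> h) = \<kappa> g" "\<And>h. h \<in> K \<Longrightarrow> \<kappa> h = \<one>\<^bsub>?H\<^esub>"
    by (rule HG.fin_index_rep[OF K]) blast
  have \<kappa>: "finite (\<kappa> ` H)" "\<And>g. g \<in> H \<Longrightarrow> \<kappa> g \<in> H"
    "\<And>g. g \<in> H \<Longrightarrow> inv\<^bsub>?H\<^esub> (\<kappa> g) \<otimes> g \<in> K"
    using \<kappa>0 by simp_all
  have \<kappa>': "inv (\<kappa> g) \<otimes> g \<in> K" if "g \<in> H" for g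
    using \<kappa>(3)[OF that] m_inv_consistent[OF H.subgroup_axioms \<kappa>(2)[OF that]] by simp
  \<comment> \<open>The coset of \<open>g\<close> modulo \<open>K\<close> is determined by its coset
    modulo \<open>H\<close> and the coset in \<open>H\<close> of the remaining factor.\<close>
  define c where "c g = (\<rho> g, \<kappa> (inv (\<rho> g) \<otimes> g))" for g
  have "subgroup K G"
    using K.subgroup_axioms H.subgroup_axioms incl_subgroup by blast
  moreover have "finite (c ` carrier G)"
    by (rule finite_subset[of _ "\<rho> ` carrier G \<times> \<kappa> ` H"]) (use \<rho> \<kappa> in \<open>auto simp: c_def\<close>)
  moreover have "inv g \<otimes> g' \<in> K" if g: "g \<in> carrier G" "g' \<in> carrier G" "c g = c g'" for g g'
  proof -
    define r k where "r = \<rho> g" and "k = \<kappa> (inv r \<otimes> g)"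
    have r: "r \<in> carrier G" "inv r \<otimes> g \<in> H" "inv r \<otimes> g' \<in> H"
      using \<rho>(2,3)[OF g(1)] \<rho>(3)[OF g(2)] g(3) by (simp_all add: r_def c_def)
    have k: "k \<in> H" "inv k \<otimes> (inv r \<otimes> g) \<in> K" "inv k \<otimes> (inv r \<otimes> g') \<in> K"
      using \<kappa>(2)[OF r(2)] \<kappa>'[OF r(2)] \<kappa>'[OF r(3)] g(3) by (auto simp: r_def k_def c_def)
    have "inv\<^bsub>G\<lparr>carrier := H\<rparr>\<^esub> (inv k \<otimes> (inv r \<otimes> g)) \<otimes> (inv k \<otimes> (inv r \<otimes> g')) \<in> K"
      using K.m_closed[OF K.m_inv_closed[OF k(2)] k(3)] by simp
    moreover have "inv\<^bsub>G\<lparr>carrier := H\<rparr>\<^esub> (inv k \<otimes> (inv r \<otimes> g)) = inv (inv k \<otimes> (inv r \<otimes> g))"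
      using r k by (intro m_inv_consistent H.subgroup_axioms) auto
    moreover have "inv (inv k \<otimes> (inv r \<otimes> g)) \<otimes> (inv k \<otimes> (inv r \<otimes> g')) = inv g \<otimes> g'"
      using r k g by (simp add: inv_mult_group m_assoc inv_mult_eq)
    ultimately show ?thesis by simp
  qed
  ultimately show ?thesis by (rule fin_index_label)
qed

lemma fin_index_Int:
  assumes H: "fin_index G H" and K: "fin_index G K"
  shows "fin_index G (H \<inter> K)"
proof -
  interpret H: subgroup H G using H by (rule fin_index_subgroup)
  interpret K: subgroup K G using K by (rule fin_index_subgroup)
  obtain \<rho> where \<rho>: "finite (\<rho> ` carrier G)" "\<And>g. g \<in> carrier G \<Longrightarrow> \<rho> g \<in> carrier G"
    "\<And>g. g \<in> carrier G \<Longrightarrow> inv (\<rho> g) \<otimes> g \<in> H"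
    "\<And>g h. \<lbrakk>g \<in> carrier G; h \<in> H\<rbrakk> \<Longrightarrow> \<rho> (g \<otimes> h) = \<rho> g" "\<And>h. h \<in> H \<Longrightarrow> \<rho> h = \<one>"
    by (rule fin_index_rep[OF H]) blast
  obtain \<kappa> where \<kappa>: "finite (\<kappa> ` carrier G)" "\<And>g. g \<in> carrier G \<Longrightarrow> \<kappa> g \<in> carrier G"
    "\<And>g. g \<in> carrier G \<Longrightarrow> inv (\<kappa> g) \<otimes> g \<in> K"
    "\<And>g h. \<lbrakk>g \<in> carrier G; h \<in> K\<rbrakk> \<Longrightarrow> \<kappa> (g \<otimes> h) = \<kappa> g" "\<And>h. h \<in> K \<Longrightarrow> \<kappa> h = \<one>"
    by (rule fin_index_rep[OF K]) blast
  have eq: "inv (inv r \<otimes> g) \<otimes> (inv r \<otimes> g') = inv g \<otimes> g'"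
    if "r \<in> carrier G" "g \<in> carrier G" "g' \<in> carrier G" for r g g'
    using that by (simp add: inv_mult_group m_assoc inv_mult_eq)
  show ?thesis
  proof (rule fin_index_label[of _ "\<lambda>g. (\<rho> g, \<kappa> g)"])
    show "subgroup (H \<inter> K) G" using H.subgroup_axioms K.subgroup_axioms by (rule subgroups_Inter_pair)
    show "finite ((\<lambda>g. (\<rho> g, \<kappa> g)) ` carrier G)"
      by (rule finite_subset[of _ "\<rho> ` carrier G \<times> \<kappa> ` carrier G"]) (use \<rho> \<kappa> in auto)
    show "inv g \<otimes> g' \<in> H \<inter> K" if g: "g \<in> carrier G" "g' \<in> carrier G" "(\<rho> g, \<kappa> g) = (\<rho> g', \<kappa> g')" for g g'
      using eq[OF \<rho>(2)[OF g(1)] g(1,2)] eq[OF \<kappa>(2)[OF g(1)] g(1,2)] g(3)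
        H.m_closed[OF H.m_inv_closed[OF \<rho>(3)[OF g(1)]] \<rho>(3)[OF g(2)]]
        K.m_closed[OF K.m_inv_closed[OF \<kappa>(3)[OF g(1)]] \<kappa>(3)[OF g(2)]] by simp
  qed
qed

lemma fin_index_Inter:
  assumes "finite I" "\<And>i. i \<in> I \<Longrightarrow> fin_index G (K i)"
  shows "fin_index G (carrier G \<inter> (\<Inter>i\<in>I. K i))"
  using assms
proof (induction I)
  case empty
  show ?case by (rule fin_index_label[of _ "\<lambda>g. ()"]) (auto simp: subgroup_self)
next
  case (insert i I)
  have "fin_index G (K i \<inter> (carrier G \<inter> (\<Inter>i\<in>I. K i)))"
    using insert.prems by (intro fin_index_Int insert.IH) (simp_all only: insert_iff simp_thms)
  moreover have "K i \<inter> (carrier G \<inter> (\<Inter>i\<in>I. K i)) = carrier G \<inter> (\<Inter>i\<in>insert i I. K i)" by blast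
  ultimately show ?case by simp
qed

lemma fin_index_mono_finite:
  assumes "fin_index G H" "finite H" shows "finite (carrier G)"
proof -
  obtain R where R: "finite R" "R \<subseteq> carrier G" "\<And>g. g \<in> carrier G \<Longrightarrow> \<exists>r\<in>R. inv r \<otimes> g \<in> H"
    using assms(1) by (auto simp: fin_index_def)
  have "carrier G \<subseteq> (\<lambda>(r, h). r \<otimes> h) ` (R \<times> H)"
  proof
    fix g assume g: "g \<in> carrier G"
    then obtain r where r: "r \<in> R" "inv r \<otimes> g \<in> H" using R by blast
    then show "g \<in> (\<lambda>(r, h). r \<otimes> h) ` (R \<times> H)"
      using R g by (intro image_eqI[of _ _ "(r, inv r \<otimes> g)"]) (auto simp: inv_mult_eq subset_iff)
  qed
  then show ?thesis using R assms(2) finite_subset by blast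
qed

end

text \<open>Induction of actions. \<open>G\<close> acts on \<open>I \<times> Y\<close>, which plays
  the role of \<open>G \<times>_H Y\<close>: it permutes the coset representatives, and
  \<open>\<beta> g i\<close> is the element of \<open>H\<close> with
  \<open>g i = \<rho> (g i) \<beta> g i\<close>. As \<open>I\<close> is finite,
  \<open>I \<times> M\<close> is commensurated, and the fibre over the unit coset of an invariant
  set near \<open>I \<times> M\<close> transfixes \<open>M\<close> under \<open>H\<close>.\<close>

theorem (in group) FW_fin_index:
  assumes FW: "property_FW G" and H: "fin_index G H"
  shows "property_FW (G\<lparr>carrier := H\<rparr>)"
  unfolding property_FW_def
proof (intro allI impI)
  fix Y :: "('a \<times> 'a \<times> nat) set" and \<phi> M
  assume act: "group_action (G\<lparr>carrier := H\<rparr>) Y \<phi>" and M: "M \<subseteq> Y" "commensurated (G\<lparr>carrier := H\<rparr>) \<phi> M"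
  interpret H: subgroup H G using H by (rule fin_index_subgroup)
  interpret A: group_action "G\<lparr>carrier := H\<rparr>" Y \<phi> by (rule act)
  have \<phi>Y: "\<phi> h y \<in> Y" if "h \<in> H" "y \<in> Y" for h y
    using A.element_image[of h y] that by simp
  have \<phi>1: "\<phi> \<one> y = y" if "y \<in> Y" for y
    using A.id_eq_one that by (metis monoid.select_convs(2) monoid.surjective partial_object.update_convs(1) restrict_apply')
  have \<phi>2: "\<phi> (g \<otimes> h) y = \<phi> g (\<phi> h y)" if "g \<in> H" "h \<in> H" "y \<in> Y" for g h y
    using A.composition_rule[of y g h] that by simp
  obtain \<rho> where \<rho>: "finite (\<rho> ` carrier G)" "\<And>g. g \<in> carrier G \<Longrightarrow> \<rho> g \<in> carrier G"
    "\<And>g. g \<in> carrier G \<Longrightarrow> inv (\<rho> g) \<otimes> g \<in> H"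
    "\<And>g h. \<lbrakk>g \<in> carrier G; h \<in> H\<rbrakk> \<Longrightarrow> \<rho> (g \<otimes> h) = \<rho> g" "\<And>h. h \<in> H \<Longrightarrow> \<rho> h = \<one>"
    by (rule fin_index_rep[OF H]) blast
  define I where "I = \<rho> ` carrier G"
  define \<beta> where "\<beta> g i = inv (\<rho> (g \<otimes> i)) \<otimes> (g \<otimes> i)" for g i
  have IG: "i \<in> carrier G" if "i \<in> I" for i using that \<rho>(2) by (auto simp: I_def)
  have \<rho>\<rho>: "\<rho> (g \<otimes> \<rho> x) = \<rho> (g \<otimes> x)" if "g \<in> carrier G" "x \<in> carrier G" for g x
  proof -
    have "\<rho> (g \<otimes> \<rho> x \<otimes> (inv (\<rho> x) \<otimes> x)) = \<rho> (g \<otimes> \<rho> x)"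
      using that \<rho> by simp
    then show ?thesis using that \<rho>(2) by (simp add: m_assoc inv_mult_eq)
  qed
  have \<rho>1: "\<rho> i = i" if "i \<in> I" for i
    using that \<rho>\<rho>[of \<one>] \<rho>(2) by (auto simp: I_def)
  have \<rho>I: "\<rho> g \<in> I" if "g \<in> carrier G" for g using that by (simp add: I_def)
  have \<beta>H: "\<beta> g i \<in> H" if "g \<in> carrier G" "i \<in> I" for g i
    using that \<rho>(3) IG by (simp add: \<beta>_def)
  have \<beta>2: "\<beta> (g \<otimes> h) i = \<beta> g (\<rho> (h \<otimes> i)) \<otimes> \<beta> h i" if "g \<in> carrier G" "h \<in> carrier G" "i \<in> I" for g h i
    using that IG \<rho>(2) \<rho>\<rho> by (simp add: \<beta>_def m_assoc inv_mult_eq)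
  define \<Phi> where "\<Phi> g = (\<lambda>(i, y). (\<rho> (g \<otimes> i), \<phi> (\<beta> g i) y))" for g
  have closed: "\<Phi> g x \<in> I \<times> Y" if "g \<in> carrier G" "x \<in> I \<times> Y" for g x
    using that \<phi>Y \<beta>H \<rho>I IG by (auto simp: \<Phi>_def)
  have one: "\<Phi> \<one> x = x" if "x \<in> I \<times> Y" for x
    using that \<phi>1 \<rho>1 IG by (auto simp: \<Phi>_def \<beta>_def)
  have mult: "\<Phi> (g \<otimes> h) x = \<Phi> g (\<Phi> h x)" if "g \<in> carrier G" "h \<in> carrier G" "x \<in> I \<times> Y" for g h x
    using that \<beta>2 \<phi>2 \<beta>H \<rho>I IG \<rho>\<rho> by (auto simp: \<Phi>_def m_assoc)
  have fin: "finite (sym_diff (I \<times> M) (\<Phi> g ` (I \<times> M)))" if g: "g \<in> carrier G" for g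
  proof (rule finite_subset)
    show "finite (\<Union>i\<in>I. Pair (\<rho> (g \<otimes> i)) ` sym_diff M (\<phi> (\<beta> g i) ` M))"
    proof (rule finite_UN_I)
      show "finite I" using \<rho>(1) by (simp add: I_def)
      show "finite (Pair (\<rho> (g \<otimes> i)) ` sym_diff M (\<phi> (\<beta> g i) ` M))" if "i \<in> I" for i
        using M(2) \<beta>H[OF g that] unfolding commensurated_def by (intro finite_imageI) simp
    qed
    show "sym_diff (I \<times> M) (\<Phi> g ` (I \<times> M)) \<subseteq> (\<Union>i\<in>I. Pair (\<rho> (g \<otimes> i)) ` sym_diff M (\<phi> (\<beta> g i) ` M))"
    proof
      fix x assume "x \<in> sym_diff (I \<times> M) (\<Phi> g ` (I \<times> M))"
      then consider j y where "x = (j, y)" "j \<in> I" "y \<in> M" "x \<notin> \<Phi> g ` (I \<times> M)"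
        | i y where "i \<in> I" "y \<in> M" "x = \<Phi> g (i, y)" "x \<notin> I \<times> M" by blast
      then show "x \<in> (\<Union>i\<in>I. Pair (\<rho> (g \<otimes> i)) ` sym_diff M (\<phi> (\<beta> g i) ` M))"
      proof cases
        case 1
        define i where "i = \<rho> (inv g \<otimes> j)"
        have i: "i \<in> I" "\<rho> (g \<otimes> i) = j"
          using 1 g IG \<rho>I \<rho>\<rho> \<rho>1 by (simp_all add: i_def inv_mult_eq)
        have "y \<notin> \<phi> (\<beta> g i) ` M"
        proof
          assume "y \<in> \<phi> (\<beta> g i) ` M"
          then obtain m where "m \<in> M" "y = \<phi> (\<beta> g i) m" by blast
          then have "x = \<Phi> g (i, m)" using 1 i by (simp add: \<Phi>_def)
          then show False using 1 i \<open>m \<in> M\<close> by blast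
        qed
        then show ?thesis using 1 i by blast
      next
        case 2
        then have "\<phi> (\<beta> g i) y \<notin> M" using \<rho>I g IG by (auto simp: \<Phi>_def)
        then show ?thesis using 2 by (auto simp: \<Phi>_def)
      qed
    qed
  qed
  have sub: "I \<times> M \<subseteq> I \<times> Y" using M by auto
  have "\<exists>M0. M0 \<subseteq> I \<times> Y \<and> (\<forall>g\<in>carrier G. \<forall>x\<in>M0. \<Phi> g x \<in> M0) \<and> finite (sym_diff (I \<times> M) M0)"
    by (rule FW_transfix[OF FW is_group closed one mult sub fin])
  then obtain M0 where M0: "M0 \<subseteq> I \<times> Y" "\<And>g x. g \<in> carrier G \<Longrightarrow> x \<in> M0 \<Longrightarrow> \<Phi> g x \<in> M0"
      "finite (sym_diff (I \<times> M) M0)"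
    by (elim exE conjE) (rule that, auto)
  define N where "N = {y. (\<one>, y) \<in> M0}"
  have oneI: "\<one> \<in> I" using \<rho>(5)[of \<one>] \<rho>I[of \<one>] by simp
  have NY: "N \<subseteq> Y" using M0(1) by (auto simp: N_def)
  have N: "\<phi> h y \<in> N" if "h \<in> H" "y \<in> N" for h y
    using M0(2)[of h "(\<one>, y)"] that \<rho>(5)[of h] by (simp add: N_def \<Phi>_def \<beta>_def)
  have "\<phi> h ` N = N" if h: "h \<in> H" for h
  proof (intro equalityI subsetI)
    fix y assume y: "y \<in> N"
    then have "\<phi> h (\<phi> (inv h) y) = \<phi> \<one> y" using \<phi>2[of h "inv h" y] h NY by auto
    then have "y = \<phi> h (\<phi> (inv h) y)" using \<phi>1[OF subsetD[OF NY y]] by simp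
    then show "y \<in> \<phi> h ` N" using N[of "inv h" y] h y by blast
  qed (use N h in blast)
  moreover have "finite (sym_diff M N)"
  proof (rule finite_imageD)
    have "Pair \<one> ` sym_diff M N \<subseteq> sym_diff (I \<times> M) M0" using oneI by (auto simp: N_def)
    then show "finite (Pair \<one> ` sym_diff M N)" using M0(3) finite_subset by blast
  qed (simp add: inj_on_def)
  ultimately show "transfixed (G\<lparr>carrier := H\<rparr>) Y \<phi> M"
    unfolding transfixed_def using NY by auto
qed

section \<open>Homomorphisms to \<open>\<real>/\<int>\<close> and to \<open>\<real>\<close>\<close>

context group
begin

text \<open>On the \<open>n\<close>-th of countably many circles let \<open>g\<close> translate by
  \<open>n! \<tau> g\<close>. The set of all origins is commensurated, since
  \<open>n! \<tau> g\<close> is an integer once \<open>n\<close> reaches the denominator of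
  \<open>\<tau> g\<close>. An invariant set at finite distance has only the origin on some level
  \<open>n\<close>, which is therefore fixed: \<open>n!\<close> is a common denominator.\<close>

lemma FW_rational_mod_Ints:
  fixes \<tau> :: "'a \<Rightarrow> real"
  assumes FW: "property_FW G"
    and hom: "\<And>g h. \<lbrakk>g \<in> carrier G; h \<in> carrier G\<rbrakk> \<Longrightarrow> \<tau> (g \<otimes> h) - \<tau> g - \<tau> h \<in> \<int>"
    and rat: "\<And>g. g \<in> carrier G \<Longrightarrow> \<tau> g \<in> \<rat>"
  obtains n :: nat where "n > 0" "\<And>g. g \<in> carrier G \<Longrightarrow> n * \<tau> g \<in> \<int>"
proof -
  define \<phi> where "\<phi> g = (\<lambda>(n :: nat, x). (n, frac (x + fact n * \<tau> g)))" for g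
  define Y :: "(nat \<times> real) set" where "Y = {(n, x). frac x = x}"
  define M :: "(nat \<times> real) set" where "M = range (\<lambda>n. (n, 0))"
  have fr: "frac x = frac y" if "x - y \<in> \<int>" for x y :: real
    using frac_add_int_right[OF that, of y] by simp
  have frac0: "frac x - x \<in> \<int>" for x :: real by (simp add: frac_def)
  have frac_frac: "frac (frac x + y) = frac (x + y)" for x y :: real
    using frac0[of x] by (intro fr) simp
  have fZ: "(fact n :: real) \<in> \<int>" for n by (metis Ints_of_nat of_nat_fact)
  have one: "\<tau> \<one> \<in> \<int>" using Ints_minus[OF hom[of \<one> \<one>]] by simp
  have closed: "\<phi> g x \<in> Y" if "g \<in> carrier G" "x \<in> Y" for g x by (auto simp: \<phi>_def Y_def split_beta)
  have one': "\<phi> \<one> x = x" if "x \<in> Y" for x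
  proof -
    obtain n y where x: "x = (n, y)" by (cases x)
    then have y: "frac y = y" using that by (simp add: Y_def)
    have "frac (y + fact n * \<tau> \<one>) = frac y" using Ints_mult[OF fZ one] by (intro fr) simp
    then show ?thesis using x y by (simp add: \<phi>_def)
  qed
  have mult: "\<phi> (g \<otimes> h) x = \<phi> g (\<phi> h x)" if "g \<in> carrier G" "h \<in> carrier G" "x \<in> Y" for g h x
  proof -
    obtain n y where x: "x = (n, y)" by (cases x)
    have "fact n * (\<tau> (g \<otimes> h) - \<tau> g - \<tau> h) \<in> \<int>" using hom[OF that(1,2)] fZ by (intro Ints_mult)
    then have "frac (y + fact n * \<tau> (g \<otimes> h)) = frac (y + fact n * \<tau> h + fact n * \<tau> g)"
      by (intro fr) (simp add: algebra_simps)
    then show ?thesis by (simp add: \<phi>_def x frac_frac)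
  qed
  have MY: "M \<subseteq> Y" by (auto simp: M_def Y_def)
  have fin: "finite (sym_diff M (\<phi> g ` M))" if g: "g \<in> carrier G" for g
  proof -
    obtain q :: int and p :: int where "q > 0" "\<tau> g = of_int p / of_int q"
      using rat[OF g] by (auto elim!: Rats_cases' simp: )
    define N where "N = nat q"
    have Z: "fact n * \<tau> g \<in> \<int>" if "n \<ge> N" for n
    proof -
      have "N dvd fact n" using that \<open>q > 0\<close> by (intro dvd_fact) (auto simp: N_def)
      then obtain k where "fact n = N * k" by (auto simp: dvd_def)
      then have "(fact n :: real) = real N * real k" by (metis of_nat_fact of_nat_mult)
      then have "fact n * \<tau> g = of_int (int k * p)" using \<open>q > 0\<close> \<open>\<tau> g = _\<close> by (simp add: N_def)
      then show ?thesis by simp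
    qed
    have "\<phi> g (n, 0) = (n, 0)" if "n \<ge> N" for n using Z[OF that] by (simp add: \<phi>_def frac_eq_0_iff)
    then have fx: "(n, 0) \<in> (\<lambda>n. (n, 0)) ` {..<N} \<and> \<phi> g (n, 0) \<in> (\<lambda>n. \<phi> g (n, 0)) ` {..<N}
        \<or> \<phi> g (n, 0) = (n, 0)" for n
      by (cases "n < N") auto
    have "sym_diff M (\<phi> g ` M) \<subseteq> (\<lambda>n. (n, 0)) ` {..<N} \<union> (\<lambda>n. \<phi> g (n, 0)) ` {..<N}"
    proof
      fix x assume "x \<in> sym_diff M (\<phi> g ` M)"
      then obtain n where "x = (n, 0) \<and> x \<notin> \<phi> g ` M \<or> x = \<phi> g (n, 0) \<and> x \<notin> M"
        unfolding M_def by blast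
      moreover have "(n, 0) \<in> M" by (simp add: M_def)
      ultimately show "x \<in> (\<lambda>n. (n, 0)) ` {..<N} \<union> (\<lambda>n. \<phi> g (n, 0)) ` {..<N}"
        using fx[of n] by (metis UnI1 UnI2 imageI)
    qed
    then show ?thesis by (rule finite_subset) auto
  qed
  have "\<exists>M0. M0 \<subseteq> Y \<and> (\<forall>g\<in>carrier G. \<forall>x\<in>M0. \<phi> g x \<in> M0) \<and> finite (sym_diff (M) M0)"
    by (rule FW_transfix[OF FW is_group closed one' mult MY fin])
  then obtain M0 where M0: "M0 \<subseteq> Y" "\<And>g x. g \<in> carrier G \<Longrightarrow> x \<in> M0 \<Longrightarrow> \<phi> g x \<in> M0"
      "finite (sym_diff (M) M0)"
    by (elim exE conjE) (rule that, auto)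
  have "finite (fst ` sym_diff M M0)" using M0(3) by simp
  then obtain n where n: "n \<notin> fst ` sym_diff M M0" using infinite_UNIV_nat ex_new_if_finite by blast
  have lev: "(n, x) \<in> M0 \<longleftrightarrow> x = 0" for x
  proof -
    have "(n, x) \<notin> sym_diff M M0" using n by (metis fst_conv image_eqI)
    moreover have "(n, x) \<in> M \<longleftrightarrow> x = 0" by (auto simp: M_def)
    ultimately show ?thesis by blast
  qed
  show thesis
  proof (rule that[of "fact n"])
    fix g assume "g \<in> carrier G"
    then have "\<phi> g (n, 0) \<in> M0" using M0(2) lev by blast
    then have "frac (fact n * \<tau> g) = 0" using lev by (simp add: \<phi>_def)
    then show "real (fact n) * \<tau> g \<in> \<int>" by (simp add: frac_eq_0_iff)
  qed simp
qed

text \<open>The half-line \<open>{0..}\<close> is commensurated by translations, but a set at finite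
  distance from it cannot be invariant under a translation to the left. This is applied to
  \<open>g0\<close> and to its inverse.\<close>

lemma FW_hom_int:
  fixes f :: "'a \<Rightarrow> int"
  assumes FW: "property_FW G"
    and hom: "\<And>g h. \<lbrakk>g \<in> carrier G; h \<in> carrier G\<rbrakk> \<Longrightarrow> f (g \<otimes> h) = f g + f h"
    and g0: "g0 \<in> carrier G"
  shows "f g0 = 0"
proof -
  define \<phi> where "\<phi> g = (\<lambda>x. x + f g)" for g
  have one: "f \<one> = 0" using hom[of \<one> \<one>] by simp
  have fin: "finite (sym_diff {0..} (\<phi> g ` {0..}))" for g
  proof -
    have "\<phi> g ` {0..} = {f g..}" by (auto simp: \<phi>_def image_iff intro!: bexI[of _ "_ - f g"])
    moreover have "sym_diff {0..} {f g..} \<subseteq> {-\<bar>f g\<bar>..\<bar>f g\<bar>}" by auto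
    ultimately show ?thesis by (metis finite_subset finite_atLeastAtMost_int)
  qed
  have "\<exists>M0. M0 \<subseteq> UNIV \<and> (\<forall>g\<in>carrier G. \<forall>x\<in>M0. \<phi> g x \<in> M0) \<and> finite (sym_diff ({0..}) M0)"
    by (rule FW_transfix[OF FW is_group]) (use one hom fin in \<open>auto simp: \<phi>_def\<close>)
  then obtain M0 where M0: "M0 \<subseteq> UNIV" "\<And>g x. g \<in> carrier G \<Longrightarrow> x \<in> M0 \<Longrightarrow> \<phi> g x \<in> M0"
      "finite (sym_diff ({0..}) M0)"
    by (elim exE conjE) (rule that, auto)
  have nonpos: "f g \<ge> 0" if g: "g \<in> carrier G" for g
  proof (rule ccontr)
    assume neg: "\<not> f g \<ge> 0"
    have "infinite {0 :: int..}" by (simp add: infinite_Ici)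
    then obtain x where x: "x \<in> M0" using M0(3)
      by (metis Diff_empty Un_infinite all_not_in_conv)
    have "x - int n * nat (- f g) \<in> M0" for n
    proof (induction n)
      case (Suc n)
      then show ?case using M0(2)[OF g Suc] neg by (simp add: \<phi>_def algebra_simps)
    qed (use x in simp)
    then have inM0: "x - int n * max 0 (- f g) \<in> M0" for n by (simp add: max_def)
    have sub: "(\<lambda>n. x - int n * nat (- f g)) ` {nat x + 1..} \<subseteq> M0 - {0..}"
    proof
      fix z assume "z \<in> (\<lambda>n. x - int n * nat (- f g)) ` {nat x + 1..}"
      then obtain n where n: "z = x - int n * nat (- f g)" "n \<ge> nat x + 1" by auto
      have "int n * 1 \<le> int n * int (nat (- f g))" using neg by (intro mult_left_mono) auto
      then show "z \<in> M0 - {0..}" using inM0[of n] n neg by (auto simp: max_def)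
    qed
    have "inj (\<lambda>n. x - int n * nat (- f g))" using neg by (auto simp: inj_on_def)
    then have "infinite ((\<lambda>n. x - int n * nat (- f g)) ` {nat x + 1..})"
      by (metis finite_imageD infinite_Ici inj_on_subset subset_UNIV)
    then show False using sub M0(3) by (meson finite_Un finite_subset)
  qed
  have "f (inv g0) = - f g0" using hom[of g0 "inv g0"] g0 one by simp
  then show ?thesis using nonpos[of g0] nonpos[of "inv g0"] g0 by simp
qed

text \<open>A vector space complement of \<open>\<rat>\<close> in \<open>\<real>\<close> reduces irrational values to rational ones.\<close>

theorem FW_mod_Ints:
  fixes \<tau> :: "'a \<Rightarrow> real"
  assumes FW: "property_FW G"
    and hom: "\<And>g h. \<lbrakk>g \<in> carrier G; h \<in> carrier G\<rbrakk> \<Longrightarrow> \<tau> (g \<otimes> h) - \<tau> g - \<tau> h \<in> \<int>"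
  obtains n :: nat where "n > 0" "\<And>g. g \<in> carrier G \<Longrightarrow> n * \<tau> g \<in> \<int>"
proof (cases "\<forall>g\<in>carrier G. \<tau> g \<in> \<rat>")
  case True
  then show thesis using FW_rational_mod_Ints[OF FW hom] that by metis
next
  case False
  then obtain g0 where g0: "g0 \<in> carrier G" "\<tau> g0 \<notin> \<rat>" by blast
  interpret Q: vector_space_pair "\<lambda>(q :: rat) (x :: real). of_rat q * x" "(*) :: rat \<Rightarrow> rat \<Rightarrow> rat"
    by unfold_locales (simp_all add: algebra_simps of_rat_add of_rat_mult)
  have ind: "\<not> Q.vs1.dependent {1, \<tau> g0}"
  proof
    assume "Q.vs1.dependent {1, \<tau> g0}"
    moreover have "1 \<noteq> \<tau> g0" using g0(2) by (metis Rats_1)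
    ultimately obtain u v where uv: "of_rat u * 1 + of_rat v * \<tau> g0 = 0" "u \<noteq> 0 \<or> v \<noteq> 0"
      by (auto simp: Q.vs1.dependent_finite)
    then have "v \<noteq> 0" by auto
    then have "\<tau> g0 = of_rat (- u / v)" using uv(1) by (simp add: of_rat_divide of_rat_minus field_simps eq_neg_iff_add_eq_0)
    then show False using g0(2) by simp
  qed
  \<comment> \<open>\<open>f0\<close> prescribes a linear form over \<rat> with value 0 at 1 and
    value 1 at \<open>\<tau> g0\<close>. It kills \<int>, so its composition with
    \<open>\<tau>\<close> is a true homomorphism with rational values; a common denominator makes it
    integral, hence zero, against \<open>l (\<tau> g0) = 1\<close>.\<close>
  define f0 where "f0 x = (if x = 1 then 0 else 1 :: rat)" for x :: real
  obtain l where l: "Vector_Spaces.linear (\<lambda>(q :: rat) (x :: real). of_rat q * x) (*) l"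
      "\<forall>x\<in>{1, \<tau> g0}. l x = f0 x"
    using Q.linear_independent_extend[OF ind, of f0] by blast
  interpret l: Vector_Spaces.linear "\<lambda>(q :: rat) (x :: real). of_rat q * x" "(*) :: rat \<Rightarrow> rat \<Rightarrow> rat" l
    by (rule l(1))
  have lZ: "l x = 0" if "x \<in> \<int>" for x
  proof -
    obtain k where "x = of_int k" using \<open>x \<in> \<int>\<close> by (auto elim: Ints_cases)
    then show ?thesis using l.scale[of "of_int k" 1] l(2) by (simp add: f0_def)
  qed
  have l0: "l (\<tau> g0) = 1" using l(2) g0(2) by (auto simp: f0_def)
  have lhom: "l (\<tau> (g \<otimes> h)) = l (\<tau> g) + l (\<tau> h)" if "g \<in> carrier G" "h \<in> carrier G" for g h
    using lZ[OF hom[OF that]] by (simp add: l.diff)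
  have "real_of_rat (l (\<tau> (g \<otimes> h))) - of_rat (l (\<tau> g)) - of_rat (l (\<tau> h)) \<in> \<int>"
    if "g \<in> carrier G" "h \<in> carrier G" for g h
    by (simp add: lhom[OF that] of_rat_add)
  then obtain n :: nat where n: "n > 0" "\<And>g. g \<in> carrier G \<Longrightarrow> n * real_of_rat (l (\<tau> g)) \<in> \<int>"
    using FW_rational_mod_Ints[OF FW, of "\<lambda>g. of_rat (l (\<tau> g))"] by auto
  define f where "f g = \<lfloor>n * real_of_rat (l (\<tau> g))\<rfloor>" for g
  have f: "real_of_int (f g) = n * real_of_rat (l (\<tau> g))" if "g \<in> carrier G" for g
    using n(2)[OF that] by (simp add: f_def of_int_floor)
  have "f (g \<otimes> h) = f g + f h" if "g \<in> carrier G" "h \<in> carrier G" for g h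
  proof -
    have "real_of_int (f (g \<otimes> h)) = real_of_int (f g + f h)"
      using that by (simp add: f lhom of_rat_add distrib_left)
    then show ?thesis by linarith
  qed
  then have "f g0 = 0" using g0(1) by (rule FW_hom_int[OF FW, of f])
  then show thesis using f[OF g0(1)] l0 n(1) by simp
qed

text \<open>A nonzero homomorphism can be rescaled to take an irrational value at \<open>g0\<close>,
  and no positive integer multiple of that value is an integer.\<close>

theorem FW_hom_real:
  fixes \<tau> :: "'a \<Rightarrow> real"
  assumes FW: "property_FW G"
    and hom: "\<And>g h. \<lbrakk>g \<in> carrier G; h \<in> carrier G\<rbrakk> \<Longrightarrow> \<tau> (g \<otimes> h) = \<tau> g + \<tau> h"
    and g0: "g0 \<in> carrier G"
  shows "\<tau> g0 = 0"
proof (rule ccontr)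
  assume nz: "\<tau> g0 \<noteq> 0"
  obtain x :: real where x: "x \<notin> \<rat>"
    using countable_rat uncountable_UNIV_real by (metis UNIV_eq_I)
  obtain n :: nat where n: "n > 0" "\<And>g. g \<in> carrier G \<Longrightarrow> n * (x / \<tau> g0 * \<tau> g) \<in> \<int>"
    by (rule FW_mod_Ints[OF FW, of "\<lambda>g. x / \<tau> g0 * \<tau> g"]) (auto simp: hom algebra_simps)
  then have "n * x \<in> \<rat>" using g0 nz Ints_subset_Rats by force
  then have "n * x / n \<in> \<rat>" by (intro Rats_divide) auto
  then show False using n(1) x by simp
qed

corollary FW_hom_mult:
  fixes c :: "'a \<Rightarrow> real"
  assumes FW: "property_FW G"
    and hom: "\<And>g h. \<lbrakk>g \<in> carrier G; h \<in> carrier G\<rbrakk> \<Longrightarrow> c (g \<otimes> h) = c g * c h"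
    and nz: "\<And>g. g \<in> carrier G \<Longrightarrow> c g \<noteq> 0"
    and g0: "g0 \<in> carrier G"
  shows "\<bar>c g0\<bar> = 1"
proof -
  have "ln \<bar>c (g \<otimes> h)\<bar> = ln \<bar>c g\<bar> + ln \<bar>c h\<bar>" if "g \<in> carrier G" "h \<in> carrier G" for g h
    using nz that by (simp add: hom abs_mult ln_mult)
  then have "ln \<bar>c g0\<bar> = 0" using g0 by (rule FW_hom_real[OF FW, of "\<lambda>g. ln \<bar>c g\<bar>"])
  then show ?thesis using nz[OF g0] by simp
qed

end

text \<open>The values of the character on \<open>K\<close> have absolute value 1, so they are signs
  and the kernel has index at most 2 in \<open>K\<close>.\<close>

lemma (in group) FW_hom_kernel:
  fixes c :: "'a \<Rightarrow> real"
  assumes FW: "property_FW G" and K: "fin_index G K"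
    and hom: "\<And>g h. \<lbrakk>g \<in> K; h \<in> K\<rbrakk> \<Longrightarrow> c (g \<otimes> h) = c g * c h" and nz: "\<And>g. g \<in> K \<Longrightarrow> c g \<noteq> 0"
  shows "fin_index G {g \<in> K. c g = 1}"
proof (rule fin_index_trans[OF K])
  interpret K: subgroup K G using K by (rule fin_index_subgroup)
  interpret KG: group "G\<lparr>carrier := K\<rparr>" using K by (rule fin_index_group)
  have FWK: "property_FW (G\<lparr>carrier := K\<rparr>)" by (rule FW_fin_index[OF FW K])
  have abs1: "\<bar>c g\<bar> = 1" if "g \<in> K" for g
    by (rule KG.FW_hom_mult[OF FWK, of c]) (use hom nz that in simp_all)
  have invK: "inv\<^bsub>G\<lparr>carrier := K\<rparr>\<^esub> g = inv g" if "g \<in> K" for g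
    using K.subgroup_axioms that by (rule m_inv_consistent)
  have c1: "c \<one> = 1" using hom[of \<one> \<one>] nz[of \<one>] K.one_closed by simp
  have cinv: "c (inv g) * c g = 1" if "g \<in> K" for g
    using hom[of "inv g" g] that K.m_inv_closed[OF that] c1 K.mem_carrier[OF that] by simp
  let ?N = "{g \<in> K. c g = 1}"
  have N: "subgroup ?N (G\<lparr>carrier := K\<rparr>)"
  proof (rule KG.subgroupI)
    show "?N \<subseteq> carrier (G\<lparr>carrier := K\<rparr>)" by auto
    have "\<one> \<in> ?N" using c1 K.one_closed by simp
    then show "?N \<noteq> {}" by blast
    show "inv\<^bsub>G\<lparr>carrier := K\<rparr>\<^esub> g \<in> ?N" if "g \<in> ?N" for g
      using that cinv[of g] K.m_inv_closed[of g] invK[of g] by simp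
    show "g \<otimes>\<^bsub>G\<lparr>carrier := K\<rparr>\<^esub> h \<in> ?N" if "g \<in> ?N" "h \<in> ?N" for g h
      using that hom[of g h] K.m_closed[of g h] by simp
  qed
  show "fin_index (G\<lparr>carrier := K\<rparr>) ?N"
  proof (rule KG.fin_index_label[OF N, of c])
    have "c ` carrier (G\<lparr>carrier := K\<rparr>) \<subseteq> {1, -1}"
    proof
      fix x assume "x \<in> c ` carrier (G\<lparr>carrier := K\<rparr>)"
      then obtain g where "g \<in> K" "x = c g" by auto
      then have "\<bar>x\<bar> = 1" using abs1[of g] by simp
      then show "x \<in> {1, -1}" by (simp add: abs_if split: if_splits)
    qed
    then show "finite (c ` carrier (G\<lparr>carrier := K\<rparr>))" by (rule finite_subset) simp
    fix g g' assume "g \<in> carrier (G\<lparr>carrier := K\<rparr>)" "g' \<in> carrier (G\<lparr>carrier := K\<rparr>)" and e: "c g = c g'"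
    then have gg: "g \<in> K" "g' \<in> K" by simp_all
    have "c (inv g \<otimes> g') = 1" using hom[OF K.m_inv_closed[OF gg(1)] gg(2)] cinv[OF gg(1)] e by simp
    then show "inv\<^bsub>G\<lparr>carrier := K\<rparr>\<^esub> g \<otimes>\<^bsub>G\<lparr>carrier := K\<rparr>\<^esub> g' \<in> ?N"
      using K.m_closed[OF K.m_inv_closed[OF gg(1)] gg(2)] invK[OF gg(1)] by simp
  qed
qed

section \<open>Positive definite kernels\<close>

text \<open>Kernels that are approximated on finite sets by finite sums of squares \<open>f x * f y\<close>; this
  form of positive definiteness is visibly stable under products.\<close>

definition pos_kernel :: "'i set \<Rightarrow> ('i \<Rightarrow> 'i \<Rightarrow> real) \<Rightarrow> bool" where
  "pos_kernel I k \<longleftrightarrow> (\<forall>F e. finite F \<and> F \<subseteq> I \<and> 0 < e \<longrightarrow>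
     (\<exists>fs. \<forall>x\<in>F. \<forall>y\<in>F. \<bar>k x y - (\<Sum>f\<leftarrow>fs. f x * f y)\<bar> < e))"

lemma pos_kernelE:
  assumes "pos_kernel I k" "finite F" "F \<subseteq> I"
  obtains fs where "\<And>x y. \<lbrakk>x \<in> F; y \<in> F\<rbrakk> \<Longrightarrow> (\<lambda>n. \<Sum>f\<leftarrow>fs n. f x * f y) \<longlonglongrightarrow> k x y"
proof -
  have "\<forall>n. \<exists>fs. \<forall>x\<in>F. \<forall>y\<in>F. \<bar>k x y - (\<Sum>f\<leftarrow>fs. f x * f y)\<bar> < inverse (real (Suc n))"
    by (rule allI, rule assms(1)[unfolded pos_kernel_def, rule_format]) (simp add: assms)
  from choice[OF this] obtain fs where
    fs: "\<And>n x y. \<lbrakk>x \<in> F; y \<in> F\<rbrakk> \<Longrightarrow> \<bar>k x y - (\<Sum>f\<leftarrow>fs n. f x * f y)\<bar> < inverse (real (Suc n))"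
    by blast
  show thesis
  proof (rule that)
    fix x y assume xy: "x \<in> F" "y \<in> F"
    have "(\<lambda>n. (\<Sum>f\<leftarrow>fs n. f x * f y) - k x y) \<longlonglongrightarrow> 0"
    proof (rule Lim_null_comparison[OF _ LIMSEQ_inverse_real_of_nat], rule always_eventually, rule allI)
      show "norm ((\<Sum>f\<leftarrow>fs n. f x * f y) - k x y) \<le> inverse (real (Suc n))" for n
        using fs[OF xy, of n] unfolding real_norm_def by (subst abs_minus_commute) (rule less_imp_le)
    qed
    then show "(\<lambda>n. \<Sum>f\<leftarrow>fs n. f x * f y) \<longlonglongrightarrow> k x y" by (simp add: LIM_zero_iff)
  qed
qed

lemma pos_kernelI:
  assumes "\<And>F. finite F \<Longrightarrow> F \<subseteq> I \<Longrightarrow>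
     \<exists>fs. \<forall>x\<in>F. \<forall>y\<in>F. (\<lambda>n. \<Sum>f\<leftarrow>fs n. f x * f y) \<longlonglongrightarrow> k x y"
  shows "pos_kernel I k"
  unfolding pos_kernel_def
proof (intro allI impI, elim conjE)
  fix F and e :: real assume F: "finite F" "F \<subseteq> I" and e: "0 < e"
  obtain fs where fs: "\<forall>x\<in>F. \<forall>y\<in>F. (\<lambda>n. \<Sum>f\<leftarrow>fs n. f x * f y) \<longlonglongrightarrow> k x y"
    using assms[OF F] by blast
  have "\<forall>x\<in>F. \<forall>y\<in>F. \<forall>\<^sub>F n in sequentially. \<bar>k x y - (\<Sum>f\<leftarrow>fs n. f x * f y)\<bar> < e"
  proof (intro ballI)
    fix x y assume "x \<in> F" "y \<in> F"
    then have "(\<lambda>n. \<Sum>f\<leftarrow>fs n. f x * f y) \<longlonglongrightarrow> k x y" using fs by blast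
    from tendstoD[OF this e] show "\<forall>\<^sub>F n in sequentially. \<bar>k x y - (\<Sum>f\<leftarrow>fs n. f x * f y)\<bar> < e"
      by (subst abs_minus_commute) (simp add: dist_real_def)
  qed
  then have "\<forall>\<^sub>F n in sequentially. \<forall>x\<in>F. \<forall>y\<in>F. \<bar>k x y - (\<Sum>f\<leftarrow>fs n. f x * f y)\<bar> < e"
    using F(1) by (simp add: eventually_ball_finite_distrib)
  then show "\<exists>fs. \<forall>x\<in>F. \<forall>y\<in>F. \<bar>k x y - (\<Sum>f\<leftarrow>fs. f x * f y)\<bar> < e"
    by (auto dest!: eventually_happens'[OF sequentially_bot])
qed

lemma pos_kernel_feature: "pos_kernel I (\<lambda>x y. f x * f y)"
  by (auto simp: pos_kernel_def intro!: exI[of _ "[f]"])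

lemma pos_kernel_const: "0 \<le> c \<Longrightarrow> pos_kernel I (\<lambda>x y. c)"
  using pos_kernel_feature[of I "\<lambda>_. sqrt c"] by simp

lemma pos_kernel_comp:
  assumes k: "pos_kernel I k" and \<phi>: "\<phi> ` J \<subseteq> I"
  shows "pos_kernel J (\<lambda>x y. k (\<phi> x) (\<phi> y))"
  unfolding pos_kernel_def
proof (intro allI impI, elim conjE)
  fix F and e :: real assume F: "finite F" "F \<subseteq> J" and e: "0 < e"
  then have "finite (\<phi> ` F)" "\<phi> ` F \<subseteq> I" using \<phi> by auto
  then obtain fs where "\<forall>x\<in>\<phi> ` F. \<forall>y\<in>\<phi> ` F. \<bar>k x y - (\<Sum>f\<leftarrow>fs. f x * f y)\<bar> < e"
    using k[unfolded pos_kernel_def, rule_format, of "\<phi> ` F" e] e by auto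
  then show "\<exists>fs. \<forall>x\<in>F. \<forall>y\<in>F. \<bar>k (\<phi> x) (\<phi> y) - (\<Sum>f\<leftarrow>fs. f x * f y)\<bar> < e"
    by (intro exI[of _ "map (\<lambda>f. f \<circ> \<phi>) fs"]) (simp add: o_def)
qed

lemma pos_kernel_add:
  assumes "pos_kernel I k" "pos_kernel I k'" shows "pos_kernel I (\<lambda>x y. k x y + k' x y)"
proof (rule pos_kernelI)
  fix F assume F: "finite F" "F \<subseteq> I"
  obtain fs where fs: "\<And>x y. \<lbrakk>x \<in> F; y \<in> F\<rbrakk> \<Longrightarrow> (\<lambda>n. \<Sum>f\<leftarrow>fs n. f x * f y) \<longlonglongrightarrow> k x y"
    by (rule pos_kernelE[OF assms(1) F]) (rule that)
  obtain gs where gs: "\<And>x y. \<lbrakk>x \<in> F; y \<in> F\<rbrakk> \<Longrightarrow> (\<lambda>n. \<Sum>f\<leftarrow>gs n. f x * f y) \<longlonglongrightarrow> k' x y"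
    by (rule pos_kernelE[OF assms(2) F]) (rule that)
  show "\<exists>fs. \<forall>x\<in>F. \<forall>y\<in>F. (\<lambda>n. \<Sum>f\<leftarrow>fs n. f x * f y) \<longlonglongrightarrow> k x y + k' x y"
  proof (intro exI[of _ "\<lambda>n. fs n @ gs n"] ballI)
    fix x y assume xy: "x \<in> F" "y \<in> F"
    show "(\<lambda>n. \<Sum>f\<leftarrow>fs n @ gs n. f x * f y) \<longlonglongrightarrow> k x y + k' x y"
      using tendsto_add[OF fs[OF xy] gs[OF xy]] by simp
  qed
qed

text \<open>Products of features are features. In this description of positive definiteness it is
  the whole content of the Schur product theorem.\<close>

lemma sum_list_mult_features:
  fixes fs gs :: "('i \<Rightarrow> real) list"
  shows "(\<Sum>h\<leftarrow>concat (map (\<lambda>f. map (\<lambda>g x. f x * g x) gs) fs). h x * h y) =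
    (\<Sum>f\<leftarrow>fs. f x * f y) * (\<Sum>g\<leftarrow>gs. g x * g y)"
proof (induction fs)
  case (Cons f fs)
  have "(\<Sum>h\<leftarrow>map (\<lambda>g x. f x * g x) gs. h x * h y) = f x * f y * (\<Sum>g\<leftarrow>gs. g x * g y)"
    by (induction gs) (simp_all add: algebra_simps)
  with Cons show ?case by (simp add: distrib_right)
qed simp

lemma pos_kernel_mult:
  assumes "pos_kernel I k" "pos_kernel I k'" shows "pos_kernel I (\<lambda>x y. k x y * k' x y)"
proof (rule pos_kernelI)
  fix F assume F: "finite F" "F \<subseteq> I"
  obtain fs where fs: "\<And>x y. \<lbrakk>x \<in> F; y \<in> F\<rbrakk> \<Longrightarrow> (\<lambda>n. \<Sum>f\<leftarrow>fs n. f x * f y) \<longlonglongrightarrow> k x y"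
    by (rule pos_kernelE[OF assms(1) F]) (rule that)
  obtain gs where gs: "\<And>x y. \<lbrakk>x \<in> F; y \<in> F\<rbrakk> \<Longrightarrow> (\<lambda>n. \<Sum>f\<leftarrow>gs n. f x * f y) \<longlonglongrightarrow> k' x y"
    by (rule pos_kernelE[OF assms(2) F]) (rule that)
  show "\<exists>fs. \<forall>x\<in>F. \<forall>y\<in>F. (\<lambda>n. \<Sum>f\<leftarrow>fs n. f x * f y) \<longlonglongrightarrow> k x y * k' x y"
  proof (intro exI[of _ "\<lambda>n. concat (map (\<lambda>f. map (\<lambda>g x. f x * g x) (gs n)) (fs n))"] ballI)
    fix x y assume xy: "x \<in> F" "y \<in> F"
    show "(\<lambda>n. \<Sum>h\<leftarrow>concat (map (\<lambda>f. map (\<lambda>g x. f x * g x) (gs n)) (fs n)). h x * h y) \<longlonglongrightarrow> k x y * k' x y"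
      unfolding sum_list_mult_features by (intro tendsto_mult fs gs xy)
  qed
qed

lemma pos_kernel_limit:
  assumes k: "\<And>n. pos_kernel I (k n)"
    and lim: "\<And>x y. \<lbrakk>x \<in> I; y \<in> I\<rbrakk> \<Longrightarrow> (\<lambda>n :: nat. k n x y) \<longlonglongrightarrow> l x y"
  shows "pos_kernel I l"
  unfolding pos_kernel_def
proof (intro allI impI, elim conjE)
  fix F and e :: real assume F: "finite F" "F \<subseteq> I" and e: "0 < e"
  have "\<forall>x\<in>F. \<forall>y\<in>F. \<forall>\<^sub>F n in sequentially. \<bar>k n x y - l x y\<bar> < e / 2"
  proof (intro ballI)
    fix x y assume "x \<in> F" "y \<in> F"
    then have "(\<lambda>n. k n x y) \<longlonglongrightarrow> l x y" using lim F by blast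
    from tendstoD[OF this, of "e / 2"] e show "\<forall>\<^sub>F n in sequentially. \<bar>k n x y - l x y\<bar> < e / 2"
      by (simp add: dist_real_def)
  qed
  then have "\<forall>\<^sub>F n in sequentially. \<forall>x\<in>F. \<forall>y\<in>F. \<bar>k n x y - l x y\<bar> < e / 2"
    using F(1) by (simp add: eventually_ball_finite_distrib)
  then obtain n where n: "\<And>x y. \<lbrakk>x \<in> F; y \<in> F\<rbrakk> \<Longrightarrow> \<bar>k n x y - l x y\<bar> < e / 2"
    by (auto dest!: eventually_happens'[OF sequentially_bot])
  obtain fs where "\<forall>x\<in>F. \<forall>y\<in>F. \<bar>k n x y - (\<Sum>f\<leftarrow>fs. f x * f y)\<bar> < e / 2"
    using k[of n, unfolded pos_kernel_def, rule_format, of F "e / 2"] F e by auto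
  note fs = this
  have "\<forall>x\<in>F. \<forall>y\<in>F. \<bar>l x y - (\<Sum>f\<leftarrow>fs. f x * f y)\<bar> < e"
  proof (intro ballI)
    fix x y assume "x \<in> F" "y \<in> F"
    with fs have "\<bar>k n x y - (\<Sum>f\<leftarrow>fs. f x * f y)\<bar> < e / 2" "\<bar>k n x y - l x y\<bar> < e / 2" using n by auto
    then show "\<bar>l x y - (\<Sum>f\<leftarrow>fs. f x * f y)\<bar> < e" by linarith
  qed
  then show "\<exists>fs. \<forall>x\<in>F. \<forall>y\<in>F. \<bar>l x y - (\<Sum>f\<leftarrow>fs. f x * f y)\<bar> < e" by blast
qed

lemma pos_kernel_cong:
  "pos_kernel I k \<Longrightarrow> (\<And>x y. \<lbrakk>x \<in> I; y \<in> I\<rbrakk> \<Longrightarrow> k' x y = k x y) \<Longrightarrow> pos_kernel I k'"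
  by (rule pos_kernel_limit[of I "\<lambda>n. k"]) auto

lemma pos_kernel_sum:
  assumes "\<And>i. i \<in> A \<Longrightarrow> pos_kernel I (k i)" shows "pos_kernel I (\<lambda>x y. \<Sum>i\<in>A. k i x y)"
  using assms by (induction A rule: infinite_finite_induct) (simp_all add: pos_kernel_add pos_kernel_const)

lemma pos_kernel_prod:
  assumes "\<And>i. i \<in> A \<Longrightarrow> pos_kernel I (k i)" shows "pos_kernel I (\<lambda>x y. \<Prod>i\<in>A. k i x y)"
  using assms by (induction A rule: infinite_finite_induct) (simp_all add: pos_kernel_mult pos_kernel_const)

lemma pos_kernel_power: "pos_kernel I k \<Longrightarrow> pos_kernel I (\<lambda>x y. k x y ^ n)"
  by (induction n) (simp_all add: pos_kernel_mult pos_kernel_const)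

lemma pos_kernel_sym:
  assumes "pos_kernel I k" "x \<in> I" "y \<in> I" shows "k x y = k y x"
proof -
  obtain fs where fs: "\<And>u v. \<lbrakk>u \<in> {x, y}; v \<in> {x, y}\<rbrakk> \<Longrightarrow> (\<lambda>n. \<Sum>f\<leftarrow>fs n. f u * f v) \<longlonglongrightarrow> k u v"
    by (rule pos_kernelE[OF assms(1), of "{x, y}"]) (use assms in \<open>auto intro: that\<close>)
  have "(\<lambda>n. \<Sum>f\<leftarrow>fs n. f x * f y) = (\<lambda>n. \<Sum>f\<leftarrow>fs n. f y * f x)" by (simp add: mult.commute)
  then show ?thesis using fs[of x y] fs[of y x] LIMSEQ_unique by fastforce
qed

section \<open>The reproducing kernel Hilbert space\<close>

text \<open>A list \<open>l\<close> of pairs stands for the combination \<open>\<Sum>(a, x)\<leftarrow>l. a \<cdot> k x\<close> of the generators.\<close>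

definition lev :: "('i \<Rightarrow> 'i \<Rightarrow> real) \<Rightarrow> (complex \<times> 'i) list \<Rightarrow> 'i \<Rightarrow> complex" where
  "lev k l y = (\<Sum>(a, x)\<leftarrow>l. a * of_real (k x y))"

text \<open>The sesquilinear form with \<open><k x, k y> = k x y\<close>, linear in
  \<open>l\<close>; the evaluation \<open>lev\<close> is the pairing with a generator.\<close>

definition lip :: "('i \<Rightarrow> 'i \<Rightarrow> real) \<Rightarrow> (complex \<times> 'i) list \<Rightarrow> (complex \<times> 'i) list \<Rightarrow> complex" where
  "lip k l m = (\<Sum>(b, y)\<leftarrow>m. cnj b * lev k l y)"

definition scl :: "complex \<Rightarrow> (complex \<times> 'i) list \<Rightarrow> (complex \<times> 'i) list" where
  "scl c l = map (\<lambda>(a, x). (c * a, x)) l"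

definition ldiff :: "(complex \<times> 'i) list \<Rightarrow> (complex \<times> 'i) list \<Rightarrow> (complex \<times> 'i) list" where
  "ldiff l m = l @ scl (-1) m"

lemma lev_Nil: "lev k [] y = 0"
  by (simp add: lev_def)

lemma lev_Cons: "lev k ((a, x) # l) y = a * of_real (k x y) + lev k l y"
  by (simp add: lev_def)

lemma lip_Nil: "lip k l [] = 0"
  by (simp add: lip_def)

lemma lip_Cons: "lip k l ((b, y) # m) = cnj b * lev k l y + lip k l m"
  by (simp add: lip_def)

lemma scl_simps: "scl c [] = []" "scl c ((a, x) # l) = (c * a, x) # scl c l"
  by (simp_all add: scl_def)

lemma lev_append: "lev k (l @ m) y = lev k l y + lev k m y"
  by (simp add: lev_def)

lemma lev_scl: "lev k (scl c l) y = c * lev k l y"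
  by (induction l) (auto simp: lev_Nil lev_Cons scl_simps distrib_left)

lemma lev_ldiff: "lev k (ldiff l m) y = lev k l y - lev k m y"
  by (simp add: ldiff_def lev_append lev_scl)

lemmas lev_simps = lev_Nil lev_append lev_scl lev_ldiff

lemma lip_Nil_left: "lip k [] m = 0"
  by (induction m) (auto simp: lip_Nil lip_Cons lev_Nil)

lemma lip_append_left: "lip k (l @ l') m = lip k l m + lip k l' m"
  by (induction m) (auto simp: lip_Nil lip_Cons lev_append distrib_left)

lemma lip_append_right: "lip k l (m @ m') = lip k l m + lip k l m'"
  by (simp add: lip_def)

lemma lip_scl_left: "lip k (scl c l) m = c * lip k l m"
  by (induction m) (auto simp: lip_Nil lip_Cons lev_scl distrib_left)

lemma lip_scl_right: "lip k l (scl c m) = cnj c * lip k l m"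
  by (induction m) (auto simp: lip_Nil lip_Cons scl_simps distrib_left)

lemma lip_ldiff_left: "lip k (ldiff l l') m = lip k l m - lip k l' m"
  by (simp add: ldiff_def lip_append_left lip_scl_left)

lemma lip_ldiff_right: "lip k l (ldiff m m') = lip k l m - lip k l m'"
  by (simp add: ldiff_def lip_append_right lip_scl_right)

lemmas lip_simps = lip_Nil lip_Nil_left lip_append_left lip_append_right lip_scl_left lip_scl_right
  lip_ldiff_left lip_ldiff_right

text \<open>The quadratic is evaluated at its minimum \<open>t = - 1 / B\<close>. In Cauchy-Schwarz
  \<open>C\<close> is \<open>|c|^2\<close> for the inner product \<open>c\<close>; it multiplies
  both \<open>t\<close> and \<open>t^2\<close> because the second vector is first multiplied by
  \<open>c\<close>, which makes the cross terms real.\<close>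

lemma discriminant_bound:
  fixes A B C :: real
  assumes q: "\<And>t. 0 \<le> A + 2 * t * C + t\<^sup>2 * C * B" and nn: "0 \<le> B" "0 \<le> C"
  shows "C \<le> A * B"
proof (cases "B = 0")
  case True
  have "C = 0"
  proof (rule ccontr)
    assume C: "C \<noteq> 0"
    define t where "t = - (A + 1) / (2 * C)"
    have "2 * t * C = - (A + 1)" using C by (simp add: t_def)
    then show False using q[of t] True by simp
  qed
  then show ?thesis using True by simp
next
  case False
  define t where "t = - 1 / B"
  have tB: "t * B = -1" using False by (simp add: t_def)
  have "t\<^sup>2 * C * B = t * C * (t * B)" by (simp add: power2_eq_square)
  then have "0 \<le> A + t * C" using q[of t] unfolding tB by (simp add: algebra_simps)
  then have "0 \<le> (A + t * C) * B" using nn by simp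
  also have "\<dots> = A * B + (t * B) * C" by (simp add: algebra_simps)
  finally show ?thesis unfolding tB by simp
qed

locale kernel_space =
  fixes I :: "'i set" and k :: "'i \<Rightarrow> 'i \<Rightarrow> real"
  assumes pos: "pos_kernel I k"
begin

definition ls :: "(complex \<times> 'i) list set" where "ls = {l. snd ` set l \<subseteq> I}"

lemma ls_simps [simp]: "[] \<in> ls" "l @ m \<in> ls \<longleftrightarrow> l \<in> ls \<and> m \<in> ls" "(a, x) # l \<in> ls \<longleftrightarrow> x \<in> I \<and> l \<in> ls"
  "l \<in> ls \<Longrightarrow> scl c l \<in> ls" "l \<in> ls \<Longrightarrow> m \<in> ls \<Longrightarrow> ldiff l m \<in> ls"
  by (auto simp: ls_def ldiff_def scl_def image_subset_iff)

lemma lip_commute: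
  assumes "l \<in> ls" "m \<in> ls" shows "lip k m l = cnj (lip k l m)"
proof -
  have single: "lip k [(b, y)] l = cnj (lip k l [(b, y)])" if "y \<in> I" for b y
    using assms(1)
  proof (induction l)
    case (Cons p l)
    obtain a x where "p = (a, x)" by (cases p)
    then show ?case using Cons pos_kernel_sym[OF pos, of x y] that
      by (simp add: lip_Cons lip_Nil lev_Cons lev_Nil distrib_left mult.left_commute)
  qed (simp add: lip_simps lip_Cons lev_Nil)
  show ?thesis using assms(2)
  proof (induction m)
    case (Cons p m)
    obtain b y where p: "p = (b, y)" by (cases p)
    have "p # m = [(b, y)] @ m" by (simp add: p)
    then have "lip k (p # m) l = lip k [(b, y)] l + lip k m l"
      "lip k l (p # m) = lip k l [(b, y)] + lip k l m"
      by (simp_all only: lip_simps)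
    then show ?case using Cons single[of y b] p by simp
  qed (simp add: lip_simps)
qed

text \<open>For a single square \<open>f x * f y\<close> the form is
  \<open>|\<Sum> a f(x)|^2\<close>. Only the finitely many points in \<open>l\<close> matter, and
  there \<open>k\<close> is a limit of sums of squares.\<close>

lemma lip_nonneg:
  assumes "l \<in> ls" shows "0 \<le> Re (lip k l l)"
proof -
  obtain fs where fs: "\<And>u v. \<lbrakk>u \<in> snd ` set l; v \<in> snd ` set l\<rbrakk> \<Longrightarrow> (\<lambda>n. \<Sum>f\<leftarrow>fs n. f u * f v) \<longlonglongrightarrow> k u v"
    by (rule pos_kernelE[OF pos, of "snd ` set l"]) (use assms in \<open>auto simp: ls_def intro: that\<close>)
  define K where "K n u v = (\<Sum>f\<leftarrow>fs n. f u * f v)" for n u v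
  have lev: "(\<lambda>n. lev (K n) m y) \<longlonglongrightarrow> lev k m y" if "set m \<subseteq> set l" "y \<in> snd ` set l" for m y
    using that(1)
  proof (induction m)
    case (Cons p m)
    then have "(\<lambda>n. fst p * of_real (K n (snd p) y) + lev (K n) m y) \<longlonglongrightarrow> fst p * of_real (k (snd p) y) + lev k m y"
      using that(2) fs[of "snd p" y, folded K_def] by (intro tendsto_intros) auto
    then show ?case by (simp add: lev_def split_beta)
  qed (simp add: lev_simps)
  have lim: "(\<lambda>n. lip (K n) l m) \<longlonglongrightarrow> lip k l m" if "set m \<subseteq> set l" for m
    using that
  proof (induction m)
    case (Cons p m)
    then have "(\<lambda>n. cnj (fst p) * lev (K n) l (snd p) + lip (K n) l m) \<longlonglongrightarrow> cnj (fst p) * lev k l (snd p) + lip k l m"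
      by (intro tendsto_intros lev) auto
    then show ?case by (simp add: lip_def split_beta)
  qed (simp add: lip_simps)
  have feat: "lip (\<lambda>u v. f u * f v) l m = (\<Sum>(a, x)\<leftarrow>l. a * of_real (f x)) * cnj (\<Sum>(a, x)\<leftarrow>m. a * of_real (f x))"
    for f l and m :: "(complex \<times> 'i) list"
  proof -
    have "lev (\<lambda>u v. f u * f v) l y = (\<Sum>(a, x)\<leftarrow>l. a * of_real (f x)) * of_real (f y)" for y
      by (induction l) (auto simp: lev_def algebra_simps)
    then show ?thesis by (induction m) (auto simp: lip_def algebra_simps)
  qed
  have lip0: "lip (\<lambda>u v. 0) l m = 0" for m :: "(complex \<times> 'i) list"
  proof -
    have "lev (\<lambda>u v. 0) l y = 0" for y by (induction l) (auto simp: lev_def)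
    then show ?thesis by (induction m) (auto simp: lip_def)
  qed
  have lip_add: "lip (\<lambda>u v. k1 u v + k2 u v) l m = lip k1 l m + lip k2 l m" for k1 k2 and m :: "(complex \<times> 'i) list"
  proof -
    have "lev (\<lambda>u v. k1 u v + k2 u v) l y = lev k1 l y + lev k2 l y" for y
      by (induction l) (auto simp: lev_def algebra_simps)
    then show ?thesis by (induction m) (auto simp: lip_def algebra_simps)
  qed
  have "0 \<le> Re (lip (\<lambda>u v. \<Sum>f\<leftarrow>gs. f u * f v) l l)" for gs
  proof (induction gs)
    case (Cons g gs)
    have "0 \<le> Re (z * cnj z)" for z by (simp add: complex_mult_cnj)
    then have "0 \<le> Re (lip (\<lambda>u v. g u * g v) l l)" unfolding feat .
    moreover have "lip (\<lambda>u v. \<Sum>f\<leftarrow>g # gs. f u * f v) l l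
        = lip (\<lambda>u v. g u * g v) l l + lip (\<lambda>u v. \<Sum>f\<leftarrow>gs. f u * f v) l l"
      using lip_add[of "\<lambda>u v. g u * g v" "\<lambda>u v. \<Sum>f\<leftarrow>gs. f u * f v" l] by simp
    ultimately show ?case using Cons by simp
  qed (simp add: lip0)
  then have "0 \<le> Re (lip (K n) l l)" for n by (simp add: K_def[abs_def])
  moreover have "(\<lambda>n. Re (lip (K n) l l)) \<longlonglongrightarrow> Re (lip k l l)"
    using lim[of l] by (intro tendsto_intros) auto
  ultimately show ?thesis by (meson LIMSEQ_le_const)
qed

definition nrm :: "(complex \<times> 'i) list \<Rightarrow> real" where "nrm l = sqrt (Re (lip k l l))"

lemma nrm_nonneg: "l \<in> ls \<Longrightarrow> 0 \<le> nrm l"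
  by (simp add: nrm_def lip_nonneg)

lemma nrm_sq: "l \<in> ls \<Longrightarrow> lip k l l = of_real ((nrm l)\<^sup>2)"
  using lip_commute[of l l] lip_nonneg[of l] by (simp add: nrm_def complex_eq_iff)

lemma cauchy_schwarz:
  assumes l: "l \<in> ls" and m: "m \<in> ls" shows "cmod (lip k l m) \<le> nrm l * nrm m"
proof -
  define c where "c = lip k l m"
  have q: "0 \<le> (nrm l)\<^sup>2 + 2 * t * (cmod c)\<^sup>2 + t\<^sup>2 * (cmod c)\<^sup>2 * (nrm m)\<^sup>2" for t
  proof -
    define n where "n = l @ scl (of_real t * c) m"
    have cc: "c * cnj c = of_real ((cmod c)\<^sup>2)" by (rule complex_norm_square[symmetric])
    have "lip k n n = lip k l l + of_real t * (c * cnj c) + of_real t * (c * cnj c)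
        + of_real t * of_real t * (c * cnj c) * lip k m m"
      unfolding n_def lip_simps lip_commute[OF l m] c_def[symmetric]
      by (simp only: complex_cnj_mult complex_cnj_complex_of_real) (simp only: algebra_simps)
    then have "lip k n n = of_real ((nrm l)\<^sup>2 + 2 * t * (cmod c)\<^sup>2 + t\<^sup>2 * (cmod c)\<^sup>2 * (nrm m)\<^sup>2)"
      unfolding cc nrm_sq[OF l] nrm_sq[OF m] by (simp add: power2_eq_square)
    then have "Re (lip k n n) = (nrm l)\<^sup>2 + 2 * t * (cmod c)\<^sup>2 + t\<^sup>2 * (cmod c)\<^sup>2 * (nrm m)\<^sup>2"
      by (simp only: Re_complex_of_real)
    then show ?thesis using lip_nonneg[of n] l m by (simp add: n_def)
  qed
  have "(cmod c)\<^sup>2 \<le> (nrm l * nrm m)\<^sup>2"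
    unfolding power_mult_distrib by (rule discriminant_bound[OF q]) auto
  then have "cmod c \<le> nrm l * nrm m"
    using mult_nonneg_nonneg[OF nrm_nonneg[OF l] nrm_nonneg[OF m]] by (rule power2_le_imp_le)
  then show ?thesis by (simp add: c_def)
qed

lemma nrm_scl: "l \<in> ls \<Longrightarrow> nrm (scl c l) = cmod c * nrm l"
proof -
  assume l: "l \<in> ls"
  have "lip k (scl c l) (scl c l) = of_real ((cmod c)\<^sup>2 * (nrm l)\<^sup>2)"
    unfolding lip_simps nrm_sq[OF l] of_real_mult complex_norm_square by (simp only: ac_simps)
  then have "Re (lip k (scl c l) (scl c l)) = (cmod c)\<^sup>2 * (nrm l)\<^sup>2" by (simp only: Re_complex_of_real)
  then have "nrm (scl c l) = sqrt ((cmod c)\<^sup>2 * (nrm l)\<^sup>2)" by (simp only: nrm_def[of "scl c l"])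
  then show ?thesis using nrm_nonneg[OF l] by (simp add: real_sqrt_mult)
qed

lemma nrm_append:
  assumes l: "l \<in> ls" and m: "m \<in> ls" shows "nrm (l @ m) \<le> nrm l + nrm m"
proof (rule power2_le_imp_le)
  have sq: "(nrm n)\<^sup>2 = Re (lip k n n)" if "n \<in> ls" for n
    using lip_nonneg[OF that] by (simp add: nrm_def)
  have "Re (lip k m l) = Re (lip k l m)" by (simp add: lip_commute[OF l m])
  then have "(nrm (l @ m))\<^sup>2 = (nrm l)\<^sup>2 + 2 * Re (lip k l m) + (nrm m)\<^sup>2"
    using l m by (simp add: sq lip_simps)
  also have "\<dots> \<le> (nrm l + nrm m)\<^sup>2"
    using cauchy_schwarz[OF l m] complex_Re_le_cmod[of "lip k l m"] by (simp add: power2_sum)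
  finally show "(nrm (l @ m))\<^sup>2 \<le> (nrm l + nrm m)\<^sup>2" .
qed (use nrm_nonneg l m in auto)

lemma nrm_ldiff_triangle:
  assumes "a \<in> ls" "b \<in> ls" "c \<in> ls"
  shows "nrm (ldiff a c) \<le> nrm (ldiff a b) + nrm (ldiff b c)"
proof -
  have "nrm (ldiff a c) = nrm (ldiff a b @ ldiff b c)"
    unfolding nrm_def lip_simps by (simp add: algebra_simps)
  then show ?thesis using nrm_append[of "ldiff a b" "ldiff b c"] assms by simp
qed

lemma nrm_ldiff_commute: "nrm (ldiff a b) = nrm (ldiff b a)"
  unfolding nrm_def lip_simps by (simp add: algebra_simps)

lemma nrm_ldiff_append:
  assumes "a \<in> ls" "b \<in> ls" "c \<in> ls" "d \<in> ls"
  shows "nrm (ldiff (a @ b) (c @ d)) \<le> nrm (ldiff a c) + nrm (ldiff b d)"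
proof -
  have "nrm (ldiff (a @ b) (c @ d)) = nrm (ldiff a c @ ldiff b d)"
    unfolding nrm_def lip_simps by (simp add: algebra_simps)
  then show ?thesis using nrm_append[of "ldiff a c" "ldiff b d"] assms by simp
qed

lemma nrm_ldiff_scl:
  assumes "a \<in> ls" "b \<in> ls" shows "nrm (ldiff (scl c a) (scl c b)) = cmod c * nrm (ldiff a b)"
proof -
  have "nrm (ldiff (scl c a) (scl c b)) = nrm (scl c (ldiff a b))"
    unfolding nrm_def lip_simps by (simp add: algebra_simps)
  then show ?thesis using nrm_scl[of "ldiff a b" c] assms by simp
qed

lemma nrm_diff_le:
  assumes "a \<in> ls" "b \<in> ls" shows "\<bar>nrm a - nrm b\<bar> \<le> nrm (ldiff a b)"
proof -
  have "nrm (ldiff a []) = nrm a" for a unfolding nrm_def lip_simps by simp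
  then show ?thesis
    using nrm_ldiff_triangle[of a b "[]"] nrm_ldiff_triangle[of b a "[]"] nrm_ldiff_commute[of a b] assms by simp
qed

lemma lev_bound:
  assumes "l \<in> ls" "x \<in> I" shows "cmod (lev k l x) \<le> nrm l * sqrt (k x x)"
  using cauchy_schwarz[of l "[(1, x)]"] assms by (simp add: lip_Cons lip_Nil lev_Cons lev_Nil nrm_def)

definition cau :: "(nat \<Rightarrow> (complex \<times> 'i) list) \<Rightarrow> bool" where
  "cau L \<longleftrightarrow> range L \<subseteq> ls \<and> (\<forall>e>0. \<exists>M. \<forall>m\<ge>M. \<forall>n\<ge>M. nrm (ldiff (L m) (L n)) < e)"

lemma cauD: "cau L \<Longrightarrow> L n \<in> ls"
  by (auto simp: cau_def)

lemma cauE: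
  assumes "cau L" "0 < e" obtains M where "\<And>m n. \<lbrakk>m \<ge> M; n \<ge> M\<rbrakk> \<Longrightarrow> nrm (ldiff (L m) (L n)) < e"
proof -
  obtain M where "\<forall>m\<ge>M. \<forall>n\<ge>M. nrm (ldiff (L m) (L n)) < e"
    using assms(1)[unfolded cau_def, THEN conjunct2, rule_format, OF assms(2)] ..
  then show thesis by (intro that[of M]) simp
qed

lemma cauI:
  assumes "\<And>n. L n \<in> ls" "\<And>e. 0 < e \<Longrightarrow> \<exists>M. \<forall>m\<ge>M. \<forall>n\<ge>M. nrm (ldiff (L m) (L n)) < e"
  shows "cau L"
  using assms by (auto simp: cau_def)

lemma cau_const: "l \<in> ls \<Longrightarrow> cau (\<lambda>_. l)"
proof (rule cauI)
  have "nrm (ldiff l l) = 0" unfolding nrm_def lip_simps by simp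
  then show "\<exists>M. \<forall>m\<ge>M. \<forall>n\<ge>M. nrm (ldiff l l) < e" if "0 < e" for e using that by simp
qed

lemma cau_append:
  assumes "cau L" "cau L'" shows "cau (\<lambda>n. L n @ L' n)"
proof (rule cauI)
  fix e :: real assume "0 < e"
  then have e: "0 < e / 2" by simp
  obtain M where M: "\<And>m n. \<lbrakk>m \<ge> M; n \<ge> M\<rbrakk> \<Longrightarrow> nrm (ldiff (L m) (L n)) < e / 2"
    by (rule cauE[OF assms(1) e]) (rule that)
  obtain M' where M': "\<And>m n. \<lbrakk>m \<ge> M'; n \<ge> M'\<rbrakk> \<Longrightarrow> nrm (ldiff (L' m) (L' n)) < e / 2"
    by (rule cauE[OF assms(2) e]) (rule that)
  have close: "nrm (ldiff (L m @ L' m) (L n @ L' n)) < e" if "m \<ge> max M M'" "n \<ge> max M M'" for m n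
    using nrm_ldiff_append[of "L m" "L' m" "L n" "L' n"] M[of m n] M'[of m n] that assms by (simp add: cauD)
  then show "\<exists>M. \<forall>m\<ge>M. \<forall>n\<ge>M. nrm (ldiff (L m @ L' m) (L n @ L' n)) < e" by (intro exI[of _ "max M M'"] allI impI)
qed (use assms in \<open>simp add: cauD\<close>)

lemma cau_scl:
  assumes "cau L" shows "cau (\<lambda>n. scl c (L n))"
proof (rule cauI)
  fix e :: real assume "0 < e"
  then have e: "0 < e / (cmod c + 1)" by (simp add: add_nonneg_pos)
  obtain M where M: "\<And>m n. \<lbrakk>m \<ge> M; n \<ge> M\<rbrakk> \<Longrightarrow> nrm (ldiff (L m) (L n)) < e / (cmod c + 1)"
    by (rule cauE[OF assms(1) e]) (rule that)
  have close: "nrm (ldiff (scl c (L m)) (scl c (L n))) < e" if "m \<ge> M" "n \<ge> M" for m n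
  proof -
    have pos: "0 < cmod c + 1" by (simp add: add_nonneg_pos)
    have "cmod c * nrm (ldiff (L m) (L n)) \<le> (cmod c + 1) * nrm (ldiff (L m) (L n))"
      using nrm_nonneg[of "ldiff (L m) (L n)"] cauD[OF assms] by (intro mult_right_mono) auto
    also have "\<dots> < e" using M[OF that] pos by (simp add: pos_less_divide_eq mult.commute)
    finally show ?thesis using cauD[OF assms] by (simp add: nrm_ldiff_scl)
  qed
  then show "\<exists>M. \<forall>m\<ge>M. \<forall>n\<ge>M. nrm (ldiff (scl c (L m)) (scl c (L n))) < e" by (intro exI[of _ "M"] allI impI)
qed (use assms in \<open>simp add: cauD\<close>)

lemma cau_ldiff: "cau L \<Longrightarrow> cau L' \<Longrightarrow> cau (\<lambda>n. ldiff (L n) (L' n))"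
  unfolding ldiff_def by (intro cau_append cau_scl)

lemma cau_convergent: assumes "cau L" shows "convergent (\<lambda>n. nrm (L n))"
proof (rule Cauchy_convergent, rule CauchyI)
  fix e :: real assume "0 < e"
  obtain M where M: "\<And>m n. \<lbrakk>m \<ge> M; n \<ge> M\<rbrakk> \<Longrightarrow> nrm (ldiff (L m) (L n)) < e"
    by (rule cauE[OF assms \<open>0 < e\<close>]) (rule that)
  have close: "norm (nrm (L m) - nrm (L n)) < e" if "m \<ge> M" "n \<ge> M" for m n
    using nrm_diff_le[of "L m" "L n"] M[OF that] cauD[OF assms] by simp
  then show "\<exists>M. \<forall>m\<ge>M. \<forall>n\<ge>M. norm (nrm (L m) - nrm (L n)) < e" by (intro exI[of _ "M"] allI impI)
qed

lemma cau_bounded: assumes "cau L" obtains C where "0 < C" "\<And>n. nrm (L n) \<le> C"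
proof -
  have "Bseq (\<lambda>n. nrm (L n))" by (rule convergent_imp_Bseq[OF cau_convergent[OF assms]])
  then obtain C where "0 < C" "\<forall>n. norm (nrm (L n)) \<le> C" by (auto elim: BseqE)
  then show thesis by (intro that[of C]) (auto simp: abs_le_iff)
qed

text \<open>The completion is realised inside the functions on \<open>I\<close>: a Cauchy sequence
  of combinations stands for its pointwise limit. Values are continuous in the norm by
  \<open>lev_bound\<close>.\<close>

definition reps :: "(nat \<Rightarrow> (complex \<times> 'i) list) \<Rightarrow> ('i \<Rightarrow> complex) \<Rightarrow> bool" where
  "reps L F \<longleftrightarrow> cau L \<and> (\<forall>x\<in>I. (\<lambda>n. lev k (L n) x) \<longlonglongrightarrow> F x)"

definition leval :: "(complex \<times> 'i) list \<Rightarrow> 'i \<Rightarrow> complex" where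
  "leval l x = (if x \<in> I then lev k l x else 0)"

lemma reps_const: "l \<in> ls \<Longrightarrow> reps (\<lambda>_. l) (leval l)"
  by (simp add: reps_def cau_const leval_def)

lemma reps_zero: "reps (\<lambda>_. []) (\<lambda>_. 0)"
  by (simp add: reps_def cau_const lev_Nil)

lemma reps_add: "reps L F \<Longrightarrow> reps L' F' \<Longrightarrow> reps (\<lambda>n. L n @ L' n) (\<lambda>x. F x + F' x)"
  by (simp add: reps_def lev_simps cau_append tendsto_add)

lemma reps_scl: "reps L F \<Longrightarrow> reps (\<lambda>n. scl c (L n)) (\<lambda>x. c * F x)"
  by (simp add: reps_def lev_simps cau_scl tendsto_mult_left)

lemma reps_diff: "reps L F \<Longrightarrow> reps L' F' \<Longrightarrow> reps (\<lambda>n. ldiff (L n) (L' n)) (\<lambda>x. F x - F' x)"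
  by (simp add: reps_def lev_simps cau_ldiff tendsto_diff)

lemma reps_lip:
  assumes "reps L F" "m \<in> ls" shows "(\<lambda>n. lip k (L n) m) \<longlonglongrightarrow> (\<Sum>(b, y)\<leftarrow>m. cnj b * F y)"
  using assms(2)
proof (induction m)
  case (Cons p m)
  obtain b y where p: "p = (b, y)" by (cases p)
  have "(\<lambda>n. lev k (L n) y) \<longlonglongrightarrow> F y" using assms(1) Cons.prems by (simp add: reps_def p)
  then have "(\<lambda>n. cnj b * lev k (L n) y + lip k (L n) m) \<longlonglongrightarrow> cnj b * F y + (\<Sum>(b, y)\<leftarrow>m. cnj b * F y)"
    using Cons p by (intro tendsto_intros) auto
  then show ?case by (simp add: lip_Cons p)
qed (simp add: lip_Nil)

text \<open>Write \<open>|D n|^2 = <D n, D M> + <D n, D n - D M>\<close>. The first term tends to 0,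
  as it involves only the values of \<open>D n\<close> at the points of \<open>D M\<close>, and the
  second is small for large \<open>M\<close>. Hence the completion embeds into functions: a Cauchy
  sequence is determined by its pointwise limit, up to null sequences.\<close>

lemma reps_null:
  assumes D: "reps D (\<lambda>_. 0)" shows "(\<lambda>n. nrm (D n)) \<longlonglongrightarrow> 0"
proof -
  have cau: "cau D" using D by (simp add: reps_def)
  obtain r where r: "(\<lambda>n. nrm (D n)) \<longlonglongrightarrow> r" using cau_convergent[OF cau] by (auto simp: convergent_def)
  obtain C where C: "0 < C" "\<And>n. nrm (D n) \<le> C" by (rule cau_bounded[OF cau]) (rule that)
  have "r\<^sup>2 \<le> 0"
  proof (rule field_le_epsilon)
    fix e :: real assume "0 < e"
    then have e: "0 < e / C" using C by simp
    obtain M where M: "\<And>m n. \<lbrakk>m \<ge> M; n \<ge> M\<rbrakk> \<Longrightarrow> nrm (ldiff (D m) (D n)) < e / C"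
      by (rule cauE[OF cau e]) (rule that)
    have le: "(nrm (D n))\<^sup>2 \<le> cmod (lip k (D n) (D M)) + e" if n: "n \<ge> M" for n
    proof -
      have mem: "D n \<in> ls" "ldiff (D n) (D M) \<in> ls" using cauD[OF cau] by auto
      have "lip k (D n) (D n) = lip k (D n) (D M) + lip k (D n) (ldiff (D n) (D M))"
        by (simp add: lip_simps)
      then have "(nrm (D n))\<^sup>2 \<le> cmod (lip k (D n) (D M)) + cmod (lip k (D n) (ldiff (D n) (D M)))"
        using norm_triangle_ineq[of "lip k (D n) (D M)" "lip k (D n) (ldiff (D n) (D M))"]
          arg_cong[OF nrm_sq[OF mem(1)], of cmod] by (simp del: of_real_power)
      also have "cmod (lip k (D n) (ldiff (D n) (D M))) \<le> nrm (D n) * nrm (ldiff (D n) (D M))"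
        by (rule cauchy_schwarz[OF mem])
      also have "\<dots> \<le> C * (e / C)"
        using C(2)[of n] M[OF n, of M] nrm_nonneg[OF mem(1)] nrm_nonneg[OF mem(2)] C(1)
        by (intro mult_mono) auto
      finally show ?thesis using C(1) by simp
    qed
    have "(\<lambda>n. cmod (lip k (D n) (D M)) + e) \<longlonglongrightarrow> cmod (\<Sum>(b, y)\<leftarrow>D M. cnj b * 0) + e"
      by (intro tendsto_intros reps_lip[OF D] cauD[OF cau])
    moreover have "(\<Sum>(b, y)\<leftarrow>m. cnj b * 0) = 0" for m :: "(complex \<times> 'i) list"
      by (induction m) auto
    ultimately have lim: "(\<lambda>n. cmod (lip k (D n) (D M)) + e) \<longlonglongrightarrow> 0 + e" by simp
    have "(\<lambda>n. (nrm (D n))\<^sup>2) \<longlonglongrightarrow> r\<^sup>2" by (intro tendsto_intros r)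
    from LIMSEQ_le[OF this lim] show "r\<^sup>2 \<le> 0 + e" using le by (auto intro!: exI[of _ M])
  qed
  then show ?thesis using r by simp
qed

definition inn :: "('i \<Rightarrow> complex) \<Rightarrow> ('i \<Rightarrow> complex) \<Rightarrow> complex" where
  "inn F F' = lim (\<lambda>n. lip k ((SOME L. reps L F) n) ((SOME L. reps L F') n))"

lemma lip_convergent:
  assumes "cau L" "cau L'" shows "convergent (\<lambda>n. lip k (L n) (L' n))"
proof (rule Cauchy_convergent, rule CauchyI)
  fix e :: real assume "0 < e"
  obtain C where C: "0 < C" "\<And>n. nrm (L n) \<le> C" by (rule cau_bounded[OF assms(1)]) (rule that)
  obtain C' where C': "0 < C'" "\<And>n. nrm (L' n) \<le> C'" by (rule cau_bounded[OF assms(2)]) (rule that)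
  define d where "d = e / (2 * (C + C'))"
  have d: "0 < d" using C C' \<open>0 < e\<close> by (simp add: d_def)
  obtain M where M: "\<And>m n. \<lbrakk>m \<ge> M; n \<ge> M\<rbrakk> \<Longrightarrow> nrm (ldiff (L m) (L n)) < d"
    by (rule cauE[OF assms(1) d]) (rule that)
  obtain M' where M': "\<And>m n. \<lbrakk>m \<ge> M'; n \<ge> M'\<rbrakk> \<Longrightarrow> nrm (ldiff (L' m) (L' n)) < d"
    by (rule cauE[OF assms(2) d]) (rule that)
  have close: "norm (lip k (L m) (L' m) - lip k (L n) (L' n)) < e" if mn: "m \<ge> max M M'" "n \<ge> max M M'" for m n
  proof -
    have mem: "L n \<in> ls" "L' m \<in> ls" "ldiff (L m) (L n) \<in> ls" "ldiff (L' m) (L' n) \<in> ls"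
      using cauD assms by auto
    have "lip k (L m) (L' m) - lip k (L n) (L' n) = lip k (ldiff (L m) (L n)) (L' m) + lip k (L n) (ldiff (L' m) (L' n))"
      by (simp add: lip_simps)
    also have "cmod \<dots> \<le> nrm (ldiff (L m) (L n)) * nrm (L' m) + nrm (L n) * nrm (ldiff (L' m) (L' n))"
      by (rule order_trans[OF norm_triangle_ineq
            add_mono[OF cauchy_schwarz[OF mem(3,2)] cauchy_schwarz[OF mem(1,4)]]])
    also have "\<dots> \<le> d * C' + C * d"
    proof (rule add_mono)
      show "nrm (ldiff (L m) (L n)) * nrm (L' m) \<le> d * C'"
        using M[of m n] C'(1) C'(2)[of m] mn nrm_nonneg[OF mem(2)] nrm_nonneg[OF mem(3)] d
        by (intro mult_mono) auto
      show "nrm (L n) * nrm (ldiff (L' m) (L' n)) \<le> C * d"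
        using M'[of m n] C(1) C(2)[of n] mn nrm_nonneg[OF mem(1)] nrm_nonneg[OF mem(4)] d
        by (intro mult_mono) auto
    qed
    also have "\<dots> = d * (C + C')" by (simp add: algebra_simps)
    also have "\<dots> < e" using C(1) C'(1) \<open>0 < e\<close> unfolding d_def by (simp add: field_simps add_pos_pos)
    finally show ?thesis by simp
  qed
  then show "\<exists>M. \<forall>m\<ge>M. \<forall>n\<ge>M. norm (lip k (L m) (L' m) - lip k (L n) (L' n)) < e" by (intro exI[of _ "max M M'"] allI impI)
qed

lemma lip_null:
  assumes "cau L" "reps D (\<lambda>_. 0)" shows "(\<lambda>n. lip k (D n) (L n)) \<longlonglongrightarrow> 0"
proof -
  obtain C where C: "0 < C" "\<And>n. nrm (L n) \<le> C" by (rule cau_bounded[OF assms(1)]) (rule that)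
  have D: "D n \<in> ls" for n using assms(2) by (simp add: reps_def cauD)
  have le: "norm (lip k (D n) (L n)) \<le> nrm (D n) * C" for n
  proof -
    have "norm (lip k (D n) (L n)) \<le> nrm (D n) * nrm (L n)"
      by (rule cauchy_schwarz[OF D cauD[OF assms(1)]])
    also have "\<dots> \<le> nrm (D n) * C" by (rule mult_left_mono[OF C(2) nrm_nonneg[OF D]])
    finally show ?thesis .
  qed
  have "(\<lambda>n. nrm (D n) * C) \<longlonglongrightarrow> 0 * C" by (rule tendsto_mult_right[OF reps_null[OF assms(2)]])
  then have lim: "(\<lambda>n. nrm (D n) * C) \<longlonglongrightarrow> 0" by simp
  show ?thesis by (rule Lim_null_comparison[OF always_eventually[OF allI[OF le]] lim])
qed

text \<open>Changing a representing sequence alters the inner products by pairings with a sequence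
  that represents 0, which tend to 0 by \<open>lip_null\<close>; so the choice made in
  \<open>inn\<close> is immaterial.\<close>

lemma inn_lim:
  assumes L: "reps L F" and L': "reps L' F'"
  shows "(\<lambda>n. lip k (L n) (L' n)) \<longlonglongrightarrow> inn F F'"
proof -
  define K K' where "K = (SOME L. reps L F)" and "K' = (SOME L. reps L F')"
  have K: "reps K F" unfolding K_def by (rule someI[of "\<lambda>L. reps L F", OF L])
  have K': "reps K' F'" unfolding K'_def by (rule someI[of "\<lambda>L. reps L F'", OF L'])
  have cau: "cau L" "cau L'" "cau K" "cau K'" using L L' K K' by (auto simp: reps_def)
  have "convergent (\<lambda>n. lip k (K n) (K' n))" using cau by (intro lip_convergent)
  then have lim: "(\<lambda>n. lip k (K n) (K' n)) \<longlonglongrightarrow> inn F F'"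
    by (simp add: inn_def convergent_LIMSEQ_iff K_def K'_def)
  have 1: "(\<lambda>n. lip k (ldiff (L n) (K n)) (L' n)) \<longlonglongrightarrow> 0"
    using reps_diff[OF L K] cau by (intro lip_null) auto
  have "(\<lambda>n. lip k (ldiff (L' n) (K' n)) (K n)) \<longlonglongrightarrow> 0"
    using reps_diff[OF L' K'] cau by (intro lip_null) auto
  then have "(\<lambda>n. cnj (lip k (ldiff (L' n) (K' n)) (K n))) \<longlonglongrightarrow> cnj 0" by (rule tendsto_cnj)
  moreover have "cnj (lip k (ldiff (L' n) (K' n)) (K n)) = lip k (K n) (ldiff (L' n) (K' n))" for n
    using cau by (simp add: lip_commute[of "ldiff (L' n) (K' n)"] cauD)
  ultimately have 2: "(\<lambda>n. lip k (K n) (ldiff (L' n) (K' n))) \<longlonglongrightarrow> 0" by simp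
  from tendsto_add[OF tendsto_add[OF 1 2] lim]
  show ?thesis by (simp add: lip_simps)
qed

text \<open>The functions vanish outside \<open>I\<close>, so that an element is determined by its
  values on \<open>I\<close>.\<close>

definition H :: "('i \<Rightarrow> complex) set" where
  "H = {F. (\<forall>x. x \<notin> I \<longrightarrow> F x = 0) \<and> (\<exists>L. reps L F)}"

lemma HE: assumes "F \<in> H" obtains L where "reps L F"
  using assms unfolding H_def by blast

lemma H_eqI: "\<lbrakk>F \<in> H; G \<in> H; \<And>x. x \<in> I \<Longrightarrow> F x = G x\<rbrakk> \<Longrightarrow> F = G"
  unfolding H_def by (rule ext) (metis (mono_tags, lifting) mem_Collect_eq)

lemma H_zero: "(\<lambda>_. 0) \<in> H" using reps_zero by (auto simp: H_def)

lemma H_add: assumes "F \<in> H" "G \<in> H" shows "(\<lambda>x. F x + G x) \<in> H"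
proof -
  obtain L L' where "reps L F" "reps L' G" using assms by (auto elim!: HE)
  from reps_add[OF this] show ?thesis using assms unfolding H_def by auto
qed

lemma H_scl: assumes "F \<in> H" shows "(\<lambda>x. c * F x) \<in> H"
proof -
  obtain L where "reps L F" using assms by (auto elim!: HE)
  then show ?thesis using reps_scl assms by (auto simp: H_def)
qed

lemma H_diff: "F \<in> H \<Longrightarrow> G \<in> H \<Longrightarrow> (\<lambda>x. F x - G x) \<in> H"
  using H_add[of F "\<lambda>x. (-1) * G x"] H_scl[of G "-1"] by simp

lemma H_leval: "l \<in> ls \<Longrightarrow> leval l \<in> H"
  using reps_const by (auto simp: H_def leval_def)

lemma inn_add: assumes "F \<in> H" "G \<in> H" "K \<in> H" shows "inn (\<lambda>x. F x + G x) K = inn F K + inn G K"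
proof -
  obtain L1 L2 L3 where L: "reps L1 F" "reps L2 G" "reps L3 K" using assms by (auto elim!: HE)
  have "(\<lambda>n. lip k (L1 n) (L3 n) + lip k (L2 n) (L3 n)) \<longlonglongrightarrow> inn (\<lambda>x. F x + G x) K"
    using inn_lim[OF reps_add[OF L(1,2)] L(3)] unfolding lip_simps .
  moreover have "(\<lambda>n. lip k (L1 n) (L3 n) + lip k (L2 n) (L3 n)) \<longlonglongrightarrow> inn F K + inn G K"
    by (rule tendsto_add[OF inn_lim[OF L(1,3)] inn_lim[OF L(2,3)]])
  ultimately show ?thesis by (rule LIMSEQ_unique)
qed

lemma inn_scl: assumes "F \<in> H" "K \<in> H" shows "inn (\<lambda>x. c * F x) K = c * inn F K"
proof -
  obtain L1 L3 where L: "reps L1 F" "reps L3 K" using assms by (auto elim!: HE)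
  have "(\<lambda>n. c * lip k (L1 n) (L3 n)) \<longlonglongrightarrow> inn (\<lambda>x. c * F x) K"
    using inn_lim[OF reps_scl[OF L(1)] L(2), of c] unfolding lip_simps .
  moreover have "(\<lambda>n. c * lip k (L1 n) (L3 n)) \<longlonglongrightarrow> c * inn F K"
    by (rule tendsto_mult_left[OF inn_lim[OF L]])
  ultimately show ?thesis by (rule LIMSEQ_unique)
qed

lemma inn_commute: assumes "F \<in> H" "K \<in> H" shows "inn K F = cnj (inn F K)"
proof -
  obtain L1 L3 where L: "reps L1 F" "reps L3 K" using assms by (auto elim!: HE)
  have mem: "L1 n \<in> ls" "L3 n \<in> ls" for n using L by (auto simp: reps_def cauD)
  have "(\<lambda>n. cnj (lip k (L1 n) (L3 n))) \<longlonglongrightarrow> cnj (inn F K)"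
    by (rule tendsto_cnj[OF inn_lim[OF L]])
  moreover have "cnj (lip k (L1 n) (L3 n)) = lip k (L3 n) (L1 n)" for n
    by (rule lip_commute[OF mem, symmetric])
  ultimately have "(\<lambda>n. lip k (L3 n) (L1 n)) \<longlonglongrightarrow> cnj (inn F K)" by simp
  with inn_lim[OF L(2,1)] show ?thesis by (rule LIMSEQ_unique)
qed

definition hn :: "('i \<Rightarrow> complex) \<Rightarrow> real" where "hn F = sqrt (Re (inn F F))"

lemma hn_lim: assumes "reps L F" shows "(\<lambda>n. nrm (L n)) \<longlonglongrightarrow> hn F"
  unfolding nrm_def hn_def by (intro tendsto_intros inn_lim assms)

lemma hn_triangle: assumes "F \<in> H" "G \<in> H" shows "hn (\<lambda>x. F x + G x) \<le> hn F + hn G"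
proof -
  obtain L L' where L: "reps L F" "reps L' G" using assms by (auto elim!: HE)
  have mem: "L n \<in> ls" "L' n \<in> ls" for n using L by (auto simp: reps_def cauD)
  show ?thesis
    by (rule LIMSEQ_le[OF hn_lim[OF reps_add[OF L]] tendsto_add[OF hn_lim[OF L(1)] hn_lim[OF L(2)]]])
      (use nrm_append mem in blast)
qed

lemma hn_minus: assumes "F \<in> H" "G \<in> H" shows "hn (\<lambda>x. F x - G x) = hn (\<lambda>x. G x - F x)"
proof -
  obtain L L' where L: "reps L F" "reps L' G" using assms by (auto elim!: HE)
  have "(\<lambda>n. nrm (ldiff (L n) (L' n))) \<longlonglongrightarrow> hn (\<lambda>x. G x - F x)"
    using hn_lim[OF reps_diff[OF L(2,1)]] by (subst nrm_ldiff_commute)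
  with hn_lim[OF reps_diff[OF L]] show ?thesis by (rule LIMSEQ_unique)
qed

lemma hn_triangle3:
  assumes "F \<in> H" "G \<in> H" "K \<in> H" shows "hn (\<lambda>x. F x - K x) \<le> hn (\<lambda>x. F x - G x) + hn (\<lambda>x. G x - K x)"
  using hn_triangle[OF H_diff[OF assms(1,2)] H_diff[OF assms(2,3)]] by simp

lemma hn_nonneg: assumes "F \<in> H" shows "0 \<le> hn F"
proof -
  obtain L where L: "reps L F" using assms by (auto elim!: HE)
  have mem: "L n \<in> ls" for n using L by (auto simp: reps_def cauD)
  show ?thesis by (rule LIMSEQ_le_const[OF hn_lim[OF L]]) (use nrm_nonneg mem in blast)
qed

lemma eval_bound: assumes "F \<in> H" "x \<in> I" shows "cmod (F x) \<le> hn F * sqrt (k x x)"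
proof -
  obtain L where L: "reps L F" using assms by (auto elim!: HE)
  have mem: "L n \<in> ls" for n using L by (auto simp: reps_def cauD)
  have "(\<lambda>n. lev k (L n) x) \<longlonglongrightarrow> F x" using L assms(2) by (simp add: reps_def)
  from LIMSEQ_le[OF tendsto_norm[OF this] tendsto_mult_right[OF hn_lim[OF L]]]
  show ?thesis using lev_bound[OF mem assms(2)] by blast
qed

lemma inn_pos: assumes "F \<in> H" "F \<noteq> (\<lambda>_. 0)" shows "0 < Re (inn F F)"
proof -
  have "hn F \<noteq> 0"
  proof
    assume "hn F = 0"
    then have "F x = 0" if "x \<in> I" for x using eval_bound[OF assms(1) that] by simp
    then have "F = (\<lambda>_. 0)" by (intro H_eqI assms(1) H_zero)
    then show False using assms(2) by blast
  qed
  then have "0 < hn F" using hn_nonneg[OF assms(1)] by linarith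
  then show ?thesis by (simp add: hn_def)
qed

lemma H_approx:
  assumes "F \<in> H" "0 < e" obtains l where "l \<in> ls" "hn (\<lambda>x. F x - leval l x) < e"
proof -
  obtain L where L: "reps L F" using assms by (auto elim!: HE)
  then have cau: "cau L" by (simp add: reps_def)
  have e2: "0 < e / 2" using assms by simp
  obtain M where M: "\<And>m n. \<lbrakk>m \<ge> M; n \<ge> M\<rbrakk> \<Longrightarrow> nrm (ldiff (L m) (L n)) < e / 2"
    by (rule cauE[OF cau e2]) (rule that)
  have "hn (\<lambda>x. F x - leval (L M) x) \<le> e / 2"
    by (rule LIMSEQ_le_const2[OF hn_lim[OF reps_diff[OF L reps_const[OF cauD[OF cau]]]]])
      (use M in \<open>auto intro!: exI[of _ M] less_imp_le\<close>)
  then show thesis using assms(2) cauD[OF cau, of M] by (intro that[of "L M"]) auto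
qed

lemma hn_leval: assumes "l \<in> ls" "m \<in> ls" shows "hn (\<lambda>x. leval l x - leval m x) = nrm (ldiff l m)"
  using hn_lim[OF reps_diff[OF reps_const[OF assms(1)] reps_const[OF assms(2)]]]
  by (simp add: LIMSEQ_const_iff)

text \<open>Each \<open>X n\<close> is replaced by a finite combination at distance less than
  \<open>1 / (n + 1)\<close>; these combinations are Cauchy, and their pointwise limit is the limit
  of \<open>X\<close>.\<close>

lemma H_complete:
  assumes X: "\<And>n. X n \<in> H"
    and cauchy: "\<And>e. 0 < e \<Longrightarrow> \<exists>N. \<forall>m\<ge>N. \<forall>n\<ge>N. hn (\<lambda>x. X m x - X n x) < e"
  obtains F where "F \<in> H" "(\<lambda>n :: nat. hn (\<lambda>x. X n x - F x)) \<longlonglongrightarrow> 0"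
proof -
  have "\<forall>n. \<exists>l. l \<in> ls \<and> hn (\<lambda>x. X n x - leval l x) < inverse (real (Suc n))"
  proof
    fix n
    have pos: "0 < inverse (real (Suc n))" by simp
    show "\<exists>l. l \<in> ls \<and> hn (\<lambda>x. X n x - leval l x) < inverse (real (Suc n))"
      by (rule H_approx[OF X pos]) blast
  qed
  from choice[OF this] obtain l where
    l: "\<And>n. l n \<in> ls" "\<And>n. hn (\<lambda>x. X n x - leval (l n) x) < inverse (real (Suc n))" by blast
  have small: "\<exists>N. \<forall>n\<ge>N. inverse (real (Suc n)) < e" if "0 < e" for e
  proof -
    have "\<forall>\<^sub>F n in sequentially. inverse (real (Suc n)) < e"
      using LIMSEQ_inverse_real_of_nat that by (rule order_tendstoD)
    then show ?thesis by (simp add: eventually_sequentially)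
  qed
  have cau: "cau l"
  proof (rule cauI)
    fix e :: real assume "0 < e"
    then have e: "0 < e / 3" by simp
    obtain N where N: "\<forall>n\<ge>N. inverse (real (Suc n)) < e / 3" using small[OF e] by blast
    obtain M where M: "\<forall>m\<ge>M. \<forall>n\<ge>M. hn (\<lambda>x. X m x - X n x) < e / 3" using cauchy[OF e] by blast
    have close: "nrm (ldiff (l m) (l n)) < e" if "m \<ge> max M N" "n \<ge> max M N" for m n
    proof -
      have "inverse (real (Suc m)) < e / 3" "inverse (real (Suc n)) < e / 3" "hn (\<lambda>x. X m x - X n x) < e / 3"
        using N M that by auto
      moreover have "hn (\<lambda>x. leval (l m) x - leval (l n) x)
          \<le> hn (\<lambda>x. leval (l m) x - X m x) + hn (\<lambda>x. X m x - leval (l n) x)"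
        by (rule hn_triangle3[OF H_leval[OF l(1)] X H_leval[OF l(1)]])
      ultimately show ?thesis
        using hn_triangle3[OF X X H_leval[OF l(1)], of m n n]
          l(2)[of m] l(2)[of n] hn_minus[OF X[of m] H_leval[OF l(1)], of m] hn_leval[OF l(1) l(1), of m n]
        by linarith
    qed
    then show "\<exists>M. \<forall>m\<ge>M. \<forall>n\<ge>M. nrm (ldiff (l m) (l n)) < e"
      by (intro exI[of _ "max M N"] allI impI)
  qed (rule l)
  define F where "F x = (if x \<in> I then lim (\<lambda>n. lev k (l n) x) else 0)" for x
  have "convergent (\<lambda>n. lev k (l n) x)" if x: "x \<in> I" for x
  proof (rule Cauchy_convergent, rule CauchyI)
    fix e :: real assume "0 < e"
    define s where "s = sqrt (k x x) + 1"
    have s: "0 < s" using lip_nonneg[of "[(1, x)]"] x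
      by (simp add: s_def lip_Cons lip_Nil lev_Cons lev_Nil add_nonneg_pos)
    then have e: "0 < e / s" using \<open>0 < e\<close> by simp
    obtain M where M: "\<And>m n. \<lbrakk>m \<ge> M; n \<ge> M\<rbrakk> \<Longrightarrow> nrm (ldiff (l m) (l n)) < e / s"
      by (rule cauE[OF cau e]) (rule that)
    have close: "norm (lev k (l m) x - lev k (l n) x) < e" if "m \<ge> M" "n \<ge> M" for m n
    proof -
      have mem: "ldiff (l m) (l n) \<in> ls" using l by simp
      have "norm (lev k (l m) x - lev k (l n) x) \<le> nrm (ldiff (l m) (l n)) * sqrt (k x x)"
        using lev_bound[OF mem x] by (simp add: lev_simps)
      also have "\<dots> \<le> nrm (ldiff (l m) (l n)) * s"
        using nrm_nonneg[OF mem] by (intro mult_left_mono) (auto simp: s_def)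
      also have "\<dots> < e" using M[OF that] s by (simp add: pos_less_divide_eq)
      finally show ?thesis .
    qed
    then show "\<exists>M. \<forall>m\<ge>M. \<forall>n\<ge>M. norm (lev k (l m) x - lev k (l n) x) < e"
      by (intro exI[of _ M] allI impI)
  qed
  then have reps: "reps l F"
    using cau by (simp add: reps_def F_def convergent_LIMSEQ_iff)
  then have FH: "F \<in> H" by (auto simp: H_def F_def)
  have "(\<lambda>n. hn (\<lambda>x. X n x - F x)) \<longlonglongrightarrow> 0"
  proof (rule LIMSEQ_I)
    fix e :: real assume "0 < e"
    then have e: "0 < e / 3" by simp
    obtain N where N: "\<forall>n\<ge>N. inverse (real (Suc n)) < e / 3" using small[OF e] by blast
    obtain M where M: "\<And>m n. \<lbrakk>m \<ge> M; n \<ge> M\<rbrakk> \<Longrightarrow> nrm (ldiff (l m) (l n)) < e / 3"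
      by (rule cauE[OF cau e]) (rule that)
    have "norm (hn (\<lambda>x. X n x - F x) - 0) < e" if n: "n \<ge> max M N" for n
    proof -
      have "hn (\<lambda>x. leval (l n) x - F x) \<le> e / 3"
        by (rule LIMSEQ_le_const2[OF hn_lim[OF reps_diff[OF reps_const[OF l(1)] reps]]])
          (use M n in \<open>auto intro!: exI[of _ M] less_imp_le\<close>)
      moreover have "hn (\<lambda>x. X n x - leval (l n) x) < e / 3"
        using l(2)[of n] N n by (meson max.boundedE less_trans)
      moreover have "0 \<le> hn (\<lambda>x. X n x - F x)" by (intro hn_nonneg H_diff X FH)
      ultimately show ?thesis using hn_triangle3[OF X H_leval[OF l(1)] FH, of n n] \<open>0 < e\<close> by simp
    qed
    then show "\<exists>no. \<forall>n\<ge>no. norm (hn (\<lambda>x. X n x - F x) - 0) < e" by (intro exI[of _ "max M N"] allI impI)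
  qed
  with FH show thesis by (rule that)
qed

definition V :: "('i \<Rightarrow> complex) inner_module" where
  "V = \<lparr>carrier = H, mult = undefined, one = undefined, zero = (\<lambda>_. 0),
     add = (\<lambda>F G x. F x + G x), smult = (\<lambda>c F x. c * F x), inprod = inn\<rparr>"

lemma V_simps [simp]: "carrier V = H" "\<zero>\<^bsub>V\<^esub> = (\<lambda>_. 0)" "F \<oplus>\<^bsub>V\<^esub> G = (\<lambda>x. F x + G x)"
  "c \<odot>\<^bsub>V\<^esub> F = (\<lambda>x. c * F x)" "inprod V = inn" "hnorm V F = hn F"
  by (simp_all add: V_def hnorm_def hn_def)

lemma abelian_group_V: "abelian_group V"
proof (rule abelian_groupI)
  fix F assume "F \<in> carrier V"
  then show "\<exists>G\<in>carrier V. G \<oplus>\<^bsub>V\<^esub> F = \<zero>\<^bsub>V\<^esub>"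
    using H_scl[of F "-1"] by (intro bexI[of _ "\<lambda>x. -1 * F x"]) auto
qed (auto simp: H_zero H_add add_ac)

lemma V_minus: assumes "F \<in> H" "G \<in> H" shows "F \<ominus>\<^bsub>V\<^esub> G = (\<lambda>x. F x - G x)"
proof -
  interpret abelian_group V by (rule abelian_group_V)
  have "\<ominus>\<^bsub>V\<^esub> G = (\<lambda>x. -1 * G x)"
    using assms H_scl[of G "-1"] by (intro minus_equality) auto
  then show ?thesis by (simp add: a_minus_def)
qed

lemma cring_complex_ring: "cring complex_ring"
proof (rule cringI)
  show "abelian_group complex_ring"
  proof (rule abelian_groupI)
    fix x assume "x \<in> carrier complex_ring"
    show "\<exists>y\<in>carrier complex_ring. y \<oplus>\<^bsub>complex_ring\<^esub> x = \<zero>\<^bsub>complex_ring\<^esub>"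
      by (intro bexI[of _ "- x"]) (auto simp: complex_ring_def)
  qed (auto simp: complex_ring_def)
  show "comm_monoid complex_ring" by (rule comm_monoidI) (auto simp: complex_ring_def)
qed (auto simp: complex_ring_def distrib_right)

theorem hilbert_space_V: "hilbert_space V"
proof -
  have "module complex_ring V"
    by (rule moduleI[OF cring_complex_ring abelian_group_V])
      (auto simp: H_scl complex_ring_def algebra_simps)
  moreover have "hilbert_space_axioms V"
  proof
    fix X :: "nat \<Rightarrow> 'i \<Rightarrow> complex"
    assume "range X \<subseteq> carrier V"
      and cauchy: "\<And>e. 0 < e \<Longrightarrow> \<exists>N. \<forall>m\<ge>N. \<forall>n\<ge>N. hnorm V (X m \<ominus>\<^bsub>V\<^esub> X n) < e"
    then have X: "X n \<in> H" for n by auto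
    obtain F where F: "F \<in> H" "(\<lambda>n. hn (\<lambda>x. X n x - F x)) \<longlonglongrightarrow> 0"
      by (rule H_complete[OF X cauchy[simplified V_minus[OF X X] V_simps]]) auto
    then show "\<exists>L\<in>carrier V. (\<lambda>n. hnorm V (X n \<ominus>\<^bsub>V\<^esub> L)) \<longlonglongrightarrow> 0"
      using X by (intro bexI[of _ F]) (simp_all add: V_minus)
  qed (auto simp: inn_add inn_scl inn_pos intro: inn_commute)
  ultimately show ?thesis by (simp add: hilbert_space_def)
qed

end

section \<open>Consequences of Property T\<close>

text \<open>The functions \<open>k x\<close> are moved by a left-invariant kernel's group like \<open>x\<close> itself, which makes the
  reproducing kernel Hilbert space a unitary representation.\<close>

locale invariant_kernel = group G + kernel_space "carrier G" k
  for G :: "('a, 'b) monoid_scheme" (structure) and k :: "'a \<Rightarrow> 'a \<Rightarrow> real" +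
  assumes invar: "\<lbrakk>g \<in> carrier G; x \<in> carrier G; y \<in> carrier G\<rbrakk> \<Longrightarrow> k (g \<otimes> x) (g \<otimes> y) = k x y"
begin

definition tr :: "'a \<Rightarrow> ('a \<Rightarrow> complex) \<Rightarrow> 'a \<Rightarrow> complex" where
  "tr g F = (\<lambda>x. if x \<in> carrier G then F (inv g \<otimes> x) else 0)"

definition ltr :: "'a \<Rightarrow> (complex \<times> 'a) list \<Rightarrow> (complex \<times> 'a) list" where
  "ltr g l = map (\<lambda>(a, x). (a, g \<otimes> x)) l"

lemma ltr_simps: "ltr g [] = []" "ltr g ((a, x) # l) = (a, g \<otimes> x) # ltr g l"
  "ltr g (l @ m) = ltr g l @ ltr g m" "ltr g (scl c l) = scl c (ltr g l)"
  "ltr g (ldiff l m) = ldiff (ltr g l) (ltr g m)"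
  by (auto simp: ltr_def scl_def ldiff_def)

lemma ltr_ls: "g \<in> carrier G \<Longrightarrow> l \<in> ls \<Longrightarrow> ltr g l \<in> ls"
  by (induction l) (auto simp: ltr_simps)

lemma lev_ltr:
  assumes g: "g \<in> carrier G" and x: "x \<in> carrier G"
  shows "l \<in> ls \<Longrightarrow> lev k (ltr g l) x = lev k l (inv g \<otimes> x)"
proof (induction l)
  case (Cons p l)
  obtain a y where p: "p = (a, y)" by (cases p)
  then have y: "y \<in> carrier G" using Cons.prems by simp
  have "k (g \<otimes> y) x = k y (inv g \<otimes> x)"
    using invar[of g y "inv g \<otimes> x"] g x y by (simp add: m_assoc[symmetric])
  then show ?case using Cons p by (simp add: ltr_simps lev_Cons)
qed (simp add: ltr_simps lev_Nil)

lemma lip_ltr: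
  assumes g: "g \<in> carrier G" and l: "l \<in> ls"
  shows "m \<in> ls \<Longrightarrow> lip k (ltr g l) (ltr g m) = lip k l m"
proof (induction m)
  case (Cons p m)
  obtain b y where p: "p = (b, y)" by (cases p)
  then have y: "y \<in> carrier G" using Cons.prems by simp
  have "lev k (ltr g l) (g \<otimes> y) = lev k l y"
    using lev_ltr[OF g _ l, of "g \<otimes> y"] g y by (simp add: m_assoc[symmetric])
  then show ?case using Cons p by (simp add: ltr_simps lip_Cons)
qed (simp add: ltr_simps lip_Nil)

lemma nrm_ltr: "g \<in> carrier G \<Longrightarrow> l \<in> ls \<Longrightarrow> nrm (ltr g l) = nrm l"
  by (simp add: nrm_def lip_ltr)

lemma reps_tr:
  assumes g: "g \<in> carrier G" and L: "reps L F" shows "reps (\<lambda>n. ltr g (L n)) (tr g F)"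
proof -
  have cau: "cau L" using L by (simp add: reps_def)
  have "cau (\<lambda>n. ltr g (L n))"
  proof (rule cauI)
    show "ltr g (L n) \<in> ls" for n using ltr_ls g cauD[OF cau] by blast
    fix e :: real assume "0 < e"
    obtain M where M: "\<And>m n. \<lbrakk>m \<ge> M; n \<ge> M\<rbrakk> \<Longrightarrow> nrm (ldiff (L m) (L n)) < e"
      by (rule cauE[OF cau \<open>0 < e\<close>]) (rule that)
    have "nrm (ldiff (ltr g (L m)) (ltr g (L n))) = nrm (ldiff (L m) (L n))" for m n
      using nrm_ltr[OF g, of "ldiff (L m) (L n)"] cauD[OF cau] by (simp add: ltr_simps)
    then show "\<exists>M. \<forall>m\<ge>M. \<forall>n\<ge>M. nrm (ldiff (ltr g (L m)) (ltr g (L n))) < e"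
      using M by (intro exI[of _ M]) simp
  qed
  moreover have "(\<lambda>n. lev k (ltr g (L n)) x) \<longlonglongrightarrow> tr g F x" if "x \<in> carrier G" for x
    using L g that by (simp add: reps_def tr_def lev_ltr[OF g that cauD[OF cau]])
  ultimately show ?thesis by (simp add: reps_def)
qed

lemma tr_H: assumes "g \<in> carrier G" "F \<in> H" shows "tr g F \<in> H"
proof -
  obtain L where "reps L F" using assms by (auto elim!: HE)
  from reps_tr[OF assms(1) this] show ?thesis unfolding H_def by (auto simp: tr_def)
qed

lemma inn_tr:
  assumes g: "g \<in> carrier G" and "F \<in> H" "K \<in> H" shows "inn (tr g F) (tr g K) = inn F K"
proof -
  obtain L M where L: "reps L F" "reps M K" using assms by (auto elim!: HE)
  have mem: "L n \<in> ls" "M n \<in> ls" for n using L by (auto simp: reps_def cauD)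
  have "(\<lambda>n. lip k (L n) (M n)) \<longlonglongrightarrow> inn (tr g F) (tr g K)"
    using inn_lim[OF reps_tr[OF g L(1)] reps_tr[OF g L(2)]] unfolding lip_ltr[OF g mem] .
  then show ?thesis using inn_lim[OF L] by (rule LIMSEQ_unique)
qed

lemma unitary_rep_V: "unitary_rep G V (\<lambda>g. \<lambda>F\<in>carrier V. tr g F)"
proof (intro unitary_rep.intro unitary_rep_axioms.intro hilbert_space_V group_actionI)
  fix F assume "F \<in> carrier V"
  then show "tr \<one> F = F" by (intro ext) (auto simp: tr_def H_def)
next
  fix g h F assume "g \<in> carrier G" "h \<in> carrier G" "F \<in> carrier V"
  then show "tr (g \<otimes> h) F = tr g (tr h F)"
    by (intro ext) (auto simp: tr_def inv_mult_group m_assoc)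
next
  fix g F K assume "g \<in> carrier G" "F \<in> carrier V" "K \<in> carrier V"
  moreover have "tr g (\<lambda>x. F x + K x) = (\<lambda>x. tr g F x + tr g K x)" by (simp add: tr_def fun_eq_iff)
  ultimately show "(\<lambda>F\<in>carrier V. tr g F) (F \<oplus>\<^bsub>V\<^esub> K) =
      (\<lambda>F\<in>carrier V. tr g F) F \<oplus>\<^bsub>V\<^esub> (\<lambda>F\<in>carrier V. tr g F) K"
    by (simp add: H_add)
next
  fix g F c assume "g \<in> carrier G" "F \<in> carrier V"
  moreover have "tr g (\<lambda>x. c * F x) = (\<lambda>x. c * tr g F x)" by (simp add: tr_def fun_eq_iff)
  ultimately show "(\<lambda>F\<in>carrier V. tr g F) (c \<odot>\<^bsub>V\<^esub> F) = c \<odot>\<^bsub>V\<^esub> (\<lambda>F\<in>carrier V. tr g F) F"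
    by (simp add: H_scl)
next
  fix g F K assume "g \<in> carrier G" "F \<in> carrier V" "K \<in> carrier V"
  then show "inprod V ((\<lambda>F\<in>carrier V. tr g F) F) ((\<lambda>F\<in>carrier V. tr g F) K) = inprod V F K"
    by (simp add: inn_tr)
qed (simp_all add: tr_H is_group)

text \<open>If \<open>k x\<close> has small inner product with any fixed finite set of \<open>k y\<close> for suitable \<open>x\<close>, then an
  invariant \<open>F\<close>, which is constant on the group, has to vanish.\<close>

lemma no_invariant_vector:
  assumes diag: "\<And>x. x \<in> carrier G \<Longrightarrow> k x x = 1"
    and esc: "\<And>Y d. \<lbrakk>finite Y; Y \<subseteq> carrier G; 0 < d\<rbrakk> \<Longrightarrow> \<exists>x\<in>carrier G. \<forall>y\<in>Y. \<bar>k y x\<bar> < d"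
  shows "\<not> has_invariant_vector G V (\<lambda>g. \<lambda>F\<in>carrier V. tr g F)"
proof
  assume "has_invariant_vector G V (\<lambda>g. \<lambda>F\<in>carrier V. tr g F)"
  then obtain F where F0: "F \<in> carrier V - {\<zero>\<^bsub>V\<^esub>}" "\<forall>g\<in>carrier G. (\<lambda>F\<in>carrier V. tr g F) F = F"
    unfolding has_invariant_vector_def by blast
  have F: "F \<in> H" "F \<noteq> (\<lambda>_. 0)" using F0(1) by simp_all
  have inv: "tr g F = F" if "g \<in> carrier G" for g using F0(2) F(1) that by simp
  have const: "F x = F \<one>" if "x \<in> carrier G" for x
    using fun_cong[OF inv[OF that], of x] that by (simp add: tr_def)
  have "cmod (F \<one>) \<le> 0"
  proof (rule field_le_epsilon)
    fix e :: real assume "0 < e"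
    then have e: "0 < e / 2" by simp
    obtain l where l: "l \<in> ls" "hn (\<lambda>x. F x - leval l x) < e / 2" by (rule H_approx[OF F(1) e]) (rule that)
    define A where "A = (\<Sum>(a, y)\<leftarrow>l. cmod a) + 1"
    have A: "0 < A" unfolding A_def by (intro add_nonneg_pos sum_list_nonneg) auto
    obtain x where x: "x \<in> carrier G" "\<forall>y\<in>snd ` set l. \<bar>k y x\<bar> < e / 2 / A"
      using esc[of "snd ` set l" "e / 2 / A"] l e A by (auto simp: ls_def)
    have "cmod (lev k m x) \<le> (\<Sum>(a, y)\<leftarrow>m. cmod a) * (e / 2 / A)" if "set m \<subseteq> set l" for m
      using that
    proof (induction m)
      case (Cons p m)
      obtain a y where p: "p = (a, y)" by (cases p)
      have "(a, y) \<in> set l" using Cons.prems p by simp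
      then have "y \<in> snd ` set l" by (rule image_eqI[rotated]) simp
      then have "\<bar>k y x\<bar> \<le> e / 2 / A" using x(2) by (intro less_imp_le) (rule bspec)
      then have "cmod (a * of_real (k y x)) \<le> cmod a * (e / 2 / A)"
        using mult_left_mono[OF _ norm_ge_zero[of a]] by (simp only: norm_mult norm_of_real)
      then show ?case using Cons p norm_triangle_ineq[of "a * of_real (k y x)" "lev k m x"]
        by (simp add: lev_Cons algebra_simps)
    qed (simp add: lev_Nil)
    then have "cmod (lev k l x) \<le> (A - 1) * (e / 2 / A)" by (simp add: A_def)
    also have "\<dots> \<le> A * (e / 2 / A)" using e A by (intro mult_right_mono) auto
    finally have 1: "cmod (leval l x) \<le> e / 2" using A x(1) by (simp add: leval_def)
    have "cmod (F x - leval l x) \<le> hn (\<lambda>x. F x - leval l x)"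
      using eval_bound[OF H_diff[OF F(1) H_leval[OF l(1)]] x(1)] diag[OF x(1)] by simp
    then have "cmod (F x) \<le> e / 2 + e / 2"
      using 1 l(2) norm_triangle_ineq[of "F x - leval l x" "leval l x"] by simp
    then show "cmod (F \<one>) \<le> 0 + e" using const[OF x(1)] by simp
  qed
  then have F1: "F \<one> = 0" by simp
  have "F x = 0" if "x \<in> carrier G" for x using const[OF that] unfolding F1 .
  then have "F = (\<lambda>_. 0)" by (rule H_eqI[OF F(1) H_zero])
  then show False using F(2) by blast
qed

text \<open>The vector is the generator at the unit: it has norm 1, and the square of its
  displacement by \<open>s\<close> is \<open>2 * (1 - k s \<one>)\<close>.\<close>

lemma almost_invariant_vector:
  assumes S: "S \<subseteq> carrier G" and diag: "\<And>x. x \<in> carrier G \<Longrightarrow> k x x = 1"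
    and e: "0 < e" and near: "\<And>s. s \<in> S \<Longrightarrow> 2 * (1 - k s \<one>) < e\<^sup>2"
  shows "has_almost_invariant_vector V (\<lambda>g. \<lambda>F\<in>carrier V. tr g F) S e"
proof -
  define l where "l = [(1 :: complex, \<one>)]"
  have l: "l \<in> ls" by (simp add: l_def)
  have nl: "nrm l = 1" by (simp add: l_def nrm_def lip_Cons lip_Nil lev_Cons lev_Nil diag)
  have hl: "hn (leval l) = 1"
    using hn_lim[OF reps_const[OF l]] nl by (simp add: LIMSEQ_const_iff)
  have z: "leval l \<noteq> (\<lambda>_. 0)"
    using diag[of \<one>] by (auto simp: l_def leval_def lev_Cons lev_Nil dest!: fun_cong[of _ _ \<one>])
  have "hn (\<lambda>x. tr s (leval l) x - leval l x) < e" if s: "s \<in> S" for s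
  proof -
    have sG: "s \<in> carrier G" using s S by blast
    have ks: "k \<one> s = k s \<one>" using pos_kernel_sym[OF pos, of s \<one>] sG by simp
    have "reps (\<lambda>_. ldiff (ltr s l) l) (\<lambda>x. tr s (leval l) x - leval l x)"
      by (intro reps_diff reps_tr reps_const l sG)
    from hn_lim[OF this] have "hn (\<lambda>x. tr s (leval l) x - leval l x) = nrm (ldiff (ltr s l) l)"
      by (simp add: LIMSEQ_const_iff)
    also have "lip k (ldiff (ltr s l) l) (ldiff (ltr s l) l) = of_real (2 * (1 - k s \<one>))"
      using sG diag ks by (simp add: lip_simps l_def ltr_simps lip_Cons lev_Cons lev_simps)
    then have "nrm (ldiff (ltr s l) l) = sqrt (2 * (1 - k s \<one>))" by (simp only: nrm_def Re_complex_of_real)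
    also have "\<dots> < e" using near[OF s] e by (simp add: real_less_lsqrt)
    finally show ?thesis .
  qed
  moreover have "tr s (leval l) \<in> H" if "s \<in> S" for s
    using tr_H[OF _ H_leval[OF l]] S that by blast
  ultimately have "\<forall>s\<in>S. hnorm V ((\<lambda>F\<in>carrier V. tr s F) (leval l) \<ominus>\<^bsub>V\<^esub> leval l) < e * hnorm V (leval l)"
    using H_leval[OF l] by (simp add: V_minus hl)
  moreover have "leval l \<in> carrier V - {\<zero>\<^bsub>V\<^esub>}" using H_leval[OF l] z by simp
  ultimately show ?thesis unfolding has_almost_invariant_vector_def by blast
qed

end

text \<open>A length function is a function of conditionally negative type, described by the positive
  definiteness of \<open>exp (- t * \<psi>)\<close>.\<close>

definition neg_length :: "('a, 'b) monoid_scheme \<Rightarrow> ('a \<Rightarrow> 'a \<Rightarrow> real) \<Rightarrow> bool" where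
  "neg_length G \<psi> \<longleftrightarrow>
     (\<forall>t>0. pos_kernel (carrier G) (\<lambda>x y. exp (- t * \<psi> x y))) \<and>
     (\<forall>g\<in>carrier G. \<forall>x\<in>carrier G. \<forall>y\<in>carrier G. \<psi> (g \<otimes>\<^bsub>G\<^esub> x) (g \<otimes>\<^bsub>G\<^esub> y) = \<psi> x y) \<and>
     (\<forall>x\<in>carrier G. \<psi> x x = 0) \<and>
     (\<forall>x\<in>carrier G. \<forall>y\<in>carrier G. 0 \<le> \<psi> x y) \<and>
     (\<forall>y\<in>carrier G. \<exists>C. \<forall>x\<in>carrier G. \<psi> x \<one>\<^bsub>G\<^esub> \<le> \<psi> y x + C)"

definition bounded_lengths :: "('a, 'b) monoid_scheme \<Rightarrow> bool" where
  "bounded_lengths G \<longleftrightarrow> (\<forall>\<psi>. neg_length G \<psi> \<longrightarrow> (\<exists>C. \<forall>x\<in>carrier G. \<psi> x \<one>\<^bsub>G\<^esub> \<le> C))"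

text \<open>For small \<open>t\<close> the kernel \<open>exp (- t * \<psi>)\<close> is close to 1
  between the unit and the elements of the finite set \<open>S\<close>, so the generator at the unit
  is almost invariant. If \<open>\<psi>\<close> were unbounded, elements far from the unit would be
  far from any given finite set by the last clause of \<open>neg_length\<close>, and
  \<open>no_invariant_vector\<close> would apply.\<close>

theorem (in group) property_T_bounded_lengths:
  assumes "property_T G" shows "bounded_lengths G"
  unfolding bounded_lengths_def
proof (intro allI impI, rule ccontr)
  fix \<psi> assume \<psi>: "neg_length G \<psi>" and unb: "\<not> (\<exists>C. \<forall>x\<in>carrier G. \<psi> x \<one> \<le> C)"
  obtain S e where S: "S \<subseteq> carrier G" "finite S" and e: "0 < e" and pair: "kazhdan_pair G S e"
    using assms by (auto simp: property_T_def)
  have "\<forall>s\<in>S. \<forall>\<^sub>F t in at_right 0. 2 * (1 - exp (- t * \<psi> s \<one>)) < e\<^sup>2"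
  proof
    fix s
    have "((\<lambda>t. 2 * (1 - exp (- t * \<psi> s \<one>))) \<longlongrightarrow> 2 * (1 - exp (- 0 * \<psi> s \<one>))) (at_right 0)"
      by (intro tendsto_intros)
    then show "\<forall>\<^sub>F t in at_right 0. 2 * (1 - exp (- t * \<psi> s \<one>)) < e\<^sup>2"
      using e by (intro order_tendstoD(2)) auto
  qed
  then have "\<forall>\<^sub>F t in at_right 0. (\<forall>s\<in>S. 2 * (1 - exp (- t * \<psi> s \<one>)) < e\<^sup>2) \<and> 0 < t"
    using S(2) by (intro eventually_conj) (auto simp: eventually_ball_finite_distrib eventually_at_right_less)
  then obtain t where t: "\<forall>s\<in>S. 2 * (1 - exp (- t * \<psi> s \<one>)) < e\<^sup>2" "0 < t"
    by (auto dest!: eventually_happens)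
  define k where "k x y = exp (- t * \<psi> x y)" for x y
  interpret invariant_kernel G k
  proof (intro invariant_kernel.intro invariant_kernel_axioms.intro kernel_space.intro is_group)
    show "pos_kernel (carrier G) k" using \<psi> t(2) unfolding neg_length_def k_def[abs_def] by blast
    show "k (g \<otimes> x) (g \<otimes> y) = k x y" if "g \<in> carrier G" "x \<in> carrier G" "y \<in> carrier G" for g x y
      using \<psi> that unfolding neg_length_def k_def by simp
  qed
  interpret unitary_rep G V "\<lambda>g. \<lambda>F\<in>carrier V. tr g F" by (rule unitary_rep_V)
  have diag: "k x x = 1" if "x \<in> carrier G" for x using \<psi> that by (simp add: neg_length_def k_def)
  have "has_almost_invariant_vector V (\<lambda>g. \<lambda>F\<in>carrier V. tr g F) S e"
    using S(1) diag e t(1) by (intro almost_invariant_vector) (auto simp: k_def)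
  then have "has_invariant_vector G V (\<lambda>g. \<lambda>F\<in>carrier V. tr g F)"
    by (rule kazhdan_pair_universal[OF pair S(1)])
  moreover have "\<exists>x\<in>carrier G. \<forall>y\<in>Y. \<bar>k y x\<bar> < d" if Y: "finite Y" "Y \<subseteq> carrier G" and d: "0 < d" for Y d
  proof -
    have "\<forall>y\<in>Y. \<exists>C. \<forall>x\<in>carrier G. \<psi> x \<one> \<le> \<psi> y x + C" using \<psi> Y(2) by (auto simp: neg_length_def)
    from bchoice[OF this] obtain C where C: "\<And>y x. y \<in> Y \<Longrightarrow> x \<in> carrier G \<Longrightarrow> \<psi> x \<one> \<le> \<psi> y x + C y" by blast
    \<comment> \<open>Large enough that \<open>\<psi> x \<one> > B\<close> forces
      \<open>\<psi> y x > - ln d / t\<close>, that is \<open>k y x < d\<close>, for all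
      \<open>y\<close> in \<open>Y\<close>.\<close>
    define B where "B = Max (insert 0 (C ` Y)) - ln d / t"
    obtain x where x: "x \<in> carrier G" "B < \<psi> x \<one>" using unb by (meson not_le)
    have "\<bar>k y x\<bar> < d" if y: "y \<in> Y" for y
    proof -
      have "C y \<le> Max (insert 0 (C ` Y))" using Y(1) y by (intro Max_ge) auto
      then have "- ln d / t < \<psi> y x" using C[OF y x(1)] x(2) by (simp add: B_def)
      then have "- t * \<psi> y x < ln d" using t(2) by (simp add: field_simps)
      then have "exp (- t * \<psi> y x) < exp (ln d)" by (simp only: exp_less_mono)
      then show ?thesis using d by (simp add: k_def)
    qed
    then show ?thesis using x(1) by blast
  qed
  ultimately show False using no_invariant_vector[OF diag] by blast
qed

text \<open>The length is induced by summing over cosets: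
  \<open>g \<rho> (g^-1 i) = i \<beta> g i\<close> defines the \<open>H\<close>-valued cocycle
  \<open>\<beta>\<close>. Left translation permutes the summands, the exponential of the sum is a
  finite product of positive definite kernels, and on \<open>H\<close> the summand of the unit coset
  is the given length.\<close>

theorem (in group) bounded_lengths_fin_index:
  assumes b: "bounded_lengths G" and H: "fin_index G H"
  shows "bounded_lengths (G\<lparr>carrier := H\<rparr>)"
  unfolding bounded_lengths_def
proof (intro allI impI)
  fix \<psi>0 assume "neg_length (G\<lparr>carrier := H\<rparr>) \<psi>0"
  then have \<psi>0: "\<And>t. 0 < t \<Longrightarrow> pos_kernel H (\<lambda>x y. exp (- t * \<psi>0 x y))"
    "\<And>g x y. \<lbrakk>g \<in> H; x \<in> H; y \<in> H\<rbrakk> \<Longrightarrow> \<psi>0 (g \<otimes> x) (g \<otimes> y) = \<psi>0 x y"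
    "\<And>x. x \<in> H \<Longrightarrow> \<psi>0 x x = 0" "\<And>x y. \<lbrakk>x \<in> H; y \<in> H\<rbrakk> \<Longrightarrow> 0 \<le> \<psi>0 x y"
    and tri: "\<forall>y\<in>H. \<exists>C. \<forall>x\<in>H. \<psi>0 x \<one> \<le> \<psi>0 y x + C"
    by (simp_all add: neg_length_def)
  interpret H: subgroup H G using H by (rule fin_index_subgroup)
  obtain \<rho> where \<rho>: "finite (\<rho> ` carrier G)" "\<And>g. g \<in> carrier G \<Longrightarrow> \<rho> g \<in> carrier G"
    "\<And>g. g \<in> carrier G \<Longrightarrow> inv (\<rho> g) \<otimes> g \<in> H"
    "\<And>g h. \<lbrakk>g \<in> carrier G; h \<in> H\<rbrakk> \<Longrightarrow> \<rho> (g \<otimes> h) = \<rho> g" "\<And>h. h \<in> H \<Longrightarrow> \<rho> h = \<one>"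
    by (rule fin_index_rep[OF H]) blast
  define I where "I = \<rho> ` carrier G"
  define \<beta> where "\<beta> g i = inv i \<otimes> (g \<otimes> \<rho> (inv g \<otimes> i))" for g i
  define \<psi> where "\<psi> g h = (\<Sum>i\<in>I. \<psi>0 (\<beta> g i) (\<beta> h i))" for g h
  have finI: "finite I" using \<rho>(1) by (simp add: I_def)
  have IG: "i \<in> carrier G" if "i \<in> I" for i using that \<rho>(2) by (auto simp: I_def)
  have \<rho>\<rho>: "\<rho> (g \<otimes> \<rho> x) = \<rho> (g \<otimes> x)" if "g \<in> carrier G" "x \<in> carrier G" for g x
  proof -
    have "\<rho> (g \<otimes> \<rho> x \<otimes> (inv (\<rho> x) \<otimes> x)) = \<rho> (g \<otimes> \<rho> x)"
      using that \<rho> by simp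
    then show ?thesis using that \<rho>(2) by (simp add: m_assoc inv_mult_eq)
  qed
  have \<rho>1: "\<rho> i = i" if "i \<in> I" for i
    using that \<rho>\<rho>[of \<one>] \<rho>(2) by (auto simp: I_def)
  have \<rho>I: "\<rho> g \<in> I" if "g \<in> carrier G" for g using that by (simp add: I_def)
  have \<beta>H: "\<beta> g i \<in> H" if "g \<in> carrier G" "i \<in> I" for g i
  proof -
    have "inv (inv (\<rho> (inv g \<otimes> i)) \<otimes> (inv g \<otimes> i)) \<in> H"
      using that IG \<rho>(3) by (intro H.m_inv_closed) simp
    then show ?thesis using that IG \<rho>(2) by (simp add: \<beta>_def inv_mult_group m_assoc)
  qed
  have \<beta>2: "\<beta> (g \<otimes> h) i = \<beta> g i \<otimes> \<beta> h (\<rho> (inv g \<otimes> i))" if "g \<in> carrier G" "h \<in> carrier G" "i \<in> I" for g h i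
    using that IG \<rho>(2) \<rho>\<rho> by (simp add: \<beta>_def inv_mult_group m_assoc inv_mult_eq)
  have \<beta>1: "\<beta> \<one> i = \<one>" if "i \<in> I" for i using that IG \<rho>1 by (simp add: \<beta>_def)
  have "neg_length G \<psi>"
    unfolding neg_length_def
  proof (intro conjI allI impI ballI)
    fix t :: real assume t: "0 < t"
    have "pos_kernel (carrier G) (\<lambda>x y. \<Prod>i\<in>I. exp (- t * \<psi>0 (\<beta> x i) (\<beta> y i)))"
      using \<beta>H by (intro pos_kernel_prod pos_kernel_comp[OF \<psi>0(1)[OF t]]) auto
    then show "pos_kernel (carrier G) (\<lambda>x y. exp (- t * \<psi> x y))"
      by (simp add: \<psi>_def exp_sum[OF finI, symmetric] sum_distrib_left)
  next
    fix g x y assume g: "g \<in> carrier G" "x \<in> carrier G" "y \<in> carrier G"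
    have "\<psi> (g \<otimes> x) (g \<otimes> y) = (\<Sum>i\<in>I. \<psi>0 (\<beta> x (\<rho> (inv g \<otimes> i))) (\<beta> y (\<rho> (inv g \<otimes> i))))"
      using g \<rho>I IG \<beta>H unfolding \<psi>_def by (intro sum.cong refl) (simp add: \<beta>2 \<psi>0(2))
    also have "\<dots> = \<psi> x y"
      unfolding \<psi>_def using g \<rho>I IG \<rho>\<rho> \<rho>1
      by (intro sum.reindex_bij_witness[of _ "\<lambda>j. \<rho> (g \<otimes> j)" "\<lambda>i. \<rho> (inv g \<otimes> i)"])
        (simp_all add: m_assoc[symmetric])
    finally show "\<psi> (g \<otimes> x) (g \<otimes> y) = \<psi> x y" .
  next
    fix x assume "x \<in> carrier G"
    then show "\<psi> x x = 0" using \<beta>H \<psi>0(3) by (simp add: \<psi>_def)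
  next
    fix x y assume "x \<in> carrier G" "y \<in> carrier G"
    then show "0 \<le> \<psi> x y" unfolding \<psi>_def using \<beta>H \<psi>0(4) by (intro sum_nonneg) blast
  next
    fix y assume y: "y \<in> carrier G"
    from bchoice[OF tri] obtain C where C: "\<forall>y\<in>H. \<forall>x\<in>H. \<psi>0 x \<one> \<le> \<psi>0 y x + C y" by blast
    have "\<psi> x \<one> \<le> \<psi> y x + (\<Sum>i\<in>I. C (\<beta> y i))" if x: "x \<in> carrier G" for x
    proof -
      have "\<psi> x \<one> \<le> (\<Sum>i\<in>I. \<psi>0 (\<beta> y i) (\<beta> x i) + C (\<beta> y i))"
        unfolding \<psi>_def using \<beta>1 \<beta>H[OF x] \<beta>H[OF y] C by (intro sum_mono) simp
      then show ?thesis by (simp add: \<psi>_def sum.distrib)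
    qed
    then show "\<exists>C. \<forall>x\<in>carrier G. \<psi> x \<one> \<le> \<psi> y x + C" by blast
  qed
  then obtain C where C: "\<And>x. x \<in> carrier G \<Longrightarrow> \<psi> x \<one> \<le> C"
    using b unfolding bounded_lengths_def by blast
  have "\<psi>0 h \<one> \<le> C" if h: "h \<in> H" for h
  proof -
    have one: "\<one> \<in> I" using \<rho>(5)[of \<one>] \<rho>I[of \<one>] by simp
    have "\<beta> h \<one> = h" using h \<rho>(5)[of "inv h"] by (simp add: \<beta>_def)
    then have "\<psi>0 h \<one> = \<psi>0 (\<beta> h \<one>) (\<beta> \<one> \<one>)" using \<beta>1[OF one] by simp
    also have "\<dots> \<le> \<psi> h \<one>"
      unfolding \<psi>_def using h \<beta>H \<psi>0(4) by (intro member_le_sum finI one) auto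
    finally show ?thesis using C[of h] h by simp
  qed
  then show "\<exists>C. \<forall>x\<in>carrier (G\<lparr>carrier := H\<rparr>). \<psi>0 x \<one>\<^bsub>G\<lparr>carrier := H\<rparr>\<^esub> \<le> C" by auto
qed

section \<open>Commensurated sets as length functions: Property T implies Property FW\<close>

lemma pos_kernel_finite:
  assumes "\<And>F. finite F \<Longrightarrow> F \<subseteq> I \<Longrightarrow> pos_kernel F k" shows "pos_kernel I k"
  unfolding pos_kernel_def
proof (intro allI impI, elim conjE)
  fix F and e :: real assume F: "finite F" "F \<subseteq> I" and e: "0 < e"
  from assms[OF F, unfolded pos_kernel_def, rule_format, of F e] F(1) e
  show "\<exists>fs. \<forall>x\<in>F. \<forall>y\<in>F. \<bar>k x y - (\<Sum>f\<leftarrow>fs. f x * f y)\<bar> < e" by simp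
qed

lemma card_sym_diff_sum:
  assumes "finite D" "sym_diff A B \<subseteq> D"
  shows "real (card (sym_diff A B)) = (\<Sum>d\<in>D. of_bool ((d \<in> A) \<noteq> (d \<in> B)))"
proof -
  have "sym_diff A B = {d \<in> D. (d \<in> A) \<noteq> (d \<in> B)}" using assms(2) by blast
  then have "real (card (sym_diff A B)) = (\<Sum>d\<in>{d \<in> D. (d \<in> A) \<noteq> (d \<in> B)}. 1)" by simp
  also have "\<dots> = (\<Sum>d\<in>D. if (d \<in> A) \<noteq> (d \<in> B) then 1 else 0)"
    by (rule sum.inter_filter[OF assms(1)])
  finally show ?thesis by (simp only: of_bool_def)
qed

text \<open>A product over points \<open>d\<close> of kernels with value 1 or
  \<open>exp (- t)\<close>, according to whether or not \<open>d\<close> lies on the same side of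
  both sets. On a finite \<open>F\<close> only the finitely many \<open>d\<close> in
  \<open>D\<close> separate anything.\<close>

lemma pos_kernel_sym_diff:
  fixes A :: "'i \<Rightarrow> 'y set"
  assumes fin: "\<And>x. x \<in> I \<Longrightarrow> finite (sym_diff (A x) M)" and t: "0 < t"
  shows "pos_kernel I (\<lambda>x y. exp (- t * real (card (sym_diff (A x) (A y)))))"
proof (rule pos_kernel_finite)
  fix F assume F: "finite F" "F \<subseteq> I"
  define D where "D = (\<Union>x\<in>F. sym_diff (A x) M)"
  have D: "finite D" using F fin unfolding D_def by (intro finite_UN_I) auto
  define r where "r = exp (- t)"
  have r: "0 \<le> r" "0 \<le> 1 - r" using t by (auto simp: r_def)
  define s where "s d x = (if d \<in> A x then 1 else 0 :: real)" for d x
  define k where "k d x y = r + (1 - r) * (s d x * s d y + (1 - s d x) * (1 - s d y))" for d x y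
  have "pos_kernel F (k d)" for d
    unfolding k_def[abs_def]
    by (intro pos_kernel_add pos_kernel_mult pos_kernel_const r pos_kernel_feature)
  then have "pos_kernel F (\<lambda>x y. \<Prod>d\<in>D. k d x y)" by (intro pos_kernel_prod)
  then show "pos_kernel F (\<lambda>x y. exp (- t * real (card (sym_diff (A x) (A y)))))"
  proof (rule pos_kernel_cong)
    fix x y assume xy: "x \<in> F" "y \<in> F"
    have sub: "sym_diff (A x) (A y) \<subseteq> D" using xy by (auto simp: D_def)
    have "exp (- t * of_bool ((d \<in> A x) \<noteq> (d \<in> A y))) = k d x y" for d
      by (simp add: k_def s_def r_def of_bool_def)
    then show "exp (- t * real (card (sym_diff (A x) (A y)))) = (\<Prod>d\<in>D. k d x y)"
      by (simp only: card_sym_diff_sum[OF D sub] sum_distrib_left exp_sum[OF D])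
  qed
qed

lemma card_sym_diff_triangle:
  assumes "finite (sym_diff A B)" "finite (sym_diff B C)"
  shows "real (card (sym_diff A C)) \<le> real (card (sym_diff A B)) + real (card (sym_diff B C))"
proof -
  have "card (sym_diff A C) \<le> card (sym_diff A B \<union> sym_diff B C)"
    using assms by (intro card_mono) auto
  also have "\<dots> \<le> card (sym_diff A B) + card (sym_diff B C)" by (rule card_Un_le)
  finally show ?thesis by linarith
qed

lemma image_sym_diff:
  "inj_on f E \<Longrightarrow> A \<subseteq> E \<Longrightarrow> B \<subseteq> E \<Longrightarrow> sym_diff (f ` A) (f ` B) = f ` sym_diff A B"
  unfolding inj_on_def by blast

lemma sum_list_separated:
  fixes p :: "'i \<Rightarrow> bool"
  defines "c \<equiv> \<lambda>xs. (\<Sum>x\<leftarrow>xs. of_bool (p x) :: real)"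
  shows "(\<Sum>x\<leftarrow>xs. \<Sum>y\<leftarrow>ys. of_bool (p x \<noteq> p y)) =
    c xs * (real (length ys) - c ys) + (real (length xs) - c xs) * c ys"
proof (induction xs)
  case (Cons x xs)
  have "(\<Sum>y\<leftarrow>ys. of_bool (p x \<noteq> p y)) = (if p x then real (length ys) - c ys else c ys)"
    by (induction ys) (auto simp: c_def)
  moreover have "c (x # xs) = of_bool (p x) + c xs" by (simp add: c_def)
  ultimately show ?case using Cons by (cases "p x") (simp_all add: algebra_simps)
qed (simp add: c_def)

lemma sum_list_sum_swap: "(\<Sum>x\<leftarrow>xs. \<Sum>d\<in>D. f x d) = (\<Sum>d\<in>D. \<Sum>x\<leftarrow>xs. f x d :: real)"
  by (induction xs) (simp_all add: sum.distrib)

text \<open>Let \<open>a\<close> and \<open>b\<close> be the numbers of sets in \<open>xs\<close>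
  and in \<open>ys\<close> that contain a given point, and \<open>n\<close> the common length. The
  right-hand side is the sum over all points of
  \<open>a (n - b) + (n - a) b - a (n - a) - b (n - b) = (a - b)^2\<close>; one summand is
  kept.\<close>

lemma separation_gap:
  fixes A :: "'i \<Rightarrow> 'y set" and xs ys :: "'i list"
  defines "S \<equiv> \<lambda>xs ys. (\<Sum>x\<leftarrow>xs. \<Sum>y\<leftarrow>ys. real (card (sym_diff (A x) (A y))))"
    and "c \<equiv> \<lambda>xs d. (\<Sum>x\<leftarrow>xs. of_bool (d \<in> A x) :: real)"
  assumes fin: "\<And>x. x \<in> set xs \<union> set ys \<Longrightarrow> finite (sym_diff (A x) M)" and len: "length xs = length ys"
  shows "(c xs d - c ys d)\<^sup>2 \<le> S xs ys - S xs xs / 2 - S ys ys / 2"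
proof -
  define D where "D = insert d (\<Union>x\<in>set xs \<union> set ys. sym_diff (A x) M)"
  have D: "finite D" using fin unfolding D_def by (intro finite.insertI finite_UN_I) auto
  have S: "S us vs = (\<Sum>d\<in>D. c us d * (real (length vs) - c vs d) + (real (length us) - c us d) * c vs d)"
    if uv: "set us \<subseteq> set xs \<union> set ys" "set vs \<subseteq> set xs \<union> set ys" for us vs
  proof -
    have "S us vs = (\<Sum>x\<leftarrow>us. \<Sum>y\<leftarrow>vs. \<Sum>d\<in>D. of_bool ((d \<in> A x) \<noteq> (d \<in> A y)))"
      unfolding S_def
    proof (intro arg_cong[of _ _ sum_list] map_cong refl)
      fix x y assume "x \<in> set us" "y \<in> set vs"
      then have "sym_diff (A x) M \<subseteq> D" "sym_diff (A y) M \<subseteq> D" using uv unfolding D_def by blast+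
      then have "sym_diff (A x) (A y) \<subseteq> D" by blast
      then show "real (card (sym_diff (A x) (A y))) = (\<Sum>d\<in>D. of_bool ((d \<in> A x) \<noteq> (d \<in> A y)))"
        by (rule card_sym_diff_sum[OF D])
    qed
    then show ?thesis by (simp only: sum_list_sum_swap sum_list_separated c_def)
  qed
  have "(c xs d - c ys d)\<^sup>2 \<le> (\<Sum>d\<in>D. (c xs d - c ys d)\<^sup>2)"
    using D by (intro member_le_sum) (auto simp: D_def)
  also have "\<dots> = S xs ys - S xs xs / 2 - S ys ys / 2"
    by (simp add: S sum_divide_distrib sum_subtractf[symmetric] len) 
      (intro sum.cong refl, simp add: power2_eq_square field_simps)
  finally show ?thesis .
qed

text \<open>The functional \<open>\<Sum> f (1 - f)\<close> is invariant and strictly concave on convex combinations \<open>f\<close>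
  of translates of the indicator function of \<open>M\<close>, so a near-maximiser is nearly constant on orbits.\<close>

lemma (in group_action) bounded_commensurated_transfixed:
  assumes M: "M \<subseteq> E" and com: "commensurated G \<phi> M"
    and bd: "\<And>g. g \<in> carrier G \<Longrightarrow> real (card (sym_diff (\<phi> g ` M) M)) \<le> C"
  shows "transfixed G E \<phi> M"
proof -
  interpret G: group G using group_hom by (simp add: group_hom_def)
  define A where "A g = \<phi> g ` M" for g
  have fin: "finite (sym_diff (A g) M)" if "g \<in> carrier G" for g
    using com that unfolding commensurated_def A_def by (simp add: Un_commute)
  have AM: "A g \<subseteq> E" if "g \<in> carrier G" for g using M surj_prop[OF that] by (auto simp: A_def)
  have comp: "\<phi> (g \<otimes> h) y = \<phi> g (\<phi> h y)" if "g \<in> carrier G" "h \<in> carrier G" "y \<in> E" for g h y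
    using composition_rule that by blast
  have \<phi>E: "\<phi> g y \<in> E" if "g \<in> carrier G" "y \<in> E" for g y using element_image[OF that refl] .
  have \<phi>1: "\<phi> \<one> y = y" if "y \<in> E" for y using id_eq_one that by (metis restrict_apply')
  have Amult: "A (g \<otimes> h) = \<phi> g ` A h" if "g \<in> carrier G" "h \<in> carrier G" for g h
    unfolding A_def image_image by (intro image_cong refl comp that subsetD[OF M])
  have memA: "y \<in> A (g \<otimes> h) \<longleftrightarrow> \<phi> (inv g) y \<in> A h" if "g \<in> carrier G" "h \<in> carrier G" "y \<in> E" for g h y
  proof
    assume "y \<in> A (g \<otimes> h)"
    then have "y \<in> \<phi> g ` A h" unfolding Amult[OF that(1,2)] .
    then obtain z where z: "z \<in> A h" "y = \<phi> g z" by (rule imageE)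
    have "\<phi> (inv g) y = z" by (rule orbit_sym_aux[OF that(1) subsetD[OF AM[OF that(2)] z(1)] z(2)[symmetric]])
    then show "\<phi> (inv g) y \<in> A h" using z by simp
  next
    assume "\<phi> (inv g) y \<in> A h"
    moreover have "\<phi> g (\<phi> (inv g) y) = y" using comp[of g "inv g" y] \<phi>1 that by simp
    ultimately show "y \<in> A (g \<otimes> h)" unfolding Amult[OF that(1,2)] by (metis imageI)
  qed
  define S where "S xs ys = (\<Sum>x\<leftarrow>xs. \<Sum>y\<leftarrow>ys. real (card (sym_diff (A x) (A y))))" for xs ys
  define c where "c xs d = (\<Sum>x\<leftarrow>xs. of_bool (d \<in> A x) :: real)" for xs d
  define L where "L = {xs. xs \<noteq> [] \<and> set xs \<subseteq> carrier G}"
  \<comment> \<open>\<open>En xs\<close> is \<open>\<Sum> f (1 - f)\<close> for the average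
    \<open>f\<close> of the indicator functions of the sets \<open>A x\<close>.\<close>
  define En where "En xs = S xs xs / (2 * (real (length xs))\<^sup>2)" for xs
  have S_sym: "S xs ys = S ys xs" for xs ys
  proof -
    have "S xs ys = (\<Sum>y\<leftarrow>ys. \<Sum>x\<leftarrow>xs. real (card (sym_diff (A x) (A y))))"
      unfolding S_def by (induction xs) (simp_all add: sum_list_addf)
    then show ?thesis by (simp only: S_def Un_commute)
  qed
  have S_app: "S (xs @ ys) zs = S xs zs + S ys zs" "S zs (xs @ ys) = S zs xs + S zs ys" for xs ys zs
    by (simp_all add: S_def sum_list_addf)
  have S_le: "S xs ys \<le> real (length xs) * (real (length ys) * (2 * C))"
    if "set xs \<subseteq> carrier G" "set ys \<subseteq> carrier G" for xs ys
  proof -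
    have cC: "real (card (sym_diff (A x) (A y))) \<le> 2 * C" if "x \<in> carrier G" "y \<in> carrier G" for x y
    proof -
      have sw: "sym_diff M (A y) = sym_diff (A y) M" by blast
      have "real (card (sym_diff (A x) (A y))) \<le> real (card (sym_diff (A x) M)) + real (card (sym_diff M (A y)))"
        using fin[OF that(1)] fin[OF that(2)] unfolding sw[symmetric] by (rule card_sym_diff_triangle)
      then show ?thesis using bd[OF that(1)] bd[OF that(2)] unfolding sw unfolding A_def by linarith
    qed
    have row: "(\<Sum>y\<leftarrow>ys. real (card (sym_diff (A x) (A y)))) \<le> real (length ys) * (2 * C)" if x: "x \<in> carrier G" for x
    proof -
      have "(\<Sum>y\<leftarrow>ys. real (card (sym_diff (A x) (A y)))) \<le> (\<Sum>y\<leftarrow>ys. 2 * C)"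
        by (rule sum_list_mono, rule cC[OF x]) (rule subsetD[OF \<open>set ys \<subseteq> carrier G\<close>])
      then show ?thesis by (simp add: sum_list_triv)
    qed
    have "S xs ys \<le> (\<Sum>x\<leftarrow>xs. real (length ys) * (2 * C))"
      unfolding S_def by (rule sum_list_mono, rule row) (rule subsetD[OF \<open>set xs \<subseteq> carrier G\<close>])
    then show ?thesis by (simp add: sum_list_triv)
  qed
  have bdd: "bdd_above (En ` L)"
  proof (rule bdd_aboveI2)
    fix xs assume "xs \<in> L"
    then have xs: "set xs \<subseteq> carrier G" "0 < length xs" by (auto simp: L_def)
    then show "En xs \<le> C"
      using S_le[OF xs(1) xs(1)] by (simp add: En_def pos_divide_le_eq power2_eq_square mult_ac)
  qed
  have "[\<one>] \<in> L" by (simp add: L_def)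
  then have ne: "En ` L \<noteq> {}" by blast
  \<comment> \<open>Appending the translates of \<open>xs\<close> by \<open>g\<close> raises
    \<open>En\<close> by a quarter of the squared distance between \<open>f\<close> and its
    translate. A gain below 1/16 keeps the two within 1/2 of each other at every point.\<close>
  obtain xs where xs: "xs \<in> L" "Sup (En ` L) - 1/16 < En xs"
    using less_cSup_iff[OF ne bdd, of "Sup (En ` L) - 1/16"] by auto
  define n where "n = real (length xs)"
  have n: "0 < n" and xsG: "set xs \<subseteq> carrier G" using xs(1) by (auto simp: L_def n_def)
  have near: "\<bar>c xs d - c xs (\<phi> (inv g) d)\<bar> < n / 2" if g: "g \<in> carrier G" and d: "d \<in> E" for g d
  proof -
    define ys where "ys = map (\<lambda>x. g \<otimes> x) xs"
    have ysG: "set ys \<subseteq> carrier G" using xsG g by (auto simp: ys_def)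
    have cy: "c ys d = c xs (\<phi> (inv g) d)"
      unfolding c_def ys_def map_map o_def
      using xsG memA[OF g _ d] by (intro arg_cong[of _ _ sum_list] map_cong refl) auto
    have inv: "card (sym_diff (A (g \<otimes> x)) (A (g \<otimes> y))) = card (sym_diff (A x) (A y))"
      if "x \<in> carrier G" "y \<in> carrier G" for x y
    proof -
      have inj: "inj_on (\<phi> g) E" by (rule inj_prop[OF g])
      have "sym_diff (A (g \<otimes> x)) (A (g \<otimes> y)) = \<phi> g ` sym_diff (A x) (A y)"
        unfolding Amult[OF g that(1)] Amult[OF g that(2)] by (rule image_sym_diff[OF inj AM AM]) (rule that)+
      moreover have "inj_on (\<phi> g) (sym_diff (A x) (A y))"
        using AM that by (intro inj_on_subset[OF inj]) blast
      ultimately show ?thesis by (simp add: card_image)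
    qed
    then have Sy: "S ys ys = S xs xs"
      unfolding S_def ys_def map_map o_def
      by (intro arg_cong[of _ _ sum_list] map_cong refl arg_cong[of _ _ real]) (rule inv; rule subsetD[OF xsG]; assumption)
    have "En (xs @ ys) \<le> Sup (En ` L)"
    proof (rule cSup_upper[OF imageI bdd])
      show "xs @ ys \<in> L" using xs(1) ysG unfolding L_def by simp
    qed
    then have "En (xs @ ys) - En xs < 1/16" using xs(2) by simp
    moreover have "En (xs @ ys) - En xs = (S xs ys - S xs xs) / (4 * n\<^sup>2)"
    proof -
      have "En (xs @ ys) = (2 * S xs xs + 2 * S xs ys) / (2 * (2 * n)\<^sup>2)"
        unfolding En_def S_app Sy S_sym[of ys xs] by (simp add: n_def ys_def)
      moreover have "En xs = S xs xs / (2 * n\<^sup>2)" by (simp add: En_def n_def)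
      moreover have "(2 * a + 2 * b) / (2 * (2 * n)\<^sup>2) - a / (2 * n\<^sup>2) = (b - a) / (4 * n\<^sup>2)" for a b
        using n by (simp add: divide_simps power2_eq_square)
      ultimately show ?thesis by simp
    qed
    ultimately have lt: "(S xs ys - S xs xs) / (4 * n\<^sup>2) < 1/16" by simp
    have "S xs ys - S xs xs < n\<^sup>2 / 4"
      using lt n by (simp add: pos_divide_less_eq)
    moreover have "(c xs d - c ys d)\<^sup>2 \<le> S xs ys - S xs xs / 2 - S ys ys / 2"
      unfolding c_def S_def
    proof (rule separation_gap)
      show "finite (sym_diff (A x) M)" if "x \<in> set xs \<union> set ys" for x
        using that xsG ysG by (intro fin) blast
    qed (simp add: ys_def)
    ultimately have "(c xs d - c ys d)\<^sup>2 < (n / 2)\<^sup>2" using Sy by (simp add: power_divide)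
    then show ?thesis using n power2_less_imp_less[of "\<bar>c xs d - c ys d\<bar>" "n / 2"] by (simp add: cy)
  qed
  \<comment> \<open>Outside a finite set \<open>f\<close> is the indicator function of
    \<open>M\<close>, with values 0 and 1 only, and along orbits it varies by less than 1/2. So the
    union of the orbits that meet \<open>f = 1\<close> differs from \<open>M\<close> by a finite
    set.\<close>
  define M0 where "M0 = {y \<in> E. \<exists>g\<in>carrier G. c xs (\<phi> g y) = n}"
  have sub: "\<phi> g ` M0 \<subseteq> M0" if g: "g \<in> carrier G" for g
  proof
    fix z assume "z \<in> \<phi> g ` M0"
    then obtain y h where y: "y \<in> E" "z = \<phi> g y" "h \<in> carrier G" "c xs (\<phi> h y) = n" by (auto simp: M0_def)
    have "\<phi> (h \<otimes> inv g) z = \<phi> h y"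
      using comp[of h "inv g" z] orbit_sym_aux[OF g y(1) y(2)[symmetric]] y \<phi>E g by simp
    then show "z \<in> M0" unfolding M0_def using y g \<phi>E by (intro CollectI conjI bexI[of _ "h \<otimes> inv g"]) auto
  qed
  have "\<phi> g ` M0 = M0" if g: "g \<in> carrier G" for g
  proof (intro equalityI sub[OF g] subsetI)
    fix y assume y: "y \<in> M0"
    then have yE: "y \<in> E" by (simp add: M0_def)
    have "\<phi> (inv g) y \<in> M0" using sub[of "inv g"] g y by blast
    moreover have "\<phi> g (\<phi> (inv g) y) = y" using comp[of g "inv g" y] \<phi>1 yE g by simp
    ultimately show "y \<in> \<phi> g ` M0" by (metis imageI)
  qed
  moreover have "finite (sym_diff M M0)"
  proof (rule finite_subset)
    show "finite (\<Union>x\<in>set xs. sym_diff (A x) M)" using fin xsG by (intro finite_UN_I) auto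
    show "sym_diff M M0 \<subseteq> (\<Union>x\<in>set xs. sym_diff (A x) M)"
    proof (rule subsetI, rule ccontr)
      fix y assume y: "y \<in> sym_diff M M0" "y \<notin> (\<Union>x\<in>set xs. sym_diff (A x) M)"
      then have yE: "y \<in> E" using M by (auto simp: M0_def)
      have mem: "y \<in> A x \<longleftrightarrow> y \<in> M" if "x \<in> set xs" for x using y(2) that by blast
      then have "c xs y = (\<Sum>x\<leftarrow>xs. of_bool (y \<in> M))"
        unfolding c_def by (intro arg_cong[of _ _ sum_list] map_cong refl) simp
      then have cy: "c xs y = (if y \<in> M then n else 0)" by (simp add: n_def sum_list_triv)
      show False
      proof (cases "y \<in> M")
        case True
        then have "y \<in> M0" unfolding M0_def using cy \<phi>1[OF yE] yE by (intro CollectI conjI bexI[of _ \<one>]) auto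
        then show False using True y(1) by blast
      next
        case False
        then obtain g where g: "g \<in> carrier G" "c xs (\<phi> g y) = n" using y(1) by (auto simp: M0_def)
        then show False using near[of "inv g" y] yE cy False n by simp
      qed
    qed
  qed
  ultimately show ?thesis unfolding transfixed_def by (intro exI[of _ M0]) (auto simp: M0_def)
qed

text \<open>The length to be bounded is the number of points by which two translates of
  \<open>M\<close> differ.\<close>

theorem (in group) bounded_lengths_FW:
  assumes "bounded_lengths G" shows "property_FW G"
  unfolding property_FW_def
proof (intro allI impI)
  fix Y :: "('a \<times> 'a \<times> nat) set" and \<phi> M
  assume act: "group_action G Y \<phi>" and M: "M \<subseteq> Y" "commensurated G \<phi> M"
  interpret group_action G Y \<phi> by (rule act)
  define \<psi> where "\<psi> g h = real (card (sym_diff (\<phi> g ` M) (\<phi> h ` M)))" for g h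
  have fin: "finite (sym_diff (\<phi> g ` M) M)" if "g \<in> carrier G" for g
    using M(2) that unfolding commensurated_def by (simp add: Un_commute)
  have fin': "finite (sym_diff (\<phi> g ` M) (\<phi> h ` M))" if "g \<in> carrier G" "h \<in> carrier G" for g h
  proof (rule finite_subset)
    show "finite (sym_diff (\<phi> g ` M) M \<union> sym_diff (\<phi> h ` M) M)" using that by (intro finite_UnI fin)
  qed blast
  have M1: "\<phi> \<one> ` M = M"
  proof -
    have "\<phi> \<one> y = y" if "y \<in> M" for y using id_eq_one that M(1) by (metis restrict_apply' subsetD)
    then show ?thesis by simp
  qed
  have "neg_length G \<psi>"
    unfolding neg_length_def
  proof (intro conjI allI impI ballI)
    fix t :: real assume "0 < t"
    then show "pos_kernel (carrier G) (\<lambda>x y. exp (- t * \<psi> x y))"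
      unfolding \<psi>_def by (intro pos_kernel_sym_diff[where M = M] fin)
  next
    fix g x y assume g: "g \<in> carrier G" "x \<in> carrier G" "y \<in> carrier G"
    have im: "\<phi> (g \<otimes> h) ` M = \<phi> g ` \<phi> h ` M" "\<phi> h ` M \<subseteq> Y" if "h \<in> carrier G" for h
    proof -
      have "\<phi> (g \<otimes> h) y = \<phi> g (\<phi> h y)" if "y \<in> M" for y
        using composition_rule[of y g h] that M(1) g(1) \<open>h \<in> carrier G\<close> by blast
      then show "\<phi> (g \<otimes> h) ` M = \<phi> g ` \<phi> h ` M" by (simp add: image_image)
      show "\<phi> h ` M \<subseteq> Y" using M(1) surj_prop[OF that] by blast
    qed
    have inj: "inj_on (\<phi> g) Y" by (rule inj_prop[OF g(1)])
    have "sym_diff (\<phi> (g \<otimes> x) ` M) (\<phi> (g \<otimes> y) ` M) = \<phi> g ` sym_diff (\<phi> x ` M) (\<phi> y ` M)"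
      unfolding im(1)[OF g(2)] im(1)[OF g(3)] by (rule image_sym_diff[OF inj im(2) im(2)]) (rule g)+
    moreover have "inj_on (\<phi> g) (sym_diff (\<phi> x ` M) (\<phi> y ` M))"
      using im g by (intro inj_on_subset[OF inj]) blast
    ultimately show "\<psi> (g \<otimes> x) (g \<otimes> y) = \<psi> x y" by (simp add: \<psi>_def card_image)
  next
    fix y assume y: "y \<in> carrier G"
    have "\<psi> x \<one> \<le> \<psi> y x + \<psi> y \<one>" if x: "x \<in> carrier G" for x
    proof -
      have "\<psi> x \<one> \<le> \<psi> x y + \<psi> y \<one>"
        unfolding \<psi>_def using fin' x y by (intro card_sym_diff_triangle) auto
      moreover have "\<psi> x y = \<psi> y x" unfolding \<psi>_def by (simp only: Un_commute)
      ultimately show ?thesis by simp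
    qed
    then show "\<exists>C. \<forall>x\<in>carrier G. \<psi> x \<one> \<le> \<psi> y x + C" by blast
  qed (simp_all add: \<psi>_def)
  then obtain C where "\<And>x. x \<in> carrier G \<Longrightarrow> \<psi> x \<one> \<le> C"
    using assms unfolding bounded_lengths_def by blast
  then show "transfixed G Y \<phi> M"
    by (intro bounded_commensurated_transfixed[OF M, of C]) (simp add: \<psi>_def M1)
qed

corollary (in group) property_T_FW: "property_T G \<Longrightarrow> property_FW G"
  by (intro bounded_lengths_FW property_T_bounded_lengths)

section \<open>The hyperbolic plane\<close>

text \<open>The hyperboloid model: \<open>p\<close>, \<open>q\<close>, \<open>r\<close> are the coordinates of a family of points, and \<open>lor\<close> is
  the hyperbolic cosine of the distance.\<close>

locale hyperboloid_points =
  fixes I :: "'i set" and p q r :: "'i \<Rightarrow> real"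
  assumes pos: "x \<in> I \<Longrightarrow> 0 < p x"
    and eq: "x \<in> I \<Longrightarrow> (p x)\<^sup>2 = 1 + (q x)\<^sup>2 + (r x)\<^sup>2"
begin

definition lor :: "'i \<Rightarrow> 'i \<Rightarrow> real" where "lor x y = p x * p y - q x * q y - r x * r y"

text \<open>With \<open>u = q x * q y + r x * r y\<close>, the square of \<open>p x * p y\<close>
  exceeds that of \<open>1 + u\<close>, and likewise that of \<open>1 - u\<close>, by a sum of three
  squares.\<close>

lemma abs_product_less:
  assumes "x \<in> I" "y \<in> I" shows "1 + \<bar>q x * q y + r x * r y\<bar> \<le> p x * p y"
proof (rule power2_le_imp_le)
  define u where "u = q x * q y + r x * r y"
  have A: "(p x * p y)\<^sup>2 = (1 + (q x)\<^sup>2 + (r x)\<^sup>2) * (1 + (q y)\<^sup>2 + (r y)\<^sup>2)"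
    by (simp only: power_mult_distrib eq[OF assms(1)] eq[OF assms(2)])
  have "(p x * p y)\<^sup>2 = (1 + u)\<^sup>2 + ((q x - q y)\<^sup>2 + (r x - r y)\<^sup>2 + (q x * r y - q y * r x)\<^sup>2)"
    unfolding A by (simp add: u_def power2_eq_square algebra_simps)
  then have 1: "(1 + u)\<^sup>2 \<le> (p x * p y)\<^sup>2" by simp
  have "(p x * p y)\<^sup>2 = (1 - u)\<^sup>2 + ((q x + q y)\<^sup>2 + (r x + r y)\<^sup>2 + (q x * r y - q y * r x)\<^sup>2)"
    unfolding A by (simp add: u_def power2_eq_square algebra_simps)
  then have 2: "(1 - u)\<^sup>2 \<le> (p x * p y)\<^sup>2" by simp
  show "(1 + \<bar>q x * q y + r x * r y\<bar>)\<^sup>2 \<le> (p x * p y)\<^sup>2"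
    unfolding u_def[symmetric] using 1 2 by (cases "0 \<le> u") simp_all
qed (use pos assms in \<open>simp add: less_imp_le\<close>)

lemma lor_ge_1: "\<lbrakk>x \<in> I; y \<in> I\<rbrakk> \<Longrightarrow> 1 \<le> lor x y"
  using abs_product_less[of x y] by (simp add: lor_def)

lemma lor_self: "x \<in> I \<Longrightarrow> lor x x = 1"
  using eq[of x] by (simp add: lor_def power2_eq_square)

text \<open>The binomial series of \<open>(1 - w) powr - t\<close> has nonnegative coefficients.\<close>

lemma pos_kernel_lor:
  assumes t: "0 < t" shows "pos_kernel I (\<lambda>x y. exp (- t * ln (lor x y)))"
proof -
  \<comment> \<open>The inner product of the points in Klein's disc model. It has modulus less than
    1, and \<open>lor x y = p x * p y * (1 - w x y)\<close> reduces the claim to powers of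
    \<open>1 - w\<close>.\<close>
  define w where "w x y = (q x / p x) * (q y / p y) + (r x / p x) * (r y / p y)" for x y
  define c where "c n = ((- t) gchoose n) * (- 1) ^ n" for n
  have c: "0 \<le> c n" for n
  proof -
    have "c n = ((- 1) ^ n * (- 1) ^ n) * (pochhammer t n / fact n)"
      by (simp add: c_def gbinomial_pochhammer)
    also have "(- 1) ^ n * (- 1) ^ n = (1 :: real)" by (rule minus_one_mult_self)
    finally show ?thesis using pochhammer_nonneg[OF t, of n] by simp
  qed
  have pw: "pos_kernel I w"
    unfolding w_def[abs_def] by (intro pos_kernel_add pos_kernel_feature)
  have w: "\<bar>w x y\<bar> < 1" "lor x y = p x * p y * (1 - w x y)" if xy: "x \<in> I" "y \<in> I" for x y
  proof -
    have P: "0 < p x * p y" using pos xy by simp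
    have weq: "w x y = (q x * q y + r x * r y) / (p x * p y)" by (simp add: w_def add_divide_distrib)
    have "\<bar>q x * q y + r x * r y\<bar> < p x * p y" using abs_product_less[OF xy] by linarith
    then show "\<bar>w x y\<bar> < 1" using P by (simp add: weq abs_divide del: abs_mult)
    show "lor x y = p x * p y * (1 - w x y)"
      using pos[OF xy(1)] pos[OF xy(2)] by (simp add: weq lor_def right_diff_distrib)
  qed
  have "pos_kernel I (\<lambda>x y. exp (- t * ln (1 - w x y)))"
  proof (rule pos_kernel_limit)
    show "pos_kernel I (\<lambda>x y. \<Sum>n<N. c n * w x y ^ n)" for N
      by (intro pos_kernel_sum pos_kernel_mult pos_kernel_const c pos_kernel_power pw)
    fix x y assume xy: "x \<in> I" "y \<in> I"
    have "\<bar>- w x y\<bar> < 1" using w(1)[OF xy] by simp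
    from gen_binomial_real[OF this, of "- t"]
    have "(\<lambda>n. c n * w x y ^ n) sums (1 + - w x y) powr (- t)"
      by (simp add: c_def power_minus[of "w x y"] mult_ac)
    moreover have "(1 + - w x y) powr (- t) = exp (- t * ln (1 - w x y))"
      using w(1)[OF xy] by (simp add: powr_def)
    ultimately show "(\<lambda>N. \<Sum>n<N. c n * w x y ^ n) \<longlonglongrightarrow> exp (- t * ln (1 - w x y))"
      by (simp add: sums_def)
  qed
  then have "pos_kernel I (\<lambda>x y. (exp (- t * ln (p x)) * exp (- t * ln (p y))) * exp (- t * ln (1 - w x y)))"
    by (intro pos_kernel_mult pos_kernel_feature)
  then show ?thesis
  proof (rule pos_kernel_cong)
    fix x y assume xy: "x \<in> I" "y \<in> I"
    have "ln (lor x y) = ln (p x) + ln (p y) + ln (1 - w x y)"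
      unfolding w(2)[OF xy] using pos[OF xy(1)] pos[OF xy(2)] w(1)[OF xy] by (simp add: ln_mult)
    then show "exp (- t * ln (lor x y)) = (exp (- t * ln (p x)) * exp (- t * ln (p y))) * exp (- t * ln (1 - w x y))"
      by (simp add: exp_add[symmetric] algebra_simps)
  qed
qed

text \<open>From \<open>(p y - m) (p y + m) = 1\<close> and \<open>m \<le> p y\<close> one gets
  \<open>p x \<le> 2 * p y * lor y x\<close>, while \<open>lor x z \<le> 2 * p x * p z\<close>. The
  constant is crude, but after taking logarithms it is additive, which is all that
  \<open>neg_length\<close> asks.\<close>

lemma lor_triangle:
  assumes "x \<in> I" "y \<in> I" "z \<in> I" shows "lor x z \<le> 4 * p y * p z * lor y x"
proof -
  define m where "m = sqrt ((q y)\<^sup>2 + (r y)\<^sup>2)"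
  have m2: "m\<^sup>2 = (q y)\<^sup>2 + (r y)\<^sup>2" by (simp add: m_def)
  have m0: "0 \<le> m" by (simp add: m_def)
  have P: "0 < p x" "0 < p y" "0 < p z" using pos assms by auto
  have "m\<^sup>2 \<le> (p y)\<^sup>2" using eq[OF assms(2)] m2 by simp
  then have mp: "m \<le> p y" by (rule power2_le_imp_le) (use P in linarith)
  have "(q y * q x + r y * r x)\<^sup>2 = m\<^sup>2 * ((q x)\<^sup>2 + (r x)\<^sup>2) - (q y * r x - r y * q x)\<^sup>2"
    unfolding m2 by (simp add: power2_eq_square algebra_simps)
  also have "\<dots> \<le> m\<^sup>2 * (p x)\<^sup>2"
  proof -
    have "m\<^sup>2 * ((q x)\<^sup>2 + (r x)\<^sup>2) \<le> m\<^sup>2 * (p x)\<^sup>2"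
      using eq[OF assms(1)] by (intro mult_left_mono) simp_all
    then show ?thesis using zero_le_power2[of "q y * r x - r y * q x"] by linarith
  qed
  finally have "(q y * q x + r y * r x)\<^sup>2 \<le> (m * p x)\<^sup>2" by (simp add: power_mult_distrib)
  then have "q y * q x + r y * r x \<le> m * p x" by (rule power2_le_imp_le) (use m0 P in simp)
  then have D: "p x * (p y - m) \<le> lor y x" by (simp add: lor_def algebra_simps)
  have "p x = p x * ((p y + m) * (p y - m))"
    using eq[OF assms(2)] m2 by (simp add: power2_eq_square algebra_simps)
  also have "\<dots> = (p y + m) * (p x * (p y - m))" by simp
  also have "\<dots> \<le> (2 * p y) * (p x * (p y - m))" using mp P by (intro mult_right_mono) auto
  also have "\<dots> \<le> (2 * p y) * lor y x" using D P by (intro mult_left_mono) auto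
  finally have "p x * (2 * p z) \<le> (2 * p y * lor y x) * (2 * p z)" using P by (intro mult_right_mono) auto
  moreover have "lor x z \<le> p x * (2 * p z)"
    using abs_product_less[OF assms(1,3)] by (simp add: lor_def)
  ultimately show ?thesis by (simp add: mult_ac)
qed

end

lemma (in group) lor_bounded:
  assumes b: "bounded_lengths G" and hyp: "hyperboloid_points (carrier G) p q r"
    and inv: "\<And>g x y. \<lbrakk>g \<in> carrier G; x \<in> carrier G; y \<in> carrier G\<rbrakk> \<Longrightarrow>
      hyperboloid_points.lor p q r (g \<otimes> x) (g \<otimes> y) = hyperboloid_points.lor p q r x y"
  obtains C where "\<And>x. x \<in> carrier G \<Longrightarrow> hyperboloid_points.lor p q r x \<one> \<le> C"
proof -
  interpret hyperboloid_points "carrier G" p q r by (rule hyp)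
  have "neg_length G (\<lambda>x y. ln (lor x y))"
    unfolding neg_length_def
  proof (intro conjI allI impI ballI)
    fix y assume y: "y \<in> carrier G"
    have "ln (lor x \<one>) \<le> ln (lor y x) + ln (4 * p y * p \<one>)" if x: "x \<in> carrier G" for x
    proof -
      have l: "1 \<le> lor x \<one>" "1 \<le> lor y x" using lor_ge_1 x y by auto
      have P: "0 < 4 * p y * p \<one>" using pos y by simp
      have "ln (lor x \<one>) \<le> ln (4 * p y * p \<one> * lor y x)"
        using lor_triangle[OF x y one_closed] l P by (subst ln_le_cancel_iff) auto
      also have "\<dots> = ln (4 * p y * p \<one>) + ln (lor y x)" by (rule ln_mult_pos) (use l P in linarith)+
      finally show ?thesis by simp
    qed
    then show "\<exists>C. \<forall>x\<in>carrier G. ln (lor x \<one>) \<le> ln (lor y x) + C" by blast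
  next
    fix t :: real assume "0 < t"
    then show "pos_kernel (carrier G) (\<lambda>x y. exp (- t * ln (lor x y)))" by (rule pos_kernel_lor)
  next
    show "ln (lor (g \<otimes> x) (g \<otimes> y)) = ln (lor x y)"
      if "g \<in> carrier G" "x \<in> carrier G" "y \<in> carrier G" for g x y
      by (simp only: inv[OF that])
    show "ln (lor x x) = 0" if "x \<in> carrier G" for x
      by (simp only: lor_self[OF that] ln_one)
    show "0 \<le> ln (lor x y)" if "x \<in> carrier G" "y \<in> carrier G" for x y
      by (rule ln_ge_zero[OF lor_ge_1[OF that]])
  qed
  from b[unfolded bounded_lengths_def, rule_format, OF this]
  obtain C where C: "\<forall>x\<in>carrier G. ln (lor x \<one>) \<le> C" by blast
  have "lor x \<one> \<le> exp C" if x: "x \<in> carrier G" for x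
  proof -
    have "0 < lor x \<one>" using lor_ge_1[OF x one_closed] by linarith
    then show ?thesis using bspec[OF C x] exp_le_cancel_iff[of "ln (lor x \<one>)" C] by simp
  qed
  then show thesis by (rule that)
qed

section \<open>Germs at directed points\<close>

text \<open>\<open>(x, True)\<close> is the germ of the circle at \<open>x\<close> on the right, \<open>(x, False)\<close> the one on the left;
  \<open>tt\<close> is the coordinate of such a point in the fundamental domain \<open>[0, 1]\<close>, which is 0 for the
  right germ and 1 for the left germ at the base point.\<close>

type_synonym dpoint = "circle \<times> bool"

definition sg :: "bool \<Rightarrow> real" where "sg b = (if b then 1 else - 1)"

definition tt :: "dpoint \<Rightarrow> real" where
  "tt d = (if snd d then frac (rep_circle (fst d)) else 1 - frac (- rep_circle (fst d)))"

text \<open>The point at distance \<open>u\<close> from \<open>d\<close> on the side to which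
  \<open>d\<close> looks, taken with an arbitrary direction \<open>b\<close>.\<close>

definition nb :: "dpoint \<Rightarrow> real \<Rightarrow> bool \<Rightarrow> dpoint" where
  "nb d u b = (to_circle (tt d + sg (snd d) * u), b)"

lemma sg_simps [simp]: "sg True = 1" "sg False = - 1" "sg b * sg b = 1" "sg b \<noteq> 0" "sg (\<not> b) = - sg b"
  by (auto simp: sg_def)

lemma to_circle_tt: "to_circle (tt d) = fst d"
proof -
  have "to_circle (rep_circle (fst d)) = fst d" by (rule Quotient_abs_rep[OF Quotient_circle])
  moreover have "to_circle (tt d) = to_circle (rep_circle (fst d))"
    by (simp add: to_circle_eq_iff tt_def frac_def)
  ultimately show ?thesis by simp
qed

lemma tt_range: "snd d \<Longrightarrow> 0 \<le> tt d" "snd d \<Longrightarrow> tt d < 1" "\<not> snd d \<Longrightarrow> 0 < tt d" "\<not> snd d \<Longrightarrow> tt d \<le> 1"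
  "0 \<le> tt d" "tt d \<le> 1"
proof -
  have 1: "0 \<le> frac x" "frac x < 1" "frac x \<le> 1" for x :: real
    using frac_lt_1[of x] by simp_all
  show "snd d \<Longrightarrow> 0 \<le> tt d" "snd d \<Longrightarrow> tt d < 1" "\<not> snd d \<Longrightarrow> 0 < tt d" "\<not> snd d \<Longrightarrow> tt d \<le> 1"
    "0 \<le> tt d" "tt d \<le> 1"
    using 1 by (simp_all add: tt_def)
qed

lemma tt_eqI:
  assumes "to_circle s = fst d" "if snd d then 0 \<le> s \<and> s < 1 else 0 < s \<and> s \<le> 1"
  shows "tt d = s"
proof -
  have "tt d - s \<in> \<int>" using assms(1) to_circle_tt[of d] by (simp add: to_circle_eq_iff[symmetric])
  then obtain n where n: "tt d - s = of_int n" by (rule Ints_cases)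
  have "\<bar>tt d - s\<bar> < 1" using assms(2) tt_range(1-4)[of d] by (auto split: if_splits)
  then have "n = 0" using n by linarith
  then show ?thesis using n by simp
qed

lemma tt_interior: "\<lbrakk>0 < s; s < 1\<rbrakk> \<Longrightarrow> tt (to_circle s, b) = s"
  by (rule tt_eqI) auto

lemma tt_inj: "tt d = tt e \<Longrightarrow> snd d = snd e \<Longrightarrow> d = e"
  using to_circle_tt[of d] to_circle_tt[of e] by (simp add: prod_eq_iff)

lemma tt_flip: "0 < tt d \<Longrightarrow> tt d < 1 \<Longrightarrow> tt (fst d, b) = tt d"
  by (rule tt_eqI) (auto simp: to_circle_tt)

lemma eventually_nb: "\<forall>\<^sub>F u in at_right 0. 0 < u \<and> 0 < tt d + sg (snd d) * u \<and> tt d + sg (snd d) * u < 1"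
proof (cases "snd d")
  case True
  then show ?thesis using tt_range(1,2)[of d]
    by (auto simp: eventually_at_right_field intro!: exI[of _ "1 - tt d"])
next
  case False
  then show ?thesis using tt_range(3,4)[of d]
    by (auto simp: eventually_at_right_field intro!: exI[of _ "tt d"])
qed

lemma tt_nb: "\<lbrakk>0 < tt d + sg (snd d) * u; tt d + sg (snd d) * u < 1\<rbrakk> \<Longrightarrow> tt (nb d u b) = tt d + sg (snd d) * u"
  unfolding nb_def by (rule tt_interior)

lemma eventually_at_right_imp_ex:
  assumes "\<forall>\<^sub>F u in at_right (0 :: real). P u" obtains u where "0 < u" "P u"
proof -
  have "\<forall>\<^sub>F u in at_right (0 :: real). P u \<and> 0 < u"
    using assms eventually_at_right_less by (rule eventually_conj)
  then show thesis using that by (auto dest!: eventually_happens)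
qed

lemma interior: "fst d \<noteq> to_circle 0 \<longleftrightarrow> 0 < tt d \<and> tt d < 1"
proof
  assume d: "fst d \<noteq> to_circle 0"
  have "to_circle 1 = to_circle 0" by (simp add: to_circle_eq_iff)
  then have "tt d \<noteq> 0" "tt d \<noteq> 1" using d to_circle_tt[of d] by auto
  then show "0 < tt d \<and> tt d < 1" using tt_range(5,6)[of d] by linarith
next
  assume t: "0 < tt d \<and> tt d < 1"
  show "fst d \<noteq> to_circle 0"
  proof
    assume "fst d = to_circle 0"
    then have "tt d \<in> \<int>" using to_circle_tt[of d] by (simp add: to_circle_eq_iff)
    then obtain n where "tt d = of_int n" by (rule Ints_cases)
    then have "0 < n" "n < 1" using t by simp_all
    then show False by linarith
  qed
qed

definition pt :: "real \<Rightarrow> real^2" where "pt t = vector [t, 1]"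

lemma pt_simps [simp]: "pt t $ 1 = t" "pt t $ 2 = 1"
  by (simp_all add: pt_def)

lemma vec2_eq_iff: "(v :: 'a^2) = w \<longleftrightarrow> v $ 1 = w $ 1 \<and> v $ 2 = w $ 2"
  by (simp add: vec_eq_iff forall_2)

lemma mat2_eq_iff: "(m :: 'a^2^2) = n \<longleftrightarrow> m$1$1 = n$1$1 \<and> m$1$2 = n$1$2 \<and> m$2$1 = n$2$1 \<and> m$2$2 = n$2$2"
  by (simp add: vec_eq_iff forall_2)

lemma mat2_mult: "((m :: 'a::semiring_1^2^2) ** (n :: 'a^2^2)) $ i $ j = m$i$1 * n$1$j + m$i$2 * n$2$j"
  by (simp add: matrix_matrix_mult_def sum_2)

lemma mat2_vec: "((m :: 'a::semiring_1^2^2) *v v) $ i = m$i$1 * v$1 + m$i$2 * v$2"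
  by (simp add: matrix_vector_mult_def sum_2)

lemma mat2_one: "(mat 1 :: 'a::zero_neq_one^2^2)$1$1 = 1" "(mat 1 :: 'a::zero_neq_one^2^2)$1$2 = 0" "(mat 1 :: 'a::zero_neq_one^2^2)$2$1 = 0" "(mat 1 :: 'a::zero_neq_one^2^2)$2$2 = 1"
  by (simp_all add: mat_def)

lemma scale_mult: "(c *\<^sub>R m) ** n = c *\<^sub>R (m ** n)" "m ** (c *\<^sub>R n) = c *\<^sub>R (m ** n)" for m n :: "real^2^2"
  by (simp_all add: mat2_eq_iff mat2_mult algebra_simps)

lemma det_inverse: "m ** n = mat 1 \<Longrightarrow> det m \<noteq> 0" "m ** n = mat 1 \<Longrightarrow> det n \<noteq> 0" for m n :: "real^2^2"
  using det_mul[of m n] by auto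

lemma mult_inverse_comm: "m ** n = mat 1 \<Longrightarrow> n ** m = mat 1" for m n :: "real^2^2"
  by (simp add: matrix_left_right_inverse)

lemma cancel_left: "\<lbrakk>m' ** m = mat 1; m ** x = m ** y\<rbrakk> \<Longrightarrow> x = y" for m m' x y :: "real^2^2"
  by (metis matrix_mul_assoc matrix_mul_lid)

lemma cancel_right: "\<lbrakk>m ** m' = mat 1; x ** m = y ** m\<rbrakk> \<Longrightarrow> x = y" for m m' x y :: "real^2^2"
  by (metis matrix_mul_assoc matrix_mul_rid)

text \<open>The matrix \<open>al g d\<close> describes the germ of \<open>g\<close> at \<open>d\<close> as a homography in the coordinates \<open>tt\<close>;
  it is normalised by \<open>al_pt\<close>.\<close>

locale germ_group = group G for G :: "('a, 'b) monoid_scheme" (structure) +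
  fixes ac :: "'a \<Rightarrow> dpoint \<Rightarrow> dpoint" and al :: "'a \<Rightarrow> dpoint \<Rightarrow> real^2^2"
  assumes ac_one: "ac \<one> d = d" and al_one: "al \<one> d = mat 1"
    and ac_mult: "\<lbrakk>g \<in> carrier G; h \<in> carrier G\<rbrakk> \<Longrightarrow> ac (g \<otimes> h) d = ac g (ac h d)"
    and al_mult: "\<lbrakk>g \<in> carrier G; h \<in> carrier G\<rbrakk> \<Longrightarrow> al (g \<otimes> h) d = al g (ac h d) ** al h d"
    and al_pt: "g \<in> carrier G \<Longrightarrow> al g d *v pt (tt d) = pt (tt (ac g d))"
    and local: "g \<in> carrier G \<Longrightarrow> \<exists>\<eta>. filterlim \<eta> (at_right 0) (at_right 0) \<and>
      (\<forall>\<^sub>F u in at_right 0. \<forall>b. ac g (nb d u b) = nb (ac g d) (\<eta> u) (b = (0 < det (al g d))) \<and>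
         (\<exists>c. al g (nb d u b) = c *\<^sub>R al g d))"
    and ac_dir: "g \<in> carrier G \<Longrightarrow> snd (ac g d) = (snd d = (0 < det (al g d)))"
    and smooth: "g \<in> carrier G \<Longrightarrow> finite {x. \<not> (\<exists>y b. y \<noteq> to_circle 0 \<and> ac g (x, True) = (y, b) \<and>
      ac g (x, False) = (y, \<not> b) \<and> al g (x, True) = al g (x, False))}"
    and faithful: "\<lbrakk>g \<in> carrier G; \<And>x. fst (ac g (x, True)) = x\<rbrakk> \<Longrightarrow> g = \<one>"
    and FW: "property_FW G"
begin

section \<open>The gluing of directed points and its invariant modification\<close>

lemma ac_inv: "g \<in> carrier G \<Longrightarrow> ac (inv g) (ac g d) = d" "g \<in> carrier G \<Longrightarrow> ac g (ac (inv g) d) = d"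
  using ac_mult[of "inv g" g d] ac_mult[of g "inv g" d] by (simp_all add: ac_one)

lemma al_inv: "g \<in> carrier G \<Longrightarrow> al (inv g) (ac g d) ** al g d = mat 1"
  "g \<in> carrier G \<Longrightarrow> al g d ** al (inv g) (ac g d) = mat 1"
proof -
  assume g: "g \<in> carrier G"
  show "al (inv g) (ac g d) ** al g d = mat 1"
    using al_mult[of "inv g" g d] g by (simp add: al_one)
  then show "al g d ** al (inv g) (ac g d) = mat 1" by (rule mult_inverse_comm)
qed

lemma al_det: "g \<in> carrier G \<Longrightarrow> det (al g d) \<noteq> 0"
  by (rule det_inverse(1)[OF al_inv(2)])

text \<open>A triple \<open>(d, e, m)\<close> is an identification of the germ of the circle at
  \<open>d\<close> with that at \<open>e\<close> by the homography \<open>m\<close>; the group moves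
  both germs and conjugates \<open>m\<close> accordingly.\<close>

definition act :: "'a \<Rightarrow> dpoint \<times> dpoint \<times> (real^2^2) \<Rightarrow> dpoint \<times> dpoint \<times> (real^2^2)" where
  "act g = (\<lambda>(d, e, m). (ac g d, ac g e, al g e ** m ** al (inv g) (ac g d)))"

lemma act_one: "act \<one> y = y"
  by (cases y) (simp add: act_def ac_one al_one)

lemma act_mult:
  assumes "g \<in> carrier G" "h \<in> carrier G" shows "act (g \<otimes> h) y = act g (act h y)"
proof -
  obtain d e m where y: "y = (d, e, m)" by (cases y)
  have "al (inv (g \<otimes> h)) (ac g (ac h d)) = al (inv h) (ac h d) ** al (inv g) (ac g (ac h d))"
    using assms al_mult[of "inv h" "inv g" "ac g (ac h d)"] ac_inv(1)[of g "ac h d"] by (simp add: inv_mult_group)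
  then show ?thesis
    using assms by (simp add: y act_def ac_mult al_mult matrix_mul_assoc)
qed

definition flip :: "dpoint \<Rightarrow> dpoint" where "flip d = (fst d, \<not> snd d)"

lemma flip_flip [simp]: "flip (flip d) = d" and flip_neq: "flip d \<noteq> d" "d \<noteq> flip d"
  by (auto simp: flip_def prod_eq_iff)

text \<open>The base point is left out: its two directed points have the coordinates 0 and 1, which
  the identity matrix does not match.\<close>

definition MM :: "(dpoint \<times> dpoint \<times> (real^2^2)) set" where
  "MM = {(d, flip d, mat 1) | d. fst d \<noteq> to_circle 0}"

text \<open>Working in the orbit of \<open>MM\<close> instead of all triples gives every new gluing
  the properties in \<open>YY_props\<close>: invertibility, compatibility with the coordinates, and
  triangularity in the affine case.\<close>

definition YY :: "(dpoint \<times> dpoint \<times> (real^2^2)) set" where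
  "YY = {act g m | g m. g \<in> carrier G \<and> m \<in> MM}"

lemma YY_props:
  assumes "(d, e, m) \<in> YY"
  shows "det m \<noteq> 0" "m *v pt (tt d) = pt (tt e)"
    and "(\<And>g d. g \<in> carrier G \<Longrightarrow> al g d $ 2 $ 1 = 0) \<Longrightarrow> m $ 2 $ 1 = 0"
proof -
  obtain g d0 where g: "g \<in> carrier G" and d0: "fst d0 \<noteq> to_circle 0"
    and eq: "(d, e, m) = act g (d0, flip d0, mat 1)"
    using assms unfolding YY_def MM_def by blast
  have m: "m = al g (flip d0) ** al (inv g) (ac g d0)" and de: "d = ac g d0" "e = ac g (flip d0)"
    using eq by (simp_all add: act_def)
  show "det m \<noteq> 0" unfolding m det_mul using al_det g by simp
  have "al (inv g) (ac g d0) *v pt (tt (ac g d0)) = pt (tt d0)"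
    using al_pt[of "inv g" "ac g d0"] g by (simp add: ac_inv)
  moreover have "tt (flip d0) = tt d0" unfolding flip_def using d0 interior by (intro tt_flip) auto
  ultimately show "m *v pt (tt d) = pt (tt e)"
    using al_pt[OF g, of "flip d0"] by (simp add: m de matrix_vector_mul_assoc[symmetric])
  show "m $ 2 $ 1 = 0" if "\<And>g d. g \<in> carrier G \<Longrightarrow> al g d $ 2 $ 1 = 0"
    using that g by (simp add: m mat2_mult)
qed

definition rough :: "'a \<Rightarrow> circle set" where
  "rough g = {x. \<not> (\<exists>y b. y \<noteq> to_circle 0 \<and> ac g (x, True) = (y, b) \<and>
      ac g (x, False) = (y, \<not> b) \<and> al g (x, True) = al g (x, False))}"

lemma act_smooth:
  assumes g: "g \<in> carrier G" and x: "fst d \<notin> rough g"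
  shows "act g (d, flip d, mat 1) \<in> MM"
proof -
  obtain y b where y: "y \<noteq> to_circle 0" "ac g (fst d, True) = (y, b)" "ac g (fst d, False) = (y, \<not> b)"
      "al g (fst d, True) = al g (fst d, False)"
    using x unfolding rough_def by blast
  have "ac g (flip d) = flip (ac g d)" "fst (ac g d) \<noteq> to_circle 0" "al g (flip d) = al g d"
    using y by (cases "snd d"; cases d; simp add: flip_def)+
  then have "act g (d, flip d, mat 1) = (ac g d, flip (ac g d), mat 1)" "fst (ac g d) \<noteq> to_circle 0"
    using g by (simp_all add: act_def al_inv)
  then show ?thesis unfolding MM_def by blast
qed

text \<open>\<open>act g\<close> keeps a standard gluing standard unless it lies over the finite set
  \<open>rough g\<close>; the symmetric difference comes from such exceptions for \<open>g\<close>
  and for its inverse.\<close>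

lemma ex_invariant_gluing:
  "\<exists>M0. M0 \<subseteq> YY \<and> (\<forall>g\<in>carrier G. \<forall>x\<in>M0. act g x \<in> M0) \<and> finite (sym_diff MM M0)"
proof (rule FW_transfix[OF FW is_group])
  show "act g y \<in> YY" if "g \<in> carrier G" "y \<in> YY" for g y
  proof -
    obtain h m where "y = act h m" "h \<in> carrier G" "m \<in> MM" using \<open>y \<in> YY\<close> unfolding YY_def by blast
    then have "act g y = act (g \<otimes> h) m" "g \<otimes> h \<in> carrier G" using \<open>g \<in> carrier G\<close> by (simp_all add: act_mult)
    then show ?thesis unfolding YY_def using \<open>m \<in> MM\<close> by blast
  qed
  show "MM \<subseteq> YY"
  proof
    fix m assume "m \<in> MM"
    then have "m = act \<one> m \<and> \<one> \<in> carrier G \<and> m \<in> MM" by (simp add: act_one)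
    then show "m \<in> YY" unfolding YY_def by blast
  qed
  have bad: "finite {m \<in> MM. act g m \<notin> MM}" if g: "g \<in> carrier G" for g
  proof (rule finite_subset)
    show "{m \<in> MM. act g m \<notin> MM} \<subseteq> (\<lambda>d. (d, flip d, mat 1)) ` (rough g \<times> UNIV)"
    proof
      fix m assume m: "m \<in> {m \<in> MM. act g m \<notin> MM}"
      then obtain d where d: "m = (d, flip d, mat 1)" unfolding MM_def by blast
      then have "fst d \<in> rough g" using act_smooth[OF g, of d] m by auto
      then show "m \<in> (\<lambda>d. (d, flip d, mat 1)) ` (rough g \<times> UNIV)"
        unfolding d by (intro imageI) (simp add: mem_Times_iff)
    qed
    show "finite ((\<lambda>d. (d, flip d, mat 1 :: real^2^2)) ` (rough g \<times> UNIV))"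
      using smooth[OF g] by (simp add: rough_def)
  qed
  show "finite (sym_diff MM (act g ` MM))" if g: "g \<in> carrier G" for g
  proof (rule finite_subset)
    show "sym_diff MM (act g ` MM) \<subseteq> {m \<in> MM. act (inv g) m \<notin> MM} \<union> act g ` {m \<in> MM. act g m \<notin> MM}"
    proof
      fix y assume y: "y \<in> sym_diff MM (act g ` MM)"
      show "y \<in> {m \<in> MM. act (inv g) m \<notin> MM} \<union> act g ` {m \<in> MM. act g m \<notin> MM}"
      proof (cases "y \<in> MM")
        case True
        have "act g (act (inv g) y) = y" using g act_mult[of g "inv g" y] by (simp add: act_one)
        moreover have "y \<notin> act g ` MM" using True y by blast
        ultimately have "act (inv g) y \<notin> MM" by (metis imageI)
        then show ?thesis using True by blast
      next
        case False
        then show ?thesis using y by blast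
      qed
    qed
    show "finite ({m \<in> MM. act (inv g) m \<notin> MM} \<union> act g ` {m \<in> MM. act g m \<notin> MM})"
      using bad[OF g] bad[of "inv g"] g by simp
  qed
qed (simp_all add: act_one act_mult)

definition M0 :: "(dpoint \<times> dpoint \<times> (real^2^2)) set" where
  "M0 = (SOME M0. M0 \<subseteq> YY \<and> (\<forall>g\<in>carrier G. \<forall>x\<in>M0. act g x \<in> M0) \<and> finite (sym_diff MM M0))"

lemma M0: "M0 \<subseteq> YY" "\<lbrakk>g \<in> carrier G; x \<in> M0\<rbrakk> \<Longrightarrow> act g x \<in> M0" "finite (sym_diff MM M0)"
proof -
  have *: "M0 \<subseteq> YY \<and> (\<forall>g\<in>carrier G. \<forall>x\<in>M0. act g x \<in> M0) \<and> finite (sym_diff MM M0)"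
    unfolding M0_def by (rule someI_ex[OF ex_invariant_gluing])
  from * show "M0 \<subseteq> YY" by (rule conjunct1)
  from * show "finite (sym_diff MM M0)" by (intro conjunct2[OF conjunct2[OF *]])
  from * show "act g x \<in> M0" if "g \<in> carrier G" "x \<in> M0" using that by blast
qed

lemma M0_iff: assumes "g \<in> carrier G" shows "act g x \<in> M0 \<longleftrightarrow> x \<in> M0"
proof -
  have "act (inv g) (act g x) = x" using assms act_mult[of "inv g" g x] by (simp add: act_one)
  then show ?thesis using M0(2)[of g x] M0(2)[of "inv g" "act g x"] assms by auto
qed

definition glues :: "dpoint \<Rightarrow> (dpoint \<times> (real^2^2)) set" where "glues d = {em. (d, em) \<in> M0}"

text \<open>The partner of \<open>d\<close> and, below, the homography onto it; both are meaningful
  only if \<open>d\<close> has exactly one gluing in \<open>M0\<close>.\<close>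

definition pr :: "dpoint \<Rightarrow> dpoint" where "pr d = fst (THE em. glues d = {em})"
definition ga :: "dpoint \<Rightarrow> real^2^2" where "ga d = snd (THE em. glues d = {em})"

definition good :: "dpoint \<Rightarrow> bool" where "good d \<longleftrightarrow> (\<exists>em. glues d = {em})"

lemma glues_good: "good d \<Longrightarrow> glues d = {(pr d, ga d)}"
  unfolding good_def pr_def ga_def by (elim exE) simp

lemma glues_ac:
  assumes g: "g \<in> carrier G"
  shows "glues (ac g d) = (\<lambda>(e, m). (ac g e, al g e ** m ** al (inv g) (ac g d))) ` glues d"
proof (intro equalityI subsetI)
  fix em assume em: "em \<in> glues (ac g d)"
  obtain e m where e: "em = (e, m)" by (cases em)
  define e' m' where "e' = ac (inv g) e" and "m' = al (inv g) e ** m ** al g d"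
  have ee: "ac g e' = e" using g by (simp add: e'_def ac_inv)
  have "al g e' ** al (inv g) e = mat 1" using al_inv(2)[OF g, of e'] by (simp add: ee)
  then have mm: "al g e' ** m' ** al (inv g) (ac g d) = m"
  proof -
    have "al g e' ** m' ** al (inv g) (ac g d) = (al g e' ** al (inv g) e) ** m ** (al g d ** al (inv g) (ac g d))"
      unfolding m'_def by (simp only: matrix_mul_assoc)
    then show ?thesis unfolding \<open>al g e' ** al (inv g) e = mat 1\<close> al_inv(2)[OF g] by simp
  qed
  have "act g (d, e', m') = (ac g d, e, m)" by (simp add: act_def ee mm)
  then have "(e', m') \<in> glues d" using em M0_iff[OF g, of "(d, e', m')"] by (simp add: glues_def e)
  then show "em \<in> (\<lambda>(e, m). (ac g e, al g e ** m ** al (inv g) (ac g d))) ` glues d"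
    by (rule image_eqI[rotated]) (simp add: e ee mm)
next
  fix em assume "em \<in> (\<lambda>(e, m). (ac g e, al g e ** m ** al (inv g) (ac g d))) ` glues d"
  then obtain e m where "(e, m) \<in> glues d" "em = (ac g e, al g e ** m ** al (inv g) (ac g d))" by auto
  then show "em \<in> glues (ac g d)" using M0(2)[OF g, of "(d, e, m)"] by (simp add: glues_def act_def)
qed

lemma good_ac:
  assumes g: "g \<in> carrier G" and d: "good d"
  shows "good (ac g d)" "pr (ac g d) = ac g (pr d)" "ga (ac g d) = al g (pr d) ** ga d ** al (inv g) (ac g d)"
proof -
  have 1: "glues (ac g d) = {(ac g (pr d), al g (pr d) ** ga d ** al (inv g) (ac g d))}"
    by (simp add: glues_ac[OF g] glues_good[OF d])
  then show 2: "good (ac g d)" by (auto simp: good_def)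
  show "pr (ac g d) = ac g (pr d)" "ga (ac g d) = al g (pr d) ** ga d ** al (inv g) (ac g d)"
    using 1 unfolding glues_good[OF 2] by auto
qed

lemma ga_props:
  assumes "good d"
  shows "det (ga d) \<noteq> 0" "ga d *v pt (tt d) = pt (tt (pr d))"
    "(\<And>g d. g \<in> carrier G \<Longrightarrow> al g d $ 2 $ 1 = 0) \<Longrightarrow> ga d $ 2 $ 1 = 0"
proof -
  have "(pr d, ga d) \<in> glues d" unfolding glues_good[OF assms] by simp
  then have "(d, pr d, ga d) \<in> M0" unfolding glues_def by (rule CollectD)
  then have "(d, pr d, ga d) \<in> YY" by (rule subsetD[OF M0(1)])
  note Y = YY_props[OF this]
  show "det (ga d) \<noteq> 0" by (rule Y(1))
  show "ga d *v pt (tt d) = pt (tt (pr d))" by (rule Y(2))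
  show "ga d $ 2 $ 1 = 0" if a: "\<And>g d. g \<in> carrier G \<Longrightarrow> al g d $ 2 $ 1 = 0" by (rule Y(3)) (rule a)
qed

definition std :: "dpoint \<Rightarrow> bool" where
  "std d \<longleftrightarrow> fst d \<noteq> to_circle 0 \<and> glues d = {(flip d, mat 1)}"

lemma std_props: assumes "std d" shows "good d" "pr d = flip d" "ga d = mat 1"
proof -
  have g: "glues d = {(flip d, mat 1)}" using assms by (simp add: std_def)
  then show d: "good d" unfolding good_def by (rule exI)
  have "(flip d, mat 1) = (pr d, ga d)" using g unfolding glues_good[OF d] by (rule singleton_inject[OF sym])
  then show "pr d = flip d" "ga d = mat 1" by simp_all
qed

text \<open>The set where \<open>M0\<close> is an honest gluing: unique, symmetric and without fixed
  points. It is invariant under the group, and its complement is finite.\<close>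

definition UU :: "dpoint set" where
  "UU = {d. good d \<and> good (pr d) \<and> pr (pr d) = d \<and> ga (pr d) ** ga d = mat 1 \<and> pr d \<noteq> d}"

lemma std_UU: "std d \<Longrightarrow> std (flip d) \<Longrightarrow> d \<in> UU"
  by (simp add: UU_def std_props flip_neq)

lemma finite_not_std: "finite {d. \<not> std d}"
proof (rule finite_subset)
  show "{d. \<not> std d} \<subseteq> {to_circle 0} \<times> UNIV \<union> fst ` sym_diff MM M0"
  proof
    fix d assume "d \<in> {d. \<not> std d}"
    then have d: "\<not> std d" by simp
    show "d \<in> {to_circle 0} \<times> UNIV \<union> fst ` sym_diff MM M0"
    proof (cases "fst d = to_circle 0")
      case True
      then show ?thesis by (cases d) simp
    next
      case False
      then have M: "(d, em) \<in> MM \<longleftrightarrow> em = (flip d, mat 1)" for em unfolding MM_def by blast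
      have "\<not> (\<forall>em. (d, em) \<in> M0 \<longleftrightarrow> (d, em) \<in> MM)"
      proof
        assume a: "\<forall>em. (d, em) \<in> M0 \<longleftrightarrow> (d, em) \<in> MM"
        have "glues d = {(flip d, mat 1)}"
        proof (intro equalityI subsetI)
          fix em assume "em \<in> glues d"
          then have "(d, em) \<in> M0" by (simp add: glues_def)
          then show "em \<in> {(flip d, mat 1)}" using a M[of em] by simp
        next
          fix em assume "em \<in> {(flip d, mat 1 :: real^2^2)}"
          then have "(d, em) \<in> MM" using M[of em] by simp
          then have "(d, em) \<in> M0" using a by blast
          then show "em \<in> glues d" unfolding glues_def by (rule CollectI)
        qed
        then show False using d False by (simp add: std_def)
      qed
      then obtain em where "\<not> ((d, em) \<in> M0 \<longleftrightarrow> (d, em) \<in> MM)" by blast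
      then have "(d, em) \<in> sym_diff MM M0" by blast
      then have "fst (d, em) \<in> fst ` sym_diff MM M0" by (rule imageI)
      then show ?thesis by simp
    qed
  qed
  show "finite ({to_circle 0} \<times> UNIV \<union> fst ` sym_diff MM M0)" using M0(3) by simp
qed

definition crit :: "dpoint set" where "crit = {d. \<not> std d \<or> \<not> std (flip d)}"

lemma finite_crit: "finite crit"
proof -
  have "crit \<subseteq> {d. \<not> std d} \<union> flip ` {d. \<not> std d}"
  proof
    fix d assume "d \<in> crit"
    then have "\<not> std d \<or> flip d \<in> {d. \<not> std d}" by (simp add: crit_def)
    then show "d \<in> {d. \<not> std d} \<union> flip ` {d. \<not> std d}"
    proof
      assume "flip d \<in> {d. \<not> std d}"
      then have "flip (flip d) \<in> flip ` {d. \<not> std d}" by (rule imageI)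
      then show ?thesis unfolding flip_flip by (rule UnI2)
    next
      assume "\<not> std d"
      then have "d \<in> {d. \<not> std d}" by (rule CollectI)
      then show ?thesis by (rule UnI1)
    qed
  qed
  then show ?thesis by (rule finite_subset) (intro finite_UnI finite_imageI finite_not_std)
qed

lemma UU_crit: "- UU \<subseteq> crit"
proof
  fix d assume "d \<in> - UU"
  then have "\<not> (std d \<and> std (flip d))" using std_UU by blast
  then show "d \<in> crit" unfolding crit_def de_Morgan_conj by (rule CollectI)
qed

lemma UU_ac: assumes g: "g \<in> carrier G" shows "ac g d \<in> UU \<longleftrightarrow> d \<in> UU"
proof -
  have 1: "ac g d \<in> UU" if g: "g \<in> carrier G" and d: "d \<in> UU" for g d
  proof -
    have G: "good d" "good (pr d)" "pr (pr d) = d" "ga (pr d) ** ga d = mat 1" "pr d \<noteq> d"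
      using d by (auto simp: UU_def)
    note A = good_ac[OF g G(1)] and B = good_ac[OF g G(2)]
    have "ga (ac g (pr d)) ** ga (ac g d) = al g d ** ga (pr d) ** (al (inv g) (ac g (pr d)) ** al g (pr d)) ** ga d ** al (inv g) (ac g d)"
      using A(3) B(3) G(3) by (simp only: matrix_mul_assoc)
    also have "\<dots> = al g d ** (ga (pr d) ** ga d) ** al (inv g) (ac g d)"
      unfolding al_inv(1)[OF g] by (simp only: matrix_mul_assoc matrix_mul_rid)
    also have "\<dots> = mat 1" unfolding G(4) by (simp add: al_inv(2)[OF g])
    finally have C: "ga (ac g (pr d)) ** ga (ac g d) = mat 1" .
    have "ac g (pr d) \<noteq> ac g d" using ac_inv(1)[OF g] G(5) by metis
    moreover have "pr (ac g (pr d)) = ac g d" using B(2) G(3) by simp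
    ultimately show ?thesis using A(1) B(1) C unfolding UU_def A(2) mem_Collect_eq by blast
  qed
  show ?thesis
  proof
    assume "ac g d \<in> UU"
    then have "ac (inv g) (ac g d) \<in> UU" by (rule 1[OF inv_closed[OF g]])
    then show "d \<in> UU" unfolding ac_inv(1)[OF g] .
  next
    assume "d \<in> UU" then show "ac g d \<in> UU" by (rule 1[OF g])
  qed
qed

lemma UU_pr: assumes "d \<in> UU" shows "pr d \<in> UU"
proof -
  have G: "good d" "good (pr d)" "pr (pr d) = d" "ga (pr d) ** ga d = mat 1" "pr d \<noteq> d"
    using assms by (auto simp: UU_def)
  have "ga (pr (pr d)) ** ga (pr d) = mat 1" unfolding G(3) by (rule mult_inverse_comm[OF G(4)])
  moreover have "pr (pr d) \<noteq> pr d" using G(3,5) by metis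
  ultimately show ?thesis using G(1-3) unfolding UU_def by simp
qed

lemma UU_D:
  assumes "d \<in> UU"
  shows "good d" "pr (pr d) = d" "ga (pr d) ** ga d = mat 1" "pr d \<noteq> d" "ga d ** ga (pr d) = mat 1"
proof -
  have G: "good d \<and> good (pr d) \<and> pr (pr d) = d \<and> ga (pr d) ** ga d = mat 1 \<and> pr d \<noteq> d"
    using assms unfolding UU_def mem_Collect_eq .
  show "good d" by (rule conjunct1[OF G])
  note G = conjunct2[OF conjunct2[OF G]]
  show "pr (pr d) = d" by (rule conjunct1[OF G])
  note G = conjunct2[OF G]
  show 1: "ga (pr d) ** ga d = mat 1" by (rule conjunct1[OF G])
  show "pr d \<noteq> d" by (rule conjunct2[OF G])
  show "ga d ** ga (pr d) = mat 1" by (rule mult_inverse_comm[OF 1])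
qed

lemma pr_ac: assumes "g \<in> carrier G" "d \<in> UU" shows "pr (ac g d) = ac g (pr d)"
  by (rule good_ac(2)[OF assms(1) UU_D(1)[OF assms(2)]])

lemma ga_ac: "\<lbrakk>g \<in> carrier G; d \<in> UU\<rbrakk> \<Longrightarrow> ga (ac g d) ** al g d = al g (pr d) ** ga d"
proof -
  assume a: "g \<in> carrier G" "d \<in> UU"
  have "ga (ac g d) ** al g d = al g (pr d) ** ga d ** (al (inv g) (ac g d) ** al g d)"
    unfolding good_ac(3)[OF a(1) UU_D(1)[OF a(2)]] by (simp only: matrix_mul_assoc)
  then show ?thesis using a(1) by (simp add: al_inv)
qed

end

declare split_paired_All [simp del] split_paired_Ex [simp del]

lemma finite_Max_less:
  fixes S :: "real set" assumes "finite S" "x \<in> S" "P x"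
  shows "Max {s \<in> S. P s} \<in> S" "P (Max {s \<in> S. P s})" "\<And>y. y \<in> S \<Longrightarrow> P y \<Longrightarrow> y \<le> Max {s \<in> S. P s}"
  using Max_in[of "{s \<in> S. P s}"] assms by (auto intro: Max_ge)

lemma finite_Min_less:
  fixes S :: "real set" assumes "finite S" "x \<in> S" "P x"
  shows "Min {s \<in> S. P s} \<in> S" "P (Min {s \<in> S. P s})" "\<And>y. y \<in> S \<Longrightarrow> P y \<Longrightarrow> Min {s \<in> S. P s} \<le> y"
  using Min_in[of "{s \<in> S. P s}"] assms by (auto intro: Min_le)

context germ_group
begin

section \<open>Locally constant functions\<close>

text \<open>Between consecutive cuts every gluing is the original one. The values 0 and 1 are the
  two coordinates of the base point.\<close>

definition cuts :: "real set" where "cuts = {0, 1} \<union> tt ` crit"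

lemma finite_cuts: "finite cuts" by (simp add: cuts_def finite_crit)

lemma cuts_range: "s \<in> cuts \<Longrightarrow> 0 \<le> s" "s \<in> cuts \<Longrightarrow> s \<le> 1"
  using tt_range(5,6) by (auto simp: cuts_def)

lemma not_cut_std:
  assumes "0 < t" "t < 1" "t \<notin> cuts" shows "std (to_circle t, b)"
proof (rule ccontr)
  assume "\<not> std (to_circle t, b)"
  then have "(to_circle t, b) \<in> crit" by (simp add: crit_def)
  then have "tt (to_circle t, b) \<in> cuts" unfolding cuts_def by blast
  then show False using assms by (simp add: tt_interior)
qed

text \<open>\<open>lo d\<close> and \<open>hi d\<close> bound the interval between cuts that
  contains the germ \<open>d\<close>; if \<open>d\<close> sits at a cut, its direction decides on
  which side it lies. \<open>lft d\<close> and \<open>rgt d\<close> are the two ends as directed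
  points, both pointing inwards.\<close>

definition lo :: "dpoint \<Rightarrow> real" where "lo d = Max {s \<in> cuts. s < tt d \<or> s = tt d \<and> snd d}"
definition hi :: "dpoint \<Rightarrow> real" where "hi d = Min {s \<in> cuts. tt d < s \<or> s = tt d \<and> \<not> snd d}"
definition lft :: "dpoint \<Rightarrow> dpoint" where "lft d = (to_circle (lo d), True)"
definition rgt :: "dpoint \<Rightarrow> dpoint" where "rgt d = (to_circle (hi d), False)"

lemma lo: "lo d \<in> cuts" "lo d < tt d \<or> lo d = tt d \<and> snd d"
    "\<And>s. s \<in> cuts \<Longrightarrow> s < tt d \<or> s = tt d \<and> snd d \<Longrightarrow> s \<le> lo d"
proof -
  have z: "0 \<in> cuts" "0 < tt d \<or> 0 = tt d \<and> snd d"
    using tt_range(3,5)[of d] by (auto simp: cuts_def)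
  note F = finite_Max_less[OF finite_cuts z(1), of "\<lambda>s. s < tt d \<or> s = tt d \<and> snd d", OF z(2), folded lo_def]
  show "lo d \<in> cuts" "lo d < tt d \<or> lo d = tt d \<and> snd d"
    "\<And>s. s \<in> cuts \<Longrightarrow> s < tt d \<or> s = tt d \<and> snd d \<Longrightarrow> s \<le> lo d" by (rule F; assumption?)+
qed

lemma hi: "hi d \<in> cuts" "tt d < hi d \<or> hi d = tt d \<and> \<not> snd d"
    "\<And>s. s \<in> cuts \<Longrightarrow> tt d < s \<or> s = tt d \<and> \<not> snd d \<Longrightarrow> hi d \<le> s"
proof -
  have z: "1 \<in> cuts" "tt d < 1 \<or> 1 = tt d \<and> \<not> snd d"
    using tt_range(2,6)[of d] by (auto simp: cuts_def)
  note F = finite_Min_less[OF finite_cuts z(1), of "\<lambda>s. tt d < s \<or> s = tt d \<and> \<not> snd d", OF z(2), folded hi_def]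
  show "hi d \<in> cuts" "tt d < hi d \<or> hi d = tt d \<and> \<not> snd d"
    "\<And>s. s \<in> cuts \<Longrightarrow> tt d < s \<or> s = tt d \<and> \<not> snd d \<Longrightarrow> hi d \<le> s" by (rule F; assumption?)+
qed

lemma lo_hi: "lo d < hi d" "lo d \<le> tt d" "tt d \<le> hi d"
  using lo(2)[of d] hi(2)[of d] by auto

lemma no_cut_between: "s \<in> cuts \<Longrightarrow> s \<le> lo d \<or> hi d \<le> s"
  using lo(3)[of s d] hi(3)[of s d] by (cases "snd d") linarith+

lemma lo_hi_unique:
  assumes "a \<in> cuts" "b \<in> cuts" "\<And>s. s \<in> cuts \<Longrightarrow> s \<le> a \<or> b \<le> s"
    "a < tt d \<or> a = tt d \<and> snd d" "tt d < b \<or> b = tt d \<and> \<not> snd d"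
  shows "lo d = a" "hi d = b"
proof -
  have ab: "a < b" using assms(4,5) by auto
  have "a \<le> lo d" "hi d \<le> b" using lo(3)[OF assms(1,4)] hi(3)[OF assms(2,5)] by auto
  moreover have "lo d \<le> a" using assms(3)[OF lo(1)[of d]] lo(2)[of d] assms(5) by auto
  moreover have "b \<le> hi d" using assms(3)[OF hi(1)[of d]] hi(2)[of d] assms(4) by auto
  ultimately show "lo d = a" "hi d = b" by auto
qed

lemma tt_lft: "tt (lft d) = lo d" and tt_rgt: "tt (rgt d) = hi d"
proof -
  have "lo d < 1" "0 < hi d"
    using lo_hi[of d] cuts_range[OF hi(1)[of d]] cuts_range[OF lo(1)[of d]] by linarith+
  then show "tt (lft d) = lo d" "tt (rgt d) = hi d"
    using cuts_range[OF hi(1)[of d]] cuts_range[OF lo(1)[of d]] by (auto simp: lft_def rgt_def intro!: tt_eqI)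
qed

lemma lo_hi_same:
  assumes "lo d < tt e \<or> lo d = tt e \<and> snd e" "tt e < hi d \<or> hi d = tt e \<and> \<not> snd e"
  shows "lo e = lo d" "hi e = hi d" "lft e = lft d" "rgt e = rgt d"
  using lo_hi_unique[OF lo(1) hi(1) no_cut_between assms] by (auto simp: lft_def rgt_def)

lemma lft_rgt: "lft (lft d) = lft d" "rgt (lft d) = rgt d" "lft (rgt d) = lft d" "rgt (rgt d) = rgt d"
    "lo (lft d) = lo d" "hi (lft d) = hi d"
  using lo_hi_same[of d "lft d"] lo_hi_same[of d "rgt d"] lo_hi[of d]
  by (auto simp: tt_lft tt_rgt) (auto simp: lft_def rgt_def)

definition loc :: "(dpoint \<Rightarrow> 'z) \<Rightarrow> bool" where
  "loc F \<longleftrightarrow> (\<forall>d. \<forall>\<^sub>F u in at_right 0. \<forall>b. F (nb d u b) = F d)"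

lemma eventually_interval: "\<forall>\<^sub>F u in at_right 0. 0 < u \<and> lo d < tt d + sg (snd d) * u \<and> tt d + sg (snd d) * u < hi d"
proof (cases "snd d")
  case True
  then show ?thesis using lo(2)[of d] hi(2)[of d]
    by (auto simp: eventually_at_right_field intro!: exI[of _ "hi d - tt d"])
next
  case False
  then show ?thesis using lo(2)[of d] hi(2)[of d]
    by (auto simp: eventually_at_right_field intro!: exI[of _ "tt d - lo d"])
qed

lemma nb_interval:
  assumes "lo d < tt d + sg (snd d) * u" "tt d + sg (snd d) * u < hi d"
  shows "tt (nb d u b) = tt d + sg (snd d) * u" "lo (nb d u b) = lo d" "hi (nb d u b) = hi d"
    "lft (nb d u b) = lft d" "rgt (nb d u b) = rgt d"
proof -
  show 1: "tt (nb d u b) = tt d + sg (snd d) * u"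
    using assms cuts_range[OF hi(1)[of d]] cuts_range[OF lo(1)[of d]] by (intro tt_nb) linarith+
  show "lo (nb d u b) = lo d" "hi (nb d u b) = hi d" "lft (nb d u b) = lft d" "rgt (nb d u b) = rgt d"
    using lo_hi_same[of d "nb d u b"] assms unfolding 1 by auto
qed

lemma loc_lft: "loc (\<lambda>d. f (lft d))"
  unfolding loc_def
proof
  fix d
  show "\<forall>\<^sub>F u in at_right 0. \<forall>b. f (lft (nb d u b)) = f (lft d)"
    using eventually_interval[of d] by eventually_elim (simp add: nb_interval)
qed

text \<open>Inside the interval the values at the two directions over a point agree, so the
  one-sided conditions join to local constancy on a connected set. The ends are then reached by
  \<open>loc\<close> at the end germs.\<close>

lemma loc_interval:
  assumes F: "loc F" and fl: "\<And>t. \<lbrakk>lo d < t; t < hi d\<rbrakk> \<Longrightarrow> F (to_circle t, True) = F (to_circle t, False)"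
  shows "F (lft d) = F d" "F (rgt d) = F d"
proof -
  define J where "J = {lo d<..<hi d}"
  define f where "f t = F (to_circle t, True)" for t
  have J01: "0 < t \<and> t < 1" if "t \<in> J" for t
    using that cuts_range[OF hi(1)[of d]] cuts_range[OF lo(1)[of d]] by (auto simp: J_def)
  have near: "\<forall>\<^sub>F u in at_right 0. f (tt e + sg (snd e) * u) = F e" for e
  proof -
    have "\<forall>\<^sub>F u in at_right 0. \<forall>b. F (nb e u b) = F e" using F unfolding loc_def by (rule spec)
    then show ?thesis by eventually_elim (simp add: f_def nb_def)
  qed
  have "f s = f t" if "s \<in> J" "t \<in> J" for s t
  proof (rule connected_local_const[OF _ that])
    show "connected J" by (simp add: J_def)
    show "\<forall>t\<in>J. \<forall>\<^sub>F s in at t within J. f t = f s"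
    proof
      fix t assume t: "t \<in> J"
      have tt: "tt (to_circle t, b) = t" for b using J01[OF t] by (simp add: tt_interior)
      have "\<forall>\<^sub>F u in at_right 0. f t = f (t + u)" using near[of "(to_circle t, True)"] tt
        by (auto simp: f_def elim!: eventually_mono)
      then have r: "\<forall>\<^sub>F s in at_right t. f t = f s"
        unfolding eventually_at_right_to_0[of _ t] by (simp add: add.commute)
      have "F (to_circle t, False) = f t" using fl[of t] t by (simp add: J_def f_def)
      then have "\<forall>\<^sub>F u in at_right 0. f t = f (t - u)" using near[of "(to_circle t, False)"] tt
        by (auto elim!: eventually_mono)
      then have l: "\<forall>\<^sub>F s in at_left t. f t = f s"
        unfolding eventually_at_left_to_right eventually_at_right_to_0[of _ "- t"] by simp
      have "at t within J = at t" using t by (intro at_within_open) (simp_all add: J_def)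
      then show "\<forall>\<^sub>F s in at t within J. f t = f s"
        using conjI[OF l r] by (simp only: eventually_at_split)
    qed
  qed
  note const = this
  define t0 where "t0 = (lo d + hi d) / 2"
  have t0: "t0 \<in> J" using lo_hi(1)[of d] by (simp add: J_def t0_def)
  have F0: "F e = f t0" if e: "lo e = lo d" "hi e = hi d" for e
  proof -
    have "\<forall>\<^sub>F u in at_right 0. f (tt e + sg (snd e) * u) = F e \<and> tt e + sg (snd e) * u \<in> J"
      using near[of e] eventually_interval[of e] by eventually_elim (simp add: J_def e)
    then obtain u where "f (tt e + sg (snd e) * u) = F e" "tt e + sg (snd e) * u \<in> J"
      by (rule eventually_at_right_imp_ex) auto
    then show ?thesis using const[OF _ t0, of "tt e + sg (snd e) * u"] by simp
  qed
  have "lo (rgt d) = lo d" "hi (rgt d) = hi d"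
    using lo_hi_same[of d "rgt d"] lo_hi[of d] by (auto simp: tt_rgt) (auto simp: rgt_def)
  then show "F (lft d) = F d" "F (rgt d) = F d"
    using F0[of d] F0[of "lft d"] F0[of "rgt d"] lft_rgt(5,6)[of d] by (simp_all del: lft_rgt)
qed

text \<open>These are the locally constant functions on the reglued space.\<close>

definition flat :: "(dpoint \<Rightarrow> 'z) \<Rightarrow> bool" where
  "flat F \<longleftrightarrow> loc F \<and> (\<forall>d\<in>UU. F (pr d) = F d)"

lemma flatD: "flat F \<Longrightarrow> d \<in> UU \<Longrightarrow> F (pr d) = F d" "flat F \<Longrightarrow> loc F"
  by (simp_all add: flat_def)

lemma interval_std:
  assumes "lo d < t" "t < hi d" shows "std (to_circle t, b)"
proof (rule not_cut_std)
  show "t \<notin> cuts" using no_cut_between[of t d] assms by auto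
qed (use assms cuts_range[OF hi(1)[of d]] cuts_range[OF lo(1)[of d]] in linarith)+

lemma interval_std_pr:
  assumes "lo d < t" "t < hi d"
  shows "(to_circle t, b) \<in> UU" "pr (to_circle t, b) = (to_circle t, \<not> b)" "ga (to_circle t, b) = mat 1"
  using interval_std[OF assms] std_UU[of "(to_circle t, b)"] std_props[of "(to_circle t, b)"] by (simp_all add: flip_def)

lemma flat_lft:
  assumes F: "flat F" shows "F (lft d) = F d" "F (rgt d) = F d"
proof -
  have fl: "F (to_circle t, True) = F (to_circle t, False)" if t: "lo d < t" "t < hi d" for t
    using flatD(1)[OF F interval_std_pr(1)[OF t, of False]] interval_std_pr(2)[OF t, of False] by simp
  show "F (lft d) = F d" by (rule loc_interval(1)[OF flatD(2)[OF F] fl])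
  show "F (rgt d) = F d" by (rule loc_interval(2)[OF flatD(2)[OF F] fl])
qed

lemma local_shift:
  assumes g: "g \<in> carrier G"
  obtains \<eta> where "filterlim \<eta> (at_right 0) (at_right 0)"
    "\<forall>\<^sub>F u in at_right 0. \<forall>b. ac g (nb d u b) = nb (ac g d) (\<eta> u) (b = (0 < det (al g d))) \<and>
      (\<exists>c. al g (nb d u b) = c *\<^sub>R al g d)"
  using local[OF g, of d] by (elim exE conjE) (rule that)

lemma loc_ac:
  assumes g: "g \<in> carrier G" and F: "loc F" shows "loc (\<lambda>d. F (ac g d))"
  unfolding loc_def
proof
  fix d
  obtain \<eta> where \<eta>: "filterlim \<eta> (at_right 0) (at_right 0)"
    "\<forall>\<^sub>F u in at_right 0. \<forall>b. ac g (nb d u b) = nb (ac g d) (\<eta> u) (b = (0 < det (al g d))) \<and>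
      (\<exists>c. al g (nb d u b) = c *\<^sub>R al g d)"
    by (rule local_shift[OF g])
  have "\<forall>\<^sub>F u in at_right 0. \<forall>b. F (nb (ac g d) u b) = F (ac g d)" using F unfolding loc_def by (rule spec)
  then have "\<forall>\<^sub>F u in at_right 0. \<forall>b. F (nb (ac g d) (\<eta> u) b) = F (ac g d)"
    using \<eta>(1) by (rule eventually_compose_filterlim)
  then show "\<forall>\<^sub>F u in at_right 0. \<forall>b. F (ac g (nb d u b)) = F (ac g d)"
    using \<eta>(2) by eventually_elim simp
qed

lemma flat_ac:
  assumes g: "g \<in> carrier G" and F: "flat F" shows "flat (\<lambda>d. F (ac g d))"
  unfolding flat_def
proof (intro conjI ballI)
  show "loc (\<lambda>d. F (ac g d))" by (rule loc_ac[OF g flatD(2)[OF F]])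
  fix d assume d: "d \<in> UU"
  then have "ac g d \<in> UU" by (simp only: UU_ac[OF g])
  then show "F (ac g (pr d)) = F (ac g d)" using flatD(1)[OF F] by (simp only: pr_ac[OF g d, symmetric])
qed

section \<open>Rigid directed points\<close>

definition triv :: "'a \<Rightarrow> dpoint \<Rightarrow> bool" where "triv g d \<longleftrightarrow> ac g d = d \<and> al g d = mat 1"

text \<open>The matrix of \<open>g\<close> at nearby points is that at \<open>d\<close> up to a
  scalar, and the normalisation \<open>al_pt\<close> forces this scalar to be 1 as soon as one of
  the two germs is trivial. Across a gluing the germ is conjugated by \<open>ga\<close>.\<close>

lemma flat_triv: assumes g: "g \<in> carrier G" shows "flat (triv g)"
  unfolding flat_def loc_def
proof (intro conjI allI ballI)
  fix d
  obtain \<eta> where \<eta>: "filterlim \<eta> (at_right 0) (at_right 0)"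
    "\<forall>\<^sub>F u in at_right 0. \<forall>b. ac g (nb d u b) = nb (ac g d) (\<eta> u) (b = (0 < det (al g d))) \<and>
      (\<exists>c. al g (nb d u b) = c *\<^sub>R al g d)"
    by (rule local_shift[OF g])
  show "\<forall>\<^sub>F u in at_right 0. \<forall>b. triv g (nb d u b) = triv g d"
    using \<eta>(2) eventually_nb[of d]
  proof eventually_elim
    case (elim u)
    show ?case
    proof
      fix b
      obtain c where b: "ac g (nb d u b) = nb (ac g d) (\<eta> u) (b = (0 < det (al g d)))" and c: "al g (nb d u b) = c *\<^sub>R al g d"
        using elim(1) by blast
      define s where "s = tt d + sg (snd d) * u"
      have s: "tt (nb d u b) = s" using elim(2) by (simp add: s_def tt_nb)
      have bb: "snd (ac g (nb d u b)) = (b = (0 < det (al g d)))" unfolding b by (simp add: nb_def)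
      have pt: "(c *\<^sub>R al g d) *v pt s = pt (tt (ac g (nb d u b)))" using al_pt[OF g, of "nb d u b"] by (simp add: s c)
      have pt': "al g d *v pt (tt d) = pt (tt (ac g d))" by (rule al_pt[OF g])
      show "triv g (nb d u b) = triv g d"
      proof
        assume T: "triv g d"
        then have m: "al g d = mat 1" by (simp add: triv_def)
        have c1: "c = 1" using pt unfolding m by (simp add: vec2_eq_iff mat2_vec mat2_one)
        have "s = tt (ac g (nb d u b))" using pt unfolding m c1 by (simp add: vec2_eq_iff)
        then have "ac g (nb d u b) = nb d u b" using s bb m by (intro tt_inj) (simp_all add: nb_def)
        then show "triv g (nb d u b)" using c c1 m by (simp add: triv_def)
      next
        assume T: "triv g (nb d u b)"
        then have cm: "c *\<^sub>R al g d = mat 1" using c by (simp add: triv_def)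
        have "(c *\<^sub>R al g d) *v pt (tt d) = c *\<^sub>R (al g d *v pt (tt d))" by (simp add: vec2_eq_iff mat2_vec algebra_simps)
        then have "pt (tt d) = c *\<^sub>R pt (tt (ac g d))" unfolding cm pt' by simp
        then have c1: "c = 1" "tt d = tt (ac g d)" by (auto simp: vec2_eq_iff)
        have m: "al g d = mat 1" using cm c1 by simp
        have "ac g d = d" using c1(2) ac_dir[OF g, of d] m by (intro tt_inj) simp_all
        then show "triv g d" using m by (simp add: triv_def)
      qed
    qed
  qed
next
  fix d assume d: "d \<in> UU"
  have eq: "ga (ac g d) ** al g d = al g (pr d) ** ga d" by (rule ga_ac[OF g d])
  show "triv g (pr d) = triv g d"
  proof
    assume T: "triv g d"
    then have p: "ac g (pr d) = pr d" using pr_ac[OF g d] by (simp add: triv_def)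
    have "mat 1 ** ga d = al g (pr d) ** ga d" using eq T by (simp add: triv_def)
    then have "al g (pr d) = mat 1" by (metis cancel_right[OF UU_D(5)[OF d]])
    then show "triv g (pr d)" using p by (simp add: triv_def)
  next
    assume T: "triv g (pr d)"
    then have p: "ac g d = d" using pr_ac[OF g UU_pr[OF d]] UU_D(2)[OF d] by (simp add: triv_def)
    have "ga d ** al g d = ga d ** mat 1" using eq T by (simp add: triv_def p)
    then have "al g d = mat 1" by (metis cancel_left[OF UU_D(3)[OF d]])
    then show "triv g d" using p by (simp add: triv_def)
  qed
qed

text \<open>Rigidity is constant along intervals and across gluings because \<open>triv g\<close> is
  flat. The argument then concentrates on one cycle without rigid points.\<close>

definition rig :: "dpoint \<Rightarrow> bool" where "rig d \<longleftrightarrow> fin_index G {g \<in> carrier G. triv g d}"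

lemma rig_lft: "rig (lft d) = rig d" "rig (rgt d) = rig d"
proof -
  have "{g \<in> carrier G. triv g (lft d)} = {g \<in> carrier G. triv g d}" "{g \<in> carrier G. triv g (rgt d)} = {g \<in> carrier G. triv g d}"
    using flat_lft[OF flat_triv] by blast+
  then show "rig (lft d) = rig d" "rig (rgt d) = rig d" by (simp_all add: rig_def)
qed

lemma rig_pr: assumes "d \<in> UU" shows "rig (pr d) = rig d"
proof -
  have "{g \<in> carrier G. triv g (pr d)} = {g \<in> carrier G. triv g d}"
    using flatD(1)[OF flat_triv assms] by blast
  then show ?thesis by (simp add: rig_def)
qed

lemma finite_ends: "finite (range lft)" "finite (range rgt)"
proof -
  have "range lft \<subseteq> (\<lambda>s. (to_circle s, True)) ` cuts" "range rgt \<subseteq> (\<lambda>s. (to_circle s, False)) ` cuts"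
    using lo(1) hi(1) by (auto simp: lft_def rgt_def)
  then show "finite (range lft)" "finite (range rgt)" by (auto intro: finite_subset[OF _ finite_imageI[OF finite_cuts]])
qed

text \<open>There are finitely many intervals, so one subgroup of finite index has trivial germs
  everywhere; it is trivial by \<open>faithful\<close>.\<close>

lemma all_rigid_finite: assumes "\<And>d. rig d" shows "finite (carrier G)"
proof (rule fin_index_mono_finite)
  let ?K = "carrier G \<inter> (\<Inter>d\<in>range lft. {g \<in> carrier G. triv g d})"
  show "fin_index G ?K"
    using finite_ends(1) assms unfolding rig_def by (rule fin_index_Inter)
  have "?K \<subseteq> {\<one>}"
  proof
    fix g assume g: "g \<in> ?K"
    then have gG: "g \<in> carrier G" by blast
    have "fst (ac g (x, True)) = x" for x
    proof -
      have "triv g (lft (x, True))" using g by blast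
      then have "triv g (x, True)" using flat_lft(1)[OF flat_triv[OF gG]] by simp
      then show ?thesis by (simp add: triv_def)
    qed
    then show "g \<in> {\<one>}" using faithful[OF gG] by simp
  qed
  then show "finite ?K" by (rule finite_subset) simp
qed

text \<open>On the stabiliser of \<open>d\<close> the determinant is a character, so Property FW
  makes it 1 on a subgroup of finite index. There the matrices are unipotent with fixed vector
  \<open>pt (tt d)\<close>, hence given by their lower left entry, which is additive and therefore
  0.\<close>

lemma finite_orbit_rig:
  assumes fin: "finite ((\<lambda>g. ac g d) ` carrier G)"
  shows "rig d"
proof -
  define H where "H = {g \<in> carrier G. ac g d = d}"
  have acinv: "ac (inv g) d = d" if "g \<in> H" for g using that ac_inv(1)[of g d] by (simp add: H_def)
  have H: "subgroup H G"
  proof (rule subgroupI)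
    show "H \<subseteq> carrier G" unfolding H_def by blast
    have "\<one> \<in> H" by (simp add: H_def ac_one)
    then show "H \<noteq> {}" by blast
    show "inv g \<in> H" if "g \<in> H" for g using acinv[OF that] that by (simp add: H_def)
    show "g \<otimes> h \<in> H" if "g \<in> H" "h \<in> H" for g h using that by (simp add: H_def ac_mult)
  qed
  have HF: "fin_index G H"
  proof (rule fin_index_label[OF H fin])
    fix g g' assume "g \<in> carrier G" "g' \<in> carrier G" "ac g d = ac g' d"
    then show "inv g \<otimes> g' \<in> H" using ac_inv(1)[of g d] by (simp add: H_def ac_mult)
  qed
  have HD: "g \<in> carrier G" "ac g d = d" if "g \<in> H" for g using that by (auto simp: H_def)
  have alm: "al (g \<otimes> h) d = al g d ** al h d" if "g \<in> H" "h \<in> H" for g h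
    using that HD by (simp add: al_mult)
  define K where "K = {g \<in> H. det (al g d) = 1}"
  have KF: "fin_index G K"
    unfolding K_def
  proof (rule FW_hom_kernel[OF FW HF])
    show "det (al (g \<otimes> h) d) = det (al g d) * det (al h d)" if "g \<in> H" "h \<in> H" for g h
      using alm[OF that] by (simp add: det_mul)
    show "det (al g d) \<noteq> 0" if "g \<in> H" for g by (rule al_det[OF HD(1)[OF that]])
  qed
  have FWK: "property_FW (G\<lparr>carrier := K\<rparr>)" by (rule FW_fin_index[OF FW KF])
  interpret KG: group "G\<lparr>carrier := K\<rparr>" using KF by (rule fin_index_group)
  have par: "al g d $ 1 $ 1 = 1 + al g d $ 2 $ 1 * tt d" "al g d $ 1 $ 2 = - al g d $ 2 $ 1 * (tt d)\<^sup>2"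
    "al g d $ 2 $ 2 = 1 - al g d $ 2 $ 1 * tt d" if g: "g \<in> K" for g
  proof -
    have p: "al g d $ 1 $ 1 * tt d + al g d $ 1 $ 2 = tt d" "al g d $ 2 $ 1 * tt d + al g d $ 2 $ 2 = 1"
    proof -
      have "g \<in> H" using g unfolding K_def by blast
      then have "al g d *v pt (tt d) = pt (tt d)" using al_pt[of g d] HD[of g] by simp
      then show "al g d $ 1 $ 1 * tt d + al g d $ 1 $ 2 = tt d" "al g d $ 2 $ 1 * tt d + al g d $ 2 $ 2 = 1"
        by (simp_all add: vec2_eq_iff mat2_vec)
    qed
    have q: "al g d $ 1 $ 1 * al g d $ 2 $ 2 - al g d $ 1 $ 2 * al g d $ 2 $ 1 = 1"
      using g by (simp add: K_def det_2)
    have dd: "al g d $ 2 $ 2 = 1 - al g d $ 2 $ 1 * tt d" and bb: "al g d $ 1 $ 2 = tt d - al g d $ 1 $ 1 * tt d"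
      using p by linarith+
    show aa: "al g d $ 1 $ 1 = 1 + al g d $ 2 $ 1 * tt d" using q unfolding dd bb by (simp add: algebra_simps)
    show "al g d $ 1 $ 2 = - al g d $ 2 $ 1 * (tt d)\<^sup>2" using bb unfolding aa by (simp add: algebra_simps power2_eq_square)
    show "al g d $ 2 $ 2 = 1 - al g d $ 2 $ 1 * tt d" by (rule dd)
  qed
  have zero: "al g d $ 2 $ 1 = 0" if g: "g \<in> K" for g
  proof (rule KG.FW_hom_real[OF FWK, of "\<lambda>g. al g d $ 2 $ 1"])
    show "al (g \<otimes>\<^bsub>G\<lparr>carrier := K\<rparr>\<^esub> h) d $ 2 $ 1 = al g d $ 2 $ 1 + al h d $ 2 $ 1"
      if "g \<in> carrier (G\<lparr>carrier := K\<rparr>)" "h \<in> carrier (G\<lparr>carrier := K\<rparr>)" for g h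
    proof -
      have gh: "g \<in> K" "h \<in> K" using that by simp_all
      then have "g \<in> H" "h \<in> H" by (simp_all add: K_def)
      then have "al (g \<otimes> h) d $ 2 $ 1 = al g d $ 2 $ 1 * al h d $ 1 $ 1 + al g d $ 2 $ 2 * al h d $ 2 $ 1"
        by (simp add: alm mat2_mult)
      also have "\<dots> = al g d $ 2 $ 1 * (1 + al h d $ 2 $ 1 * tt d) + (1 - al g d $ 2 $ 1 * tt d) * al h d $ 2 $ 1"
        by (simp only: par(1)[OF gh(2)] par(3)[OF gh(1)])
      also have "\<dots> = al g d $ 2 $ 1 + al h d $ 2 $ 1" by (simp add: algebra_simps)
      finally show ?thesis by simp
    qed
    show "g \<in> carrier (G\<lparr>carrier := K\<rparr>)" using g by simp
  qed
  have "{g \<in> carrier G. triv g d} = K"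
  proof
    show "{g \<in> carrier G. triv g d} \<subseteq> K"
    proof
      fix g assume "g \<in> {g \<in> carrier G. triv g d}"
      then have "g \<in> carrier G \<and> ac g d = d" "al g d = mat 1" unfolding triv_def by blast+
      then show "g \<in> K" unfolding K_def H_def by simp
    qed
    show "K \<subseteq> {g \<in> carrier G. triv g d}"
    proof
      fix g assume g: "g \<in> K"
      have "al g d = mat 1"
        unfolding mat2_eq_iff mat2_one par[OF g] zero[OF g] by simp
      moreover have "g \<in> H" using g unfolding K_def by blast
      ultimately show "g \<in> {g \<in> carrier G. triv g d}" using HD unfolding triv_def by blast
    qed
  qed
  then have "fin_index G {g \<in> carrier G. triv g d}" using KF by (rule ssubst)
  then show ?thesis by (simp only: rig_def)
qed

text \<open>The complement of \<open>UU\<close> is finite and invariant, so its points have finite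
  orbits.\<close>

lemma not_rig_UU: assumes "\<not> rig d" shows "d \<in> UU"
proof (rule ccontr)
  assume d: "d \<notin> UU"
  have "(\<lambda>g. ac g d) ` carrier G \<subseteq> crit"
  proof
    fix x assume "x \<in> (\<lambda>g. ac g d) ` carrier G"
    then obtain g where "g \<in> carrier G" "x = ac g d" by blast
    then have "x \<in> - UU" using d by (simp only: UU_ac Compl_iff not_False_eq_True)
    then show "x \<in> crit" by (rule subsetD[OF UU_crit])
  qed
  then have "finite ((\<lambda>g. ac g d) ` carrier G)" by (rule finite_subset) (rule finite_crit)
  then have "rig d" by (rule finite_orbit_rig)
  then show False using assms by blast
qed

end

section \<open>Two involutions on a finite set\<close>

text \<open>In the application \<open>E\<close> consists of ends of intervals,
  \<open>\<iota>\<close> goes to the other end of the same interval and \<open>\<kappa>\<close>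
  crosses a gluing. \<open>st k\<close> is the end through which the \<open>k\<close>-th interval is
  entered on a walk from \<open>e0\<close>, and \<open>cyc\<close> is the closed walk.\<close>

locale two_involutions =
  fixes E :: "'e set" and \<iota> \<kappa> :: "'e \<Rightarrow> 'e" and e0 :: 'e
  assumes finite_E: "finite E" and e0: "e0 \<in> E"
    and \<iota>: "e \<in> E \<Longrightarrow> \<iota> e \<in> E" "e \<in> E \<Longrightarrow> \<iota> (\<iota> e) = e" "e \<in> E \<Longrightarrow> \<iota> e \<noteq> e"
    and \<kappa>: "e \<in> E \<Longrightarrow> \<kappa> e \<in> E" "e \<in> E \<Longrightarrow> \<kappa> (\<kappa> e) = e" "e \<in> E \<Longrightarrow> \<kappa> e \<noteq> e"
begin

definition st :: "nat \<Rightarrow> 'e" where "st k = ((\<lambda>e. \<kappa> (\<iota> e)) ^^ k) e0"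

definition cyc :: "'e set" where "cyc = range st \<union> \<iota> ` range st"

lemma st_0: "st 0 = e0" and st_Suc: "st (Suc k) = \<kappa> (\<iota> (st k))"
  by (simp_all add: st_def)

lemma st_E: "st k \<in> E"
  by (induction k) (simp_all add: st_0 st_Suc e0 \<iota>(1) \<kappa>(1))

lemma st_back: assumes "st (Suc j) = st (Suc k)" shows "st j = st k"
proof -
  have "\<kappa> (\<kappa> (\<iota> (st j))) = \<kappa> (\<kappa> (\<iota> (st k)))" using assms by (simp only: st_Suc)
  then have "\<iota> (st j) = \<iota> (st k)" by (simp only: \<kappa>(2)[OF \<iota>(1)[OF st_E]])
  then have "\<iota> (\<iota> (st j)) = \<iota> (\<iota> (st k))" by (rule arg_cong)
  then show ?thesis by (simp only: \<iota>(2)[OF st_E])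
qed

lemma st_shift: "st (i + d) = st i \<Longrightarrow> st d = e0"
proof (induction i)
  case 0
  then show ?case by (simp add: st_0)
next
  case (Suc i)
  have "st (Suc (i + d)) = st (Suc i)" using Suc.prems by simp
  then have "st (i + d) = st i" by (rule st_back)
  then show ?case by (rule Suc.IH)
qed

lemma ex_period: "\<exists>m>0. st m = e0"
proof -
  have "\<not> inj st"
  proof
    assume "inj st"
    moreover have "finite (range st)" using finite_E st_E by (blast intro: finite_subset)
    ultimately have "finite (UNIV :: nat set)" by (rule finite_imageD[rotated])
    then show False by simp
  qed
  then obtain i j where "st i = st j" "i < j" unfolding inj_on_def by (metis nat_neq_iff)
  then have "st (i + (j - i)) = st i" by simp
  then have "st (j - i) = e0" by (rule st_shift)
  then show ?thesis using \<open>i < j\<close> by (intro exI[of _ "j - i"]) simp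
qed

definition period :: nat where "period = (LEAST m. 0 < m \<and> st m = e0)"

lemma period: "0 < period" "st period = e0" "\<lbrakk>0 < m; m < period\<rbrakk> \<Longrightarrow> st m \<noteq> e0"
  using LeastI_ex[OF ex_period] not_less_Least[of m "\<lambda>m. 0 < m \<and> st m = e0"]
  by (simp_all add: period_def)

lemma st_period: "st (k + period) = st k"
  by (induction k) (simp_all add: st_0 st_Suc period(2))

lemma st_less_period: obtains i where "i < period" "st k = st i"
proof (induction k arbitrary: thesis rule: less_induct)
  case (less k)
  show ?case
  proof (cases "k < period")
    case True
    then show ?thesis using less.prems by blast
  next
    case False
    then have 1: "k - period < k" and 2: "st k = st (k - period)" using period(1) st_period[of "k - period"] by simp_all
    show ?thesis by (rule less.IH[OF 1]) (use less.prems 2 in simp)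
  qed
qed

lemma st_inj: assumes "i < period" "j < period" "st i = st j" shows "i = j"
proof -
  have "\<not> a < b" if "a < period" "b < period" "st a = st b" for a b
  proof
    assume "a < b"
    then have "st (a + (b - a)) = st a" using that by simp
    then have "st (b - a) = e0" by (rule st_shift)
    then show False using period(3)[of "b - a"] that \<open>a < b\<close> by simp
  qed
  from this[of i j] this[of j i] show ?thesis using assms by simp
qed

text \<open>The walk never comes back through an interval in the opposite direction. Such a
  coincidence at distance \<open>n\<close> gives one at distance \<open>n - 2\<close>, and at
  distance 0 or 1 it would be a fixed point of \<open>\<iota>\<close> or of
  \<open>\<kappa>\<close>.\<close>

lemma st_not_\<iota>_add: "st j \<noteq> \<iota> (st (j + n))"
proof (induction n arbitrary: j rule: less_induct)
  case (less n)
  consider "n = 0" | "n = 1" | k where "n = Suc (Suc k)" by (metis One_nat_def not0_implies_Suc)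
  then show ?case
  proof cases
    case 1
    then show ?thesis using \<iota>(3)[OF st_E, of j] by simp
  next
    case 2
    show ?thesis
    proof
      assume "st j = \<iota> (st (j + n))"
      then have "\<iota> (st j) = st (Suc j)" using 2 \<iota>(2)[OF st_E, of "Suc j"] by simp
      then show False using \<kappa>(3)[OF \<iota>(1)[OF st_E], of j] by (simp add: st_Suc)
    qed
  next
    case 3
    show ?thesis
    proof
      assume "st j = \<iota> (st (j + n))"
      then have "\<iota> (st j) = st (Suc (Suc j + k))" using 3 \<iota>(2)[OF st_E, of "j + n"] by simp
      then have "\<kappa> (\<iota> (st j)) = \<kappa> (\<kappa> (\<iota> (st (Suc j + k))))" by (simp only: st_Suc[of "Suc j + k"])
      then have "st (Suc j) = \<iota> (st (Suc j + k))" by (simp only: st_Suc[of j] \<kappa>(2)[OF \<iota>(1)[OF st_E]])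
      then show False using less.IH[of k "Suc j"] 3 by simp
    qed
  qed
qed

lemma st_not_\<iota>: "st j \<noteq> \<iota> (st k)"
proof (cases "j \<le> k")
  case True
  then show ?thesis using st_not_\<iota>_add[of j "k - j"] by simp
next
  case False
  show ?thesis
  proof
    assume "st j = \<iota> (st k)"
    then have "st k = \<iota> (st j)" by (simp only: \<iota>(2)[OF st_E])
    then show False using st_not_\<iota>_add[of k "j - k"] False by simp
  qed
qed

lemma cyc_cases:
  assumes "e \<in> cyc"
  obtains k where "k < period" "e = st k" | k where "k < period" "e = \<iota> (st k)"
proof -
  from assms obtain k where "e = st k \<or> e = \<iota> (st k)" unfolding cyc_def by blast
  moreover obtain i where "i < period" "st k = st i" by (rule st_less_period)
  ultimately show thesis using that by metis
qed

lemma \<kappa>_st: "0 < k \<Longrightarrow> \<kappa> (st k) = \<iota> (st (k - 1))"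
  using st_Suc[of "k - 1"] \<kappa>(2)[OF \<iota>(1)[OF st_E], of "k - 1"] by simp

lemma cyc_closed: "e0 \<in> cyc" "e \<in> cyc \<Longrightarrow> e \<in> E" "e \<in> cyc \<Longrightarrow> \<iota> e \<in> cyc" "e \<in> cyc \<Longrightarrow> \<kappa> e \<in> cyc"
proof -
  show "e0 \<in> cyc" unfolding cyc_def using st_0 by (metis UnI1 rangeI)
  have in1: "st k \<in> cyc" and in2: "\<iota> (st k) \<in> cyc" for k unfolding cyc_def by blast+
  show "e \<in> E" if "e \<in> cyc" using that by (rule cyc_cases) (simp_all add: st_E \<iota>(1))
  show "\<iota> e \<in> cyc" if "e \<in> cyc" using that by (rule cyc_cases) (simp_all add: in1 in2 \<iota>(2)[OF st_E])
  show "\<kappa> e \<in> cyc" if "e \<in> cyc" using that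
  proof (rule cyc_cases)
    fix k assume "e = st k"
    then have "\<kappa> e = \<iota> (st (k + period - 1))" using \<kappa>_st[of "k + period"] period(1) by (simp add: st_period)
    then show ?thesis using in2 by simp
  next
    fix k assume "e = \<iota> (st k)"
    then show ?thesis using in1[of "Suc k"] by (simp add: st_Suc)
  qed
qed

text \<open>The edge between \<open>e0\<close> and \<open>\<kappa> e0\<close> closes the cycle, and is not needed for the induction.\<close>

lemma cyc_induct:
  assumes e: "e \<in> cyc" and 0: "P e0" and 1: "\<And>e. e \<in> cyc \<Longrightarrow> P e \<Longrightarrow> P (\<iota> e)"
    and 2: "\<And>e. \<lbrakk>e \<in> cyc; P e; e \<noteq> e0; e \<noteq> \<kappa> e0\<rbrakk> \<Longrightarrow> P (\<kappa> e)"
  shows "P e"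
proof -
  have in1: "st k \<in> cyc" and in2: "\<iota> (st k) \<in> cyc" for k unfolding cyc_def by blast+
  have st: "P (st k)" if "k < period" for k
    using that
  proof (induction k)
    case 0
    then show ?case using assms(2) by (simp add: st_0)
  next
    case (Suc k)
    have "P (\<iota> (st k))" using Suc by (intro 1[OF in1]) simp
    moreover have "\<iota> (st k) \<noteq> e0" using st_not_\<iota>[of 0 k] by (simp add: st_0)
    moreover have "\<iota> (st k) \<noteq> \<kappa> e0"
    proof
      assume "\<iota> (st k) = \<kappa> e0"
      then have "st (Suc k) = e0" by (simp add: st_Suc \<kappa>(2)[OF e0])
      then show False using period(3)[of "Suc k"] Suc.prems by simp
    qed
    ultimately have "P (\<kappa> (\<iota> (st k)))" by (intro 2[OF in2])
    then show ?case by (simp add: st_Suc)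
  qed
  from e show ?thesis
  proof (rule cyc_cases)
    fix k assume "k < period" "e = st k" then show ?thesis using st by simp
  next
    fix k assume "k < period" "e = \<iota> (st k)" then show ?thesis using 1[OF in1] st by simp
  qed
qed

text \<open>Parallel transport along the cycle, starting at \<open>e0\<close>. The relation is not
  claimed across the edge between \<open>e0\<close> and \<open>\<kappa> e0\<close>, where the walk
  closes up and a holonomy appears. It is applied to matrices, for \<open>Aw\<close>, and to
  additive constants, in \<open>no_invariant_section\<close>.\<close>

lemma transport:
  fixes T :: "'e \<Rightarrow> 'z \<Rightarrow> 'z"
  assumes T: "\<And>e x. e \<in> cyc \<Longrightarrow> T (\<kappa> e) (T e x) = x"
  shows "\<exists>z. z e0 = z0 \<and> (\<forall>e\<in>cyc. z (\<iota> e) = z e) \<and>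
    (\<forall>e\<in>cyc. e \<noteq> e0 \<longrightarrow> e \<noteq> \<kappa> e0 \<longrightarrow> z (\<kappa> e) = T e (z e))"
proof -
  have in1: "st k \<in> cyc" and in2: "\<iota> (st k) \<in> cyc" for k unfolding cyc_def by blast+
  define w where "w = rec_nat z0 (\<lambda>k. T (\<iota> (st k)))"
  have w: "w 0 = z0" "w (Suc k) = T (\<iota> (st k)) (w k)" for k by (simp_all add: w_def)
  define idx where "idx e = (THE k. k < period \<and> (e = st k \<or> e = \<iota> (st k)))" for e
  have \<iota>_inj: "st i = st k" if "\<iota> (st i) = \<iota> (st k)" for i k
    using arg_cong[OF that, of \<iota>] by (simp only: \<iota>(2)[OF st_E])
  have idx1: "idx (st k) = k" if "k < period" for k
    unfolding idx_def using that st_inj st_not_\<iota> by (intro the_equality) blast+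
  have idx2: "idx (\<iota> (st k)) = k" if k: "k < period" for k
    unfolding idx_def
  proof (rule the_equality)
    show "k < period \<and> (\<iota> (st k) = st k \<or> \<iota> (st k) = \<iota> (st k))" using k by simp
    fix i assume "i < period \<and> (\<iota> (st k) = st i \<or> \<iota> (st k) = \<iota> (st i))"
    then have i: "i < period" "\<iota> (st k) = \<iota> (st i)" using st_not_\<iota>[of i k] by auto
    show "i = k" by (rule st_inj[OF i(1) k \<iota>_inj[OF i(2)[symmetric]]])
  qed
  define z where "z e = w (idx e)" for e
  have z1: "z (st k) = w k" and z2: "z (\<iota> (st k)) = w k" if "k < period" for k
    using that idx1 idx2 by (simp_all add: z_def)
  have "z e0 = z0" using z1[OF period(1)] by (simp add: st_0 w(1))
  moreover have "z (\<iota> e) = z e" if "e \<in> cyc" for e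
    using that by (rule cyc_cases) (simp_all add: z1 z2 \<iota>(2)[OF st_E])
  moreover have "z (\<kappa> e) = T e (z e)" if e: "e \<in> cyc" "e \<noteq> e0" "e \<noteq> \<kappa> e0" for e
    using e(1)
  proof (rule cyc_cases)
    fix k assume k: "k < period" "e = st k"
    then have "0 < k" using e(2) st_0 by (cases k) auto
    then obtain i where i: "k = Suc i" by (cases k) auto
    have "\<kappa> e = \<iota> (st i)" using \<kappa>_st[of k] k(2) i by simp
    then have "z (\<kappa> e) = w i" using z2[of i] k i by simp
    moreover have "T (\<kappa> (\<iota> (st i))) (T (\<iota> (st i)) (w i)) = w i" by (rule T[OF in2])
    then have "T e (z e) = w i" using z1[OF k(1)] k(2) i by (simp only: w st_Suc)
    ultimately show ?thesis by simp
  next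
    fix k assume k: "k < period" "e = \<iota> (st k)"
    have "Suc k \<noteq> period"
    proof
      assume "Suc k = period"
      then have "\<kappa> e = e0" using period(2) st_Suc[of k] k(2) by simp
      then have "\<kappa> (\<kappa> e) = \<kappa> e0" by simp
      then have "e = \<kappa> e0" by (simp only: \<kappa>(2)[OF cyc_closed(2)[OF e(1)]])
      then show False using e(3) by contradiction
    qed
    then have "z (st (Suc k)) = w (Suc k)" using k(1) by (intro z1) simp
    then show ?thesis using z2[OF k(1)] k(2) by (simp only: st_Suc w)
  qed
  ultimately show ?thesis by blast
qed

end

section \<open>A cycle of intervals\<close>

context germ_group
begin

definition is_end :: "dpoint \<Rightarrow> bool" where "is_end e \<longleftrightarrow> e = lft e \<or> e = rgt e"
definition oth :: "dpoint \<Rightarrow> dpoint" where "oth e = (if e = lft e then rgt e else lft e)"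

lemma lft_neq_rgt: "lft d \<noteq> rgt d'" by (simp add: lft_def rgt_def)

lemma end_cases: assumes "is_end e" obtains "e = lft e" "oth e = rgt e" | "e = rgt e" "oth e = lft e"
  using assms lft_neq_rgt[of e e] unfolding is_end_def oth_def by (metis (full_types))

lemma oth_props:
  assumes "is_end e"
  shows "is_end (oth e)" "oth (oth e) = e" "oth e \<noteq> e" "lft (oth e) = lft e" "rgt (oth e) = rgt e"
proof -
  have "is_end (oth e) \<and> oth (oth e) = e \<and> oth e \<noteq> e \<and> lft (oth e) = lft e \<and> rgt (oth e) = rgt e"
    using assms
  proof (cases rule: end_cases)
    case 1
    have "oth (rgt e) = lft e" using lft_neq_rgt[of e e] by (simp add: oth_def lft_rgt)
    then show ?thesis using 1 lft_neq_rgt[of e e] by (simp add: is_end_def lft_rgt)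
  next
    case 2
    have "oth (lft e) = rgt e" by (simp add: oth_def lft_rgt)
    then show ?thesis using 2 lft_neq_rgt[of e e] by (simp add: is_end_def lft_rgt)
  qed
  then show "is_end (oth e)" "oth (oth e) = e" "oth e \<noteq> e" "lft (oth e) = lft e" "rgt (oth e) = rgt e" by blast+
qed

lemma is_end_iff: "is_end d \<longleftrightarrow> \<not> (lo d < tt d \<and> tt d < hi d)"
proof
  assume "is_end d"
  then show "\<not> (lo d < tt d \<and> tt d < hi d)" using tt_lft[of d] tt_rgt[of d] unfolding is_end_def by auto
next
  assume "\<not> (lo d < tt d \<and> tt d < hi d)"
  then have "(tt d = lo d \<and> snd d) \<or> (tt d = hi d \<and> \<not> snd d)" using lo(2)[of d] hi(2)[of d] by auto
  then show "is_end d"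
  proof
    assume "tt d = lo d \<and> snd d"
    then have "d = lft d" by (intro tt_inj) (simp_all add: tt_lft, simp add: lft_def)
    then show ?thesis by (simp add: is_end_def)
  next
    assume "tt d = hi d \<and> \<not> snd d"
    then have "d = rgt d" by (intro tt_inj) (simp_all add: tt_rgt, simp add: rgt_def)
    then show ?thesis by (simp add: is_end_def)
  qed
qed

lemma interior_pr:
  assumes "\<not> is_end d"
  shows "pr d = flip d" "ga d = mat 1" "tt (pr d) = tt d" "lft (pr d) = lft d" "\<not> is_end (pr d)" "d \<in> UU"
proof -
  have t: "lo d < tt d" "tt d < hi d" using assms by (simp_all add: is_end_iff)
  have d: "d = (to_circle (tt d), snd d)" by (simp add: prod_eq_iff to_circle_tt)
  have f: "flip d = (to_circle (tt d), \<not> snd d)" by (simp add: flip_def to_circle_tt)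
  show p: "pr d = flip d" unfolding f by (subst d) (rule interval_std_pr(2)[OF t])
  show "ga d = mat 1" by (subst d) (rule interval_std_pr(3)[OF t])
  show "d \<in> UU" by (subst d) (rule interval_std_pr(1)[OF t])
  have t01: "0 < tt d" "tt d < 1" using t cuts_range[OF hi(1)[of d]] cuts_range[OF lo(1)[of d]] by linarith+
  show tt: "tt (pr d) = tt d" unfolding p f by (rule tt_interior[OF t01])
  have s: "lo (pr d) = lo d" "hi (pr d) = hi d" and l: "lft (pr d) = lft d"
    using lo_hi_same[of d "pr d"] t unfolding tt by auto
  show "lft (pr d) = lft d" by (rule l)
  show "\<not> is_end (pr d)" using t by (simp add: is_end_iff s tt)
qed

lemma pr_end: assumes "is_end d" "d \<in> UU" shows "is_end (pr d)"
proof (rule ccontr)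
  assume "\<not> is_end (pr d)"
  then have "\<not> is_end (pr (pr d))" by (rule interior_pr(5))
  then show False using assms UU_D(2)[OF assms(2)] by simp
qed

lemma fin_index_orbit:
  assumes K: "fin_index G K" and fin: "finite ((\<lambda>g. ac g d) ` K)" shows "rig d"
proof (rule finite_orbit_rig)
  obtain R where R: "finite R" "R \<subseteq> carrier G" "\<And>g. g \<in> carrier G \<Longrightarrow> \<exists>r\<in>R. inv r \<otimes> g \<in> K"
    using K by (auto simp: fin_index_def)
  have "(\<lambda>g. ac g d) ` carrier G \<subseteq> (\<Union>r\<in>R. ac r ` ((\<lambda>g. ac g d) ` K))"
  proof
    fix x assume "x \<in> (\<lambda>g. ac g d) ` carrier G"
    then obtain g where g: "g \<in> carrier G" "x = ac g d" by blast
    obtain r where r: "r \<in> R" "inv r \<otimes> g \<in> K" using R(3)[OF g(1)] by blast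
    have rG: "r \<in> carrier G" using r(1) R(2) by blast
    have "x = ac r (ac (inv r \<otimes> g) d)" using g rG by (simp add: ac_mult ac_inv)
    then show "x \<in> (\<Union>r\<in>R. ac r ` ((\<lambda>g. ac g d) ` K))" using r by blast
  qed
  then show "finite ((\<lambda>g. ac g d) ` carrier G)" by (rule finite_subset) (intro finite_UN_I R(1) finite_imageI fin)
qed

end

text \<open>The base \<open>e0\<close> of the cycle is the left end of an interval; since
  \<open>rig\<close> is constant on intervals, any non-rigid point provides one.\<close>

locale nonrigid_germ = germ_group +
  fixes e0 :: dpoint
  assumes e0_lft: "lft e0 = e0" and e0_rig: "\<not> rig e0"
begin

definition EE :: "dpoint set" where "EE = {e. is_end e \<and> \<not> rig e}"

lemma EE_UU: "e \<in> EE \<Longrightarrow> e \<in> UU" "e \<in> EE \<Longrightarrow> is_end e"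
  by (simp_all add: EE_def not_rig_UU)

sublocale cy: two_involutions EE oth pr e0
proof
  have "EE \<subseteq> range lft \<union> range rgt" by (auto simp: EE_def is_end_def)
  then show "finite EE" by (rule finite_subset) (intro finite_UnI finite_ends)
  show "e0 \<in> EE" using e0_lft e0_rig by (simp add: EE_def is_end_def)
  fix e assume e: "e \<in> EE"
  note o = oth_props[OF EE_UU(2)[OF e]]
  have "rig (oth e) = rig e" using rig_lft(1)[of "oth e"] rig_lft(1)[of e] o(4) by simp
  then show "oth e \<in> EE" using o(1) e by (simp add: EE_def)
  show "oth (oth e) = e" "oth e \<noteq> e" by (rule o)+
  show "pr e \<in> EE" using e pr_end[OF EE_UU(2)[OF e] EE_UU(1)[OF e]] rig_pr[OF EE_UU(1)[OF e]] by (simp add: EE_def)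
  show "pr (pr e) = e" "pr e \<noteq> e" by (rule UU_D[OF EE_UU(1)[OF e]])+
qed

text \<open>The cycle of intervals through \<open>e0\<close>, a connected component of the reglued
  circle.\<close>

definition CC :: "dpoint set" where "CC = {d. lft d \<in> cy.cyc}"

lemma cyc_lft: assumes "e \<in> cy.cyc" shows "lft e \<in> cy.cyc" "lft e = e \<or> lft e = oth e"
proof -
  show "lft e = e \<or> lft e = oth e"
    using EE_UU(2)[OF cy.cyc_closed(2)[OF assms]] by (cases rule: end_cases) simp_all
  then show "lft e \<in> cy.cyc" using assms cy.cyc_closed(3)[OF assms] by auto
qed

lemma CC_lft: "d \<in> CC \<Longrightarrow> lft d \<in> cy.cyc" "e \<in> cy.cyc \<Longrightarrow> e \<in> CC" "e0 \<in> CC" "lft e = lft d \<Longrightarrow> d \<in> CC \<Longrightarrow> e \<in> CC"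
  using cyc_lft(1) cy.cyc_closed(1) by (simp_all add: CC_def)

lemma CC_end: assumes "d \<in> CC" "is_end d" shows "d \<in> cy.cyc"
  using assms(2)
proof (cases rule: end_cases)
  case 1
  then show ?thesis using CC_lft(1)[OF assms(1)] by simp
next
  case 2
  have "oth (oth d) \<in> cy.cyc" using cy.cyc_closed(3)[OF CC_lft(1)[OF assms(1)]] 2 by simp
  then show ?thesis by (simp add: oth_props(2)[OF assms(2)])
qed

lemma CC_rig: assumes "d \<in> CC" shows "\<not> rig d" "d \<in> UU"
proof -
  have "lft d \<in> EE" by (rule cy.cyc_closed(2)[OF CC_lft(1)[OF assms]])
  then show "\<not> rig d" by (simp add: EE_def rig_lft)
  then show "d \<in> UU" by (rule not_rig_UU)
qed

lemma CC_pr: assumes "d \<in> CC" shows "pr d \<in> CC"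
proof (cases "is_end d")
  case True
  then show ?thesis using CC_lft(2) cy.cyc_closed(4) CC_end[OF assms] by blast
next
  case False
  then show ?thesis using CC_lft(4) interior_pr(4) assms by blast
qed

lemma flat_CC: "flat (\<lambda>d. d \<in> CC)"
  unfolding flat_def
proof (intro conjI ballI)
  show "loc (\<lambda>d. d \<in> CC)" using loc_lft[of "\<lambda>x. x \<in> cy.cyc"] by (simp add: CC_def)
  fix d assume d: "d \<in> UU"
  show "(pr d \<in> CC) = (d \<in> CC)"
  proof
    assume "pr d \<in> CC"
    then have "pr (pr d) \<in> CC" by (rule CC_pr)
    then show "d \<in> CC" by (simp only: UU_D(2)[OF d])
  qed (rule CC_pr)
qed

lemma flat_const: assumes F: "flat F" and d: "d \<in> CC" shows "F d = F e0"
proof -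
  have "F (lft d) = F e0"
  proof (rule cy.cyc_induct[OF CC_lft(1)[OF d]])
    fix e assume e: "e \<in> cy.cyc" "F e = F e0"
    show "F (oth e) = F e0" using e(2) flat_lft[OF F, of e] by (simp add: oth_def)
    show "F (pr e) = F e0" using e(2) flatD(1)[OF F EE_UU(1)[OF cy.cyc_closed(2)[OF e(1)]]] by simp
  qed (rule refl)
  then show ?thesis using flat_lft(1)[OF F, of d] by simp
qed

definition G0 :: "'a set" where "G0 = {g \<in> carrier G. ac g e0 \<in> CC}"

lemma G0_carrier: "g \<in> G0 \<Longrightarrow> g \<in> carrier G" by (simp add: G0_def)

lemma G0_CC: assumes "g \<in> G0" "d \<in> CC" shows "ac g d \<in> CC"
  using flat_const[OF flat_ac[OF G0_carrier[OF assms(1)] flat_CC] assms(2)] assms(1) by (simp add: G0_def)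

lemma CC_back: assumes g: "g \<in> carrier G" and d: "ac g d \<in> CC" "d \<in> CC" shows "g \<in> G0" "inv g \<in> G0"
proof -
  have "ac g e0 \<in> CC" using flat_const[OF flat_ac[OF g flat_CC] d(2)] d(1) by simp
  then show "g \<in> G0" using g by (simp add: G0_def)
  have "ac (inv g) (ac g d) \<in> CC" using d(2) by (simp only: ac_inv[OF g])
  then have "ac (inv g) e0 \<in> CC" using flat_const[OF flat_ac[OF inv_closed[OF g] flat_CC] d(1)] by simp
  then show "inv g \<in> G0" using g by (simp add: G0_def)
qed

lemma G0_inv: "g \<in> G0 \<Longrightarrow> inv g \<in> G0"
  using CC_back(2)[OF G0_carrier G0_CC[OF _ CC_lft(3)] CC_lft(3)] .

lemma G0_subgroup: "subgroup G0 G"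
proof (rule subgroupI)
  show "G0 \<subseteq> carrier G" using G0_carrier by blast
  have "\<one> \<in> G0" using CC_lft(3) by (simp add: G0_def ac_one)
  then show "G0 \<noteq> {}" by blast
  show "inv g \<in> G0" if "g \<in> G0" for g by (rule G0_inv[OF that])
  show "g \<otimes> h \<in> G0" if "g \<in> G0" "h \<in> G0" for g h
  proof -
    have "ac (g \<otimes> h) e0 \<in> CC"
      unfolding ac_mult[OF G0_carrier[OF that(1)] G0_carrier[OF that(2)]]
      by (rule G0_CC[OF that(1) G0_CC[OF that(2) CC_lft(3)]])
    then show ?thesis using m_closed[OF G0_carrier[OF that(1)] G0_carrier[OF that(2)]] unfolding G0_def by blast
  qed
qed

text \<open>There are only finitely many intervals that can contain the image of \<open>e0\<close>,
  and elements that put it in the same interval differ by an element preserving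
  \<open>CC\<close>.\<close>

lemma G0_fin_index: "fin_index G G0"
proof (rule fin_index_label[OF G0_subgroup, of "\<lambda>g. lft (ac g e0)"])
  show "finite ((\<lambda>g. lft (ac g e0)) ` carrier G)"
    by (rule finite_subset[OF _ finite_ends(1)]) blast
  fix g g' assume g: "g \<in> carrier G" "g' \<in> carrier G" and e: "lft (ac g e0) = lft (ac g' e0)"
  note F = flat_lft(1)[OF flat_ac[OF inv_closed[OF g(1)] flat_CC]]
  have "ac (inv g) (ac g e0) \<in> CC" using CC_lft(3) by (simp only: ac_inv[OF g(1)])
  then have "ac (inv g) (ac g' e0) \<in> CC" using F[of "ac g e0"] F[of "ac g' e0"] e by simp
  then show "inv g \<otimes> g' \<in> G0" using g by (simp add: G0_def ac_mult)
qed

section \<open>Flat sections of the adjoint bundle\<close>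

text \<open>All 2 by 2 matrices are allowed as values, so that the identity is a section; only the
  traceless part acts as a vector field. A section is constant in the coordinate \<open>tt\<close>
  on each interval and is carried across gluings by conjugation.\<close>

definition sec :: "(dpoint \<Rightarrow> real^2^2) \<Rightarrow> bool" where
  "sec Q \<longleftrightarrow> loc Q \<and> (\<forall>d\<in>UU. Q (pr d) ** ga d = ga d ** Q d)"

lemma secD: "sec Q \<Longrightarrow> loc Q" "sec Q \<Longrightarrow> d \<in> UU \<Longrightarrow> Q (pr d) ** ga d = ga d ** Q d"
  by (simp_all add: sec_def)

lemma sec_lft: assumes Q: "sec Q" shows "Q (lft d) = Q d" "Q (rgt d) = Q d"
proof -
  have fl: "Q (to_circle t, True) = Q (to_circle t, False)" if t: "lo d < t" "t < hi d" for t
    using secD(2)[OF Q interval_std_pr(1)[OF t, of False]]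
    unfolding interval_std_pr(2)[OF t, of False] interval_std_pr(3)[OF t, of False] by simp
  show "Q (lft d) = Q d" by (rule loc_interval(1)[OF secD(1)[OF Q] fl])
  show "Q (rgt d) = Q d" by (rule loc_interval(2)[OF secD(1)[OF Q] fl])
qed

lemma sec_zero: assumes Q: "sec Q" shows "flat (\<lambda>d. Q d = 0)"
  unfolding flat_def
proof (intro conjI ballI)
  show "loc (\<lambda>d. Q d = 0)"
    unfolding loc_def
  proof
    fix d
    have "\<forall>\<^sub>F u in at_right 0. \<forall>b. Q (nb d u b) = Q d" using secD(1)[OF Q] unfolding loc_def by (rule spec)
    then show "\<forall>\<^sub>F u in at_right 0. \<forall>b. (Q (nb d u b) = 0) = (Q d = 0)" by eventually_elim simp
  qed
  fix d assume d: "d \<in> UU"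
  have eq: "Q (pr d) ** ga d = ga d ** Q d" by (rule secD(2)[OF Q d])
  show "(Q (pr d) = 0) = (Q d = 0)"
  proof
    assume "Q (pr d) = 0"
    then have "ga d ** Q d = ga d ** 0" using eq by simp
    then show "Q d = 0" by (rule cancel_left[OF UU_D(3)[OF d]])
  next
    assume "Q d = 0"
    then have "Q (pr d) ** ga d = 0 ** ga d" using eq by simp
    then show "Q (pr d) = 0" by (rule cancel_right[OF UU_D(5)[OF d]])
  qed
qed

lemma mat_diff_mult: "(X - c *\<^sub>R Y) ** m = X ** m - c *\<^sub>R (Y ** m)" "m ** (X - c *\<^sub>R Y) = m ** X - c *\<^sub>R (m ** Y)"
  for X Y m :: "real^2^2"
  by (simp_all add: mat2_eq_iff mat2_mult algebra_simps)

text \<open>The difference of the two sides is itself a section, and the vanishing of a section is a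
  flat condition.\<close>

lemma sec_eq:
  assumes Q: "sec Q" and Q': "sec Q'" and e: "Q e0 = c *\<^sub>R Q' e0" and d: "d \<in> CC"
  shows "Q d = c *\<^sub>R Q' d"
proof -
  have "sec (\<lambda>d. Q d - c *\<^sub>R Q' d)"
    unfolding sec_def loc_def
  proof (intro conjI ballI allI)
    fix d
    have "\<forall>\<^sub>F u in at_right 0. \<forall>b. Q (nb d u b) = Q d" "\<forall>\<^sub>F u in at_right 0. \<forall>b. Q' (nb d u b) = Q' d"
      using secD(1)[OF Q] secD(1)[OF Q'] unfolding loc_def by blast+
    then show "\<forall>\<^sub>F u in at_right 0. \<forall>b. Q (nb d u b) - c *\<^sub>R Q' (nb d u b) = Q d - c *\<^sub>R Q' d" by eventually_elim simp
    assume d: "d \<in> UU"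
    show "(Q (pr d) - c *\<^sub>R Q' (pr d)) ** ga d = ga d ** (Q d - c *\<^sub>R Q' d)"
      unfolding mat_diff_mult secD(2)[OF Q d] secD(2)[OF Q' d] by (rule refl)
  qed
  from flat_const[OF sec_zero[OF this] d] show ?thesis using e by simp
qed

definition gs :: "'a \<Rightarrow> (dpoint \<Rightarrow> real^2^2) \<Rightarrow> dpoint \<Rightarrow> real^2^2" where
  "gs g Q d = al g (ac (inv g) d) ** Q (ac (inv g) d) ** al (inv g) d"

text \<open>The matrices of \<open>g\<close> at nearby points agree up to a scalar only, and
  conjugation does not see the scalar.\<close>

lemma conj_scale:
  fixes m m' n n' X :: "real^2^2"
  assumes "m' ** m = mat 1" "n' ** n = mat 1" "n = c *\<^sub>R m" shows "n' ** X ** n = m' ** X ** m"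
proof -
  have "(c *\<^sub>R n') ** m = m' ** m" using assms(1,2) unfolding assms(3) by (simp add: scale_mult)
  then have "c *\<^sub>R n' = m'" by (rule cancel_right[OF mult_inverse_comm[OF assms(1)]])
  moreover have "n' ** X ** n = (c *\<^sub>R n') ** X ** m" unfolding assms(3) by (simp add: scale_mult)
  ultimately show ?thesis by simp
qed

lemma al_inv': assumes "g \<in> carrier G"
  shows "al g (ac (inv g) d) ** al (inv g) d = mat 1" "al (inv g) d ** al g (ac (inv g) d) = mat 1"
  using al_inv[OF inv_closed[OF assms], of d] assms by simp_all

lemma gs_mult:
  assumes "g \<in> carrier G" "h \<in> carrier G" shows "gs (g \<otimes> h) Q d = gs g (gs h Q) d"
  using assms by (simp add: gs_def inv_mult_group ac_mult al_mult ac_inv matrix_mul_assoc)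

lemma sec_gs: assumes g: "g \<in> carrier G" and Q: "sec Q" shows "sec (gs g Q)"
  unfolding sec_def loc_def
proof (intro conjI ballI allI)
  fix d
  have gi: "inv g \<in> carrier G" using g by simp
  define d1 where "d1 = ac (inv g) d"
  obtain \<eta> where \<eta>: "filterlim \<eta> (at_right 0) (at_right 0)"
    "\<forall>\<^sub>F u in at_right 0. \<forall>b. ac (inv g) (nb d u b) = nb (ac (inv g) d) (\<eta> u) (b = (0 < det (al (inv g) d))) \<and>
      (\<exists>c. al (inv g) (nb d u b) = c *\<^sub>R al (inv g) d)"
    by (rule local_shift[OF gi])
  have "\<forall>\<^sub>F u in at_right 0. \<forall>b. Q (nb d1 u b) = Q d1" using secD(1)[OF Q] unfolding loc_def by (rule spec)
  then have "\<forall>\<^sub>F u in at_right 0. \<forall>b. Q (nb d1 (\<eta> u) b) = Q d1" using \<eta>(1) by (rule eventually_compose_filterlim)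
  then show "\<forall>\<^sub>F u in at_right 0. \<forall>b. gs g Q (nb d u b) = gs g Q d"
    using \<eta>(2)
  proof eventually_elim
    case (elim u)
    show ?case
    proof
      fix b
      obtain c where "al (inv g) (nb d u b) = c *\<^sub>R al (inv g) d" and a: "ac (inv g) (nb d u b) = nb d1 (\<eta> u) (b = (0 < det (al (inv g) d)))"
        using elim(2) unfolding d1_def by blast
      note c = conj_scale[OF al_inv'(1)[OF g] al_inv'(1)[OF g] this(1)]
      have "Q (ac (inv g) (nb d u b)) = Q (ac (inv g) d)" using elim(1) unfolding a d1_def[symmetric] by simp
      then show "gs g Q (nb d u b) = gs g Q d" unfolding gs_def by (simp only: c)
    qed
  qed
  assume d: "d \<in> UU"
  have d1: "d1 \<in> UU" using d UU_ac[OF gi] by (simp add: d1_def)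
  have p: "ac (inv g) (pr d) = pr d1" using pr_ac[OF gi d] by (simp add: d1_def)
  have 1: "al (inv g) (pr d) ** ga d = ga d1 ** al (inv g) d" using ga_ac[OF gi d] by (simp add: d1_def)
  have 2: "al g (pr d1) ** ga d1 = ga d ** al g d1" using ga_ac[OF g d1] ac_inv(2)[OF g, of d] by (simp add: d1_def)
  have "gs g Q (pr d) ** ga d = al g (pr d1) ** Q (pr d1) ** (al (inv g) (pr d) ** ga d)"
    by (simp only: gs_def p matrix_mul_assoc)
  also have "\<dots> = al g (pr d1) ** (Q (pr d1) ** ga d1) ** al (inv g) d" by (simp only: 1 matrix_mul_assoc)
  also have "\<dots> = (al g (pr d1) ** ga d1) ** Q d1 ** al (inv g) d" by (simp only: secD(2)[OF Q d1] matrix_mul_assoc)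
  also have "\<dots> = ga d ** gs g Q d" by (simp only: 2 gs_def d1_def[symmetric] matrix_mul_assoc)
  finally show "gs g Q (pr d) ** ga d = ga d ** gs g Q d" .
qed

section \<open>Holonomy\<close>

text \<open>Parallel transport of the fibre at \<open>e0\<close> along the cycle, cut open between
  \<open>e0\<close> and \<open>pr e0\<close>.\<close>

definition Aw :: "dpoint \<Rightarrow> real^2^2" where
  "Aw = (SOME z. z e0 = mat 1 \<and> (\<forall>e\<in>cy.cyc. z (oth e) = z e) \<and>
    (\<forall>e\<in>cy.cyc. e \<noteq> e0 \<longrightarrow> e \<noteq> pr e0 \<longrightarrow> z (pr e) = ga e ** z e))"

lemma cyc_UU: "e \<in> cy.cyc \<Longrightarrow> e \<in> UU" by (rule EE_UU(1)[OF cy.cyc_closed(2)])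

lemma Aw: "Aw e0 = mat 1" "e \<in> cy.cyc \<Longrightarrow> Aw (oth e) = Aw e"
    "\<lbrakk>e \<in> cy.cyc; e \<noteq> e0; e \<noteq> pr e0\<rbrakk> \<Longrightarrow> Aw (pr e) = ga e ** Aw e"
proof -
  have "ga (pr e) ** (ga e ** X) = X" if "e \<in> cy.cyc" for e X
    by (simp add: matrix_mul_assoc UU_D(3)[OF cyc_UU[OF that]])
  from cy.transport[of "\<lambda>e X. ga e ** X", OF this, of "mat 1"]
  have *: "Aw e0 = mat 1 \<and> (\<forall>e\<in>cy.cyc. Aw (oth e) = Aw e) \<and>
    (\<forall>e\<in>cy.cyc. e \<noteq> e0 \<longrightarrow> e \<noteq> pr e0 \<longrightarrow> Aw (pr e) = ga e ** Aw e)"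
    unfolding Aw_def by (rule someI_ex)
  show "Aw e0 = mat 1" by (rule conjunct1[OF *])
  show "Aw (oth e) = Aw e" if "e \<in> cy.cyc" using * that by blast
  show "Aw (pr e) = ga e ** Aw e" if "e \<in> cy.cyc" "e \<noteq> e0" "e \<noteq> pr e0" using * that by blast
qed

lemma Aw_det: assumes "e \<in> cy.cyc" shows "det (Aw e) \<noteq> 0"
proof (rule cy.cyc_induct[OF assms])
  fix e assume e: "e \<in> cy.cyc" "det (Aw e) \<noteq> 0"
  show "det (Aw (oth e)) \<noteq> 0" using e by (simp add: Aw(2))
  assume "e \<noteq> e0" "e \<noteq> pr e0"
  then show "det (Aw (pr e)) \<noteq> 0"
    using e ga_props(1)[OF UU_D(1)[OF cyc_UU[OF e(1)]]] by (simp add: Aw(3) det_mul)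
qed (simp add: Aw(1))

definition Bw :: "dpoint \<Rightarrow> real^2^2" where "Bw e = matrix_inv (Aw e)"

lemma Bw: assumes "e \<in> cy.cyc" shows "Aw e ** Bw e = mat 1" "Bw e ** Aw e = mat 1"
  using someI_ex[of "\<lambda>B. Aw e ** B = mat 1 \<and> B ** Aw e = mat 1"] Aw_det[OF assms]
  unfolding Bw_def invertible_det_nz[symmetric] invertible_def matrix_inv_def by blast+

lemma Aw_lft: "e \<in> cy.cyc \<Longrightarrow> Aw (lft e) = Aw e"
  using cyc_lft(2)[of e] Aw(2)[of e] by auto

text \<open>The transport once around the cycle: along \<open>Aw\<close> up to \<open>pr e0\<close>,
  then through the gluing back to \<open>e0\<close>.\<close>

definition hol :: "real^2^2" where "hol = ga (pr e0) ** Aw (pr e0)"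

definition QQ :: "real^2^2 \<Rightarrow> dpoint \<Rightarrow> real^2^2" where
  "QQ X d = (if d \<in> CC then Aw (lft d) ** X ** Bw (lft d) else 0)"

lemma QQ_e0: "QQ X e0 = X"
  using Bw(1)[OF cy.cyc_closed(1)] CC_lft(3) by (simp add: QQ_def e0_lft Aw(1))

lemma QQ_cyc: assumes "e \<in> cy.cyc" shows "QQ X e = Aw e ** X ** Bw e"
  using CC_lft(2)[OF assms] Aw_lft[OF assms] by (simp add: QQ_def Bw_def)

text \<open>Away from the edge between \<open>e0\<close> and \<open>pr e0\<close> the gluing
  condition holds by the construction of \<open>Aw\<close>. Across this edge it says exactly that
  \<open>X\<close> commutes with the holonomy; \<open>sec_hol\<close> is the converse.\<close>

lemma sec_QQ: assumes h: "hol ** X = X ** hol" shows "sec (QQ X)"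
  unfolding sec_def
proof (intro conjI ballI)
  show "loc (QQ X)" using loc_lft[of "\<lambda>e. if e \<in> cy.cyc then Aw e ** X ** Bw e else 0"]
    unfolding QQ_def CC_def mem_Collect_eq .
  fix d assume d: "d \<in> UU"
  show "QQ X (pr d) ** ga d = ga d ** QQ X d"
  proof (cases "d \<in> CC")
    case False
    then have "pr d \<notin> CC" using flatD(1)[OF flat_CC d] by simp
    then show ?thesis using False by (simp add: QQ_def)
  next
    case dC: True
    show ?thesis
    proof (cases "is_end d")
      case False
      then show ?thesis using dC CC_pr[OF dC] interior_pr(2,4)[OF False] by (simp add: QQ_def)
    next
      case True
      have c: "d \<in> cy.cyc" by (rule CC_end[OF dC True])
      have x: "pr e0 \<in> cy.cyc" by (rule cy.cyc_closed(4)[OF cy.cyc_closed(1)])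
      have e0U: "e0 \<in> UU" by (rule cyc_UU[OF cy.cyc_closed(1)])
      have h': "ga (pr e0) ** Aw (pr e0) ** X ** Bw (pr e0) = X ** ga (pr e0)"
      proof -
        have "ga (pr e0) ** Aw (pr e0) ** X ** Bw (pr e0) = X ** ga (pr e0) ** (Aw (pr e0) ** Bw (pr e0))"
          using h unfolding hol_def by (simp only: matrix_mul_assoc)
        then show ?thesis by (simp only: Bw[OF x] matrix_mul_rid)
      qed
      consider "d = e0" | "d = pr e0" | "d \<noteq> e0" "d \<noteq> pr e0" by blast
      then show ?thesis
      proof cases
        case 1
        have "ga (pr e0) ** (QQ X (pr e0) ** ga e0) = (ga (pr e0) ** Aw (pr e0) ** X ** Bw (pr e0)) ** ga e0"
          unfolding QQ_cyc[OF x] by (simp only: matrix_mul_assoc)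
        also have "\<dots> = X ** (ga (pr e0) ** ga e0)" unfolding h' by (simp only: matrix_mul_assoc)
        also have "\<dots> = (ga (pr e0) ** ga e0) ** X" by (simp only: UU_D(3)[OF e0U] matrix_mul_rid matrix_mul_lid)
        also have "\<dots> = ga (pr e0) ** (ga e0 ** X)" by (simp only: matrix_mul_assoc)
        finally have "QQ X (pr e0) ** ga e0 = ga e0 ** X" by (rule cancel_left[OF UU_D(5)[OF e0U]])
        then show ?thesis unfolding 1 QQ_e0 .
      next
        case 2
        show ?thesis unfolding 2 UU_D(2)[OF e0U] QQ_e0 QQ_cyc[OF x]
          using h' by (simp only: matrix_mul_assoc)
      next
        case 3
        have A: "Aw (pr d) = ga d ** Aw d" by (rule Aw(3)[OF c 3])
        have "(Bw (pr d) ** ga d) ** Aw d = Bw d ** Aw d"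
          using Bw(2)[OF cy.cyc_closed(4)[OF c]] Bw(2)[OF c] unfolding A by (simp only: matrix_mul_assoc)
        then have B: "Bw (pr d) ** ga d = Bw d" by (rule cancel_right[OF Bw(1)[OF c]])
        have "QQ X (pr d) ** ga d = ga d ** Aw d ** X ** (Bw (pr d) ** ga d)"
          unfolding QQ_cyc[OF cy.cyc_closed(4)[OF c]] A by (simp only: matrix_mul_assoc)
        then show ?thesis unfolding B QQ_cyc[OF c] by (simp only: matrix_mul_assoc)
      qed
    qed
  qed
qed

lemma sec_hol: assumes Q: "sec Q" shows "hol ** Q e0 = Q e0 ** hol"
proof -
  have x: "pr e0 \<in> cy.cyc" by (rule cy.cyc_closed(4)[OF cy.cyc_closed(1)])
  have e0U: "e0 \<in> UU" by (rule cyc_UU[OF cy.cyc_closed(1)])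
  have "Q (pr e0) ** Aw (pr e0) = Aw (pr e0) ** Q e0"
  proof (rule cy.cyc_induct[OF x])
    fix e assume e: "e \<in> cy.cyc" "Q e ** Aw e = Aw e ** Q e0"
    have "Q (oth e) = Q e" using sec_lft[OF Q, of e] by (simp add: oth_def)
    then show "Q (oth e) ** Aw (oth e) = Aw (oth e) ** Q e0" using e by (simp add: Aw(2))
    assume n: "e \<noteq> e0" "e \<noteq> pr e0"
    have "Q (pr e) ** Aw (pr e) = (Q (pr e) ** ga e) ** Aw e" by (simp only: Aw(3)[OF e(1) n] matrix_mul_assoc)
    also have "\<dots> = ga e ** (Q e ** Aw e)" by (simp only: secD(2)[OF Q cyc_UU[OF e(1)]] matrix_mul_assoc)
    also have "\<dots> = Aw (pr e) ** Q e0" by (simp only: e(2) Aw(3)[OF e(1) n] matrix_mul_assoc)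
    finally show "Q (pr e) ** Aw (pr e) = Aw (pr e) ** Q e0" .
  qed (simp add: Aw(1))
  then have "hol ** Q e0 = ga (pr e0) ** (Q (pr e0) ** Aw (pr e0))" by (simp only: hol_def matrix_mul_assoc)
  also have "\<dots> = (ga (pr e0) ** Q (pr e0)) ** Aw (pr e0)" by (simp only: matrix_mul_assoc)
  also have "\<dots> = Q e0 ** hol" using secD(2)[OF Q UU_pr[OF e0U]] unfolding UU_D(2)[OF e0U]
    by (simp only: hol_def matrix_mul_assoc)
  finally show ?thesis .
qed

end

text \<open>The quadratic form \<open>fvv X\<close> is the vector field on the projective line generated by \<open>X\<close>.\<close>

definition fvv :: "real^2^2 \<Rightarrow> real^2 \<Rightarrow> real" where
  "fvv X v = (X *v v) $ 1 * v $ 2 - (X *v v) $ 2 * v $ 1"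

definition fv :: "real^2^2 \<Rightarrow> real \<Rightarrow> real" where "fv X t = fvv X (pt t)"

lemma fvv_transform:
  assumes "X' ** m = m ** X" shows "fvv X' (m *v v) = det m * fvv X v"
proof -
  have "X' *v (m *v v) = m *v (X *v v)" by (simp add: matrix_vector_mul_assoc assms)
  then show ?thesis unfolding fvv_def by (simp add: mat2_vec det_2 algebra_simps)
qed

lemma fvv_scale: "fvv X (c *\<^sub>R v) = c\<^sup>2 * fvv X v"
  by (simp add: fvv_def mat2_vec algebra_simps power2_eq_square)

lemma fvv_mult: "fvv (c *\<^sub>R X) v = c * fvv X v"
  by (simp add: fvv_def mat2_vec algebra_simps)

lemma fv_eq: "fv X t = X$1$2 + (X$1$1 - X$2$2) * t - X$2$1 * t\<^sup>2"
  by (simp add: fv_def fvv_def mat2_vec algebra_simps power2_eq_square)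

definition tr2 :: "real^2^2 \<Rightarrow> real" where "tr2 X = X$1$1 + X$2$2"

lemma tr2_comm: "tr2 (X ** Y) = tr2 (Y ** X)"
  by (simp add: tr2_def mat2_mult algebra_simps)

lemma tr2_conj: "m' ** m = mat 1 \<Longrightarrow> tr2 (m ** X ** m') = tr2 X"
  using tr2_comm[of "m ** X" m'] by (simp add: matrix_mul_assoc)

text \<open>\<open>fv X\<close> is a polynomial of degree at most 2, and for traceless
  \<open>X\<close> its coefficients determine \<open>X\<close>.\<close>

lemma finite_zeros_fv:
  assumes "tr2 X = 0" "X \<noteq> 0" shows "finite {t. fv X t = 0}"
proof -
  define p where "p = [:X$1$2, X$1$1 - X$2$2, - X$2$1:]"
  have "p \<noteq> 0"
  proof
    assume "p = 0"
    then have "X$1$2 = 0" "X$1$1 = X$2$2" "X$2$1 = 0" by (simp_all add: p_def)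
    then have "X = 0" using assms(1) by (simp add: mat2_eq_iff tr2_def)
    then show False using assms(2) by contradiction
  qed
  then have "finite {t. poly p t = 0}" by (rule poly_roots_finite)
  moreover have "poly p t = fv X t" for t by (simp add: p_def fv_eq algebra_simps power2_eq_square)
  ultimately show ?thesis by simp
qed

lemma frac_cong: assumes "x - y \<in> \<int>" shows "frac x = frac (y :: real)"
proof -
  obtain n where "x = y + of_int n" using assms by (auto elim!: Ints_cases simp: algebra_simps)
  then show ?thesis by (simp add: frac_def)
qed

lemma frac_eq_diff: assumes "frac x = frac (y :: real)" shows "x - y \<in> \<int>"
proof -
  have "x - y = of_int (\<lfloor>x\<rfloor> - \<lfloor>y\<rfloor>)" using assms by (simp add: frac_def)
  then show ?thesis by (simp only: Ints_of_int)
qed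

lemma (in germ_group) interval_point:
  assumes "lo d \<le> t" "t \<le> hi d" obtains e where "lft e = lft d" "tt e = t"
proof (cases "t = lo d")
  case True
  show thesis by (rule that[of "lft d"]) (simp_all add: lft_rgt tt_lft True)
next
  case False
  then have t: "lo d < t" using assms by simp
  have "tt (to_circle t, False) = t"
    using t assms(2) cuts_range[OF hi(1)[of d]] cuts_range[OF lo(1)[of d]] by (intro tt_eqI) auto
  moreover have "lft (to_circle t, False) = lft d"
  proof (rule lo_hi_same(3))
    show "lo d < tt (to_circle t, False) \<or> lo d = tt (to_circle t, False) \<and> snd (to_circle t, False)"
      using t calculation by simp
    have "t < hi d \<or> hi d = t" using assms(2) by linarith
    then show "tt (to_circle t, False) < hi d \<or> hi d = tt (to_circle t, False) \<and> \<not> snd (to_circle t, False)"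
      using calculation by simp
  qed
  ultimately show thesis by (intro that)
qed

section \<open>Invariant vector fields on a cycle\<close>

context nonrigid_germ
begin

lemma flat_tr2: assumes Q: "sec Q" and d: "d \<in> CC" shows "tr2 (Q d) = tr2 (Q e0)"
proof -
  have "flat (\<lambda>d. tr2 (Q d))"
    unfolding flat_def loc_def
  proof (intro conjI allI ballI)
    fix d
    have "\<forall>\<^sub>F u in at_right 0. \<forall>b. Q (nb d u b) = Q d" using secD(1)[OF Q] unfolding loc_def by (rule spec)
    then show "\<forall>\<^sub>F u in at_right 0. \<forall>b. tr2 (Q (nb d u b)) = tr2 (Q d)" by eventually_elim simp
    assume d: "d \<in> UU"
    have "Q (pr d) = Q (pr d) ** ga d ** ga (pr d)" using UU_D(5)[OF d] by (simp only: matrix_mul_assoc[symmetric] matrix_mul_rid)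
    then have "Q (pr d) = ga d ** Q d ** ga (pr d)" unfolding secD(2)[OF Q d] .
    then show "tr2 (Q (pr d)) = tr2 (Q d)" using tr2_conj[OF UU_D(3)[OF d]] by simp
  qed
  then show ?thesis using d by (rule flat_const)
qed

text \<open>The primitive \<open>\<theta>\<close> of the inverse of the vector field of an invariant section is a coordinate on
  the cycle on which the group acts by translations, up to the period \<open>L\<close>; a group with
  Property FW has a finite orbit there.\<close>

lemma no_invariant_section:
  assumes K: "fin_index G K" "K \<subseteq> G0" and Q: "sec Q"
    and eqv: "\<And>g d. \<lbrakk>g \<in> K; d \<in> CC\<rbrakk> \<Longrightarrow> Q (ac g d) ** al g d = al g d ** Q d"
    and nz: "\<And>d. d \<in> CC \<Longrightarrow> fv (Q d) (tt d) \<noteq> 0"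
  shows False
proof -
  have KG: "g \<in> carrier G" "g \<in> G0" if "g \<in> K" for g using that K(2) G0_carrier by blast+
  have nz': "fv (Q d) t \<noteq> 0" if d: "d \<in> CC" and t: "lo d \<le> t" "t \<le> hi d" for d t
  proof -
    obtain e where e: "lft e = lft d" "tt e = t" using t by (rule interval_point)
    have "Q e = Q d" using sec_lft(1)[OF Q, of e] sec_lft(1)[OF Q, of d] e(1) by simp
    then show ?thesis using nz[OF CC_lft(4)[OF e(1) d]] e(2) by simp
  qed
  have "\<forall>d\<in>CC. \<exists>f. \<forall>t\<in>{lo d..hi d}. (f has_field_derivative 1 / fv (Q d) t) (at t within {lo d..hi d})"
  proof
    fix d assume d: "d \<in> CC"
    have "continuous_on {lo d..hi d} (\<lambda>t. 1 / fv (Q d) t)"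
    proof (rule continuous_on_divide)
      show "continuous_on {lo d..hi d} (fv (Q d))" unfolding fv_eq by (intro continuous_intros)
      show "\<forall>t\<in>{lo d..hi d}. fv (Q d) t \<noteq> 0" using nz'[OF d] by simp
    qed (rule continuous_on_const)
    then obtain f where "\<And>t. t \<in> {lo d..hi d} \<Longrightarrow> (f has_vector_derivative 1 / fv (Q d) t) (at t within {lo d..hi d})"
      by (rule antiderivative_continuous) blast
    then show "\<exists>f. \<forall>t\<in>{lo d..hi d}. (f has_field_derivative 1 / fv (Q d) t) (at t within {lo d..hi d})"
      unfolding has_real_derivative_iff_has_vector_derivative by blast
  qed
  then obtain Th0 where "\<forall>d\<in>CC. \<forall>t\<in>{lo d..hi d}. (Th0 d has_field_derivative 1 / fv (Q d) t) (at t within {lo d..hi d})"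
    by (rule bchoice[THEN exE])
  then have Th0: "(Th0 d has_field_derivative 1 / fv (Q d) t) (at t within {lo d..hi d})"
    if "d \<in> CC" "t \<in> {lo d..hi d}" for d t using that by blast
  \<comment> \<open>Taking the primitive chosen at the left end makes \<open>Th\<close> depend on
    the interval only.\<close>
  define Th where "Th d = Th0 (lft d)" for d
  have Th: "(Th d has_field_derivative 1 / fv (Q d) t) (at t within {lo d..hi d})"
    if "d \<in> CC" "t \<in> {lo d..hi d}" for d t
    using Th0[of "lft d" t] that CC_lft(4)[of "lft d" d] by (simp add: Th_def lft_rgt sec_lft[OF Q])
  have Th_lft: "Th d = Th e" if "lft d = lft e" for d e using that by (simp add: Th_def)
  \<comment> \<open>Transport of additive constants: \<open>z\<close> makes \<open>\<theta>\<close>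
    match across every gluing except the one between \<open>e0\<close> and \<open>pr e0\<close>,
    where the jump is the period \<open>L0\<close>.\<close>
  define T where "T e x = x + Th e (tt e) - Th (pr e) (tt (pr e))" for e and x :: real
  have "T (pr e) (T e x) = x" if "e \<in> cy.cyc" for e x by (simp add: T_def UU_D(2)[OF cyc_UU[OF that]])
  from cy.transport[of T, OF this, of 0] obtain z where z:
    "\<forall>e\<in>cy.cyc. z (oth e) = z e" "\<forall>e\<in>cy.cyc. e \<noteq> e0 \<longrightarrow> e \<noteq> pr e0 \<longrightarrow> z (pr e) = T e (z e)" by blast
  define \<theta> where "\<theta> d = z (lft d) + Th d (tt d)" for d
  define L0 where "L0 = \<theta> (pr e0) - \<theta> e0"
  \<comment> \<open>If the period is 0, then \<open>\<theta>\<close> matches across all gluings and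
    any nonzero \<open>L\<close> serves.\<close>
  define L where "L = (if L0 = 0 then 1 else L0)"
  have L: "L \<noteq> 0" "L0 / L \<in> \<int>" by (simp_all add: L_def)
  have z_lft: "z (lft e) = z e" if "e \<in> cy.cyc" for e using cyc_lft(2)[OF that] z(1) that by auto
  have \<theta>_pr: "(\<theta> (pr d) - \<theta> d) / L \<in> \<int>" if d: "d \<in> CC" for d
  proof (cases "is_end d")
    case False
    then show ?thesis using interior_pr(3,4)[OF False] Th_lft[of "pr d" d] by (simp add: \<theta>_def)
  next
    case True
    have c: "d \<in> cy.cyc" by (rule CC_end[OF d True])
    consider "d = e0" | "d = pr e0" | "d \<noteq> e0" "d \<noteq> pr e0" by blast
    then show ?thesis
    proof cases
      case 1
      then show ?thesis using L(2) by (simp add: L0_def)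
    next
      case 2
      then have "\<theta> (pr d) - \<theta> d = - L0" by (simp add: L0_def UU_D(2)[OF cyc_UU[OF cy.cyc_closed(1)]])
      then show ?thesis using Ints_minus[OF L(2)] by simp
    next
      case 3
      then have "z (pr d) = T d (z d)" using z(2) c by blast
      then show ?thesis by (simp add: \<theta>_def T_def z_lft[OF c] z_lft[OF cy.cyc_closed(4)[OF c]])
    qed
  qed
  \<comment> \<open>On the side of \<open>d\<close> the germ of \<open>g\<close> sends
    \<open>s u\<close> to \<open>r u\<close>. Invariance of the section gives
    \<open>(w u)^2 * fv (Q d') (r u) = det m * fv (Q d) (s u)\<close>, so
    \<open>Th d' (r u) - Th d (s u)\<close> has derivative 0.\<close>
  have local\<theta>: "\<forall>\<^sub>F u in at_right 0. \<forall>b. \<theta> (ac g (nb d u b)) - \<theta> (nb d u b) = \<theta> (ac g d) - \<theta> d"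
    if g: "g \<in> K" and d: "d \<in> CC" for g d
  proof -
    define d' where "d' = ac g d"
    define m where "m = al g d"
    define s where "s u = tt d + sg (snd d) * u" for u
    define w where "w u = m$2$1 * s u + m$2$2" for u
    define r where "r u = (m$1$1 * s u + m$1$2) / w u" for u
    have d': "d' \<in> CC" unfolding d'_def by (rule G0_CC[OF KG(2)[OF g] d])
    obtain \<eta> where \<eta>: "filterlim \<eta> (at_right 0) (at_right 0)"
      "\<forall>\<^sub>F u in at_right 0. \<forall>b. ac g (nb d u b) = nb (ac g d) (\<eta> u) (b = (0 < det (al g d))) \<and>
      (\<exists>c. al g (nb d u b) = c *\<^sub>R al g d)"
      by (rule local_shift[OF KG(1)[OF g]])
    have ev: "\<forall>\<^sub>F u in at_right 0. lo d' < tt d' + sg (snd d') * \<eta> u \<and> tt d' + sg (snd d') * \<eta> u < hi d'"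
      by (rule eventually_compose_filterlim[OF _ \<eta>(1)]) (rule eventually_mono[OF eventually_interval[of d']], blast)
    have "\<forall>\<^sub>F u in at_right 0. (lo d < s u \<and> s u < hi d \<and> w u \<noteq> 0 \<and> lo d' < r u \<and> r u < hi d') \<and>
        (\<forall>b. tt (nb d u b) = s u \<and> lft (nb d u b) = lft d \<and> tt (ac g (nb d u b)) = r u \<and> lft (ac g (nb d u b)) = lft d')"
      using \<eta>(2) ev eventually_interval[of d]
    proof eventually_elim
      case (elim u)
      have i: "lo d < s u" "s u < hi d" using elim(3) by (simp_all add: s_def)
      have "w u \<noteq> 0 \<and> lo d' < r u \<and> r u < hi d' \<and> tt (nb d u b) = s u \<and> lft (nb d u b) = lft d \<and>
          tt (ac g (nb d u b)) = r u \<and> lft (ac g (nb d u b)) = lft d'" for b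
      proof -
        obtain c where c: "al g (nb d u b) = c *\<^sub>R m" and a: "ac g (nb d u b) = nb d' (\<eta> u) (b = (0 < det (al g d)))"
          using elim(1) unfolding d'_def m_def by blast
        have n: "tt (nb d u b) = s u" "lft (nb d u b) = lft d"
          using nb_interval[of d u b] i unfolding s_def by simp_all
        have n': "tt (ac g (nb d u b)) = tt d' + sg (snd d') * \<eta> u" "lft (ac g (nb d u b)) = lft d'"
          unfolding a using nb_interval[of d' "\<eta> u"] elim(2) by simp_all
        have "(c *\<^sub>R m) *v pt (s u) = pt (tt (ac g (nb d u b)))" using al_pt[OF KG(1)[OF g], of "nb d u b"] by (simp only: n c)
        then have p: "c * (m$1$1 * s u + m$1$2) = tt (ac g (nb d u b))" "c * w u = 1"
          by (simp_all add: vec2_eq_iff mat2_vec w_def algebra_simps)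
        then have w0: "w u \<noteq> 0" by auto
        then have "c = 1 / w u" using p(2) by (simp add: field_simps)
        then have "tt (ac g (nb d u b)) = r u" using p(1) by (simp add: r_def)
        then show ?thesis using n n' w0 elim(2) by simp
      qed
      then show ?case using i by blast
    qed
    then obtain \<delta> where \<delta>: "\<delta> > 0" and near: "\<And>u. 0 < u \<Longrightarrow> u < \<delta> \<Longrightarrow>
        (lo d < s u \<and> s u < hi d \<and> w u \<noteq> 0 \<and> lo d' < r u \<and> r u < hi d') \<and>
        (\<forall>b. tt (nb d u b) = s u \<and> lft (nb d u b) = lft d \<and> tt (ac g (nb d u b)) = r u \<and> lft (ac g (nb d u b)) = lft d')"
      unfolding eventually_at_right_field by blast
    define S where "S = {0..\<delta>/2}"
    have "m *v pt (tt d) = pt (tt d')" unfolding m_def d'_def by (rule al_pt[OF KG(1)[OF g]])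
    then have zero: "s 0 = tt d" "w 0 = 1" "r 0 = tt d'"
      by (simp_all add: s_def w_def r_def vec2_eq_iff mat2_vec)
    have inS: "s u \<in> {lo d..hi d}" "w u \<noteq> 0" "r u \<in> {lo d'..hi d'}" if u: "u \<in> S" for u
    proof -
      have "s u \<in> {lo d..hi d} \<and> w u \<noteq> 0 \<and> r u \<in> {lo d'..hi d'}"
      proof (cases "u = 0")
        case True
        then show ?thesis using zero lo_hi[of d] lo_hi[of d'] by simp
      next
        case False
        then have "0 < u" "u < \<delta>" using u \<delta> by (auto simp: S_def)
        from near[OF this] show ?thesis by simp
      qed
      then show "s u \<in> {lo d..hi d}" "w u \<noteq> 0" "r u \<in> {lo d'..hi d'}" by blast+
    qed
    define \<Phi> where "\<Phi> u = Th d' (r u) - Th d (s u)" for u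
    have der: "(\<Phi> has_field_derivative 0) (at u within S)" if u: "u \<in> S" for u
    proof -
      have Ds: "(s has_field_derivative sg (snd d)) (at u within S)"
        unfolding s_def by (auto intro!: derivative_eq_intros)
      have D1: "((\<lambda>u. m$1$1 * s u + m$1$2) has_field_derivative m$1$1 * sg (snd d)) (at u within S)"
        by (auto intro!: derivative_eq_intros Ds)
      have D2: "(w has_field_derivative m$2$1 * sg (snd d)) (at u within S)"
        unfolding w_def by (auto intro!: derivative_eq_intros Ds)
      have Dr: "(r has_field_derivative det m * sg (snd d) / (w u)\<^sup>2) (at u within S)"
      proof -
        have "m$1$1 * sg (snd d) * w u - (m$1$1 * s u + m$1$2) * (m$2$1 * sg (snd d)) = det m * sg (snd d)"
          by (simp add: w_def det_2 algebra_simps)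
        then show ?thesis unfolding r_def using DERIV_divide[OF D1 D2 inS(2)[OF u]] by (simp add: power2_eq_square)
      qed
      have "((Th d \<circ> s) has_field_derivative 1 / fv (Q d) (s u) * sg (snd d)) (at u within S)"
        by (rule DERIV_image_chain[OF has_field_derivative_subset[OF Th[OF d inS(1)[OF u]]] Ds]) (use inS(1) in blast)
      moreover have "((Th d' \<circ> r) has_field_derivative 1 / fv (Q d') (r u) * (det m * sg (snd d) / (w u)\<^sup>2)) (at u within S)"
        by (rule DERIV_image_chain[OF has_field_derivative_subset[OF Th[OF d' inS(3)[OF u]]] Dr]) (use inS(3) in blast)
      ultimately have D: "(\<Phi> has_field_derivative 1 / fv (Q d') (r u) * (det m * sg (snd d) / (w u)\<^sup>2) - 1 / fv (Q d) (s u) * sg (snd d)) (at u within S)"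
        unfolding \<Phi>_def comp_def by (rule DERIV_diff[rotated])
      have "m *v pt (s u) = w u *\<^sub>R pt (r u)"
        using inS(2)[OF u] by (simp add: vec2_eq_iff mat2_vec r_def w_def)
      then have "(w u)\<^sup>2 * fv (Q d') (r u) = det m * fv (Q d) (s u)"
        using fvv_transform[OF eqv[OF g d], of "pt (s u)"] unfolding fv_def d'_def[symmetric] m_def[symmetric] by (simp add: fvv_scale)
      moreover have "fv (Q d') (r u) \<noteq> 0" "fv (Q d) (s u) \<noteq> 0"
        using nz'[OF d', of "r u"] nz'[OF d, of "s u"] inS[OF u] by simp_all
      ultimately have "1 / fv (Q d') (r u) * (det m * sg (snd d) / (w u)\<^sup>2) - 1 / fv (Q d) (s u) * sg (snd d) = 0"
        using inS(2)[OF u] by (simp add: divide_simps) (simp add: algebra_simps)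
      then show ?thesis using D by simp
    qed
    have "convex S" by (simp add: S_def)
    then obtain c where c: "\<And>u. u \<in> S \<Longrightarrow> \<Phi> u = c"
      using has_field_derivative_zero_constant[OF _ der] by blast
    have "\<forall>\<^sub>F u in at_right 0. 0 < u \<and> u < \<delta>/2"
      unfolding eventually_at_right_field using \<delta> by (intro exI[of _ "\<delta>/2"]) simp
    then show ?thesis
    proof eventually_elim
      case (elim u)
      have "\<Phi> u = \<Phi> 0" using c[of u] c[of 0] elim by (simp add: S_def)
      then have e: "Th d' (r u) - Th d (s u) = Th d' (tt d') - Th d (tt d)" by (simp add: \<Phi>_def zero)
      show ?case
      proof
        fix b
        have "tt (nb d u b) = s u \<and> lft (nb d u b) = lft d \<and> tt (ac g (nb d u b)) = r u \<and> lft (ac g (nb d u b)) = lft d'"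
          using near[of u] elim \<delta> by simp
        then have "\<theta> (ac g (nb d u b)) - \<theta> (nb d u b) = (z (lft d') + Th d' (r u)) - (z (lft d) + Th d (s u))"
          using Th_lft[of "nb d u b" d] Th_lft[of "ac g (nb d u b)" d'] by (simp add: \<theta>_def)
        then show "\<theta> (ac g (nb d u b)) - \<theta> (nb d u b) = \<theta> (ac g d) - \<theta> d"
          unfolding \<theta>_def d'_def[symmetric] using e by linarith
      qed
    qed
  qed
  \<comment> \<open>Modulo \<open>L\<close> the displacement of \<open>\<theta>\<close> by
    \<open>g\<close> is flat, hence constant on the cycle, which makes \<open>\<tau>\<close> a
    homomorphism modulo \<int>.\<close>
  define \<Delta> where "\<Delta> g d = (if d \<in> CC then frac ((\<theta> (ac g d) - \<theta> d) / L) else 0)" for g d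
  have flat\<Delta>: "flat (\<Delta> g)" if g: "g \<in> K" for g
    unfolding flat_def loc_def
  proof (intro conjI allI ballI)
    fix d
    have C: "\<forall>\<^sub>F u in at_right 0. \<forall>b. (nb d u b \<in> CC) = (d \<in> CC)" using flatD(2)[OF flat_CC] unfolding loc_def by (rule spec)
    show "\<forall>\<^sub>F u in at_right 0. \<forall>b. \<Delta> g (nb d u b) = \<Delta> g d"
    proof (cases "d \<in> CC")
      case True
      from C local\<theta>[OF g True] show ?thesis by eventually_elim (simp add: \<Delta>_def True)
    next
      case False
      from C show ?thesis by eventually_elim (simp add: \<Delta>_def False)
    qed
    assume d: "d \<in> UU"
    show "\<Delta> g (pr d) = \<Delta> g d"
    proof (cases "d \<in> CC")
      case True
      have p: "ac g (pr d) = pr (ac g d)" using pr_ac[OF KG(1)[OF g] d] by simp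
      have "(\<theta> (pr (ac g d)) - \<theta> (ac g d)) / L - (\<theta> (pr d) - \<theta> d) / L \<in> \<int>"
        by (intro Ints_diff \<theta>_pr G0_CC KG(2) g True)
      then have "(\<theta> (ac g (pr d)) - \<theta> (pr d)) / L - (\<theta> (ac g d) - \<theta> d) / L \<in> \<int>"
        unfolding p by (simp add: diff_divide_distrib algebra_simps)
      then have "frac ((\<theta> (ac g (pr d)) - \<theta> (pr d)) / L) = frac ((\<theta> (ac g d) - \<theta> d) / L)" by (rule frac_cong)
      then show ?thesis using True CC_pr[OF True] by (simp add: \<Delta>_def)
    next
      case False
      then have "pr d \<notin> CC" using flatD(1)[OF flat_CC d] by simp
      then show ?thesis using False by (simp add: \<Delta>_def)
    qed
  qed
  define \<tau> where "\<tau> g = (\<theta> (ac g e0) - \<theta> e0) / L" for g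
  have hom: "\<tau> (g \<otimes> h) - \<tau> g - \<tau> h \<in> \<int>" if g: "g \<in> K" and h: "h \<in> K" for g h
  proof -
    have hC: "ac h e0 \<in> CC" by (rule G0_CC[OF KG(2)[OF h] CC_lft(3)])
    have "\<Delta> g (ac h e0) = \<Delta> g e0" by (rule flat_const[OF flat\<Delta>[OF g] hC])
    then have "frac ((\<theta> (ac g (ac h e0)) - \<theta> (ac h e0)) / L) = frac ((\<theta> (ac g e0) - \<theta> e0) / L)"
      using hC CC_lft(3) by (simp add: \<Delta>_def)
    then have "(\<theta> (ac g (ac h e0)) - \<theta> (ac h e0)) / L - (\<theta> (ac g e0) - \<theta> e0) / L \<in> \<int>" by (rule frac_eq_diff)
    then show ?thesis by (simp add: \<tau>_def ac_mult[OF KG(1)[OF g] KG(1)[OF h]] diff_divide_distrib algebra_simps)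
  qed
  interpret KGr: group "G\<lparr>carrier := K\<rparr>" using K(1) by (rule fin_index_group)
  obtain n :: nat where n: "n > 0" "\<And>g. g \<in> K \<Longrightarrow> n * \<tau> g \<in> \<int>"
    by (rule KGr.FW_mod_Ints[OF FW_fin_index[OF FW K(1)], of \<tau>]) (use hom in simp_all)
  \<comment> \<open>On the orbit of \<open>e0\<close> the values of \<open>\<theta>\<close> lie in a
    translate of a lattice. They are bounded, since the cycle consists of finitely many compact
    intervals, and so they are finite in number.\<close>
  have "\<exists>B. \<forall>d\<in>CC. \<bar>\<theta> d\<bar> \<le> B"
  proof -
    have "\<exists>B. \<forall>t\<in>{lo e..hi e}. \<bar>z e + Th e t\<bar> \<le> B" if e: "e \<in> CC" for e
    proof -
      have "continuous_on {lo e..hi e} (\<lambda>t. z e + Th e t)"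
        using Th[OF e] by (intro continuous_intros DERIV_continuous_on)
      then have "bounded ((\<lambda>t. z e + Th e t) ` {lo e..hi e})"
        by (intro compact_imp_bounded compact_continuous_image compact_Icc)
      then show ?thesis by (simp add: bounded_iff)
    qed
    then have "\<forall>e\<in>cy.cyc. \<exists>B. \<forall>t\<in>{lo e..hi e}. \<bar>z e + Th e t\<bar> \<le> B" using CC_lft(2) by blast
    then obtain B where B: "\<forall>e\<in>cy.cyc. \<forall>t\<in>{lo e..hi e}. \<bar>z e + Th e t\<bar> \<le> B e" by (rule bchoice[THEN exE])
    have fin: "finite cy.cyc" using cy.finite_E cy.cyc_closed(2) by (blast intro: finite_subset)
    show ?thesis
    proof (intro exI ballI)
      fix d assume d: "d \<in> CC"
      have c: "lft d \<in> cy.cyc" by (rule CC_lft(1)[OF d])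
      have "\<bar>\<theta> d\<bar> \<le> B (lft d)" using B c lo_hi[of d] Th_lft[of d "lft d"] by (simp add: \<theta>_def lft_rgt)
      also have "\<dots> \<le> Max (B ` cy.cyc)" using fin c by simp
      finally show "\<bar>\<theta> d\<bar> \<le> Max (B ` cy.cyc)" .
    qed
  qed
  then obtain B where B: "\<And>d. d \<in> CC \<Longrightarrow> \<bar>\<theta> d\<bar> \<le> B" by blast
  define Orb where "Orb = (\<lambda>g. ac g e0) ` K"
  have OC: "d \<in> CC" if "d \<in> Orb" for d using that G0_CC[OF KG(2) CC_lft(3)] by (auto simp: Orb_def)
  define f where "f x = n * (x - \<theta> e0) / L" for x
  have f1: "f (\<theta> d) \<in> \<int>" if "d \<in> Orb" for d using that n(2) by (auto simp: f_def Orb_def \<tau>_def)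
  have "\<theta> ` Orb \<subseteq> (\<lambda>y. y * L / n + \<theta> e0) ` {k \<in> \<int>. \<bar>k\<bar> \<le> n * (2 * B) / \<bar>L\<bar>}"
  proof
    fix x assume "x \<in> \<theta> ` Orb"
    then obtain d where d: "d \<in> Orb" "x = \<theta> d" by blast
    have "\<bar>\<theta> d - \<theta> e0\<bar> \<le> 2 * B" using B[OF OC[OF d(1)]] B[OF CC_lft(3)] by linarith
    then have "n * \<bar>\<theta> d - \<theta> e0\<bar> / \<bar>L\<bar> \<le> n * (2 * B) / \<bar>L\<bar>" by (intro divide_right_mono mult_left_mono) auto
    then have "\<bar>f x\<bar> \<le> n * (2 * B) / \<bar>L\<bar>" by (simp add: f_def d abs_mult)
    moreover have "x = f x * L / n + \<theta> e0" using L(1) n(1) by (simp add: f_def)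
    ultimately show "x \<in> (\<lambda>y. y * L / n + \<theta> e0) ` {k \<in> \<int>. \<bar>k\<bar> \<le> n * (2 * B) / \<bar>L\<bar>}"
      using f1[OF d(1)] d(2) by (intro image_eqI[where x = "f x"]) auto
  qed
  then have fin\<theta>: "finite (\<theta> ` Orb)" by (rule finite_subset) (intro finite_imageI finite_abs_int_segment)
  \<comment> \<open>Within an interval \<open>\<theta>\<close> is injective, because its derivative
    \<open>1 / fv\<close> has no zero.\<close>
  have "inj_on (\<lambda>d. (lft d, \<theta> d, snd d)) Orb"
  proof (rule inj_onI)
    fix d e assume d: "d \<in> Orb" and e: "e \<in> Orb" and eq: "(lft d, \<theta> d, snd d) = (lft e, \<theta> e, snd e)"
    have lf: "lft e = lft d" using eq by simp
    have le: "lo e = lo d" "hi e = hi d" using lft_rgt(5,6)[of d] lft_rgt(5,6)[of e] lf by simp_all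
    have "\<theta> d = \<theta> e" using eq by simp
    then have T: "Th d (tt d) = Th d (tt e)" unfolding \<theta>_def lf Th_lft[OF lf] by simp
    have no: False if ab: "a < b" "lo d \<le> a" "b \<le> hi d" "Th d a = Th d b" for a b
    proof -
      have "(Th d has_derivative (*) (1 / fv (Q d) x)) (at x within {a..b})" if "a \<le> x" "x \<le> b" for x
        using has_field_derivative_subset[OF Th[OF OC[OF d], of x], of "{a..b}"] that ab
        by (simp add: has_field_derivative_def)
      from mvt_simple[OF ab(1) this] obtain x where x: "x \<in> {a<..<b}" "Th d b - Th d a = 1 / fv (Q d) x * (b - a)" by blast
      then show False using nz'[OF OC[OF d], of x] ab by simp
    qed
    have "tt d = tt e"
      using no[of "tt d" "tt e"] no[of "tt e" "tt d"] T lo_hi[of d] lo_hi[of e] le by (metis linorder_neqE_linordered_idom)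
    then show "d = e" using eq by (intro tt_inj) simp_all
  qed
  moreover have "finite ((\<lambda>d. (lft d, \<theta> d, snd d)) ` Orb)"
  proof (rule finite_subset)
    show "(\<lambda>d. (lft d, \<theta> d, snd d)) ` Orb \<subseteq> range lft \<times> \<theta> ` Orb \<times> UNIV" by blast
    show "finite (range lft \<times> \<theta> ` Orb \<times> (UNIV :: bool set))" by (intro finite_cartesian_product finite_ends fin\<theta> finite)
  qed
  ultimately have "finite Orb" by (rule finite_imageD[rotated])
  then have "rig e0" unfolding Orb_def by (rule fin_index_orbit[OF K(1)])
  then show False using e0_rig by contradiction
qed

text \<open>The factors \<open>c g\<close> form a character, which is 1 on a subgroup of finite
  index, so the section is invariant there. Its vector field has no zero on the cycle: the group
  permutes the finitely many zeros, and a zero would have a finite orbit and be rigid.\<close>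

lemma no_eigensection:
  assumes K: "fin_index G K" "K \<subseteq> G0" and Q: "sec Q" and tr: "tr2 (Q e0) = 0" and nz: "Q e0 \<noteq> 0"
    and eig: "\<And>g. g \<in> K \<Longrightarrow> \<exists>c. gs g Q e0 = c *\<^sub>R Q e0"
  shows False
proof -
  have KG: "g \<in> carrier G" "g \<in> G0" if "g \<in> K" for g using that K(2) G0_carrier by blast+
  interpret K: subgroup K G using K(1) by (rule fin_index_subgroup)
  have Qnz: "Q d \<noteq> 0" if "d \<in> CC" for d using flat_const[OF sec_zero[OF Q] that] nz by simp
  have "\<forall>g\<in>K. \<exists>c. gs g Q e0 = c *\<^sub>R Q e0" using eig by blast
  then obtain c where c: "\<forall>g\<in>K. gs g Q e0 = c g *\<^sub>R Q e0" by (rule bchoice[THEN exE])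
  have E: "al g d ** Q d = c g *\<^sub>R (Q (ac g d) ** al g d)" if g: "g \<in> K" and d: "d \<in> CC" for g d
  proof -
    have "gs g Q (ac g d) = c g *\<^sub>R Q (ac g d)"
      using c g by (intro sec_eq[OF sec_gs[OF KG(1)[OF g] Q] Q _ G0_CC[OF KG(2)[OF g] d]]) blast
    then have "al g d ** Q d ** al (inv g) (ac g d) = c g *\<^sub>R Q (ac g d)"
      by (simp only: gs_def ac_inv[OF KG(1)[OF g]])
    then have "al g d ** Q d ** (al (inv g) (ac g d) ** al g d) = (c g *\<^sub>R Q (ac g d)) ** al g d"
      by (simp only: matrix_mul_assoc)
    then show ?thesis by (simp only: al_inv[OF KG(1)[OF g]] matrix_mul_rid scale_mult)
  qed
  have nzm: "Q d ** al g d' \<noteq> 0" "al g d' ** Q d \<noteq> 0" if "g \<in> K" "d \<in> CC" for g d d'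
  proof -
    show "Q d ** al g d' \<noteq> 0"
    proof
      assume "Q d ** al g d' = 0"
      then have "Q d ** al g d' = 0 ** al g d'" by simp
      then have "Q d = 0" by (rule cancel_right[OF al_inv(2)[OF KG(1)[OF that(1)]]])
      then show False using Qnz[OF that(2)] by contradiction
    qed
    show "al g d' ** Q d \<noteq> 0"
    proof
      assume "al g d' ** Q d = 0"
      then have "al g d' ** Q d = al g d' ** 0" by simp
      then have "Q d = 0" by (rule cancel_left[OF al_inv(1)[OF KG(1)[OF that(1)]]])
      then show False using Qnz[OF that(2)] by contradiction
    qed
  qed
  have c0: "c g \<noteq> 0" if g: "g \<in> K" for g
    using E[OF g CC_lft(3)] nzm(2)[of g e0 e0, OF g CC_lft(3)] by auto
  have hom: "c (g \<otimes> h) = c g * c h" if g: "g \<in> K" and h: "h \<in> K" for g h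
  proof -
    have hC: "ac h e0 \<in> CC" by (rule G0_CC[OF KG(2)[OF h] CC_lft(3)])
    have gh: "g \<otimes> h \<in> K" using g h by (rule K.m_closed)
    note m = ac_mult[OF KG(1)[OF g] KG(1)[OF h]] al_mult[OF KG(1)[OF g] KG(1)[OF h]]
    let ?M = "Q (ac g (ac h e0)) ** al g (ac h e0) ** al h e0"
    have "c (g \<otimes> h) *\<^sub>R ?M = al g (ac h e0) ** (al h e0 ** Q e0)"
      using E[OF gh CC_lft(3)] by (simp only: m matrix_mul_assoc)
    also have "\<dots> = c h *\<^sub>R ((al g (ac h e0) ** Q (ac h e0)) ** al h e0)"
      by (simp only: E[OF h CC_lft(3)] scale_mult matrix_mul_assoc)
    also have "\<dots> = (c g * c h) *\<^sub>R ?M" by (simp only: E[OF g hC] scale_mult scaleR_scaleR mult.commute)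
    finally have eq: "c (g \<otimes> h) *\<^sub>R ?M = (c g * c h) *\<^sub>R ?M" .
    have "Q (ac (g \<otimes> h) e0) ** al (g \<otimes> h) e0 \<noteq> 0"
      by (rule nzm(1)[OF gh G0_CC[OF KG(2)[OF gh] CC_lft(3)]])
    then have "?M \<noteq> 0" by (simp only: m matrix_mul_assoc not_False_eq_True)
    then show ?thesis using eq by simp
  qed
  define K1 where "K1 = {g \<in> K. c g = 1}"
  have K1: "fin_index G K1" unfolding K1_def by (rule FW_hom_kernel[OF FW K(1) hom c0])
  show False
  proof (rule no_invariant_section[OF K1 _ Q])
    show "K1 \<subseteq> G0" using K(2) by (auto simp: K1_def)
    show "Q (ac g d) ** al g d = al g d ** Q d" if "g \<in> K1" "d \<in> CC" for g d
      using E[of g d] that by (simp add: K1_def)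
    show "fv (Q d) (tt d) \<noteq> 0" if d: "d \<in> CC" for d
    proof
      assume z: "fv (Q d) (tt d) = 0"
      define Z where "Z = {d \<in> CC. fv (Q d) (tt d) = 0}"
      have "(\<lambda>g. ac g d) ` K \<subseteq> Z"
      proof
        fix x assume "x \<in> (\<lambda>g. ac g d) ` K"
        then obtain g where g: "g \<in> K" "x = ac g d" by blast
        have "(c g *\<^sub>R Q (ac g d)) ** al g d = al g d ** Q d" using E[OF g(1) d] by (simp add: scale_mult)
        from fvv_transform[OF this, of "pt (tt d)"] have "c g * fv (Q (ac g d)) (tt (ac g d)) = 0"
          using z by (simp add: fv_def fvv_mult al_pt[OF KG(1)[OF g(1)]])
        then show "x \<in> Z" using c0[OF g(1)] G0_CC[OF KG(2)[OF g(1)] d] by (simp add: Z_def g(2))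
      qed
      moreover have "finite Z"
      proof (rule finite_imageD)
        show "inj_on (\<lambda>d. (tt d, snd d)) Z"
        proof (rule inj_onI)
          fix d e assume "(tt d, snd d) = (tt e, snd e)"
          then show "d = e" by (intro tt_inj) simp_all
        qed
        have fin: "finite cy.cyc" using cy.finite_E cy.cyc_closed(2) by (blast intro: finite_subset)
        have "(\<lambda>d. (tt d, snd d)) ` Z \<subseteq> (\<Union>e\<in>cy.cyc. {t. fv (Q e) t = 0}) \<times> UNIV"
        proof
          fix x assume "x \<in> (\<lambda>d. (tt d, snd d)) ` Z"
          then obtain d where d: "d \<in> CC" "fv (Q d) (tt d) = 0" "x = (tt d, snd d)" by (auto simp: Z_def)
          have "tt d \<in> (\<Union>e\<in>cy.cyc. {t. fv (Q e) t = 0})"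
            using CC_lft(1)[OF d(1)] by (rule UN_I) (simp add: sec_lft[OF Q] d(2))
          then show "x \<in> (\<Union>e\<in>cy.cyc. {t. fv (Q e) t = 0}) \<times> UNIV" unfolding d(3) by blast
        qed
        moreover have "finite ((\<Union>e\<in>cy.cyc. {t. fv (Q e) t = 0}) \<times> (UNIV :: bool set))"
          using fin by (intro finite_cartesian_product finite_UN_I finite_zeros_fv finite)
            (simp_all add: flat_tr2[OF Q CC_lft(2)] tr Qnz[OF CC_lft(2)])
        ultimately show "finite ((\<lambda>d. (tt d, snd d)) ` Z)" by (rule finite_subset)
      qed
      ultimately have "finite ((\<lambda>g. ac g d) ` K)" by (rule finite_subset)
      then have "rig d" by (rule fin_index_orbit[OF K(1)])
      then show False using CC_rig(1)[OF d] by contradiction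
    qed
  qed
qed

end

section \<open>Traceless matrices and fixed points in the hyperbolic plane\<close>

definition E12 :: "real^2^2" where "E12 = (\<chi> i j. if i = 1 \<and> j = 2 then 1 else 0)"
text \<open>The symplectic form of the plane:
  \<open>transpose B ** J2 ** B = det B *\<^sub>R J2\<close> for every \<open>B\<close>.\<close>

definition J2 :: "real^2^2" where "J2 = (\<chi> i j. if i = j then 0 else if i = 1 then - 1 else 1)"

lemma E12_simps [simp]: "E12$1$1 = 0" "E12$1$2 = 1" "E12$2$1 = 0" "E12$2$2 = 0"
  by (simp_all add: E12_def)

lemma J2_simps [simp]: "J2$1$1 = 0" "J2$1$2 = - 1" "J2$2$1 = 1" "J2$2$2 = 0"
  by (simp_all add: J2_def)

lemma mat2_scale: "(c *\<^sub>R (m :: real^2^2)) $ i $ j = c * m $ i $ j"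
  by simp

text \<open>The commutator of traceless matrices is a nondegenerate cross product, so it vanishes
  only for proportional ones. The cases provide a nonzero entry of \<open>X\<close> to divide
  by.\<close>

lemma commute_traceless:
  fixes X Y :: "real^2^2"
  assumes t: "tr2 X = 0" "tr2 Y = 0" and nz: "X \<noteq> 0" and c: "X ** Y = Y ** X"
  shows "\<exists>c. Y = c *\<^sub>R X"
proof -
  have X: "X$2$2 = - (X$1$1)" and Y: "Y$2$2 = - (Y$1$1)" using t unfolding tr2_def by linarith+
  have e: "X$1$2 * Y$2$1 = Y$1$2 * X$2$1" "X$1$1 * Y$1$2 = X$1$2 * Y$1$1" "X$1$1 * Y$2$1 = X$2$1 * Y$1$1"
  proof -
    have m: "(X ** Y) $ i $ j = (Y ** X) $ i $ j" for i j using c by (rule arg_cong[where f = "\<lambda>Z. Z $ i $ j"])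
    have c: "X$1$2 * Y$2$2 = - (X$1$2 * Y$1$1)" "Y$1$2 * X$2$2 = - (X$1$1 * Y$1$2)"
      "Y$2$2 * X$2$1 = - (X$2$1 * Y$1$1)" "X$2$2 * Y$2$1 = - (X$1$1 * Y$2$1)"
      "Y$1$1 * X$1$1 = X$1$1 * Y$1$1" "Y$1$1 * X$1$2 = X$1$2 * Y$1$1" "Y$2$1 * X$1$1 = X$1$1 * Y$2$1"
      by (simp_all add: X Y)
    show "X$1$2 * Y$2$1 = Y$1$2 * X$2$1" using m[of 1 1] c unfolding mat2_mult by linarith
    show "X$1$1 * Y$1$2 = X$1$2 * Y$1$1" using m[of 1 2] c unfolding mat2_mult by linarith
    show "X$1$1 * Y$2$1 = X$2$1 * Y$1$1" using m[of 2 1] c unfolding mat2_mult by linarith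
  qed
  have s: "Y = k *\<^sub>R X" if "Y$1$1 = k * X$1$1" "Y$1$2 = k * X$1$2" "Y$2$1 = k * X$2$1" for k
    using that X Y by (simp add: mat2_eq_iff)
  consider "X$1$1 \<noteq> 0" | "X$1$1 = 0" "X$1$2 \<noteq> 0" | "X$1$1 = 0" "X$1$2 = 0" "X$2$1 \<noteq> 0"
    using nz X by (auto simp: mat2_eq_iff)
  then show ?thesis
  proof cases
    case 1
    have "Y = (Y$1$1 / X$1$1) *\<^sub>R X"
    proof (rule s)
      show "Y$1$1 = Y$1$1 / X$1$1 * X$1$1" using 1 by simp
      show "Y$1$2 = Y$1$1 / X$1$1 * X$1$2" using 1 e(2) by (simp add: field_simps)
      show "Y$2$1 = Y$1$1 / X$1$1 * X$2$1" using 1 e(3) by (simp add: field_simps)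
    qed
    then show ?thesis by blast
  next
    case 2
    have "Y = (Y$1$2 / X$1$2) *\<^sub>R X"
    proof (rule s)
      show "Y$1$1 = Y$1$2 / X$1$2 * X$1$1" using 2 e(2) by simp
      show "Y$1$2 = Y$1$2 / X$1$2 * X$1$2" using 2 by simp
      show "Y$2$1 = Y$1$2 / X$1$2 * X$2$1" using 2(2) e(1) by (simp add: field_simps)
    qed
    then show ?thesis by blast
  next
    case 3
    have "Y = (Y$2$1 / X$2$1) *\<^sub>R X"
    proof (rule s)
      show "Y$1$1 = Y$2$1 / X$2$1 * X$1$1" using 3 e(3) by simp
      show "Y$1$2 = Y$2$1 / X$2$1 * X$1$2" using 3 e(1) by simp
      show "Y$2$1 = Y$2$1 / X$2$1 * X$2$1" using 3 by simp
    qed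
    then show ?thesis by blast
  qed
qed

lemma commute_all:
  fixes N :: "real^2^2" assumes "\<And>X. N ** X = X ** N" shows "\<exists>c. N = c *\<^sub>R mat 1"
proof -
  have "N$2$1 = 0" "N$1$1 = N$2$2" using assms[of E12] by (simp_all add: mat2_eq_iff mat2_mult)
  moreover have "N$1$2 = N$2$1 * (- 1)"
    using arg_cong[OF assms[of J2], of "\<lambda>Z. Z$1$1"] unfolding mat2_mult J2_simps by linarith
  ultimately have "N = (N$2$2) *\<^sub>R mat 1" by (simp add: mat2_eq_iff mat2_one)
  then show ?thesis by blast
qed

text \<open>Reversed Cauchy-Schwarz inequality on a sheet of the hyperboloid
  \<open>p^2 - q^2 - r^2 = M\<close>: the Lorentzian product of two of its points is at least
  \<open>M\<close>, with equality only if they coincide.\<close>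

lemma symmetric_posdef_eq:
  fixes p q r p' q' r' M :: real
  assumes "0 < M" "0 < p" "0 < p'" "p\<^sup>2 = M + q\<^sup>2 + r\<^sup>2" "p'\<^sup>2 = M + q'\<^sup>2 + r'\<^sup>2"
    and le: "p * p' - q * q' - r * r' \<le> M"
  shows "q = q' \<and> r = r' \<and> p = p'"
proof -
  define w where "w = M + q * q' + r * r'"
  have pw: "0 < p * p'" "p * p' \<le> w" using assms by (simp_all add: w_def)
  then have "(p * p')\<^sup>2 \<le> w\<^sup>2" by (intro power_mono) simp_all
  moreover have "(p * p')\<^sup>2 = w\<^sup>2 + M * ((q - q')\<^sup>2 + (r - r')\<^sup>2) + (q * r' - r * q')\<^sup>2"
    unfolding power_mult_distrib assms(4,5) w_def by (simp add: power2_eq_square algebra_simps)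
  ultimately have "M * ((q - q')\<^sup>2 + (r - r')\<^sup>2) + (q * r' - r * q')\<^sup>2 \<le> 0" by linarith
  moreover have "0 \<le> (q * r' - r * q')\<^sup>2" by simp
  ultimately have "M * ((q - q')\<^sup>2 + (r - r')\<^sup>2) \<le> 0" by linarith
  then have "(q - q')\<^sup>2 + (r - r')\<^sup>2 \<le> 0" using assms(1) by (simp add: mult_le_0_iff)
  then have "q = q' \<and> r = r'" by (simp add: sum_power2_le_zero_iff)
  then have "p\<^sup>2 = p'\<^sup>2" using assms(4,5) by simp
  then have "p = p'" using assms(2,3) by (simp add: power2_eq_iff)
  then show ?thesis using \<open>q = q' \<and> r = r'\<close> by blast
qed

text \<open>\<open>GL\<^sub>2(\<real>)\<close> acts on the hyperbolic plane, seen as the set of positive definite symmetric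
  matrices of determinant 1.\<close>

definition sact :: "real^2^2 \<Rightarrow> real^2^2 \<Rightarrow> real^2^2" where
  "sact B S = (1 / \<bar>det B\<bar>) *\<^sub>R (B ** S ** transpose B)"

lemma tr_entries: "transpose B $ i $ j = (B :: real^2^2) $ j $ i"
  by (simp add: transpose_def)

lemma det_scale: "det (c *\<^sub>R (B :: real^2^2)) = c\<^sup>2 * det B"
  by (simp add: det_2 power2_eq_square algebra_simps)

lemma sact_det: assumes "det B \<noteq> 0" shows "det (sact B S) = det S"
proof -
  have "det (sact B S) = (1 / \<bar>det B\<bar>)\<^sup>2 * (det B * det S * det B)"
    by (simp add: sact_def det_scale det_mul)
  also have "\<dots> = det S" using assms by (simp add: power_divide power2_eq_square)
  finally show ?thesis .
qed

lemma linear_sandwich: "linear (\<lambda>S. k *\<^sub>R (B ** S ** C))" for B C :: "real^2^2"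
  by (rule linearI) (simp_all add: mat2_eq_iff mat2_mult algebra_simps)

lemma linear_sact: "linear (sact B)"
  using linear_sandwich[of "1 / \<bar>det B\<bar>" B "transpose B"] by (simp add: sact_def[abs_def])

lemma sact_scale: assumes "c \<noteq> 0" shows "sact (c *\<^sub>R B) S = sact B S"
proof -
  have t: "transpose (c *\<^sub>R B) = c *\<^sub>R transpose B" by (simp add: mat2_eq_iff tr_entries)
  show ?thesis using assms by (simp add: sact_def det_scale abs_mult t scale_mult power2_eq_square)
qed

lemma sact_mult: "sact (B ** C) S = sact B (sact C S)"
proof -
  have "sact B (sact C S) = (1 / \<bar>det B\<bar>) *\<^sub>R ((1 / \<bar>det C\<bar>) *\<^sub>R (B ** (C ** S ** transpose C) ** transpose B))"
    by (simp only: sact_def scale_mult)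
  then show ?thesis by (simp add: sact_def det_mul abs_mult matrix_transpose_mul matrix_mul_assoc)
qed

lemma sact_sym: assumes "S $ 1 $ 2 = S $ 2 $ 1" shows "sact B S $ 1 $ 2 = sact B S $ 2 $ 1"
proof -
  have "(B ** S ** transpose B) $ 1 $ 2 = (B ** S ** transpose B) $ 2 $ 1"
    unfolding mat2_mult tr_entries assms by (simp add: algebra_simps)
  then show ?thesis by (simp add: sact_def)
qed

lemma norm_mat2_le: "norm (X :: real^2^2) \<le> \<bar>X$1$1\<bar> + \<bar>X$1$2\<bar> + \<bar>X$2$1\<bar> + \<bar>X$2$2\<bar>"
proof -
  have "norm X \<le> (\<Sum>i\<in>UNIV. norm (X $ i))" unfolding norm_vec_def by (rule L2_set_le_sum) simp
  then have "norm X \<le> norm (X $ 1) + norm (X $ 2)" by (simp add: sum_2)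
  moreover have n: "norm (X $ i) \<le> \<bar>X$i$1\<bar> + \<bar>X$i$2\<bar>" for i
    using norm_le_l1_cart[of "X $ i"] by (simp add: sum_2)
  ultimately show ?thesis using n[of 1] n[of 2] by linarith
qed

text \<open>Let \<open>K\<close> be the closed convex hull of the orbit of the identity. It is
  compact and invariant, and \<open>det\<close>, which the action preserves, has a unique maximum on
  \<open>K\<close>, because the midpoint of two distinct maximisers would have a larger determinant;
  so the maximiser is fixed. \<open>W\<close> collects the closed convex conditions that pass from
  the orbit to \<open>K\<close>: symmetry and trace at least 2.\<close>

lemma sact_fixed_point:
  fixes \<B> :: "(real^2^2) set"
  assumes ne: "\<B> \<noteq> {}" and nz: "\<And>B. B \<in> \<B> \<Longrightarrow> det B \<noteq> 0"
    and mult: "\<And>B C. \<lbrakk>B \<in> \<B>; C \<in> \<B>\<rbrakk> \<Longrightarrow> \<exists>D\<in>\<B>. \<exists>c. c \<noteq> 0 \<and> D = c *\<^sub>R (B ** C)"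
    and bd: "\<And>B. B \<in> \<B> \<Longrightarrow> sact B (mat 1) $ 1 $ 1 + sact B (mat 1) $ 2 $ 2 \<le> C0"
  obtains S where "S $ 1 $ 2 = S $ 2 $ 1" "det S \<noteq> 0" "\<And>B. B \<in> \<B> \<Longrightarrow> sact B S = S"
proof -
  define R where "R = (\<lambda>B. sact B (mat 1)) ` \<B>"
  define W where "W = {X :: real^2^2. X$1$2 = X$2$1 \<and> 2 \<le> X$1$1 + X$2$2}"
  define K where "K = closure (convex hull R)"
  have diag: "0 \<le> X$1$1 \<and> 0 \<le> X$2$2 \<and> X$1$2 = X$2$1 \<and> det X = 1 \<and> X$1$1 * X$2$2 = 1 + (X$1$2)\<^sup>2"
    if X: "X \<in> R" for X
  proof -
    obtain B where B: "B \<in> \<B>" "X = sact B (mat 1)" using X unfolding R_def by blast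
    have d: "det X = 1" using sact_det[OF nz[OF B(1)], of "mat 1"] B(2) by simp
    moreover have s: "X$1$2 = X$2$1" unfolding B(2) by (rule sact_sym) (simp add: mat2_one)
    moreover have "X$1$1 * X$2$2 = 1 + (X$1$2)\<^sup>2" using d unfolding det_2 power2_eq_square s by simp
    moreover have "0 \<le> X$1$1 \<and> 0 \<le> X$2$2" unfolding B(2) by (simp add: sact_def mat2_mult tr_entries)
    ultimately show ?thesis by blast
  qed
  have "R \<subseteq> W"
  proof
    fix X assume X: "X \<in> R"
    note d = diag[OF X]
    have "1 \<le> X$1$1 * X$2$2" using d by simp
    moreover have "(X$1$1 + X$2$2)\<^sup>2 = (X$1$1 - X$2$2)\<^sup>2 + 4 * (X$1$1 * X$2$2)"
      by (simp add: power2_eq_square algebra_simps)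
    ultimately have "4 \<le> (X$1$1 + X$2$2)\<^sup>2" using zero_le_power2[of "X$1$1 - X$2$2"] by linarith
    then have "2 \<le> X$1$1 + X$2$2" using d by (intro power2_le_imp_le[of 2]) simp_all
    then show "X \<in> W" using d by (simp add: W_def)
  qed
  moreover have "convex W"
  proof -
    have "W = {X. (\<lambda>X. X$1$2 - X$2$1) X = 0} \<inter> {X. (\<lambda>X. X$1$1 + X$2$2) X \<ge> 2}" by (auto simp: W_def)
    moreover have "convex \<dots>"
    proof (rule convexI)
      fix X Y :: "real^2^2" and u v :: real
      assume a: "X \<in> {X. (\<lambda>X. X$1$2 - X$2$1) X = 0} \<inter> {X. (\<lambda>X. X$1$1 + X$2$2) X \<ge> 2}"
        "Y \<in> {X. (\<lambda>X. X$1$2 - X$2$1) X = 0} \<inter> {X. (\<lambda>X. X$1$1 + X$2$2) X \<ge> 2}" "0 \<le> u" "0 \<le> v" "u + v = 1"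
      have "u * 2 + v * 2 \<le> u * (X$1$1 + X$2$2) + v * (Y$1$1 + Y$2$2)" using a by (intro add_mono mult_left_mono) auto
      moreover have "u * 2 + v * 2 = 2" using a(5) by (simp add: distrib_right[symmetric])
      ultimately show "u *\<^sub>R X + v *\<^sub>R Y \<in> {X. (\<lambda>X. X$1$2 - X$2$1) X = 0} \<inter> {X. (\<lambda>X. X$1$1 + X$2$2) X \<ge> 2}"
        using a(1,2) by (simp add: algebra_simps)
    qed
    ultimately show ?thesis by simp
  qed
  moreover have "closed W"
    unfolding W_def by (intro closed_Collect_conj closed_Collect_eq closed_Collect_le continuous_intros)
  ultimately have KW: "K \<subseteq> W" unfolding K_def by (intro closure_minimal hull_minimal)
  have "bounded R"
    unfolding bounded_iff
  proof (intro exI ballI)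
    fix X assume X: "X \<in> R"
    note d = diag[OF X]
    have t: "X$1$1 + X$2$2 \<le> C0" using X bd unfolding R_def by blast
    have "X$1$1 * X$2$2 = 1 + (X$1$2)\<^sup>2" using d by blast
    moreover have "X$1$1 * X$2$2 \<le> (X$1$1 + X$2$2)\<^sup>2"
    proof -
      have "(X$1$1 + X$2$2)\<^sup>2 = X$1$1 * X$2$2 + ((X$1$1)\<^sup>2 + (X$2$2)\<^sup>2 + X$1$1 * X$2$2)"
        by (simp add: power2_eq_square algebra_simps)
      moreover have "0 \<le> X$1$1 * X$2$2" using d by simp
      ultimately show ?thesis by simp
    qed
    ultimately have "\<bar>X$1$2\<bar>\<^sup>2 \<le> (X$1$1 + X$2$2)\<^sup>2" by simp
    then have "\<bar>X$1$2\<bar> \<le> X$1$1 + X$2$2" using d by (intro power2_le_imp_le[of "\<bar>X$1$2\<bar>"]) simp_all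
    then have "\<bar>X$1$2\<bar> \<le> C0" "\<bar>X$2$1\<bar> \<le> C0" "\<bar>X$1$1\<bar> \<le> C0" "\<bar>X$2$2\<bar> \<le> C0" using t d by auto
    then show "norm X \<le> 4 * C0" using norm_mat2_le[of X] by linarith
  qed
  then have cK: "compact K" unfolding K_def by (intro compact_closure[THEN iffD2] bounded_convex_hull)
  have RK: "R \<subseteq> K" unfolding K_def by (rule subset_trans[OF hull_subset closure_subset])
  have "continuous_on K (det :: real^2^2 \<Rightarrow> real)" unfolding det_2 by (intro continuous_intros)
  moreover have "K \<noteq> {}" using RK ne unfolding R_def by blast
  ultimately obtain S where S: "S \<in> K" "\<And>X. X \<in> K \<Longrightarrow> det X \<le> det S"
    using continuous_attains_sup[OF cK] by blast
  obtain X1 where "X1 \<in> R" using ne unfolding R_def by blast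
  then have M: "1 \<le> det S" using S(2)[of X1] RK diag[of X1] by auto
  have uniq: "X = S" if X: "X \<in> K" "det X = det S" for X
  proof -
    have "(1/2) *\<^sub>R X + (1/2) *\<^sub>R S \<in> K"
      using convexD[of K X S "1/2" "1/2"] X(1) S(1) by (simp add: K_def)
    \<comment> \<open>The determinant at the midpoint is half of the common value plus half of the
      Lorentzian product, so maximality bounds the product as \<open>symmetric_posdef_eq\<close>
      requires.\<close>
    then have m: "det ((1/2) *\<^sub>R X + (1/2) *\<^sub>R S) \<le> det S" by (rule S(2))
    define Dm where "Dm = det ((1/2) *\<^sub>R X + (1/2) *\<^sub>R S)"
    have w: "X$1$2 = X$2$1" "2 \<le> X$1$1 + X$2$2" "S$1$2 = S$2$1" "2 \<le> S$1$1 + S$2$2"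
      using KW X(1) S(1) by (auto simp: W_def)
    define p q r p' q' r' where d: "p = (X$1$1 + X$2$2) / 2" "q = (X$1$1 - X$2$2) / 2" "r = X$2$1"
      "p' = (S$1$1 + S$2$2) / 2" "q' = (S$1$1 - S$2$2) / 2" "r' = S$2$1"
    have ent: "X$1$1 = p + q" "X$2$2 = p - q" "X$1$2 = r" "X$2$1 = r" "S$1$1 = p' + q'" "S$2$2 = p' - q'" "S$1$2 = r'" "S$2$1 = r'"
      using w unfolding d by (simp_all add: field_simps)
    have "q = q' \<and> r = r' \<and> p = p'"
    proof (rule symmetric_posdef_eq)
      show "0 < det S" using M by simp
      show "0 < p" "0 < p'" using w by (simp_all add: d)
      have D: "det X = p\<^sup>2 - q\<^sup>2 - r\<^sup>2" "det S = p'\<^sup>2 - q'\<^sup>2 - r'\<^sup>2"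
        unfolding det_2 ent by (simp_all add: power2_eq_square algebra_simps)
      show pp: "p\<^sup>2 = det S + q\<^sup>2 + r\<^sup>2" "p'\<^sup>2 = det S + q'\<^sup>2 + r'\<^sup>2" using D X(2) by linarith+
      have "Dm = ((p\<^sup>2 - q\<^sup>2 - r\<^sup>2) + (p'\<^sup>2 - q'\<^sup>2 - r'\<^sup>2) + 2 * (p * p' - q * q' - r * r')) / 4"
        unfolding Dm_def det_2 vector_add_component mat2_scale ent by (simp add: power2_eq_square field_simps)
      then have "Dm = (det S + det S + 2 * (p * p' - q * q' - r * r')) / 4"
        unfolding D(1)[symmetric] D(2)[symmetric] X(2) .
      then show "p * p' - q * q' - r * r' \<le> det S" using m[folded Dm_def] by (simp add: field_simps)
    qed
    then show ?thesis by (simp add: mat2_eq_iff ent)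
  qed
  show thesis
  proof (rule that)
    show "S $ 1 $ 2 = S $ 2 $ 1" using KW S(1) by (auto simp: W_def)
    show "det S \<noteq> 0" using M by simp
    fix B assume B: "B \<in> \<B>"
    have "sact B ` R \<subseteq> R"
    proof
      fix Y assume "Y \<in> sact B ` R"
      then obtain C where C: "C \<in> \<B>" "Y = sact B (sact C (mat 1))" unfolding R_def by blast
      obtain D c where D: "D \<in> \<B>" "c \<noteq> 0" "D = c *\<^sub>R (B ** C)" using mult[OF B C(1)] by blast
      have "Y = sact D (mat 1)" unfolding C(2) D(3) sact_scale[OF D(2)] by (rule sact_mult[symmetric])
      then show "Y \<in> R" using D(1) unfolding R_def by blast
    qed
    then have "sact B ` (convex hull R) \<subseteq> convex hull R"
      unfolding convex_hull_linear_image[OF linear_sact] by (rule hull_mono)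
    then have sub: "sact B ` (convex hull R) \<subseteq> closure (convex hull R)" by (rule subset_trans[OF _ closure_subset])
    have "continuous_on (closure (convex hull R)) (sact B)"
      by (intro linear_continuous_on linear_conv_bounded_linear[THEN iffD1] linear_sact)
    then have "sact B ` K \<subseteq> K" unfolding K_def by (rule image_closure_subset[OF _ closed_closure sub])
    then have "sact B S \<in> K" using S(1) by blast
    then show "sact B S = S" using sact_det[OF nz[OF B]] by (rule uniq)
  qed
qed

text \<open>The identity \<open>transpose B ** J2 ** B = det B *\<^sub>R J2\<close> turns a
  symmetric matrix fixed by \<open>sact B\<close> into a matrix \<open>S ** J2\<close> that
  conjugation by \<open>B\<close> fixes up to sign. For a point \<open>S\<close> of the hyperbolic
  plane it is the infinitesimal rotation about \<open>S\<close>.\<close>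

lemma sact_conj:
  fixes B B' S :: "real^2^2"
  assumes b: "B ** B' = mat 1" and S: "sact B S = S"
  shows "\<exists>c. B ** (S ** J2) ** B' = c *\<^sub>R (S ** J2)"
proof -
  have d: "det B \<noteq> 0" by (rule det_inverse(1)[OF b])
  have "transpose B ** J2 ** B = det B *\<^sub>R J2"
    by (simp add: mat2_eq_iff mat2_mult tr_entries det_2 algebra_simps)
  then have "transpose B ** J2 ** (B ** B') = det B *\<^sub>R (J2 ** B')" by (simp add: matrix_mul_assoc scale_mult)
  then have J: "transpose B ** J2 = det B *\<^sub>R (J2 ** B')" by (simp add: b)
  have "B ** S ** transpose B = \<bar>det B\<bar> *\<^sub>R sact B S" using d by (simp add: sact_def)
  then have "\<bar>det B\<bar> *\<^sub>R (S ** J2) = B ** S ** (transpose B ** J2)" by (simp add: S matrix_mul_assoc scale_mult[symmetric])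
  also have "\<dots> = det B *\<^sub>R (B ** (S ** J2) ** B')" by (simp add: J scale_mult matrix_mul_assoc)
  finally have "(1 / det B) *\<^sub>R (\<bar>det B\<bar> *\<^sub>R (S ** J2)) = (1 / det B) *\<^sub>R (det B *\<^sub>R (B ** (S ** J2) ** B'))" by simp
  then have "B ** (S ** J2) ** B' = (\<bar>det B\<bar> / det B) *\<^sub>R (S ** J2)" using d by simp
  then show ?thesis by blast
qed

section \<open>Scalar holonomy and the exclusion of non-rigid cycles\<close>

context nonrigid_germ
begin

lemma gs_e0:
  assumes g: "g \<in> G0"
  shows "ac (inv g) e0 \<in> CC" "tr2 (gs g Q e0) = tr2 (Q (ac (inv g) e0))"
proof -
  show "ac (inv g) e0 \<in> CC" by (rule G0_CC[OF G0_inv[OF g] CC_lft(3)])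
  show "tr2 (gs g Q e0) = tr2 (Q (ac (inv g) e0))"
    unfolding gs_def by (rule tr2_conj[OF al_inv'(2)[OF G0_carrier[OF g]]])
qed

text \<open>The traceless part \<open>X0\<close> of the holonomy defines a section. A group element
  maps it to a section whose value at \<open>e0\<close> is traceless and commutes with the holonomy,
  hence with \<open>X0\<close>, so it is a multiple of \<open>X0\<close>; then
  \<open>no_eigensection\<close> forces \<open>X0 = 0\<close>.\<close>

lemma hol_scalar: "\<exists>c. hol = c *\<^sub>R mat 1"
proof (rule ccontr)
  assume n: "\<nexists>c. hol = c *\<^sub>R mat 1"
  define X0 where "X0 = hol - (tr2 hol / 2) *\<^sub>R mat 1"
  have com: "hol ** Y = Y ** hol \<Longrightarrow> X0 ** Y = Y ** X0" for Y
    unfolding X0_def mat_diff_mult by (simp add: scale_mult)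
  have "hol ** X0 = X0 ** hol" unfolding X0_def mat_diff_mult by (simp add: scale_mult)
  then have Q: "sec (QQ X0)" by (rule sec_QQ)
  have X0: "X0 \<noteq> 0"
  proof
    assume "X0 = 0"
    then have "hol = (tr2 hol / 2) *\<^sub>R mat 1" by (simp add: X0_def)
    then show False using n by blast
  qed
  have t: "tr2 X0 = 0" unfolding X0_def tr2_def by (simp add: mat2_one)
  show False
  proof (rule no_eigensection[OF G0_fin_index subset_refl Q])
    show "tr2 (QQ X0 e0) = 0" "QQ X0 e0 \<noteq> 0" using t X0 by (simp_all add: QQ_e0)
    fix g assume g: "g \<in> G0"
    have "tr2 (gs g (QQ X0) e0) = 0" using flat_tr2[OF Q gs_e0(1)[OF g]] t by (simp add: gs_e0(2)[OF g] QQ_e0)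
    moreover have "X0 ** gs g (QQ X0) e0 = gs g (QQ X0) e0 ** X0"
      by (rule com[OF sec_hol[OF sec_gs[OF G0_carrier[OF g] Q]]])
    ultimately show "\<exists>c. gs g (QQ X0) e0 = c *\<^sub>R QQ X0 e0" unfolding QQ_e0 using commute_traceless t X0 by blast
  qed
qed

lemma sec_QQ_all: "sec (QQ X)"
proof -
  obtain c where c: "hol = c *\<^sub>R mat 1" using hol_scalar by blast
  show ?thesis by (rule sec_QQ) (simp add: c scale_mult)
qed

text \<open>The action of \<open>g\<close> on the fibre at \<open>e0\<close>: transport from
  \<open>e0\<close> to the preimage of \<open>e0\<close> under \<open>g\<close>, then the germ of
  \<open>g\<close> back to \<open>e0\<close>. \<open>Bg' g\<close> is its inverse.\<close>

definition Bg :: "'a \<Rightarrow> real^2^2" where "Bg g = al g (ac (inv g) e0) ** Aw (lft (ac (inv g) e0))"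
definition Bg' :: "'a \<Rightarrow> real^2^2" where "Bg' g = Bw (lft (ac (inv g) e0)) ** al (inv g) e0"

lemma gs_Bg: assumes g: "g \<in> G0" shows "gs g (QQ X) e0 = Bg g ** X ** Bg' g" "Bg g ** Bg' g = mat 1"
proof -
  note C = gs_e0(1)[OF g]
  show "gs g (QQ X) e0 = Bg g ** X ** Bg' g"
    using C by (simp add: gs_def QQ_def Bg_def Bg'_def matrix_mul_assoc)
  have "Bg g ** Bg' g = al g (ac (inv g) e0) ** (Aw (lft (ac (inv g) e0)) ** Bw (lft (ac (inv g) e0))) ** al (inv g) e0"
    by (simp only: Bg_def Bg'_def matrix_mul_assoc)
  then show "Bg g ** Bg' g = mat 1" using al_inv'(1)[OF G0_carrier[OF g], of e0] by (simp only: Bw(1)[OF CC_lft(1)[OF C]] matrix_mul_rid)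
qed

text \<open>All germs and gluings, hence \<open>Aw\<close> and \<open>Bg\<close>, are upper
  triangular, so conjugation preserves the line of \<open>E12\<close>, the infinitesimal translation
  (\<open>fv E12 t = 1\<close>).\<close>

lemma affine_False: assumes aff: "\<And>g d. g \<in> carrier G \<Longrightarrow> al g d $ 2 $ 1 = 0" shows False
proof (rule no_eigensection[OF G0_fin_index subset_refl sec_QQ_all[of E12]])
  show "tr2 (QQ E12 e0) = 0" "QQ E12 e0 \<noteq> 0" by (simp_all add: QQ_e0 tr2_def mat2_eq_iff)
  fix g assume g: "g \<in> G0"
  define e where "e = lft (ac (inv g) e0)"
  have e: "e \<in> cy.cyc" unfolding e_def by (rule CC_lft(1)[OF gs_e0(1)[OF g]])
  have A: "Aw e $ 2 $ 1 = 0"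
  proof (rule cy.cyc_induct[OF e])
    fix e assume e: "e \<in> cy.cyc" "Aw e $ 2 $ 1 = 0"
    show "Aw (oth e) $ 2 $ 1 = 0" using e by (simp add: Aw(2))
    assume "e \<noteq> e0" "e \<noteq> pr e0"
    moreover have "ga e $ 2 $ 1 = 0" by (rule ga_props(3)[OF UU_D(1)[OF cyc_UU[OF e(1)]] aff])
    ultimately show "Aw (pr e) $ 2 $ 1 = 0" using e by (simp add: Aw(3) mat2_mult)
  qed (simp add: Aw(1) mat2_one)
  have "Aw e $ 2 $ 2 \<noteq> 0" using Aw_det[OF e] A by (auto simp: det_2)
  moreover have "(Aw e ** Bw e) $ 2 $ 1 = 0" unfolding Bw(1)[OF e] by (simp add: mat2_one)
  ultimately have B: "Bw e $ 2 $ 1 = 0" using A by (simp add: mat2_mult)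
  have "Bg g $ 2 $ 1 = 0" "Bg' g $ 2 $ 1 = 0"
    using A B aff[OF G0_carrier[OF g]] aff[OF inv_closed[OF G0_carrier[OF g]]]
    by (simp_all add: Bg_def Bg'_def e_def[symmetric] mat2_mult)
  then have "Bg g ** E12 ** Bg' g = (Bg g $ 1 $ 1 * Bg' g $ 2 $ 2) *\<^sub>R E12"
    by (simp add: mat2_eq_iff mat2_mult)
  then show "\<exists>c. gs g (QQ E12) e0 = c *\<^sub>R QQ E12 e0" unfolding gs_Bg(1)[OF g] QQ_e0 by blast
qed

text \<open>With scalar holonomy sections take arbitrary values at \<open>e0\<close>, so both
  matrices conjugate every \<open>X\<close> in the same way; their quotient commutes with all
  matrices.\<close>

lemma Bg_mult:
  assumes g: "g \<in> G0" and h: "h \<in> G0" shows "\<exists>c. c \<noteq> 0 \<and> Bg (g \<otimes> h) = c *\<^sub>R (Bg g ** Bg h)"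
proof -
  have gh: "g \<otimes> h \<in> G0" using g h by (rule subgroup.m_closed[OF G0_subgroup])
  note gC = G0_carrier[OF g] and hC = G0_carrier[OF h]
  have eq: "Bg (g \<otimes> h) ** X ** Bg' (g \<otimes> h) = Bg g ** (Bg h ** X ** Bg' h) ** Bg' g" for X
  proof -
    define Y where "Y = gs h (QQ X) e0"
    have "gs h (QQ X) d = 1 *\<^sub>R QQ Y d" if "d \<in> CC" for d
      by (rule sec_eq[OF sec_gs[OF hC sec_QQ_all] sec_QQ_all _ that]) (simp add: QQ_e0 Y_def)
    then have "gs g (gs h (QQ X)) e0 = gs g (QQ Y) e0" using gs_e0(1)[OF g] by (simp add: gs_def[of g])
    then have "gs (g \<otimes> h) (QQ X) e0 = gs g (QQ Y) e0" by (simp only: gs_mult[OF gC hC])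
    then show ?thesis by (simp only: gs_Bg(1)[OF gh] gs_Bg(1)[OF g] Y_def gs_Bg(1)[OF h])
  qed
  define P P' where "P = Bg g ** Bg h" and "P' = Bg' h ** Bg' g"
  have "P ** P' = Bg g ** (Bg h ** Bg' h) ** Bg' g" by (simp only: P_def P'_def matrix_mul_assoc)
  then have P1: "P ** P' = mat 1" by (simp only: gs_Bg(2)[OF h] gs_Bg(2)[OF g] matrix_mul_rid)
  have P2: "P' ** P = mat 1" by (rule mult_inverse_comm[OF P1])
  let ?B = "Bg (g \<otimes> h)" and ?B' = "Bg' (g \<otimes> h)"
  have B1: "?B ** ?B' = mat 1" by (rule gs_Bg(2)[OF gh])
  have B2: "?B' ** ?B = mat 1" by (rule mult_inverse_comm[OF B1])
  have "(P' ** ?B) ** X = X ** (P' ** ?B)" for X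
  proof -
    have "(P' ** ?B) ** X = P' ** (?B ** X ** ?B') ** ?B"
      by (simp only: matrix_mul_assoc[symmetric] B2 matrix_mul_rid)
    also have "\<dots> = (P' ** P) ** X ** (P' ** ?B)" unfolding eq P_def P'_def by (simp only: matrix_mul_assoc)
    finally show ?thesis by (simp only: P2 matrix_mul_lid)
  qed
  from commute_all[OF this] obtain c where c: "P' ** ?B = c *\<^sub>R mat 1" by blast
  have "?B = P ** (P' ** ?B)" by (simp only: matrix_mul_assoc P1 matrix_mul_lid)
  then have B: "?B = c *\<^sub>R P" unfolding c by (simp add: scale_mult)
  have "c \<noteq> 0"
  proof
    assume "c = 0"
    then have "det ?B = 0" using B by (simp add: det_2)
    then show False using det_inverse(1)[OF B1] by contradiction
  qed
  then show ?thesis using B unfolding P_def by blast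
qed

text \<open>The images \<open>S g\<close> of the identity matrix under the projective action
  \<open>Bg\<close> are points of the hyperboloid with invariant Lorentzian product. Bounded lengths
  make this orbit bounded, and a fixed point \<open>S0\<close> turns the section of
  \<open>S0 ** J2\<close> into an eigensection.\<close>

lemma bounded_lengths_False: assumes bl: "bounded_lengths G" shows False
proof -
  interpret GG: group "G\<lparr>carrier := G0\<rparr>" by (rule fin_index_group[OF G0_fin_index])
  have bl0: "bounded_lengths (G\<lparr>carrier := G0\<rparr>)" by (rule bounded_lengths_fin_index[OF bl G0_fin_index])
  define S where "S g = sact (Bg g) (mat 1)" for g
  have detB: "det (Bg g) \<noteq> 0" if "g \<in> G0" for g by (rule det_inverse(1)[OF gs_Bg(2)[OF that]])
  have S1: "S \<one> = mat 1"
    by (simp add: S_def sact_def Bg_def al_one ac_one e0_lft Aw(1) transpose_mat)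
  have S_mult: "S (g \<otimes> h) = sact (Bg g) (S h)" if gh: "g \<in> G0" "h \<in> G0" for g h
  proof -
    obtain c where c: "c \<noteq> 0" "Bg (g \<otimes> h) = c *\<^sub>R (Bg g ** Bg h)" using Bg_mult[OF gh] by blast
    show ?thesis unfolding S_def c(2) sact_scale[OF c(1)] by (rule sact_mult)
  qed
  \<comment> \<open>Coordinates in which the symmetric matrix \<open>S g\<close> has determinant
    \<open>p^2 - q^2 - r^2\<close>.\<close>
  define p q r where "p g = (S g $ 1 $ 1 + S g $ 2 $ 2) / 2" and "q g = (S g $ 1 $ 1 - S g $ 2 $ 2) / 2" and "r g = S g $ 2 $ 1" for g
  have sym: "S g $ 1 $ 2 = S g $ 2 $ 1" for g unfolding S_def by (rule sact_sym) (simp add: mat2_one)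
  have dS: "det (S g) = 1" if "g \<in> G0" for g unfolding S_def using sact_det[OF detB[OF that]] by simp
  have hyp: "hyperboloid_points G0 p q r"
  proof
    fix g assume g: "g \<in> G0"
    show eq: "(p g)\<^sup>2 = 1 + (q g)\<^sup>2 + (r g)\<^sup>2"
    proof -
      have e: "S g $ 1 $ 1 * S g $ 2 $ 2 - S g $ 2 $ 1 * S g $ 2 $ 1 = 1" using dS[OF g] unfolding det_2 sym .
      have "((a + b) / 2)\<^sup>2 = a * b + ((a - b) / 2)\<^sup>2" for a b :: real
        by (simp add: power2_eq_square field_simps)
      then show ?thesis unfolding p_def q_def r_def power2_eq_square[of "S g $ 2 $ 1"] using e by simp
    qed
    have "0 \<le> p g" by (simp add: p_def S_def sact_def mat2_mult tr_entries mat2_one)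
    moreover have "p g \<noteq> 0"
    proof
      assume "p g = 0"
      then have "1 + (q g)\<^sup>2 + (r g)\<^sup>2 = 0" using eq by simp
      then show False using zero_le_power2[of "q g"] zero_le_power2[of "r g"] by linarith
    qed
    ultimately show "0 < p g" by simp
  qed
  interpret hyp: hyperboloid_points G0 p q r by (rule hyp)
  \<comment> \<open>The Lorentzian product is the polarisation of \<open>det\<close>; this is why it
    is invariant under \<open>sact\<close>.\<close>
  have lor: "hyp.lor g h = (det (S g + S h) - det (S g) - det (S h)) / 2" for g h
    unfolding hyp.lor_def p_def q_def r_def det_2 vector_add_component sym by (simp add: field_simps)
  have inv: "hyp.lor (k \<otimes> g) (k \<otimes> h) = hyp.lor g h" if "k \<in> G0" "g \<in> G0" "h \<in> G0" for k g h
  proof -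
    have "S (k \<otimes> g) + S (k \<otimes> h) = sact (Bg k) (S g + S h)"
      by (simp only: S_mult[OF that(1,2)] S_mult[OF that(1,3)] linear_add[OF linear_sact])
    then show ?thesis
      unfolding lor by (simp only: S_mult[OF that(1,2)] S_mult[OF that(1,3)] sact_det[OF detB[OF that(1)]])
  qed
  obtain C where C: "\<And>g. g \<in> G0 \<Longrightarrow> hyp.lor g \<one> \<le> C"
  proof (rule GG.lor_bounded[OF bl0, of p q r])
    show "hyperboloid_points (carrier (G\<lparr>carrier := G0\<rparr>)) p q r" using hyp by simp
    show "hyp.lor (k \<otimes>\<^bsub>G\<lparr>carrier := G0\<rparr>\<^esub> g) (k \<otimes>\<^bsub>G\<lparr>carrier := G0\<rparr>\<^esub> h) = hyp.lor g h"
      if "k \<in> carrier (G\<lparr>carrier := G0\<rparr>)" "g \<in> carrier (G\<lparr>carrier := G0\<rparr>)" "h \<in> carrier (G\<lparr>carrier := G0\<rparr>)" for k g h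
      using inv[of k g h] that by simp
    fix C assume "\<And>x. x \<in> carrier (G\<lparr>carrier := G0\<rparr>) \<Longrightarrow> hyp.lor x \<one>\<^bsub>G\<lparr>carrier := G0\<rparr>\<^esub> \<le> C"
    then show thesis by (intro that[of C]) simp
  qed
  \<comment> \<open>\<open>S \<one>\<close> has the coordinates \<open>(1, 0, 0)\<close>, so the
    product with it is \<open>p g\<close>, half of the trace.\<close>
  have bd: "S g $ 1 $ 1 + S g $ 2 $ 2 \<le> 2 * C" if "g \<in> G0" for g
    using C[OF that] by (simp add: hyp.lor_def p_def q_def r_def S1 mat2_one)
  obtain S0 where S0: "S0 $ 1 $ 2 = S0 $ 2 $ 1" "det S0 \<noteq> 0" "\<And>B. B \<in> Bg ` G0 \<Longrightarrow> sact B S0 = S0"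
  proof (rule sact_fixed_point[of "Bg ` G0" "2 * C"])
    show "Bg ` G0 \<noteq> {}" using subgroup.one_closed[OF G0_subgroup] by blast
    show "det B \<noteq> 0" if BB: "B \<in> Bg ` G0" for B
    proof -
      obtain g where "g \<in> G0" "B = Bg g" using BB by blast
      then show ?thesis using detB[of g] by simp
    qed
    show "\<exists>D\<in>Bg ` G0. \<exists>c. c \<noteq> 0 \<and> D = c *\<^sub>R (B ** B')" if BB: "B \<in> Bg ` G0" "B' \<in> Bg ` G0" for B B'
    proof -
      obtain g where g: "g \<in> G0" "B = Bg g" using BB(1) by blast
      obtain h where h: "h \<in> G0" "B' = Bg h" using BB(2) by blast
      have "Bg (g \<otimes> h) \<in> Bg ` G0" by (intro imageI subgroup.m_closed[OF G0_subgroup] g h)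
      then show ?thesis unfolding g(2) h(2) using Bg_mult[OF g(1) h(1)] by (rule bexI[rotated])
    qed
    show "sact B (mat 1) $ 1 $ 1 + sact B (mat 1) $ 2 $ 2 \<le> 2 * C" if BB: "B \<in> Bg ` G0" for B
    proof -
      obtain g where "g \<in> G0" "B = Bg g" using BB by blast
      then show ?thesis using bd[of g] unfolding S_def by simp
    qed
    fix S assume "S $ 1 $ 2 = S $ 2 $ 1" "det S \<noteq> 0" "\<And>B. B \<in> Bg ` G0 \<Longrightarrow> sact B S = S"
    then show thesis by (rule that)
  qed
  define X where "X = S0 ** J2"
  show False
  proof (rule no_eigensection[OF G0_fin_index subset_refl sec_QQ_all[of X]])
    show "tr2 (QQ X e0) = 0" using S0(1) by (simp add: QQ_e0 X_def tr2_def mat2_mult)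
    have "det X \<noteq> 0" using S0(2) by (simp add: X_def det_mul det_2[of J2])
    then have "X \<noteq> 0" by (auto simp: det_2)
    then show "QQ X e0 \<noteq> 0" unfolding QQ_e0 .
    fix g assume g: "g \<in> G0"
    show "\<exists>c. gs g (QQ X) e0 = c *\<^sub>R QQ X e0"
      unfolding gs_Bg(1)[OF g] QQ_e0 X_def by (rule sact_conj[OF gs_Bg(2)[OF g] S0(3)[OF imageI[OF g]]])
  qed
qed

end

section \<open>Finiteness of germ groups\<close>

context germ_group
begin

lemma infinite_nonrigid:
  assumes "infinite (carrier G)" obtains e0 where "nonrigid_germ G ac al e0"
proof -
  obtain d where d: "\<not> rig d" using all_rigid_finite assms by blast
  have "nonrigid_germ G ac al (lft d)" by unfold_locales (simp_all add: lft_rgt rig_lft d)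
  then show thesis by (rule that)
qed

theorem affine_finite:
  assumes aff: "\<And>g d. g \<in> carrier G \<Longrightarrow> al g d $ 2 $ 1 = 0" shows "finite (carrier G)"
proof (rule ccontr)
  assume "infinite (carrier G)"
  then obtain e0 where e: "nonrigid_germ G ac al e0" by (rule infinite_nonrigid)
  show False by (rule nonrigid_germ.affine_False[OF e aff])
qed

theorem bounded_lengths_finite: assumes "bounded_lengths G" shows "finite (carrier G)"
proof (rule ccontr)
  assume "infinite (carrier G)"
  then obtain e0 where e: "nonrigid_germ G ac al e0" by (rule infinite_nonrigid)
  show False by (rule nonrigid_germ.bounded_lengths_False[OF e assms])
qed

end

section \<open>Germs of piecewise projective maps\<close>

definition den :: "real^2^2 \<Rightarrow> real \<Rightarrow> real" where "den m s = m$2$1 * s + m$2$2"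
definition mob :: "real^2^2 \<Rightarrow> real \<Rightarrow> real" where "mob m s = (m$1$1 * s + m$1$2) / den m s"

text \<open>Left multiplication by the matrix of the translation by \<open>n\<close>. Integer shifts
  and scalars are the ambiguity of a homography whose values are read in \<real>/\<int>.\<close>

definition shift :: "real \<Rightarrow> real^2^2 \<Rightarrow> real^2^2" where
  "shift n m = (\<chi> i j. m$i$j + (if i = 1 then n * m$2$j else 0))"

lemma shift_simps [simp]: "shift n m $ 1 $ j = m$1$j + n * m$2$j" "shift n m $ 2 $ j = m$2$j"
  by (simp_all add: shift_def)

lemma mob_vec: "den m s \<noteq> 0 \<Longrightarrow> m *v pt s = den m s *\<^sub>R pt (mob m s)"
  by (simp add: vec2_eq_iff mat2_vec mob_def den_def)

lemma mob_pt: assumes "m *v pt s = pt t" shows "den m s = 1" "mob m s = t"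
  using assms by (simp_all add: vec2_eq_iff mat2_vec mob_def den_def)

lemma den_scale: "den (c *\<^sub>R m) s = c * den m s" and mob_scale: "c \<noteq> 0 \<Longrightarrow> mob (c *\<^sub>R m) s = mob m s"
proof -
  show d: "den (c *\<^sub>R m) s = c * den m s" for c s by (simp add: den_def algebra_simps)
  have "(c *\<^sub>R m)$1$1 * s + (c *\<^sub>R m)$1$2 = c * (m$1$1 * s + m$1$2)" by (simp add: algebra_simps)
  then show "mob (c *\<^sub>R m) s = mob m s" if "c \<noteq> 0" unfolding mob_def d using that by simp
qed

lemma den_shift: "den (shift n m) s = den m s" and det_shift: "det (shift n m) = det m"
    and mob_shift: "den m s \<noteq> 0 \<Longrightarrow> mob (shift n m) s = mob m s + n"
proof -
  show d: "den (shift n m) s = den m s" for s by (simp add: den_def)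
  show "det (shift n m) = det m" by (simp add: det_2 algebra_simps)
  have num: "shift n m $ 1 $ 1 * s + shift n m $ 1 $ 2 = (m$1$1 * s + m$1$2) + n * den m s" by (simp add: den_def algebra_simps)
  show "mob (shift n m) s = mob m s + n" if "den m s \<noteq> 0"
    unfolding mob_def d num using that by (simp add: add_divide_distrib)
qed

lemma to_circle_cong: "x - y \<in> \<int> \<Longrightarrow> to_circle x = to_circle y"
  by (simp add: to_circle_eq_iff)

text \<open>The quotient of the two matrices fixes infinitely many points, so its vector field has
  infinitely many zeros and its traceless part is 0.\<close>

lemma proportional:
  assumes N: "det N \<noteq> 0" and m: "det m \<noteq> 0" and S: "infinite S"
    and eq: "\<And>x. x \<in> S \<Longrightarrow> den m x \<noteq> 0 \<and> den N x \<noteq> 0 \<and> mob m x = mob N x"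
  shows "\<exists>c. c \<noteq> 0 \<and> m = c *\<^sub>R N"
proof -
  obtain Ni where Ni: "N ** Ni = mat 1" "Ni ** N = mat 1"
    using N unfolding invertible_det_nz[symmetric] invertible_def by blast
  define Z where "Z = Ni ** m"
  define Z0 where "Z0 = Z - (tr2 Z / 2) *\<^sub>R mat 1"
  have NZ: "N ** Z = m" by (simp add: Z_def matrix_mul_assoc Ni)
  have "fv Z x = 0" if x: "x \<in> S" for x
  proof -
    have "(m ** Ni) ** N = N ** Z" unfolding NZ by (simp add: matrix_mul_assoc[symmetric] Ni)
    then have 1: "fvv (m ** Ni) (N *v pt x) = det N * fv Z x" unfolding fv_def by (rule fvv_transform)
    have 2: "(m ** Ni) *v (N *v pt x) = m *v pt x"
      by (simp add: matrix_vector_mul_assoc matrix_mul_assoc[symmetric] Ni)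
    have "fvv (m ** Ni) (N *v pt x) = 0"
      unfolding fvv_def 2 using eq[OF x] by (simp add: mob_vec)
    then show ?thesis using 1 N by simp
  qed
  moreover have "fv Z0 x = fv Z x" for x by (simp add: Z0_def fv_eq mat2_one)
  ultimately have "S \<subseteq> {x. fv Z0 x = 0}" by auto
  then have "infinite {x. fv Z0 x = 0}" using S by (rule infinite_super)
  moreover have "tr2 Z0 = 0" by (simp add: Z0_def tr2_def mat2_one)
  ultimately have "Z0 = 0" using finite_zeros_fv by blast
  then have Z: "Z = (tr2 Z / 2) *\<^sub>R mat 1" by (simp add: Z0_def)
  have "m = (tr2 Z / 2) *\<^sub>R N" using NZ by (subst (asm) Z) (simp add: scale_mult)
  moreover have "tr2 Z / 2 \<noteq> 0"
  proof
    assume "tr2 Z / 2 = 0"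
    then have "m = 0" using calculation by simp
    then show False using m by (simp add: det_2)
  qed
  ultimately show ?thesis by blast
qed

text \<open>The difference of the two real-valued maps is continuous and integral on an interval,
  hence a constant \<open>n\<close>.\<close>

lemma circle_mob_unique:
  assumes ab: "a < b" and m: "det m \<noteq> 0" "det m' \<noteq> 0"
    and eq: "\<And>x. \<lbrakk>a < x; x < b\<rbrakk> \<Longrightarrow> den m x \<noteq> 0 \<and> den m' x \<noteq> 0 \<and> to_circle (mob m x) = to_circle (mob m' x)"
  shows "\<exists>n c. n \<in> \<int> \<and> c \<noteq> 0 \<and> m' = c *\<^sub>R shift n m"
proof -
  define h where "h x = mob m' x - mob m x" for x
  have h: "h x \<in> \<int>" if "a < x" "x < b" for x
    using eq[OF that] unfolding h_def to_circle_eq_iff[symmetric] by simp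
  have "continuous_on {a<..<b} h"
    unfolding h_def mob_def den_def
    by (intro continuous_intros) (use eq in \<open>simp_all add: den_def\<close>)
  moreover have "\<exists>e>0. \<forall>y. y \<in> {a<..<b} \<and> h y \<noteq> h x \<longrightarrow> e \<le> norm (h y - h x)" if x: "x \<in> {a<..<b}" for x
  proof (intro exI[of _ 1] conjI allI impI)
    fix y assume y: "y \<in> {a<..<b} \<and> h y \<noteq> h x"
    then have "h y - h x \<in> \<int>" using x by (intro Ints_diff h) simp_all
    then obtain i where i: "h y - h x = of_int i" by (rule Ints_cases)
    then have "i \<noteq> 0" using y by auto
    then show "1 \<le> norm (h y - h x)" unfolding i by simp
  qed simp
  ultimately have "h constant_on {a<..<b}"
    by (intro continuous_discrete_range_constant connected_Ioo)
  then obtain n where n: "\<And>x. \<lbrakk>a < x; x < b\<rbrakk> \<Longrightarrow> h x = n" unfolding constant_on_def by auto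
  have nZ: "n \<in> \<int>" using h[of "(a + b) / 2"] n[of "(a + b) / 2"] ab by simp
  have "\<exists>c. c \<noteq> 0 \<and> m' = c *\<^sub>R shift n m"
  proof (rule proportional)
    show "det (shift n m) \<noteq> 0" "det m' \<noteq> 0" using m by (simp_all add: det_shift)
    show "infinite {a<..<b}" using ab by (simp add: infinite_Ioo)
    fix x assume x: "x \<in> {a<..<b}"
    then have e: "den m x \<noteq> 0" "den m' x \<noteq> 0" using eq[of x] by auto
    have "mob m' x = mob m x + n" using n[of x] x by (simp add: h_def)
    then show "den m' x \<noteq> 0 \<and> den (shift n m) x \<noteq> 0 \<and> mob m' x = mob (shift n m) x"
      using e by (simp add: den_shift mob_shift)
  qed
  then show ?thesis using nZ by blast
qed

definition rep :: "(circle \<Rightarrow> circle) \<Rightarrow> real^2^2 \<Rightarrow> real \<Rightarrow> bool" where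
  "rep f m s \<longleftrightarrow> den m s \<noteq> 0 \<and> f (to_circle s) = to_circle (mob m s)"

lemma rep_transform: "\<lbrakk>rep f m s; n \<in> \<int>; c \<noteq> 0\<rbrakk> \<Longrightarrow> rep f (c *\<^sub>R shift n m) s"
  by (simp add: rep_def den_scale den_shift mob_scale mob_shift to_circle_eq_iff)

lemma rep_unique:
  assumes "a < b" "det m \<noteq> 0" "det m' \<noteq> 0" "\<And>x. \<lbrakk>a < x; x < b\<rbrakk> \<Longrightarrow> rep f m x \<and> rep f m' x"
  shows "\<exists>n c. n \<in> \<int> \<and> c \<noteq> 0 \<and> m' = c *\<^sub>R shift n m"
proof (rule circle_mob_unique[OF assms(1-3)])
  fix x assume "a < x" "x < b"
  then have "rep f m x \<and> rep f m' x" by (rule assms(4))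
  then have a: "f (to_circle x) = to_circle (mob m x)" "f (to_circle x) = to_circle (mob m' x)" "den m x \<noteq> 0" "den m' x \<noteq> 0"
    unfolding rep_def by blast+
  then show "den m x \<noteq> 0 \<and> den m' x \<noteq> 0 \<and> to_circle (mob m x) = to_circle (mob m' x)"
    by (intro conjI trans[OF a(1)[symmetric] a(2)])
qed

text \<open>The set \<open>\<Phi> x\<close> of matrices that represent \<open>f\<close> near
  \<open>x\<close> is a single class under integer shifts and scalars, so any member determines it.
  A member at \<open>x\<close> is also one at nearby points, which makes \<open>\<Phi>\<close>
  locally constant.\<close>

lemma ex_common_rep:
  assumes ab: "a < b" and ex: "\<And>x. \<lbrakk>a < x; x < b\<rbrakk> \<Longrightarrow> \<exists>m. det m \<noteq> 0 \<and> (\<forall>\<^sub>F y in nhds x. rep f m y)"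
  obtains m where "det m \<noteq> 0" "\<And>x. \<lbrakk>a < x; x < b\<rbrakk> \<Longrightarrow> rep f m x"
proof -
  define \<Phi> where "\<Phi> x = {m. det m \<noteq> 0 \<and> (\<forall>\<^sub>F y in nhds x. rep f m y)}" for x
  have sub: "\<Phi> x \<subseteq> \<Phi> y" if "m \<in> \<Phi> x" "m \<in> \<Phi> y" for x y m
  proof
    fix m' assume m': "m' \<in> \<Phi> x"
    have "\<forall>\<^sub>F z in nhds x. rep f m z \<and> rep f m' z" using that(1) m' by (simp add: \<Phi>_def eventually_conj_iff)
    then obtain e where e: "e > 0" "\<And>z. dist z x < e \<Longrightarrow> rep f m z \<and> rep f m' z"
      unfolding eventually_nhds_metric by blast
    have "\<exists>n c. n \<in> \<int> \<and> c \<noteq> 0 \<and> m' = c *\<^sub>R shift n m"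
    proof (rule rep_unique)
      show "x < x + e" using e(1) by simp
      show "det m \<noteq> 0" "det m' \<noteq> 0" using that(1) m' by (simp_all add: \<Phi>_def)
      show "rep f m z \<and> rep f m' z" if "x < z" "z < x + e" for z using that by (intro e(2)) (simp add: dist_real_def)
    qed
    then obtain n c where nc: "n \<in> \<int>" "c \<noteq> 0" "m' = c *\<^sub>R shift n m" by blast
    have "\<forall>\<^sub>F z in nhds y. rep f m z" using that(2) by (simp add: \<Phi>_def)
    then have "\<forall>\<^sub>F z in nhds y. rep f m' z" unfolding nc(3) by eventually_elim (rule rep_transform[OF _ nc(1,2)])
    then show "m' \<in> \<Phi> y" using m' by (simp add: \<Phi>_def)
  qed
  have const: "\<Phi> x = \<Phi> y" if "x \<in> {a<..<b}" "y \<in> {a<..<b}" for x y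
  proof (rule connected_local_const[OF connected_Ioo that])
    show "\<forall>x\<in>{a<..<b}. \<forall>\<^sub>F y in at x within {a<..<b}. \<Phi> x = \<Phi> y"
    proof
      fix x assume "x \<in> {a<..<b}"
      then obtain m where m: "m \<in> \<Phi> x" using ex[of x] by (auto simp: \<Phi>_def)
      then have "\<forall>\<^sub>F y in nhds x. \<forall>\<^sub>F z in nhds y. rep f m z" by (simp add: \<Phi>_def eventually_eventually)
      then have "\<forall>\<^sub>F y in nhds x. \<Phi> x = \<Phi> y"
      proof eventually_elim
        case (elim y)
        then have "m \<in> \<Phi> y" using m by (simp add: \<Phi>_def)
        then show ?case by (intro equalityI sub[OF m] sub[OF _ m])
      qed
      then show "\<forall>\<^sub>F y in at x within {a<..<b}. \<Phi> x = \<Phi> y"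
        by (rule filter_leD[rotated]) (simp add: at_within_def)
    qed
  qed
  obtain m where m: "m \<in> \<Phi> ((a + b) / 2)" using ex[of "(a + b) / 2"] ab by (auto simp: \<Phi>_def)
  show thesis
  proof (rule that)
    show "det m \<noteq> 0" using m by (simp add: \<Phi>_def)
    fix x assume "a < x" "x < b"
    then have "\<Phi> ((a + b) / 2) = \<Phi> x" using ab by (intro const) auto
    then have "\<forall>\<^sub>F z in nhds x. rep f m z" using m by (simp add: \<Phi>_def)
    then show "rep f m x" by (rule eventually_nhds_x_imp_x)
  qed
qed

text \<open>The condition on \<open>pt\<close> removes both ambiguities of a representing matrix,
  the scalar and the integer shift, so that germs are unique. Reversal of orientation exchanges the
  two directions.\<close>

definition germ :: "(circle \<Rightarrow> circle) \<Rightarrow> dpoint \<Rightarrow> dpoint \<Rightarrow> real^2^2 \<Rightarrow> bool" where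
  "germ f d d' m \<longleftrightarrow> det m \<noteq> 0 \<and> m *v pt (tt d) = pt (tt d') \<and> snd d' = (snd d = (0 < det m)) \<and>
     (\<forall>\<^sub>F u in at_right 0. rep f m (tt d + sg (snd d) * u))"

lemma side_interval:
  assumes "\<forall>\<^sub>F u in at_right 0. Q (t + sg b * u)"
  obtains a c where "a < c" "\<And>x. \<lbrakk>a < x; x < c\<rbrakk> \<Longrightarrow> Q x"
proof -
  obtain e where e: "e > 0" "\<And>u. \<lbrakk>0 < u; u < e\<rbrakk> \<Longrightarrow> Q (t + sg b * u)"
    using assms unfolding eventually_at_right_field by blast
  show thesis
  proof (cases b)
    case True
    have "Q x" if "t < x" "x < t + e" for x using e(2)[of "x - t"] that True by simp
    then show thesis using e(1) by (intro that[of t "t + e"]) simp_all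
  next
    case False
    have "Q x" if "t - e < x" "x < t" for x using e(2)[of "t - x"] that False by simp
    then show thesis using e(1) by (intro that[of "t - e" t]) simp_all
  qed
qed

lemma nhds_side:
  assumes "\<forall>\<^sub>F y in nhds t. Q y" shows "\<forall>\<^sub>F u in at_right 0. Q (t + sg b * u)"
proof -
  have "((\<lambda>u. t + sg b * u) \<longlongrightarrow> t + sg b * 0) (at_right 0)" by (intro tendsto_intros)
  then have "filterlim (\<lambda>u. t + sg b * u) (nhds t) (at_right 0)" by simp
  with assms show ?thesis by (rule eventually_compose_filterlim)
qed

lemma germ_normalize:
  assumes m: "det m \<noteq> 0" "den m (tt d) \<noteq> 0" and ev: "\<forall>\<^sub>F u in at_right 0. rep f m (tt d + sg (snd d) * u)"
    and d': "fst d' = to_circle (mob m (tt d))" "snd d' = (snd d = (0 < det m))"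
  shows "germ f d d' ((1 / den m (tt d)) *\<^sub>R shift (tt d' - mob m (tt d)) m)"
proof -
  define n where "n = tt d' - mob m (tt d)"
  have nZ: "n \<in> \<int>" using to_circle_tt[of d'] unfolding d'(1) to_circle_eq_iff n_def .
  let ?m = "(1 / den m (tt d)) *\<^sub>R shift n m"
  have de: "det ?m = (1 / den m (tt d))\<^sup>2 * det m" by (simp only: det_scale det_shift)
  have "0 < (1 / den m (tt d))\<^sup>2" using m(2) by simp
  then have pos: "0 < det ?m \<longleftrightarrow> 0 < det m" unfolding de by (simp add: zero_less_mult_iff)
  have "shift n m *v pt (tt d) = den m (tt d) *\<^sub>R pt (tt d')"
    using m(2) mob_vec[of "shift n m" "tt d"] by (simp add: den_shift mob_shift n_def)
  moreover have "(c *\<^sub>R M) *v v = c *\<^sub>R (M *v v)" for c :: real and M :: "real^2^2" and v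
    by (simp add: vec2_eq_iff mat2_vec algebra_simps)
  ultimately have "?m *v pt (tt d) = pt (tt d')" using m(2) by simp
  moreover have "\<forall>\<^sub>F u in at_right 0. rep f ?m (tt d + sg (snd d) * u)"
    using ev by eventually_elim (rule rep_transform[OF _ nZ], use m(2) in simp_all)
  moreover have "det ?m \<noteq> 0" using m de by simp
  ultimately show ?thesis unfolding germ_def n_def[symmetric] pos using d'(2) by blast
qed

lemma germ_unique:
  assumes 1: "germ f d d1 m1" and 2: "germ f d d2 m2" shows "d1 = d2 \<and> m1 = m2"
proof -
  have "\<forall>\<^sub>F u in at_right 0. rep f m1 (tt d + sg (snd d) * u) \<and> rep f m2 (tt d + sg (snd d) * u)"
    using 1 2 unfolding germ_def by (intro eventually_conj) blast+
  then obtain a b where ab: "a < b" "\<And>x. \<lbrakk>a < x; x < b\<rbrakk> \<Longrightarrow> rep f m1 x \<and> rep f m2 x" by (rule side_interval) blast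
  have d: "det m1 \<noteq> 0" "det m2 \<noteq> 0" using 1 2 by (simp_all add: germ_def)
  obtain n c where n: "n \<in> \<int>" "c \<noteq> 0" "m2 = c *\<^sub>R shift n m1" using rep_unique[OF ab(1) d ab(2)] by blast
  have p1: "m1 *v pt (tt d) = pt (tt d1)" and p2: "m2 *v pt (tt d) = pt (tt d2)" using 1 2 by (simp_all add: germ_def)
  note M1 = mob_pt[OF p1] and M2 = mob_pt[OF p2]
  have c1: "c = 1" using M2(1) M1(1) by (simp add: n den_scale den_shift)
  have t: "tt d2 = tt d1 + n" using M2(2) M1 by (simp add: n(3) c1 mob_shift)
  have "fst d2 = fst d1" using to_circle_tt[of d1] to_circle_tt[of d2] to_circle_cong[of "tt d2" "tt d1"] n(1) t by simp
  moreover have "snd d2 = snd d1" using 1 2 by (simp add: germ_def n(3) c1 det_shift)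
  ultimately have dd: "d1 = d2" by (simp add: prod_eq_iff)
  then have "n = 0" using t by simp
  then have "m2 = m1" using n(3) c1 by (simp add: mat2_eq_iff)
  then show ?thesis using dd by simp
qed

lemma mob_diff:
  assumes "den m s \<noteq> 0" "den m t \<noteq> 0" shows "mob m s - mob m t = det m * (s - t) / (den m s * den m t)"
proof -
  have "(m$1$1 * s + m$1$2) * den m t - (m$1$1 * t + m$1$2) * den m s = det m * (s - t)"
    by (simp add: den_def det_2 algebra_simps)
  then show ?thesis unfolding mob_def diff_frac_eq[OF assms] by (simp add: mult.commute)
qed

text \<open>By \<open>mob_diff\<close> the distance \<open>u\<close> from \<open>d\<close> becomes
  \<open>\<bar>det m\<bar> * u / w u\<close> with \<open>w u\<close> tending to 1, and the sign of
  \<open>det m\<close> decides the side.\<close>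

lemma germ_shift:
  assumes "germ f d d' m"
  obtains \<eta> where "filterlim \<eta> (at_right 0) (at_right 0)"
    "\<forall>\<^sub>F u in at_right 0. den m (tt d + sg (snd d) * u) \<noteq> 0 \<and> mob m (tt d + sg (snd d) * u) = tt d' + sg (snd d') * \<eta> u"
proof -
  have det: "det m \<noteq> 0" and p: "m *v pt (tt d) = pt (tt d')" and s: "snd d' = (snd d = (0 < det m))"
    using assms by (simp_all add: germ_def)
  note M = mob_pt[OF p]
  define w where "w u = den m (tt d + sg (snd d) * u)" for u
  define \<eta> where "\<eta> u = \<bar>det m\<bar> * u / w u" for u
  have "(w \<longlongrightarrow> den m (tt d + sg (snd d) * 0)) (at_right 0)" unfolding w_def den_def by (intro tendsto_intros)
  then have w: "(w \<longlongrightarrow> 1) (at_right 0)" using M(1) by simp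
  have w0: "\<forall>\<^sub>F u in at_right 0. 0 < w u" by (rule order_tendstoD(1)[OF w]) simp
  have "(\<eta> \<longlongrightarrow> \<bar>det m\<bar> * 0 / 1) (at_right 0)" unfolding \<eta>_def by (intro tendsto_intros w) simp
  moreover have "\<forall>\<^sub>F u in at_right 0. \<eta> u \<in> {0<..} \<and> \<eta> u \<noteq> 0"
    using w0 eventually_at_right_less[of 0] by eventually_elim (use det in \<open>simp add: \<eta>_def\<close>)
  ultimately have lim: "filterlim \<eta> (at_right 0) (at_right 0)" by (simp add: filterlim_at)
  have sd: "sg (snd d') * \<bar>det m\<bar> = sg (snd d) * det m" using s by (cases "snd d"; cases "0 < det m") auto
  have "\<forall>\<^sub>F u in at_right 0. den m (tt d + sg (snd d) * u) \<noteq> 0 \<and> mob m (tt d + sg (snd d) * u) = tt d' + sg (snd d') * \<eta> u"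
    using w0
  proof eventually_elim
    case (elim u)
    have "mob m (tt d + sg (snd d) * u) - tt d' = det m * (sg (snd d) * u) / w u"
      using mob_diff[of m "tt d + sg (snd d) * u" "tt d"] elim M by (simp add: w_def)
    also have "\<dots> = (sg (snd d) * det m) * (u / w u)" by simp
    also have "\<dots> = (sg (snd d') * \<bar>det m\<bar>) * (u / w u)" unfolding sd by (rule refl)
    also have "\<dots> = sg (snd d') * \<eta> u" by (simp add: \<eta>_def)
    finally show ?case using elim by (simp add: w_def)
  qed
  with lim show thesis by (rule that)
qed

lemma germ_comp:
  assumes f: "germ f d d' m" and g: "germ g d' d'' m'" shows "germ (g \<circ> f) d d'' (m' ** m)"
proof -
  obtain \<eta> where \<eta>: "filterlim \<eta> (at_right 0) (at_right 0)"
    "\<forall>\<^sub>F u in at_right 0. den m (tt d + sg (snd d) * u) \<noteq> 0 \<and> mob m (tt d + sg (snd d) * u) = tt d' + sg (snd d') * \<eta> u"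
    by (rule germ_shift[OF f])
  have "\<forall>\<^sub>F u in at_right 0. rep g m' (tt d' + sg (snd d') * u)" using g by (simp add: germ_def)
  then have g': "\<forall>\<^sub>F u in at_right 0. rep g m' (tt d' + sg (snd d') * \<eta> u)" using \<eta>(1) by (rule eventually_compose_filterlim)
  have f': "\<forall>\<^sub>F u in at_right 0. rep f m (tt d + sg (snd d) * u)" using f by (simp add: germ_def)
  have "\<forall>\<^sub>F u in at_right 0. rep (g \<circ> f) (m' ** m) (tt d + sg (snd d) * u)"
    using f' g' \<eta>(2)
  proof eventually_elim
    case (elim u)
    define s where "s = tt d + sg (snd d) * u"
    have r: "den m s \<noteq> 0" "f (to_circle s) = to_circle (mob m s)" "den m' (mob m s) \<noteq> 0"
      "g (to_circle (mob m s)) = to_circle (mob m' (mob m s))"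
      using elim by (simp_all add: rep_def s_def)
    have "(m' ** m) *v pt s = (den m s * den m' (mob m s)) *\<^sub>R pt (mob m' (mob m s))"
    proof -
      have "(m' ** m) *v pt s = m' *v (den m s *\<^sub>R pt (mob m s))" by (simp add: matrix_vector_mul_assoc[symmetric] mob_vec[OF r(1)])
      also have "\<dots> = den m s *\<^sub>R (m' *v pt (mob m s))" by (simp add: vec2_eq_iff mat2_vec algebra_simps)
      finally show ?thesis by (simp add: mob_vec[OF r(3)])
    qed
    then have "den (m' ** m) s = den m s * den m' (mob m s)"
      "(m' ** m)$1$1 * s + (m' ** m)$1$2 = den m s * den m' (mob m s) * mob m' (mob m s)"
      by (simp_all add: vec2_eq_iff mat2_vec den_def)
    then have "den (m' ** m) s \<noteq> 0" "mob (m' ** m) s = mob m' (mob m s)" using r by (simp_all add: mob_def[of "m' ** m"])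
    then show ?case using r by (simp add: rep_def s_def[symmetric])
  qed
  moreover have "(m' ** m) *v pt (tt d) = pt (tt d'')" using f g by (simp add: germ_def matrix_vector_mul_assoc[symmetric])
  moreover have "snd d'' = (snd d = (0 < det (m' ** m)))" "det (m' ** m) \<noteq> 0"
    using f g by (auto simp: germ_def det_mul zero_less_mult_iff)
  ultimately show ?thesis by (simp add: germ_def)
qed

text \<open>At a nearby regular point the same homography \<open>m\<close> represents
  \<open>f\<close>, and only the scalar has to be renormalised: the shift is 0 because the image
  already lies in the fundamental domain.\<close>

lemma germ_local:
  assumes f: "germ f d d' m"
  shows "\<exists>\<eta>. filterlim \<eta> (at_right 0) (at_right 0) \<and>
    (\<forall>\<^sub>F u in at_right 0. \<forall>b. \<exists>c. germ f (nb d u b) (nb d' (\<eta> u) (b = (0 < det m))) (c *\<^sub>R m))"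
proof -
  obtain \<eta> where \<eta>: "filterlim \<eta> (at_right 0) (at_right 0)"
    "\<forall>\<^sub>F u in at_right 0. den m (tt d + sg (snd d) * u) \<noteq> 0 \<and> mob m (tt d + sg (snd d) * u) = tt d' + sg (snd d') * \<eta> u"
    by (rule germ_shift[OF f])
  have n': "\<forall>\<^sub>F u in at_right 0. 0 < \<eta> u \<and> 0 < tt d' + sg (snd d') * \<eta> u \<and> tt d' + sg (snd d') * \<eta> u < 1"
    using eventually_nb[of d'] \<eta>(1) by (rule eventually_compose_filterlim)
  have det: "det m \<noteq> 0" using f by (simp add: germ_def)
  have "\<forall>\<^sub>F u in at_right 0. rep f m (tt d + sg (snd d) * u)" using f by (simp add: germ_def)
  then obtain e where e: "e > 0" "\<And>u. \<lbrakk>0 < u; u < e\<rbrakk> \<Longrightarrow> rep f m (tt d + sg (snd d) * u)"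
    unfolding eventually_at_right_field by blast
  have "\<forall>\<^sub>F u in at_right 0. 0 < u \<and> u < e"
    unfolding eventually_at_right_field using e(1) by blast
  then have "\<forall>\<^sub>F u in at_right 0. \<forall>b. \<exists>c. germ f (nb d u b) (nb d' (\<eta> u) (b = (0 < det m))) (c *\<^sub>R m)"
    using \<eta>(2) n' eventually_nb[of d]
  proof eventually_elim
    case (elim u)
    define s where "s = tt d + sg (snd d) * u"
    have s: "den m s \<noteq> 0" "mob m s = tt d' + sg (snd d') * \<eta> u" using elim by (simp_all add: s_def)
    have "\<forall>\<^sub>F y in nhds s. 0 < sg (snd d) * (y - tt d) \<and> sg (snd d) * (y - tt d) < e"
    proof -
      have "((\<lambda>y. sg (snd d) * (y - tt d)) \<longlongrightarrow> sg (snd d) * (s - tt d)) (nhds s)" by (intro tendsto_intros filterlim_ident)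
      moreover have "sg (snd d) * (s - tt d) = u" by (simp add: s_def mult.assoc[symmetric])
      ultimately have l: "((\<lambda>y. sg (snd d) * (y - tt d)) \<longlongrightarrow> u) (nhds s)" by simp
      show ?thesis using order_tendstoD[OF l, of 0] order_tendstoD[OF l, of e] elim(1) by (simp add: eventually_conj_iff)
    qed
    then have near: "\<forall>\<^sub>F y in nhds s. rep f m y"
    proof eventually_elim
      case (elim y)
      have "tt d + sg (snd d) * (sg (snd d) * (y - tt d)) = y" by (simp add: mult.assoc[symmetric])
      then show ?case using e(2)[of "sg (snd d) * (y - tt d)"] elim by simp
    qed
    show ?case
    proof
      fix b
      have t: "tt (nb d u b) = s" using elim by (simp add: s_def tt_nb)
      have t': "tt (nb d' (\<eta> u) (b = (0 < det m))) = mob m s" using elim(3) s(2) tt_nb[of d' "\<eta> u"] by simp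
      have "germ f (nb d u b) (nb d' (\<eta> u) (b = (0 < det m)))
        ((1 / den m (tt (nb d u b))) *\<^sub>R shift (tt (nb d' (\<eta> u) (b = (0 < det m))) - mob m (tt (nb d u b))) m)"
      proof (rule germ_normalize)
        show "\<forall>\<^sub>F v in at_right 0. rep f m (tt (nb d u b) + sg (snd (nb d u b)) * v)"
          unfolding t by (rule nhds_side[OF near])
        show "fst (nb d' (\<eta> u) (b = (0 < det m))) = to_circle (mob m (tt (nb d u b)))"
          unfolding t s(2) by (simp add: nb_def)
      qed (simp_all add: det t s(1), simp add: nb_def)
      moreover have "shift 0 m = m" by (simp add: mat2_eq_iff)
      ultimately show "\<exists>c. germ f (nb d u b) (nb d' (\<eta> u) (b = (0 < det m))) (c *\<^sub>R m)"
        unfolding t t' by auto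
    qed
  qed
  then show ?thesis using \<eta>(1) by blast
qed

lemma side_avoids:
  assumes F: "finite F" shows "\<forall>\<^sub>F u in at_right 0. to_circle (t + sg b * u) \<notin> F"
proof -
  have "\<forall>\<^sub>F s in nhds t. to_circle s \<notin> F - {to_circle t}" by (rule eventually_not_in_vimage) (use F in auto)
  then have 1: "\<forall>\<^sub>F u in at_right 0. to_circle (t + sg b * u) \<notin> F - {to_circle t}" by (rule nhds_side)
  have 2: "\<forall>\<^sub>F u in at_right (0::real). 0 < u \<and> u < 1" unfolding eventually_at_right_field by (intro exI[of _ 1]) simp
  from 1 2 show ?thesis
  proof eventually_elim
    case (elim u)
    have "to_circle (t + sg b * u) \<noteq> to_circle t"
    proof
      assume "to_circle (t + sg b * u) = to_circle t"
      then have "sg b * u \<in> \<int>" by (simp add: to_circle_eq_iff)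
      then obtain k where k: "sg b * u = of_int k" by (rule Ints_cases)
      have "\<bar>sg b * u\<bar> = u" using elim(2) by (cases b) simp_all
      then have "real_of_int \<bar>k\<bar> = u" unfolding k by simp
      then have "0 < \<bar>k\<bar>" "\<bar>k\<bar> < 1" using elim(2) by linarith+
      then show False by linarith
    qed
    then show ?case using elim(1) by blast
  qed
qed

lemma germ_cong:
  assumes "finite {x. f x \<noteq> g x}" "germ f d d' m" shows "germ g d d' m"
proof -
  have f: "\<forall>\<^sub>F u in at_right 0. rep f m (tt d + sg (snd d) * u)" using assms(2) by (simp add: germ_def)
  have "\<forall>\<^sub>F u in at_right 0. rep g m (tt d + sg (snd d) * u)"
    using f side_avoids[OF assms(1), of "tt d" "snd d"] by eventually_elim (simp add: rep_def)
  then show ?thesis using assms(2) by (simp add: germ_def)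
qed

lemma germ_id: "germ id d d (mat 1)"
  by (simp add: germ_def rep_def den_def mob_def mat2_one)

lemma projective_rep:
  assumes "locally_projective_at f t" shows "\<exists>m. det m \<noteq> 0 \<and> (\<forall>\<^sub>F y in nhds t. rep f m y)"
proof -
  obtain a b c d where 1: "a * d - b * c \<noteq> 0"
    "\<forall>\<^sub>F s in nhds t. c * s + d \<noteq> 0 \<and> f (to_circle s) = to_circle ((a * s + b) / (c * s + d))"
    using assms unfolding locally_projective_at_def by blast
  define m :: "real^2^2" where "m = (\<chi> i j. if i = 1 then (if j = 1 then a else b) else (if j = 1 then c else d))"
  have m: "m$1$1 = a" "m$1$2 = b" "m$2$1 = c" "m$2$2 = d" by (simp_all add: m_def)
  have "\<forall>\<^sub>F y in nhds t. rep f m y" using 1(2) by (simp add: rep_def den_def mob_def m)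
  moreover have "det m \<noteq> 0" using 1(1) by (simp add: det_2 m)
  ultimately show ?thesis by blast
qed

lemma affine_rep:
  assumes "locally_affine_at f t" shows "\<exists>m. det m \<noteq> 0 \<and> m$2$1 = 0 \<and> (\<forall>\<^sub>F y in nhds t. rep f m y)"
proof -
  obtain a b where 1: "a \<noteq> 0" "\<forall>\<^sub>F s in nhds t. f (to_circle s) = to_circle (a * s + b)"
    using assms unfolding locally_affine_at_def by blast
  define m :: "real^2^2" where "m = (\<chi> i j. if i = 1 then (if j = 1 then a else b) else (if j = 1 then 0 else 1))"
  have m: "m$1$1 = a" "m$1$2 = b" "m$2$1 = 0" "m$2$2 = 1" by (simp_all add: m_def)
  have "\<forall>\<^sub>F y in nhds t. rep f m y" using 1(2) by (simp add: rep_def den_def mob_def m)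
  moreover have "det m \<noteq> 0" using 1(1) by (simp add: det_2 m)
  ultimately show ?thesis using m(3) by blast
qed

lemma germ_regular:
  assumes m: "det m \<noteq> 0" and ev: "\<forall>\<^sub>F y in nhds (tt d). rep f m y"
  defines "d' \<equiv> (f (fst d), snd d = (0 < det m))"
  shows "germ f d d' ((1 / den m (tt d)) *\<^sub>R shift (tt d' - mob m (tt d)) m)" "f (fst d) = to_circle (mob m (tt d))"
proof -
  have r: "rep f m (tt d)" using ev by (rule eventually_nhds_x_imp_x)
  then show f: "f (fst d) = to_circle (mob m (tt d))" by (simp add: rep_def to_circle_tt)
  show "germ f d d' ((1 / den m (tt d)) *\<^sub>R shift (tt d' - mob m (tt d)) m)"
  proof (rule germ_normalize[OF m])
    show "den m (tt d) \<noteq> 0" using r by (simp add: rep_def)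
    show "\<forall>\<^sub>F u in at_right 0. rep f m (tt d + sg (snd d) * u)" using ev by (rule nhds_side)
  qed (simp_all add: d'_def f)
qed

text \<open>An injective map has no germ with a pole: it would wind infinitely many times around the circle.\<close>

lemma no_pole:
  assumes e: "0 < e" "e \<le> 1" and m: "det m \<noteq> 0" and F: "inj_on f (- F)"
    and r: "\<And>u. \<lbrakk>0 < u; u < e\<rbrakk> \<Longrightarrow> to_circle (t + sg b * u) \<notin> F \<and> rep f m (t + sg b * u)"
  shows "den m t \<noteq> 0"
proof
  assume z: "den m t = 0"
  then have m22: "m$2$2 = - (m$2$1 * t)" by (simp add: den_def)
  define N where "N = m$1$1 * t + m$1$2"
  have "det m = - (m$2$1 * N)" unfolding det_2 m22 N_def by (simp add: algebra_simps)
  then have nz: "m$2$1 \<noteq> 0" "N \<noteq> 0" using m by auto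
  define B where "B = N * sg b / m$2$1"
  have B: "B \<noteq> 0" using nz by (simp add: B_def)
  have mob: "mob m (t + sg b * u) = m$1$1 / m$2$1 + B / u" if "u \<noteq> 0" for u
  proof -
    have "den m (t + sg b * u) = m$2$1 * sg b * u" by (simp add: den_def m22 algebra_simps)
    moreover have "m$1$1 * (t + sg b * u) + m$1$2 = N + m$1$1 * sg b * u" by (simp add: N_def algebra_simps)
    ultimately have "mob m (t + sg b * u) = (N + m$1$1 * sg b * u) / (m$2$1 * sg b * u)" by (simp add: mob_def)
    also have "\<dots> = m$1$1 / m$2$1 + B / u" using nz that unfolding B_def by (cases b) (simp_all add: field_simps)
    finally show ?thesis .
  qed
  define u1 where "u1 = e / 2"
  \<comment> \<open>Chosen so that \<open>B / u2 - B / u1\<close> is 1 or -1: the two distinct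
    points, less than 1 apart, then have the same image on the circle.\<close>
  define u2 where "u2 = 1 / (1 / u1 + 1 / \<bar>B\<bar>)"
  have u1: "0 < u1" "u1 < e" using e by (simp_all add: u1_def)
  have p: "0 < 1 / u1" "0 < 1 / \<bar>B\<bar>" using u1 B by simp_all
  have "0 < 1 / u1 + 1 / \<bar>B\<bar>" by (rule add_pos_pos[OF p])
  then have u2: "0 < u2" unfolding u2_def by (simp only: zero_less_divide_1_iff)
  have iu2: "1 / u2 = 1 / u1 + 1 / \<bar>B\<bar>" by (simp add: u2_def)
  have "1 / u1 < 1 / u2" unfolding iu2 using p by simp
  then have u12: "u2 < u1" using u1 u2 by (simp add: field_simps)
  have "B / u2 = B / u1 + B / \<bar>B\<bar>"
  proof -
    have "B / u2 = B * (1 / u2)" by simp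
    then show ?thesis unfolding iu2 by (simp add: distrib_left)
  qed
  then have "mob m (t + sg b * u2) - mob m (t + sg b * u1) = B / \<bar>B\<bar>" using mob[of u1] mob[of u2] u1 u2 by simp
  moreover have "B / \<bar>B\<bar> \<in> \<int>" using B by (cases "0 < B") simp_all
  ultimately have "to_circle (mob m (t + sg b * u2)) = to_circle (mob m (t + sg b * u1))" by (simp add: to_circle_eq_iff)
  moreover have r1: "to_circle (t + sg b * u1) \<notin> F \<and> rep f m (t + sg b * u1)" by (rule r[OF u1])
  moreover have r2: "to_circle (t + sg b * u2) \<notin> F \<and> rep f m (t + sg b * u2)" using u2 u12 u1 by (intro r) simp_all
  ultimately have "f (to_circle (t + sg b * u2)) = f (to_circle (t + sg b * u1))" by (simp add: rep_def)
  then have "to_circle (t + sg b * u2) = to_circle (t + sg b * u1)" by (rule inj_onD[OF F]) (use r1 r2 in simp_all)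
  then have "sg b * u2 - sg b * u1 \<in> \<int>" by (simp add: to_circle_eq_iff)
  then obtain k where k: "sg b * u2 - sg b * u1 = of_int k" by (rule Ints_cases)
  have "\<bar>sg b * u2 - sg b * u1\<bar> = u1 - u2" using u12 by (cases b) simp_all
  then have "real_of_int \<bar>k\<bar> = u1 - u2" unfolding k by simp
  then have "0 < \<bar>k\<bar>" "\<bar>k\<bar> < 1" using u12 u1 u2 e by linarith+
  then show False by linarith
qed

section \<open>Germ groups from piecewise projective maps\<close>

definition germs :: "(circle \<Rightarrow> circle) set \<Rightarrow> dpoint \<Rightarrow> dpoint \<times> (real^2^2) \<Rightarrow> bool" where
  "germs A d = (\<lambda>(d', m). \<exists>f\<in>A. germ f d d' m)"

definition pac :: "(circle \<Rightarrow> circle) set \<Rightarrow> dpoint \<Rightarrow> dpoint" where "pac A d = fst (THE x. germs A d x)"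
definition pal :: "(circle \<Rightarrow> circle) set \<Rightarrow> dpoint \<Rightarrow> real^2^2" where "pal A d = snd (THE x. germs A d x)"

locale projective_property = local_property +
  assumes proj: "P f t \<Longrightarrow> locally_projective_at f t"
begin

lemma piecewiseD:
  assumes "f \<in> piecewise P"
  shows "\<exists>F. finite F \<and> inj_on f (- F) \<and> (\<forall>t. to_circle t \<notin> F \<longrightarrow> P f t)"
proof -
  obtain F F' g where f: "finite F" "homeomorphism (- F) (- F') f g" "\<forall>t. to_circle t \<notin> F \<longrightarrow> P f t"
    using assms unfolding piecewise_def by blast
  have "inj_on f (- F)" by (rule inj_on_inverseI[of _ g]) (rule homeomorphism_apply1[OF f(2)])
  then show ?thesis using f(1,3) by blast
qed

text \<open>Off the finite set \<open>F\<close> the map is locally projective, so one matrix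
  represents it on a whole side of \<open>d\<close>; \<open>no_pole\<close> makes the limit at
  \<open>d\<close> itself finite.\<close>

lemma ex_germ: assumes f: "f \<in> piecewise P" shows "\<exists>d' m. germ f d d' m"
proof -
  obtain F where F0: "finite F" "inj_on f (- F)" "\<forall>t. to_circle t \<notin> F \<longrightarrow> P f t"
    using piecewiseD[OF f] by blast
  note F = F0(1,2) F0(3)[rule_format]
  define t b where "t = tt d" and "b = snd d"
  obtain e0 where e0: "e0 > 0" "\<And>u. \<lbrakk>0 < u; u < e0\<rbrakk> \<Longrightarrow> to_circle (t + sg b * u) \<notin> F"
    using side_avoids[OF F(1), of t b] unfolding eventually_at_right_field by blast
  define e where "e = min e0 1"
  have e: "0 < e" "e \<le> 1" "\<And>u. \<lbrakk>0 < u; u < e\<rbrakk> \<Longrightarrow> to_circle (t + sg b * u) \<notin> F"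
    using e0 by (simp_all add: e_def)
  have ex: "\<exists>m. det m \<noteq> 0 \<and> (\<forall>\<^sub>F y in nhds (t + sg b * u). rep f m y)" if "0 < u" "u < e" for u
    by (rule projective_rep[OF proj[OF F(3)[OF e(3)[OF that]]]])
  have "\<exists>m. det m \<noteq> 0 \<and> (\<forall>u. 0 < u \<longrightarrow> u < e \<longrightarrow> rep f m (t + sg b * u))"
  proof (cases b)
    case True
    have "\<exists>m. det m \<noteq> 0 \<and> (\<forall>x. t < x \<longrightarrow> x < t + e \<longrightarrow> rep f m x)"
    proof (rule ex_common_rep[of "t" "t + e" f])
      show "t < t + e" using e(1) by simp
      show "\<exists>m. det m \<noteq> 0 \<and> (\<forall>\<^sub>F y in nhds x. rep f m y)" if "t < x" "x < t + e" for x
        using ex[of "x - t"] that True by simp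
      fix m assume "det m \<noteq> 0" "\<And>x. \<lbrakk>t < x; x < t + e\<rbrakk> \<Longrightarrow> rep f m x"
      then show ?thesis by blast
    qed
    then obtain m where m: "det m \<noteq> 0" "\<forall>x. t < x \<longrightarrow> x < t + e \<longrightarrow> rep f m x" by blast
    have "rep f m (t + sg b * u)" if "0 < u" "u < e" for u using m(2) that True by simp
    then show ?thesis using m(1) by blast
  next
    case False
    have "\<exists>m. det m \<noteq> 0 \<and> (\<forall>x. t - e < x \<longrightarrow> x < t \<longrightarrow> rep f m x)"
    proof (rule ex_common_rep[of "t - e" "t" f])
      show "t - e < t" using e(1) by simp
      show "\<exists>m. det m \<noteq> 0 \<and> (\<forall>\<^sub>F y in nhds x. rep f m y)" if "t - e < x" "x < t" for x
        using ex[of "t - x"] that False by simp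
      fix m assume "det m \<noteq> 0" "\<And>x. \<lbrakk>t - e < x; x < t\<rbrakk> \<Longrightarrow> rep f m x"
      then show ?thesis by blast
    qed
    then obtain m where m: "det m \<noteq> 0" "\<forall>x. t - e < x \<longrightarrow> x < t \<longrightarrow> rep f m x" by blast
    have "rep f m (t + sg b * u)" if "0 < u" "u < e" for u using m(2) that False by simp
    then show ?thesis using m(1) by blast
  qed
  then obtain m where m: "det m \<noteq> 0" "\<And>u. \<lbrakk>0 < u; u < e\<rbrakk> \<Longrightarrow> rep f m (t + sg b * u)" by blast
  have "den m t \<noteq> 0" by (rule no_pole[OF e(1,2) m(1) F(2) conjI[OF e(3) m(2)]])
  moreover have "\<forall>\<^sub>F u in at_right 0. rep f m (t + sg b * u)"
    unfolding eventually_at_right_field using e(1) m(2) by blast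
  ultimately have "germ f d (to_circle (mob m t), snd d = (0 < det m))
      ((1 / den m (tt d)) *\<^sub>R shift (tt (to_circle (mob m t), snd d = (0 < det m)) - mob m (tt d)) m)"
    unfolding t_def b_def by (intro germ_normalize m(1)) simp_all
  then show ?thesis by blast
qed

text \<open>Maps that agree on a cofinite set have the same germs, and germs are unique, so the
  choice of a representative is immaterial.\<close>

lemma pac_pal:
  assumes f: "f \<in> piecewise P" and g: "germ f d d' m"
  shows "pac (cofinite_eq P `` {f}) d = d'" "pal (cofinite_eq P `` {f}) d = m"
proof -
  have "(THE x. germs (cofinite_eq P `` {f}) d x) = (d', m)"
  proof (rule the_equality)
    have "f \<in> cofinite_eq P `` {f}" using f by (simp add: cofinite_eq_def)
    then show "germs (cofinite_eq P `` {f}) d (d', m)" unfolding germs_def using g by auto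
    fix x assume "germs (cofinite_eq P `` {f}) d x"
    then obtain h where h: "(f, h) \<in> cofinite_eq P" "germ h d (fst x) (snd x)"
      unfolding germs_def by (auto split: prod.splits)
    have "finite {x. h x \<noteq> f x}" using h(1) by (simp add: cofinite_eq_def eq_commute)
    then have "germ f d (fst x) (snd x)" using h(2) by (rule germ_cong)
    from germ_unique[OF this g] show "x = (d', m)" by (simp add: prod_eq_iff)
  qed
  then show "pac (cofinite_eq P `` {f}) d = d'" "pal (cofinite_eq P `` {f}) d = m"
    by (simp_all add: pac_def pal_def)
qed

lemma germ_pac:
  assumes f: "f \<in> piecewise P"
  shows "germ f d (pac (cofinite_eq P `` {f}) d) (pal (cofinite_eq P `` {f}) d)"
proof -
  obtain d' m where g: "germ f d d' m" using ex_germ[OF f] by blast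
  show ?thesis unfolding pac_pal[OF f g] by (rule g)
qed

text \<open>The exceptions lie in \<open>F\<close>, are the base point, or are mapped to the base
  point; the last kind is finite by injectivity.\<close>

lemma smooth_germs:
  assumes f: "f \<in> piecewise P"
  shows "finite {x. \<not> (\<exists>y b. y \<noteq> to_circle 0 \<and> pac (cofinite_eq P `` {f}) (x, True) = (y, b) \<and>
      pac (cofinite_eq P `` {f}) (x, False) = (y, \<not> b) \<and>
      pal (cofinite_eq P `` {f}) (x, True) = pal (cofinite_eq P `` {f}) (x, False))}" (is "finite ?X")
proof -
  obtain F where F0: "finite F" "inj_on f (- F)" "\<forall>t. to_circle t \<notin> F \<longrightarrow> P f t"
    using piecewiseD[OF f] by blast
  note F = F0(1,2) F0(3)[rule_format]
  let ?Y = "{x \<in> - F. f x = to_circle 0}"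
  have "finite (f ` ?Y)" by (rule finite_subset[of _ "{to_circle 0}"]) auto
  moreover have "inj_on f ?Y" by (rule inj_on_subset[OF F(2)]) auto
  ultimately have "finite ?Y" by (rule finite_imageD)
  then have fin: "finite (F \<union> {to_circle 0} \<union> ?Y)" using F(1) by simp
  have "?X \<subseteq> F \<union> {to_circle 0} \<union> ?Y"
  proof
    fix x assume x: "x \<in> ?X"
    show "x \<in> F \<union> {to_circle 0} \<union> ?Y"
    proof (rule ccontr)
      assume n: "x \<notin> F \<union> {to_circle 0} \<union> ?Y"
      then have x0: "x \<notin> F" "x \<noteq> to_circle 0" "f x \<noteq> to_circle 0" by auto
      define t where "t = tt (x, True)"
      have "0 < t \<and> t < 1" using interior[of "(x, True)"] x0(2) by (simp add: t_def)
      then have t: "tt (x, b) = t" for b using tt_flip[of "(x, True)" b] by (simp add: t_def)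
      have xt: "to_circle t = x" using to_circle_tt[of "(x, True)"] by (simp add: t_def)
      have "0 < tt (f x, True) \<and> tt (f x, True) < 1" using interior[of "(f x, True)"] x0(3) by simp
      then have t': "tt (f x, b) = tt (f x, True)" for b using tt_flip[of "(f x, True)" b] by simp
      have "\<exists>m. det m \<noteq> 0 \<and> (\<forall>\<^sub>F y in nhds t. rep f m y)"
        using x0(1) by (intro projective_rep proj F(3)) (simp add: xt)
      then obtain m where m: "det m \<noteq> 0" "\<forall>\<^sub>F y in nhds t. rep f m y" by blast
      have g: "germ f (x, b) (f x, b = (0 < det m)) ((1 / den m t) *\<^sub>R shift (tt (f x, True) - mob m t) m)" for b
        using germ_regular(1)[where d = "(x, b)" and f = f, OF m(1)] m(2) by (simp add: t t'[of "b = (0 < det m)"])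
      note G = pac_pal[OF f g[of True]] pac_pal[OF f g[of False]]
      have "x \<notin> ?X"
        unfolding mem_Collect_eq not_not
        by (rule exI[of _ "f x"], rule exI[of _ "True = (0 < det m)"]) (simp add: G x0(3))
      then show False using x by contradiction
    qed
  qed
  then show ?thesis using fin by (rule finite_subset)
qed

text \<open>Composition and uniqueness of germs give the action and cocycle laws. For faithfulness,
  a map whose right germs all stay in place is the identity off a finite set, which is the unit of
  \<open>PC P\<close>.\<close>

theorem germ_group_PC:
  assumes H: "subgroup H (PC P)" and FW: "property_FW ((PC P)\<lparr>carrier := H\<rparr>)"
  shows "germ_group ((PC P)\<lparr>carrier := H\<rparr>) pac pal"
proof (intro germ_group.intro germ_group_axioms.intro)
  let ?G = "(PC P)\<lparr>carrier := H\<rparr>"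
  interpret PC: group "PC P" by (rule group_PC)
  interpret H: subgroup H "PC P" by (rule H)
  show "group ?G" by (rule PC.subgroup_imp_group[OF H])
  have rp: "\<exists>f. f \<in> piecewise P \<and> A = cofinite_eq P `` {f}" if "A \<in> carrier ?G" for A
  proof -
    have "A \<in> carrier (PC P)" using that by simp
    then show ?thesis by (auto elim: PC_carrierE)
  qed
  show "pac \<one>\<^bsub>?G\<^esub> d = d" "pal \<one>\<^bsub>?G\<^esub> d = mat 1" for d
    using pac_pal[OF piecewise_id germ_id[of d]] by (simp_all add: PC_one)
  have mult: "pac (A \<otimes>\<^bsub>?G\<^esub> B) d = pac A (pac B d) \<and> pal (A \<otimes>\<^bsub>?G\<^esub> B) d = pal A (pac B d) ** pal B d"
    if AB: "A \<in> carrier ?G" "B \<in> carrier ?G" for A B d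
  proof -
    obtain f where f: "f \<in> piecewise P" "A = cofinite_eq P `` {f}" using rp[OF AB(1)] by blast
    obtain g where g: "g \<in> piecewise P" "B = cofinite_eq P `` {g}" using rp[OF AB(2)] by blast
    have "germ (f \<circ> g) d (pac A (pac B d)) (pal A (pac B d) ** pal B d)"
      unfolding f(2) g(2) by (rule germ_comp[OF germ_pac[OF g(1)] germ_pac[OF f(1)]])
    from pac_pal[OF piecewise_comp[OF f(1) g(1)] this] show ?thesis
      by (simp add: f(2) g(2) PC_mult[OF f(1) g(1)])
  qed
  show "pac (A \<otimes>\<^bsub>?G\<^esub> B) d = pac A (pac B d)" "pal (A \<otimes>\<^bsub>?G\<^esub> B) d = pal A (pac B d) ** pal B d"
    if "A \<in> carrier ?G" "B \<in> carrier ?G" for A B d using mult[OF that] by blast+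
  have ger: "germ f d (pac A d) (pal A d)" if "f \<in> piecewise P" "A = cofinite_eq P `` {f}" for f A d
    unfolding that(2) by (rule germ_pac[OF that(1)])
  show "pal A d *v pt (tt d) = pt (tt (pac A d))" "snd (pac A d) = (snd d = (0 < det (pal A d)))" if A: "A \<in> carrier ?G" for A d
  proof -
    obtain f where f: "f \<in> piecewise P" "A = cofinite_eq P `` {f}" using rp[OF A] by blast
    show "pal A d *v pt (tt d) = pt (tt (pac A d))" "snd (pac A d) = (snd d = (0 < det (pal A d)))"
      using ger[OF f, of d] unfolding germ_def by blast+
  qed
  show "\<exists>\<eta>. filterlim \<eta> (at_right 0) (at_right 0) \<and>
      (\<forall>\<^sub>F u in at_right 0. \<forall>b. pac A (nb d u b) = nb (pac A d) (\<eta> u) (b = (0 < det (pal A d))) \<and>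
         (\<exists>c. pal A (nb d u b) = c *\<^sub>R pal A d))" if A: "A \<in> carrier ?G" for A d
  proof -
    obtain f where f: "f \<in> piecewise P" "A = cofinite_eq P `` {f}" using rp[OF A] by blast
    obtain \<eta> where \<eta>: "filterlim \<eta> (at_right 0) (at_right 0)"
      "\<forall>\<^sub>F u in at_right 0. \<forall>b. \<exists>c. germ f (nb d u b) (nb (pac A d) (\<eta> u) (b = (0 < det (pal A d)))) (c *\<^sub>R pal A d)"
      using germ_local[OF ger[OF f, of d]] by blast
    have "\<forall>\<^sub>F u in at_right 0. \<forall>b. pac A (nb d u b) = nb (pac A d) (\<eta> u) (b = (0 < det (pal A d))) \<and>
         (\<exists>c. pal A (nb d u b) = c *\<^sub>R pal A d)"
      using \<eta>(2)
    proof eventually_elim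
      case (elim u)
      show ?case
      proof
        fix b
        obtain c where c: "germ f (nb d u b) (nb (pac A d) (\<eta> u) (b = (0 < det (pal A d)))) (c *\<^sub>R pal A d)"
          using elim by blast
        show "pac A (nb d u b) = nb (pac A d) (\<eta> u) (b = (0 < det (pal A d))) \<and> (\<exists>c. pal A (nb d u b) = c *\<^sub>R pal A d)"
          using pac_pal[OF f(1) c, folded f(2)] by blast
      qed
    qed
    with \<eta>(1) show ?thesis by blast
  qed
  show "finite {x. \<not> (\<exists>y b. y \<noteq> to_circle 0 \<and> pac A (x, True) = (y, b) \<and>
      pac A (x, False) = (y, \<not> b) \<and> pal A (x, True) = pal A (x, False))}" if A: "A \<in> carrier ?G" for A
  proof -
    obtain f where f: "f \<in> piecewise P" "A = cofinite_eq P `` {f}" using rp[OF A] by blast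
    show ?thesis unfolding f(2) by (rule smooth_germs[OF f(1)])
  qed
  show "A = \<one>\<^bsub>?G\<^esub>" if A: "A \<in> carrier ?G" and fx: "\<And>x. fst (pac A (x, True)) = x" for A
  proof -
    obtain f where f: "f \<in> piecewise P" "A = cofinite_eq P `` {f}" using rp[OF A] by blast
    obtain F where F0: "finite F" "inj_on f (- F)" "\<forall>t. to_circle t \<notin> F \<longrightarrow> P f t"
    using piecewiseD[OF f(1)] by blast
  note F = F0(1,2) F0(3)[rule_format]
    have "f x = x" if x: "x \<notin> F" for x
    proof -
      have "P f (tt (x, True))" using x by (intro F(3)) (simp add: to_circle_tt)
      then obtain m where m: "det m \<noteq> 0" "\<forall>\<^sub>F y in nhds (tt (x, True)). rep f m y" using projective_rep[OF proj] by blast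
      from pac_pal(1)[OF f(1) germ_regular(1)[OF m]] show ?thesis using fx[of x] by (simp add: f(2))
    qed
    then have "{x. f x \<noteq> id x} \<subseteq> F" by auto
    then have "(f, id) \<in> cofinite_eq P" using F(1) f(1) piecewise_id by (simp add: cofinite_eq_def finite_subset)
    then show ?thesis using equiv_class_eq[OF equiv_cofinite_eq] by (simp add: f(2) PC_one)
  qed
qed (rule FW)

end

interpretation aff: projective_property locally_affine_at
proof
  fix f t assume "locally_affine_at f t"
  then obtain a b where 1: "a \<noteq> 0" "\<forall>\<^sub>F s in nhds t. f (to_circle s) = to_circle (a * s + b)"
    unfolding locally_affine_at_def by blast
  show "locally_projective_at f t"
    unfolding locally_projective_at_def
    by (rule exI[of _ a], rule exI[of _ b], rule exI[of _ 0], rule exI[of _ 1]) (use 1 in simp)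
qed

interpretation proj: projective_property locally_projective_at
  by unfold_locales

text \<open>At a singular point the matrix is read off from a nearby regular point: there the germ
  is a nonzero multiple of \<open>m\<close> by \<open>germ_local\<close>, and it is affine.\<close>

lemma affine_pal:
  assumes f: "f \<in> piecewise locally_affine_at"
  shows "pal (cofinite_eq locally_affine_at `` {f}) d $ 2 $ 1 = 0"
proof -
  define m where "m = pal (cofinite_eq locally_affine_at `` {f}) d"
  obtain d' where g: "germ f d d' m" using aff.germ_pac[OF f] unfolding m_def by blast
  obtain F where F0: "finite F" "\<forall>t. to_circle t \<notin> F \<longrightarrow> locally_affine_at f t"
    using aff.piecewiseD[OF f] by blast
  note F = F0(1) F0(2)[rule_format]
  obtain \<eta> where \<eta>: "\<forall>\<^sub>F u in at_right 0. \<forall>b. \<exists>c. germ f (nb d u b) (nb d' (\<eta> u) (b = (0 < det m))) (c *\<^sub>R m)"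
    using germ_local[OF g] by blast
  obtain u where u: "0 < u" "(\<forall>b. \<exists>c. germ f (nb d u b) (nb d' (\<eta> u) (b = (0 < det m))) (c *\<^sub>R m)) \<and>
      to_circle (tt d + sg (snd d) * u) \<notin> F"
    by (rule eventually_at_right_imp_ex[OF eventually_conj[OF \<eta> side_avoids[OF F(1), of "tt d" "snd d"]]])
  obtain c where c: "germ f (nb d u True) (nb d' (\<eta> u) (True = (0 < det m))) (c *\<^sub>R m)" using u(2) by blast
  have "to_circle (tt (nb d u True)) \<notin> F" using u(2) unfolding to_circle_tt by (simp add: nb_def)
  then obtain m1 where m1: "det m1 \<noteq> 0" "m1 $ 2 $ 1 = 0" "\<forall>\<^sub>F y in nhds (tt (nb d u True)). rep f m1 y"
    using affine_rep[OF F(2)] by blast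
  from germ_unique[OF c germ_regular(1)[OF m1(1,3)]] have "(c *\<^sub>R m) $ 2 $ 1 = 0" using m1(2) by simp
  moreover have "c \<noteq> 0" using c by (auto simp: germ_def det_2)
  ultimately show ?thesis unfolding m_def by simp
qed

lemma no_infinite_FW_affine:
  assumes H: "subgroup H PC_Aff" and FW: "property_FW (PC_Aff\<lparr>carrier := H\<rparr>)" shows "finite H"
proof -
  interpret germ_group "PC_Aff\<lparr>carrier := H\<rparr>" pac pal
    using aff.germ_group_PC H FW unfolding PC_Aff_def by blast
  have "pal A d $ 2 $ 1 = 0" if "A \<in> carrier (PC_Aff\<lparr>carrier := H\<rparr>)" for A d
  proof -
    have "A \<in> carrier (PC locally_affine_at)" using that subgroup.subset[OF H] unfolding PC_Aff_def by auto
    then obtain f where "f \<in> piecewise locally_affine_at" "A = cofinite_eq locally_affine_at `` {f}"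
      by (rule affine.PC_carrierE)
    then show ?thesis using affine_pal by simp
  qed
  then show ?thesis using affine_finite by simp
qed

theorem corollary1p3:
  shows "(\<nexists>H. subgroup H PC_Aff \<and> infinite H \<and> property_FW (PC_Aff\<lparr>carrier := H\<rparr>)) \<and>
         (\<nexists>H. subgroup H PC_Aff \<and> infinite H \<and> property_T (PC_Aff\<lparr>carrier := H\<rparr>)) \<and>
         (\<nexists>H. subgroup H PC_Proj \<and> infinite H \<and> property_T (PC_Proj\<lparr>carrier := H\<rparr>))"
proof (intro conjI notI; elim exE conjE)
  fix H assume "subgroup H PC_Aff" "infinite H" "property_FW (PC_Aff\<lparr>carrier := H\<rparr>)"
  then show False using no_infinite_FW_affine by blast
next
  fix H assume H: "subgroup H PC_Aff" "infinite H" and T: "property_T (PC_Aff\<lparr>carrier := H\<rparr>)"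
  interpret group "PC_Aff\<lparr>carrier := H\<rparr>" by (rule group.subgroup_imp_group[OF group_PC_Aff H(1)])
  have "finite H" by (rule no_infinite_FW_affine[OF H(1) property_T_FW[OF T]])
  then show False using H(2) by contradiction
next
  fix H assume H: "subgroup H PC_Proj" "infinite H" and T: "property_T (PC_Proj\<lparr>carrier := H\<rparr>)"
  interpret H: group "PC_Proj\<lparr>carrier := H\<rparr>" by (rule group.subgroup_imp_group[OF _ H(1)]) (simp add: PC_Proj_def projective.group_PC)
  interpret germ_group "PC_Proj\<lparr>carrier := H\<rparr>" pac pal
    using proj.germ_group_PC[of H] H(1) H.property_T_FW[OF T] unfolding PC_Proj_def by blast
  have "finite H" using bounded_lengths_finite[OF H.property_T_bounded_lengths[OF T]] by simp
  then show False using H(2) by contradiction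
qed

end
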